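(* Let $V\in C([0,T]\times\mathbb{R}^n)$ and $\mu\in\mathcal{M}$. Assume that - $H$ is differentiable with respect to $p$; - $V$ is a classical solution of $\frac{\partial V}{\partial t}+H(t,x,\mu[t],\nabla V)=0$, $V(T,\cdot)=\sigma(\cdot,\mu[T])$ (i.e. $V$ is differentiable and satisfies the equation at every $(t,x)\in[0,T]\times\mathbb{R}^n$), and $\nabla V$ is Lipschitz continuous with respect to $x$; - $\mu$ is a weak solution of $\frac{d}{dt}\mu[t]=\mu[t]\langle\frac{\partial H}{\partial p}(t,x,\mu[t],\nabla V),\nabla\rangle$, $\mu[0]=m_0$, i.e. $\mu[0]=m_0$ and for all $\phi\in C_b^1(\mathbb{R}^n)$ and $\psi\in C_b^1([0,T])$ with $\psi(0)=\psi(T)=0$ $$-\int_0^T\int_{\mathbb{R}^n}\psi'(t)\phi(x)\,\mu[t](dx)\,dt=\int_0^T\int_{\mathbb{R}^n}\psi(t)\Big\langle\frac{\partial H}{\partial p}(t,x,\mu[t],\nabla V(t,x)),\nabla\phi(x)\Big\rangle\mu[t](dx)\,dt .$$ Then $(V,\mu)$ is a minimax solution of the mean field game system formed by these two equations.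
   Context: Spaces. $\mathcal{P}(\mathbb{R}^n)$ is the set of Borel probability measures on $\mathbb{R}^n$ with finite first moment, metrized by $W(m',m'')=\sup\{\int\phi\,d(m'-m''):\phi:\mathbb{R}^n\to\mathbb{R}\ \text{1-Lipschitz}\}$. $\mathcal{M}$ is the set of continuous maps $\mu:[0,T]\to\mathcal{P}(\mathbb{R}^n)$, $t\mapsto\mu[t]$ (external fields). $C_b^1$ denotes bounded $C^1$ functions with bounded first derivatives. Data and standing assumptions. $T>0$; $P$ is a nonempty compact metric space; $f:[0,T]\times\mathbb{R}^n\times\mathcal{P}(\mathbb{R}^n)\times P\to\mathbb{R}^n$ and $g:[0,T]\times\mathbb{R}^n\times\mathcal{P}(\mathbb{R}^n)\times P\to\mathbb{R}$ are continuous; there are constants $L_{f,x},L_{f,m}$ with $\|f(t,x',m,u)-f(t,x'',m,u)\|\le L_{f,x}\|x'-x''\|$ and $\|f(t,x,m',u)-f(t,x,m'',u)\|\le L_{f,m}W(m',m'')$; $\sigma:\mathbb{R}^n\times\mathcal{P}(\mathbb{R}^n)\to\mathbb{R}$ is continuous; $m_0\in\mathcal{P}(\mathbb{R}^n)$ has compact support $G_0$. There is a compact set $G\subset\mathbb{R}^n$ such that for every $\mu\in\mathcal{M}$, every measurable $u:[0,T]\to P$ and every solution of $\dot x(t)=f(t,x(t),\mu[t],u(t))$ with $x(0)\in G_0$, one has $x(t)\in G$ for all $t\in[0,T]$. The Hamiltonian is $H(t,x,m,p)=\max_{u\in P}[\langle p,f(t,x,m,u)\rangle-g(t,x,m,u)]$.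 Minimax solutions. Put $E^-(t,x,m)=\mathrm{co}\{(f(t,x,m,u),g(t,x,m,u)):u\in P\}\subset\mathbb{R}^{n+1}$ and $E^+(t,x,m,u)=\{(f(t,x,m,u),g(t,x,m,u))\}$, $u\in P$. A set $D\subset[0,T]\times\mathbb{R}^n\times\mathbb{R}$ is viable under a differential inclusion for $(x,z)$ if for every $(t_0,x_0,z_0)\in D$ there is an absolutely continuous solution on $[t_0,T]$ starting at $(x_0,z_0)$ with $(t,x(t),z(t))\in D$ for all $t\in[t_0,T]$. For given $\mu\in\mathcal{M}$, a continuous $V:[0,T]\times\mathbb{R}^n\to\mathbb{R}$ is a minimax solution of the Hamilton--Jacobi equation if: (i) $V(T,\cdot)=\sigma(\cdot,\mu[T])$; (ii) for every $u\in P$ the epigraph $\{z\ge V(t,x)\}$ is viable under $(\dot x,\dot z)\in E^+(t,x,\mu[t],u)$; (iii) the hypograph $\{z\le V(t,x)\}$ is viable under $(\dot x,\dot z)\in E^-(t,x,\mu[t])$. $\mathcal{S}[V,\mu]$ is the set of absolutely continuous $(x(\cdot),z(\cdot)):[0,T]\to\mathbb{R}^{n+1}$ with $(\dot x(t),\dot z(t))\in E^-(t,x(t),\mu[t])$ for a.e. $t$ and $z(t)=V(t,x(t))$ for all $t$; $e_t(x(\cdot),z(\cdot))=x(t)$. A pair $(V,\mu)\in C([0,T]\times\mathbb{R}^n)\times\mathcal{M}$ is a minimax solution of the mean field game system if: (1) $V$ is a minimax solution of the Hamilton--Jacobi equation for $\mu$; (2) $\mu[0]=m_0$; (3) there is a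 Borel (probability) measure $\chi$ on $\mathcal{S}[V,\mu]$ with $\mu[t]=e_t\#\chi$ for all $t\in[0,T]$. *)

theory Defs
  imports "HOL-Probability.Probability"
begin

text \<open>The space of Borel probability measures with finite first moment, metrized by the
  Kantorovich--Rubinstein distance; \<open>law\<close> yields the underlying measure.\<close>

typedef (overloaded) ('a::euclidean_space) prob1 =
  "{m :: 'a measure. prob_space m \<and> sets m = sets borel \<and> integrable m (\<lambda>x. norm x)}"
  morphisms law Prob1
proof
  show "return borel 0 \<in> {m :: 'a measure. prob_space m \<and> sets m = sets borel \<and> integrable m (\<lambda>x. norm x)}"
    by (auto simp: prob_space_return integrable_iff_bounded nn_integral_return)
qed

lemma law_prob1:
  "prob_space (law m)" "sets (law m) = sets borel" "space (law m) = UNIV"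
  "integrable (law m) (\<lambda>x. norm x)"
  using law[of m] sets_eq_imp_space_eq[of "law m" borel] by auto

definition wdist :: "'a::euclidean_space prob1 \<Rightarrow> 'a prob1 \<Rightarrow> real" where
  "wdist m m' = (SUP \<phi>\<in>{\<phi> :: 'a \<Rightarrow> real. 1-lipschitz_on UNIV \<phi>}.
      (\<integral>x. \<phi> x \<partial>law m) - (\<integral>x. \<phi> x \<partial>law m'))"

lemma law_lipschitz:
  fixes \<phi> :: "'a::euclidean_space \<Rightarrow> real"
  assumes "L-lipschitz_on UNIV \<phi>"
  shows "integrable (law m) \<phi>"
    and "\<bar>(\<integral>x. \<phi> x \<partial>law m) - \<phi> 0\<bar> \<le> L * (\<integral>x. norm x \<partial>law m)"
proof -
  interpret prob_space "law m" by (rule law_prob1)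
  note [measurable_cong] = law_prob1(2)[of m]
  have [measurable]: "\<phi> \<in> borel_measurable borel"
    by (intro borel_measurable_continuous_onI lipschitz_on_continuous_on[OF assms])
  have bd: "\<bar>\<phi> x - \<phi> 0\<bar> \<le> L * norm x" for x
    using lipschitz_onD[OF assms, of x 0] by (simp add: dist_real_def)
  have 1: "integrable (law m) (\<lambda>x. \<phi> x - \<phi> 0)"
    by (rule Bochner_Integration.integrable_bound[where f = "\<lambda>x. L * norm x"])
       (use law_prob1(4)[of m] bd order_trans[OF _ abs_ge_self] in auto)
  have "integrable (law m) (\<lambda>x. (\<phi> x - \<phi> 0) + \<phi> 0)"
    using 1 by (intro Bochner_Integration.integrable_add) auto
  then show int: "integrable (law m) \<phi>" by simp
  have "(\<integral>x. \<phi> x \<partial>law m) - \<phi> 0 = (\<integral>x. \<phi> x - \<phi> 0 \<partial>law m)"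
    using int by (simp add: prob_space)
  also have "\<bar>\<dots>\<bar> \<le> (\<integral>x. \<bar>\<phi> x - \<phi> 0\<bar> \<partial>law m)" by (rule integral_abs_bound)
  also have "\<dots> \<le> (\<integral>x. L * norm x \<partial>law m)"
    using 1 law_prob1(4)[of m] bd by (intro integral_mono) auto
  finally show "\<bar>(\<integral>x. \<phi> x \<partial>law m) - \<phi> 0\<bar> \<le> L * (\<integral>x. norm x \<partial>law m)" by simp
qed

lemma wdist_upper:
  fixes \<phi> :: "'a::euclidean_space \<Rightarrow> real"
  assumes "1-lipschitz_on UNIV \<phi>"
  shows "(\<integral>x. \<phi> x \<partial>law m) - (\<integral>x. \<phi> x \<partial>law m') \<le> wdist m m'"
  unfolding wdist_def
proof (rule cSUP_upper)
  show "bdd_above ((\<lambda>\<phi>. (\<integral>x. \<phi> x \<partial>law m) - (\<integral>x. \<phi> x \<partial>law m')) ` {\<phi> :: 'a \<Rightarrow> real. 1-lipschitz_on UNIV \<phi>})"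
  proof (rule bdd_aboveI2)
    fix \<phi> :: "'a \<Rightarrow> real" assume "\<phi> \<in> {\<phi>. 1-lipschitz_on UNIV \<phi>}"
    then show "(\<integral>x. \<phi> x \<partial>law m) - (\<integral>x. \<phi> x \<partial>law m')
        \<le> (\<integral>x. norm x \<partial>law m) + (\<integral>x. norm x \<partial>law m')"
      using law_lipschitz(2)[of 1 \<phi> m] law_lipschitz(2)[of 1 \<phi> m'] by auto
  qed
qed (use assms in auto)

lemma wdist_least:
  fixes m m' :: "'a::euclidean_space prob1"
  assumes "\<And>\<phi> :: 'a \<Rightarrow> real. 1-lipschitz_on UNIV \<phi> \<Longrightarrow>
      (\<integral>x. \<phi> x \<partial>law m) - (\<integral>x. \<phi> x \<partial>law m') \<le> c"
  shows "wdist m m' \<le> c"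
proof -
  have "(\<lambda>x. 0) \<in> {\<phi> :: 'a \<Rightarrow> real. 1-lipschitz_on UNIV \<phi>}"
    by (auto simp: lipschitz_on_def)
  then show ?thesis unfolding wdist_def using assms by (intro cSUP_least) auto
qed

lemma wdist_commute: "wdist m m' = wdist m' m"
proof -
  have "wdist m m' \<le> wdist m' m" for m m' :: "'a prob1"
  proof (rule wdist_least)
    fix \<phi> :: "'a \<Rightarrow> real" assume "1-lipschitz_on UNIV \<phi>"
    then have "1-lipschitz_on UNIV (\<lambda>x. - \<phi> x)" by (simp add: lipschitz_on_def dist_minus)
    from wdist_upper[OF this, of m' m]
    show "(\<integral>x. \<phi> x \<partial>law m) - (\<integral>x. \<phi> x \<partial>law m') \<le> wdist m' m" by simp
  qed
  then show ?thesis by (metis order_antisym)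
qed

lemma lipschitz_cutoff:
  fixes C :: "'a::euclidean_space set"
  assumes "k \<ge> 0"
  shows "k-lipschitz_on UNIV (\<lambda>x. max 0 (1 - k * infdist x C))"
proof (rule lipschitz_onI)
  fix x y :: 'a
  have "\<bar>max 0 (1 - k * infdist x C) - max 0 (1 - k * infdist y C)\<bar>
      \<le> \<bar>k * infdist x C - k * infdist y C\<bar>" by auto
  also have "\<dots> = k * \<bar>infdist x C - infdist y C\<bar>"
    using assms by (simp add: abs_mult flip: right_diff_distrib)
  also have "\<dots> \<le> k * dist x y"
    using assms infdist_triangle_abs[of x C y] by (intro mult_left_mono)
  finally show "dist (max 0 (1 - k * infdist x C)) (max 0 (1 - k * infdist y C)) \<le> k * dist x y"
    by (simp add: dist_real_def)
qed (use assms in auto)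

lemma cutoff_tendsto:
  fixes C :: "'a::euclidean_space set"
  assumes "closed C" "C \<noteq> {}"
  shows "(\<lambda>i. max 0 (1 - real (Suc i) * infdist x C)) \<longlonglongrightarrow> indicator C x"
proof (cases "x \<in> C")
  case False
  then have pos: "infdist x C > 0" using assms
    by (metis in_closed_iff_infdist_zero infdist_nonneg order_le_less)
  then obtain N where N: "real N > 1 / infdist x C" using reals_Archimedean2 by blast
  have "eventually (\<lambda>i. max 0 (1 - real (Suc i) * infdist x C) = 0) sequentially"
    using eventually_ge_at_top[of N]
  proof eventually_elim
    case (elim i)
    have "1 < real N * infdist x C" using N pos by (simp add: field_simps)
    also have "\<dots> \<le> real (Suc i) * infdist x C" using elim pos by (intro mult_right_mono) auto
    finally show ?case by simp
  qed
  then show ?thesis using False by (simp add: tendsto_eventually)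
qed simp

lemma wdist_eq_0D:
  fixes m m' :: "'a::euclidean_space prob1"
  assumes "wdist m m' = 0"
  shows "m = m'"
proof -
  interpret M: prob_space "law m" by (rule law_prob1)
  interpret M': prob_space "law m'" by (rule law_prob1)
  note [measurable_cong] = law_prob1(2)[of m] law_prob1(2)[of m']
  have eq1: "(\<integral>x. \<phi> x \<partial>law m) = (\<integral>x. \<phi> x \<partial>law m')"
    if "1-lipschitz_on UNIV \<phi>" for \<phi> :: "'a \<Rightarrow> real"
    using wdist_upper[OF that, of m m'] wdist_upper[OF that, of m' m] assms
    by (simp add: wdist_commute[of m' m])
  have eqk: "(\<integral>x. \<phi> x \<partial>law m) = (\<integral>x. \<phi> x \<partial>law m')"
    if "k-lipschitz_on UNIV \<phi>" "k > 0" for \<phi> :: "'a \<Rightarrow> real" and k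
  proof -
    have "1-lipschitz_on UNIV (\<lambda>x. \<phi> x / k)"
      using that by (auto simp: lipschitz_on_def dist_real_def field_simps simp flip: diff_divide_distrib)
    from eq1[OF this] show ?thesis using \<open>k > 0\<close> by simp
  qed
  have closed: "emeasure (law m) C = emeasure (law m') C" if "closed C" for C
  proof (cases "C = {}")
    case False
    have C[measurable]: "C \<in> sets borel" using that by simp
    let ?\<phi> = "\<lambda>i x. max 0 (1 - real (Suc i) * infdist x C)"
    have [measurable]: "?\<phi> i \<in> borel_measurable borel" for i
      by (intro borel_measurable_continuous_onI lipschitz_on_continuous_on[OF lipschitz_cutoff]) simp
    have lim: "(\<lambda>i. \<integral>x. ?\<phi> i x \<partial>N) \<longlonglongrightarrow> (\<integral>x. indicator C x \<partial>N)"
      if "prob_space N" "sets N = sets borel" for N :: "'a measure"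
    proof -
      interpret prob_space N by fact
      note [measurable_cong] = that(2)
      show ?thesis
        by (rule integral_dominated_convergence[where w = "\<lambda>_. 1"])
           (use cutoff_tendsto[OF \<open>closed C\<close> False] \<open>\<And>i. ?\<phi> i \<in> borel_measurable borel\<close> that(2) in
             \<open>auto simp: infdist_nonneg cong: measurable_cong_sets\<close>)
    qed
    have "(\<integral>x. indicator C x \<partial>law m) = (\<integral>x. indicator C x \<partial>law m' :: real)"
      using lim[OF law_prob1(1,2)[of m]] lim[OF law_prob1(1,2)[of m']]
        eqk[OF lipschitz_cutoff[of "real (Suc _)" C]]
      by (simp add: LIMSEQ_unique)
    then show ?thesis
      by (simp add: M.emeasure_eq_measure M'.emeasure_eq_measure law_prob1)
  qed simp
  have "law m = law m'"
  proof (rule measure_eqI_generator_eq[where E = "{C. closed C}" and \<Omega> = UNIV and A = "\<lambda>_. UNIV"])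
    show "Int_stable {C :: 'a set. closed C}" by (auto simp: Int_stable_def)
    show "sets (law m) = sigma_sets UNIV {C. closed C}" "sets (law m') = sigma_sets UNIV {C. closed C}"
      by (simp_all add: law_prob1 borel_eq_closed)
  qed (use closed in auto)
  then show ?thesis by (simp add: law_inject)
qed

instantiation prob1 :: (euclidean_space) metric_space
begin

definition dist_prob1 :: "'a prob1 \<Rightarrow> 'a prob1 \<Rightarrow> real" where
  "dist_prob1 = wdist"

definition uniformity_prob1 :: "('a prob1 \<times> 'a prob1) filter" where
  "uniformity_prob1 = (INF e\<in>{0<..}. principal {(x, y). dist x y < e})"

definition open_prob1 :: "'a prob1 set \<Rightarrow> bool" where
  "open_prob1 U \<longleftrightarrow> (\<forall>x\<in>U. \<forall>\<^sub>F (x', y) in uniformity. x' = x \<longrightarrow> y \<in> U)"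

instance
proof
  fix x y z :: "'a prob1"
  show "dist x y = 0 \<longleftrightarrow> x = y"
  proof
    assume "x = y"
    have "wdist y y \<le> 0" by (rule wdist_least) simp
    moreover have "0 \<le> wdist y y"
      using wdist_upper[of "\<lambda>_. 0" y y] by (simp add: lipschitz_on_def)
    ultimately show "dist x y = 0" using \<open>x = y\<close> by (simp add: dist_prob1_def)
  qed (simp add: dist_prob1_def wdist_eq_0D)
  have "wdist x y \<le> wdist x z + wdist z y"
  proof (rule wdist_least)
    fix \<phi> :: "'a \<Rightarrow> real" assume "1-lipschitz_on UNIV \<phi>"
    from wdist_upper[OF this, of x z] wdist_upper[OF this, of z y]
    show "(\<integral>x. \<phi> x \<partial>law x) - (\<integral>x. \<phi> x \<partial>law y) \<le> wdist x z + wdist z y" by simp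
  qed
  then show "dist x y \<le> dist x z + dist y z"
    by (simp add: dist_prob1_def wdist_commute[of z y])
qed (simp_all add: uniformity_prob1_def open_prob1_def)

end

definition grad :: "('a::real_inner \<Rightarrow> real) \<Rightarrow> 'a \<Rightarrow> 'a" where
  "grad F x = (THE D. GDERIV F x :> D)"

definition Cb1 :: "('a::euclidean_space \<Rightarrow> real) set" where
  "Cb1 = {\<phi>. (\<forall>x. \<phi> differentiable (at x)) \<and> continuous_on UNIV (grad \<phi>) \<and>
     bounded (range \<phi>) \<and> bounded (range (grad \<phi>))}"

definition Cb1_interval :: "real \<Rightarrow> (real \<Rightarrow> real) set" where
  "Cb1_interval T = {\<psi>. (\<forall>t\<in>{0..T}. \<psi> differentiable (at t within {0..T})) \<and>
     continuous_on {0..T} (\<lambda>t. vector_derivative \<psi> (at t within {0..T})) \<and>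
     bounded (\<psi> ` {0..T}) \<and> bounded ((\<lambda>t. vector_derivative \<psi> (at t within {0..T})) ` {0..T})}"

definition abs_cont_on :: "real \<Rightarrow> real \<Rightarrow> (real \<Rightarrow> 'b::real_normed_vector) \<Rightarrow> bool" where
  "abs_cont_on a b y \<longleftrightarrow> (\<forall>\<epsilon>>0. \<exists>\<delta>>0. \<forall>I :: (real \<times> real) set.
     finite I \<longrightarrow> (\<forall>(c, d)\<in>I. a \<le> c \<and> c \<le> d \<and> d \<le> b) \<longrightarrow>
     disjoint_family_on (\<lambda>(c, d). {c<..<d}) I \<longrightarrow>
     (\<Sum>(c, d)\<in>I. d - c) < \<delta> \<longrightarrow> (\<Sum>(c, d)\<in>I. norm (y d - y c)) < \<epsilon>)"

definition solves_inclusion ::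
    "(real \<Rightarrow> 'b::real_normed_vector \<Rightarrow> 'b set) \<Rightarrow> real \<Rightarrow> real \<Rightarrow> (real \<Rightarrow> 'b) \<Rightarrow> bool" where
  "solves_inclusion F a b y \<longleftrightarrow> abs_cont_on a b y \<and>
     (AE t in lebesgue_on {a..b}. \<exists>v\<in>F t (y t). (y has_vector_derivative v) (at t within {a..b}))"

definition viable ::
    "real \<Rightarrow> (real \<times> 'b::real_normed_vector) set \<Rightarrow> (real \<Rightarrow> 'b \<Rightarrow> 'b set) \<Rightarrow> bool" where
  "viable T D F \<longleftrightarrow> (\<forall>(t\<^sub>0, y\<^sub>0)\<in>D. \<exists>y. solves_inclusion F t\<^sub>0 T y \<and> y t\<^sub>0 = y\<^sub>0 \<and>
     (\<forall>t\<in>{t\<^sub>0..T}. (t, y t) \<in> D))"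

text \<open>In the following, \<open>P\<close> is the control set, \<open>f\<close> the dynamics, \<open>g\<close> the running cost
  and \<open>\<sigma>\<close> the terminal payoff.\<close>

type_synonym ('a, 'p, 'r) coefficient = "real \<Rightarrow> 'a \<Rightarrow> 'a prob1 \<Rightarrow> 'p \<Rightarrow> 'r"

text \<open>For compact nonempty \<open>P\<close> and continuous \<open>f\<close>, \<open>g\<close> the supremum is a maximum.\<close>

definition ham :: "'p set \<Rightarrow> ('a::euclidean_space, 'p, 'a) coefficient \<Rightarrow> ('a, 'p, real) coefficient \<Rightarrow>
    real \<Rightarrow> 'a \<Rightarrow> 'a prob1 \<Rightarrow> 'a \<Rightarrow> real" where
  "ham P f g t x m p = (SUP u\<in>P. p \<bullet> f t x m u - g t x m u)"

definition E_minus :: "'p set \<Rightarrow> ('a::euclidean_space, 'p, 'a) coefficient \<Rightarrow> ('a, 'p, real) coefficient \<Rightarrow>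
    real \<Rightarrow> 'a \<Rightarrow> 'a prob1 \<Rightarrow> ('a \<times> real) set" where
  "E_minus P f g t x m = convex hull ((\<lambda>u. (f t x m u, g t x m u)) ` P)"

definition E_plus :: "('a::euclidean_space, 'p, 'a) coefficient \<Rightarrow> ('a, 'p, real) coefficient \<Rightarrow>
    real \<Rightarrow> 'a \<Rightarrow> 'a prob1 \<Rightarrow> 'p \<Rightarrow> ('a \<times> real) set" where
  "E_plus f g t x m u = {(f t x m u, g t x m u)}"

definition minimax_HJ :: "real \<Rightarrow> 'p set \<Rightarrow> ('a::euclidean_space, 'p, 'a) coefficient \<Rightarrow>
    ('a, 'p, real) coefficient \<Rightarrow> ('a \<Rightarrow> 'a prob1 \<Rightarrow> real) \<Rightarrow> (real \<Rightarrow> 'a prob1) \<Rightarrow>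
    (real \<Rightarrow> 'a \<Rightarrow> real) \<Rightarrow> bool" where
  "minimax_HJ T P f g \<sigma> \<mu> V \<longleftrightarrow>
     continuous_on ({0..T} \<times> UNIV) (\<lambda>(t, x). V t x) \<and>
     (\<forall>x. V T x = \<sigma> x (\<mu> T)) \<and>
     (\<forall>u\<in>P. viable T {(t, x, z). t \<in> {0..T} \<and> V t x \<le> z} (\<lambda>t (x, z). E_plus f g t x (\<mu> t) u)) \<and>
     viable T {(t, x, z). t \<in> {0..T} \<and> z \<le> V t x} (\<lambda>t (x, z). E_minus P f g t x (\<mu> t))"

definition classical_HJ :: "real \<Rightarrow> 'p set \<Rightarrow> ('a::euclidean_space, 'p, 'a) coefficient \<Rightarrow>
    ('a, 'p, real) coefficient \<Rightarrow> ('a \<Rightarrow> 'a prob1 \<Rightarrow> real) \<Rightarrow> (real \<Rightarrow> 'a prob1) \<Rightarrow>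
    (real \<Rightarrow> 'a \<Rightarrow> real) \<Rightarrow> bool" where
  "classical_HJ T P f g \<sigma> \<mu> V \<longleftrightarrow>
     (\<forall>t\<in>{0..T}. \<forall>x. (\<lambda>(s, y). V s y) differentiable (at (t, x) within {0..T} \<times> UNIV) \<and>
        vector_derivative (\<lambda>s. V s x) (at t within {0..T}) +
          ham P f g t x (\<mu> t) (grad (V t) x) = 0) \<and>
     (\<forall>x. V T x = \<sigma> x (\<mu> T))"

text \<open>Weak solutions of \<open>d/dt \<mu>[t] = \<mu>[t]\<langle>b(t,x), \<nabla>\<rangle>\<close> with \<open>\<mu>[0] = m\<^sub>0\<close>.\<close>

definition weak_solution :: "real \<Rightarrow> (real \<Rightarrow> 'a::euclidean_space \<Rightarrow> 'a) \<Rightarrow> 'a prob1 \<Rightarrow>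
    (real \<Rightarrow> 'a prob1) \<Rightarrow> bool" where
  "weak_solution T b m\<^sub>0 \<mu> \<longleftrightarrow> \<mu> 0 = m\<^sub>0 \<and>
     (\<forall>\<phi>\<in>Cb1. \<forall>\<psi>\<in>Cb1_interval T. \<psi> 0 = 0 \<and> \<psi> T = 0 \<longrightarrow>
        - (LBINT t:{0..T}. \<integral>x. vector_derivative \<psi> (at t within {0..T}) * \<phi> x \<partial>law (\<mu> t)) =
          (LBINT t:{0..T}. \<integral>x. \<psi> t * (b t x \<bullet> grad \<phi> x) \<partial>law (\<mu> t)))"

text \<open>\<open>C([0,T])\<close> with the topology of uniform convergence. Its elements are functions on the
  whole line with the default value \<open>undefined\<close> outside \<open>[0,T]\<close>.\<close>

definition curves :: "real \<Rightarrow> (real \<Rightarrow> 'b::real_normed_vector) topology" where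
  "curves T = mtopology_of (cfunspace (top_of_set {0..T}) euclidean_metric)"

definition char_curves :: "real \<Rightarrow> 'p set \<Rightarrow> ('a::euclidean_space, 'p, 'a) coefficient \<Rightarrow>
    ('a, 'p, real) coefficient \<Rightarrow> (real \<Rightarrow> 'a prob1) \<Rightarrow> (real \<Rightarrow> 'a \<Rightarrow> real) \<Rightarrow>
    (real \<Rightarrow> 'a \<times> real) set" where
  "char_curves T P f g \<mu> V = {\<omega> \<in> topspace (curves T).
     solves_inclusion (\<lambda>t (x, z). E_minus P f g t x (\<mu> t)) 0 T \<omega> \<and>
     (\<forall>t\<in>{0..T}. snd (\<omega> t) = V t (fst (\<omega> t)))}"

definition borel_of_topology :: "'b topology \<Rightarrow> 'b measure" where
  "borel_of_topology X = sigma (topspace X) {U. openin X U}"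

definition minimax_MFG :: "real \<Rightarrow> 'p set \<Rightarrow> ('a::euclidean_space, 'p, 'a) coefficient \<Rightarrow>
    ('a, 'p, real) coefficient \<Rightarrow> ('a \<Rightarrow> 'a prob1 \<Rightarrow> real) \<Rightarrow> 'a prob1 \<Rightarrow> (real \<Rightarrow> 'a \<Rightarrow> real) \<Rightarrow>
    (real \<Rightarrow> 'a prob1) \<Rightarrow> bool" where
  "minimax_MFG T P f g \<sigma> m\<^sub>0 V \<mu> \<longleftrightarrow>
     continuous_on ({0..T} \<times> UNIV) (\<lambda>(t, x). V t x) \<and> continuous_on {0..T} \<mu> \<and>
     minimax_HJ T P f g \<sigma> \<mu> V \<and> \<mu> 0 = m\<^sub>0 \<and>
     (\<exists>\<xi>. prob_space \<xi> \<and>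
        sets \<xi> = sets (borel_of_topology (subtopology (curves T) (char_curves T P f g \<mu> V))) \<and>
        (\<forall>t\<in>{0..T}. law (\<mu> t) = distr \<xi> borel (\<lambda>\<omega>. fst (\<omega> t))))"

definition support :: "'a::topological_space measure \<Rightarrow> 'a set" where
  "support m = {x. \<forall>U. open U \<longrightarrow> x \<in> U \<longrightarrow> emeasure m U > 0}"

end

theory Submission
  imports Defs
begin

text \<open>Along a solution of \<open>x' = b(t, x)\<close> with \<open>b = \<partial>H/\<partial>p(t, x, \<mu>[t], \<nabla>V)\<close> the derivative of \<open>V(t, x(t))\<close>
is \<open>\<langle>\<nabla>V, b\<rangle> - H\<close>, and \<open>(b, \<langle>\<nabla>V, b\<rangle> - H)\<close> lies in \<open>E\<^sup>-\<close> because \<open>b\<close> is the gradient of a maximum of affine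
functions; this gives the viability of the hypograph. Along \<open>x' = f(t, x, \<mu>[t], u)\<close> the derivative is at most
\<open>g\<close>, which gives that of the epigraph. It remains to represent \<open>\<mu>\<close> by a measure on the integral curves of \<open>b\<close>.

Since \<open>b\<close> is merely continuous there is no flow to push \<open>m\<^sub>0\<close> forward, and the representation is a superposition
principle. The measures \<open>\<mu>[t]\<close> stay in a fixed ball. Their Bernstein weights on the points of a fine lattice
satisfy the forward equation of a jump process up to a small error; this yields finite-state Markov chains with
one-time laws near \<open>\<mu>[t]\<close> and drift near \<open>b\<close>, whose interpolated paths nearly solve the equation in mean.
The laws of these paths are carried by a compact set of Lipschitz curves. Any limit is carried by integral curves of \<open>b\<close> and has the
marginals \<open>\<mu>[t]\<close>; compactness of the laws is Helly's theorem on the line, after parametrising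
the curves by a compact subset of \<open>\<real>\<close>.\<close>

section \<open>Compact spaces as images of compact sets of reals\<close>

text \<open>The drift is only continuous, so its integral curves need not be unique and the
  approximating processes must be read off \<mu> itself. Bernstein weights suit this because the
  derivative of a weight is a multiple of a difference of two weights of lower degree, each of which
  belongs to an edge of the lattice and is shared by both its end points
  (\<open>wgt_down_shift\<close>). Testing the weak equation with a weight therefore gives an exact
  balance of mass with nonnegative fluxes between neighbours, and fluxes divided by masses are
  transition probabilities. With spacing of order 1/n, jumps have size of order 1/n and total rate
  of order n, so their quadratic variation is of order 1/n: the chain minus its accumulated drift
  tends to 0 in mean square. The chain paths jump; the curves used instead have the drift along the
  chain as velocity, which gives them a common Lipschitz constant. Before the limit every law on
  paths has finite support, so that conditioning amounts to finite sums.\<close>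

definition cantor :: "(nat \<Rightarrow> bool) \<Rightarrow> real" where
  "cantor d = (\<Sum>n. of_bool (d n) * (1/3) ^ n)"

lemma cantor_summable: "summable (\<lambda>n. of_bool (d n) * (1/3::real) ^ n)"
  by (rule summable_comparison_test'[where g = "\<lambda>n. (1/3::real)^n" and N = 0]) auto

text \<open>The ratio 1/3 leaves gaps: at the first differing digit one number gains (1/3)^n, while
  all later digits together weigh at most half of that and cannot make up for it.\<close>

lemma inj_cantor: "inj cantor"
proof (rule injI, rule ccontr)
  have *: False if eq: "cantor d = cantor d'" and n: "\<And>m. m < n \<Longrightarrow> d m = d' m" "d n" "\<not> d' n"
    for d d' n
  proof -
    let ?t = "\<lambda>d n. of_bool (d n) * (1/3::real) ^ n"
    have split: "cantor d = (\<Sum>m. ?t d (m + Suc n)) + (\<Sum>m<Suc n. ?t d m)" for d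
      unfolding cantor_def by (rule suminf_split_initial_segment[OF cantor_summable])
    have "(\<Sum>m. ?t d' (m + Suc n)) \<le> (\<Sum>m. (1/3::real) ^ Suc n * (1/3) ^ m)"
    proof (rule suminf_le)
      show "summable (\<lambda>m. ?t d' (m + Suc n))"
        using cantor_summable[of d'] by (rule summable_ignore_initial_segment)
      show "summable (\<lambda>m. (1/3::real) ^ Suc n * (1/3) ^ m)"
        by (intro summable_mult summable_geometric) simp
    qed (simp add: power_add)
    also have "\<dots> = (1/3) ^ n / 2"
      by (subst suminf_mult) (auto simp: suminf_geometric)
    also have "\<dots> < (1/3) ^ n" by simp
    finally have "(\<Sum>m. ?t d' (m + Suc n)) < (1/3) ^ n" .
    moreover have "(\<Sum>m. ?t d (m + Suc n)) \<ge> 0"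
      using cantor_summable[of d] by (intro suminf_nonneg summable_ignore_initial_segment) auto
    moreover have "(\<Sum>m<n. ?t d m) = (\<Sum>m<n. ?t d' m)" using n(1) by (intro sum.cong) auto
    ultimately show False using eq n(2,3) unfolding split by simp
  qed
  fix d d' assume "cantor d = cantor d'" "d \<noteq> d'"
  define n where "n = (LEAST n. d n \<noteq> d' n)"
  have "\<exists>n. d n \<noteq> d' n" using \<open>d \<noteq> d'\<close> by auto
  then have "d n \<noteq> d' n" unfolding n_def by (rule LeastI_ex)
  moreover have "d m = d' m" if "m < n" for m using not_less_Least that unfolding n_def by blast
  ultimately show False using *[of d d' n] *[of d' d n] \<open>cantor d = cantor d'\<close> by (cases "d n") auto
qed

lemma continuous_on_cantor: "continuous_on UNIV cantor"
proof (rule uniform_limit_theorem[where F = sequentially and f = "\<lambda>N d. \<Sum>n<N. of_bool (d n) * (1/3::real) ^ n"])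
  have 1: "continuous_on UNIV (\<lambda>d :: nat \<Rightarrow> bool. of_bool (d n) :: real)" for n
  proof -
    have "continuous_on UNIV (of_bool :: bool \<Rightarrow> real)" by simp
    then show ?thesis
      by (rule continuous_on_compose2[of UNIV]) (auto intro: continuous_on_product_coordinates)
  qed
  show "\<forall>\<^sub>F N in sequentially. continuous_on UNIV (\<lambda>d. \<Sum>n<N. of_bool (d n) * (1/3::real) ^ n)"
    by (intro always_eventually allI continuous_on_sum continuous_on_mult 1 continuous_on_const)
  show "uniform_limit UNIV (\<lambda>N d. \<Sum>n<N. of_bool (d n) * (1/3::real) ^ n) cantor sequentially"
    unfolding cantor_def by (rule Weierstrass_m_test[where M = "\<lambda>n. (1/3)^n"]) auto
qed simp

lemma compact_UNIV_bool_seq: "compact (UNIV :: (nat \<Rightarrow> bool) set)"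
proof -
  have "compactin (product_topology (\<lambda>n::nat. euclidean :: bool topology) UNIV) (UNIV \<rightarrow>\<^sub>E UNIV)"
    by (subst compactin_PiE) (auto intro: finite_imp_compact)
  then show ?thesis by (simp add: euclidean_product_topology)
qed

text \<open>A point is encoded by a sequence of binary digits, the \<open>n\<close>-th of which tells in which of the two
  closed sets \<open>A n\<close>, \<open>B n\<close> it lies (both digits are allowed in the intersection).\<close>

lemma compact_image_of_real_compact:
  fixes K :: "'a::topological_space set" and A B :: "nat \<Rightarrow> 'a set"
  assumes K: "compact K" and cl: "\<And>n. closed (A n)" "\<And>n. closed (B n)"
    and cover: "\<And>n. K \<subseteq> A n \<union> B n"
    and sep: "\<And>x y. x \<in> K \<Longrightarrow> y \<in> K \<Longrightarrow> x \<noteq> y \<Longrightarrow>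
      \<exists>n. x \<notin> A n \<and> y \<notin> B n \<or> x \<notin> B n \<and> y \<notin> A n"
  obtains C :: "real set" and \<pi> :: "real \<Rightarrow> 'a"
  where "compact C" "continuous_on C \<pi>" "\<pi> ` C = K"
proof -
  define S where "S = (UNIV \<times> K) \<inter> (\<Inter>n. {p. \<not> fst p n \<and> snd p \<in> A n \<or> fst p n \<and> snd p \<in> B n})"
  have "closed {p :: (nat \<Rightarrow> bool) \<times> 'a. \<not> fst p n \<and> snd p \<in> A n \<or> fst p n \<and> snd p \<in> B n}" for n
  proof -
    have *: "continuous_on UNIV (\<lambda>p :: (nat \<Rightarrow> bool) \<times> 'a. fst p n)"
      by (rule continuous_on_compose2[OF continuous_on_product_coordinates, of UNIV fst])
         (auto intro: continuous_intros)
    have "closed ((\<lambda>p :: (nat \<Rightarrow> bool) \<times> 'a. fst p n) -` {b})" for b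
      by (intro closed_vimage *) simp
    moreover have "closed (snd -` X :: ((nat \<Rightarrow> bool) \<times> 'a) set)" if "closed X" for X :: "'a set"
      using that by (intro closed_vimage continuous_intros)
    moreover have "{p :: (nat \<Rightarrow> bool) \<times> 'a. \<not> fst p n \<and> snd p \<in> A n \<or> fst p n \<and> snd p \<in> B n} =
        ((\<lambda>p. fst p n) -` {False} \<inter> snd -` A n) \<union> ((\<lambda>p. fst p n) -` {True} \<inter> snd -` B n)" by auto
    ultimately show ?thesis by (simp add: closed_Un closed_Int cl)
  qed
  then have S: "compact S"
    unfolding S_def by (intro compact_Int_closed compact_Times K compact_UNIV_bool_seq closed_INT) auto
  \<comment> \<open>The code keeps only the digits. On \<open>S\<close> they determine the point by
    \<open>sep\<close>, so \<open>e\<close> is a continuous injection of a compact set and its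
    inverse is continuous.\<close>
  define e where "e = (\<lambda>p :: (nat \<Rightarrow> bool) \<times> 'a. cantor (fst p))"
  have e: "continuous_on S e"
    unfolding e_def by (rule continuous_on_compose2[OF continuous_on_cantor]) (auto intro: continuous_intros)
  have inj: "inj_on e S"
  proof (rule inj_onI)
    fix p q assume pq: "p \<in> S" "q \<in> S" "e p = e q"
    then have d: "fst p = fst q" using inj_cantor by (auto simp: e_def inj_def)
    have "snd p = snd q"
    proof (rule ccontr)
      assume "snd p \<noteq> snd q"
      moreover have "snd p \<in> K" "snd q \<in> K" using pq by (auto simp: S_def)
      ultimately obtain n where n: "snd p \<notin> A n \<and> snd q \<notin> B n \<or> snd p \<notin> B n \<and> snd q \<notin> A n"
        using sep by blast
      have "\<not> fst p n \<and> snd p \<in> A n \<or> fst p n \<and> snd p \<in> B n"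
        "\<not> fst q n \<and> snd q \<in> A n \<or> fst q n \<and> snd q \<in> B n"
        using pq(1,2) by (simp_all add: S_def)
      with n d show False by auto
    qed
    with d show "p = q" by (simp add: prod_eq_iff)
  qed
  have inv: "continuous_on (e ` S) (inv_into S e)"
    by (rule continuous_on_inv[OF e S]) (simp add: inj)
  show ?thesis
  proof (rule that[of "e ` S" "\<lambda>c. snd (inv_into S e c)"])
    show "compact (e ` S)" by (rule compact_continuous_image[OF e S])
    show "continuous_on (e ` S) (\<lambda>c. snd (inv_into S e c))" using inv by (rule continuous_on_snd)
    have "K \<subseteq> snd ` S"
    proof
      fix x assume "x \<in> K"
      \<comment> \<open>Digit 1 is taken only where \<open>A n\<close> fails; \<open>cover\<close>
        then puts the point in \<open>B n\<close>.\<close>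
      then have "((\<lambda>n. x \<notin> A n), x) \<in> S" using cover by (auto simp: S_def)
      then show "x \<in> snd ` S" by force
    qed
    then have "snd ` S = K" by (auto simp: S_def)
    then show "(\<lambda>c. snd (inv_into S e c)) ` e ` S = K"
      by (simp add: image_image inv_into_f_f[OF inj] cong: image_cong_simp)
  qed
qed

text \<open>A Prokhorov theorem for discrete measures: transporting them to the compact set \<open>C\<close> of reals
  reduces it to Helly's selection theorem.\<close>

lemma discrete_measures_subsequence:
  fixes C :: "real set" and \<pi> :: "real \<Rightarrow> 'a" and Q :: "nat \<Rightarrow> 'a pmf"
  assumes C: "compact C" and Q: "\<And>n. set_pmf (Q n) \<subseteq> \<pi> ` C"
  obtains \<nu> :: "real measure" and r :: "nat \<Rightarrow> nat"
  where "prob_space \<nu>" "sets \<nu> = sets borel" "AE c in \<nu>. c \<in> C" "strict_mono r"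
    "\<And>F :: 'a \<Rightarrow> real. continuous_on C (\<lambda>c. F (\<pi> c)) \<Longrightarrow>
      (\<lambda>n. \<integral>x. F x \<partial>measure_pmf (Q (r n))) \<longlonglongrightarrow> (\<integral>c. F (\<pi> c) * indicator C c \<partial>\<nu>)"
proof -
  have nonempty: "C \<noteq> {}" using Q[of 0] set_pmf_not_empty[of "Q 0"] by auto
  define s where "s = inv_into C \<pi>"
  \<comment> \<open>The section \<open>s\<close> need not be Borel measurable: it acts on a pmf,
    whose sigma-algebra contains all sets. Pushing forward along the identity only passes to the
    Borel sets of the line.\<close>
  define N where "N = (\<lambda>n. distr (measure_pmf (map_pmf s (Q n))) borel (\<lambda>c. c))"
  have s: "s x \<in> C" "\<pi> (s x) = x" if "x \<in> set_pmf (Q n)" for x n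
    using that Q[of n] unfolding s_def by (auto simp: inv_into_into f_inv_into_f)
  have Nint: "(\<integral>c. h c \<partial>N n) = (\<integral>x. h (s x) \<partial>measure_pmf (Q n))" if "h \<in> borel_measurable borel" for h :: "real \<Rightarrow> real" and n
    unfolding N_def using that by (subst integral_distr) auto
  have rd: "real_distribution (N n)" for n
    unfolding N_def real_distribution_def real_distribution_axioms_def
    by (auto intro: measure_pmf.prob_space_distr)
  obtain R where R: "R > 0" "\<And>c. c \<in> C \<Longrightarrow> \<bar>c\<bar> < R"
    using compact_imp_bounded[OF C] unfolding bounded_pos_less by auto
  have "tight N"
    unfolding tight_def
  proof (intro conjI allI impI rd)
    fix \<epsilon> :: real assume "\<epsilon> > 0"
    have "measure (N n) {-R<..R} = 1" for n
    proof -
      interpret real_distribution "N n" by (rule rd)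
      have "AE c in N n. c \<in> {-R<..R}"
        unfolding N_def using s(1) R(2) by (subst AE_distr_iff) (force simp: AE_measure_pmf_iff abs_less_iff)+
      then show ?thesis by (subst prob_eq_1) (auto simp: N_def)
    qed
    then show "\<exists>a b. a < b \<and> (\<forall>n. 1 - \<epsilon> < measure (N n) {a<..b})"
      using R(1) \<open>\<epsilon> > 0\<close> by (intro exI[of _ "-R"] exI[of _ R]) auto
  qed
  from tight_imp_convergent_subsubsequence[OF this strict_mono_id] obtain r \<nu>
    where r: "strict_mono r" and \<nu>: "real_distribution \<nu>" and conv: "weak_conv_m (N \<circ> r) \<nu>"
    by (auto simp: o_def)
  interpret \<nu>: real_distribution \<nu> by fact
  have lim: "(\<lambda>n. \<integral>x. h (s x) \<partial>measure_pmf (Q (r n))) \<longlonglongrightarrow> (\<integral>c. h c \<partial>\<nu>)"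
    if h: "continuous_on UNIV h" "\<And>c. \<bar>h c\<bar> \<le> B" for h :: "real \<Rightarrow> real" and B
  proof -
    have "(\<lambda>n. \<integral>c. h c \<partial>(N \<circ> r) n) \<longlonglongrightarrow> (\<integral>c. h c \<partial>\<nu>)"
      using h by (intro weak_conv_imp_integral_bdd_continuous_conv[OF _ \<nu> conv])
        (auto simp: rd continuous_on_eq_continuous_at)
    moreover have "h \<in> borel_measurable borel" using h(1) by (rule borel_measurable_continuous_onI)
    ultimately show ?thesis by (simp add: Nint)
  qed
  \<comment> \<open>A bounded continuous function that vanishes exactly on the closed set
    \<open>C\<close>. Its integrals are 0 along the sequence, hence for the limit, which is
    therefore carried by \<open>C\<close>.\<close>
  let ?d = "\<lambda>c. min 1 (infdist c C)"
  have d: "continuous_on UNIV ?d" by (intro continuous_intros)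
  have "(\<lambda>n. \<integral>x. ?d (s x) \<partial>measure_pmf (Q (r n))) \<longlonglongrightarrow> (\<integral>c. ?d c \<partial>\<nu>)"
    using d by (intro lim[of ?d 1]) (auto simp: infdist_nonneg)
  moreover have "(\<integral>x. ?d (s x) \<partial>measure_pmf (Q n)) = 0" for n
    using s(1) by (intro integral_eq_zero_AE) (auto simp: AE_measure_pmf_iff)
  ultimately have "(\<lambda>n. 0) \<longlonglongrightarrow> (\<integral>c. ?d c \<partial>\<nu>)" by simp
  then have "(\<integral>c. ?d c \<partial>\<nu>) = 0" by (simp add: LIMSEQ_const_iff)
  moreover have "integrable \<nu> ?d"
    using borel_measurable_continuous_onI[OF d] by (intro \<nu>.integrable_const_bound[where B = 1]) (auto simp: infdist_nonneg)
  ultimately have "AE c in \<nu>. ?d c = 0"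
    using integral_nonneg_eq_0_iff_AE[of \<nu> ?d] by (simp add: infdist_nonneg)
  then have AE: "AE c in \<nu>. c \<in> C"
    by eventually_elim
       (use compact_imp_closed[OF C] nonempty in_closed_iff_infdist_zero in \<open>auto simp: min_def split: if_splits\<close>)
  show ?thesis
  proof (rule that[OF _ _ AE r])
    fix F :: "'a \<Rightarrow> real" assume F: "continuous_on C (\<lambda>c. F (\<pi> c))"
    obtain B where B: "B \<ge> 0" "\<And>c. c \<in> C \<Longrightarrow> norm (F (\<pi> c)) \<le> B"
      using compact_imp_bounded[OF compact_continuous_image[OF F C]] unfolding bounded_pos
      by (auto intro: less_imp_le)
    \<comment> \<open>Weak convergence asks for a bounded continuous function on the whole line; all
      measures involved are carried by \<open>C\<close>, so any such extension will do.\<close>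
    obtain h where h: "continuous_on UNIV h" "\<And>c. c \<in> C \<Longrightarrow> h c = F (\<pi> c)" "\<And>c. norm (h c) \<le> B"
      using Tietze[OF F _ B(1), of UNIV] B(2) compact_imp_closed[OF C] by auto
    have "(\<lambda>n. \<integral>x. h (s x) \<partial>measure_pmf (Q (r n))) \<longlonglongrightarrow> (\<integral>c. h c \<partial>\<nu>)"
      using h(1,3) by (intro lim) auto
    moreover have "(\<integral>x. h (s x) \<partial>measure_pmf (Q n)) = (\<integral>x. F x \<partial>measure_pmf (Q n))" for n
      using s h(2) by (intro integral_cong_AE) (auto simp: AE_measure_pmf_iff)
    moreover have "(\<integral>c. h c \<partial>\<nu>) = (\<integral>c. F (\<pi> c) * indicator C c \<partial>\<nu>)"
    proof (rule integral_cong_AE)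
      show "h \<in> borel_measurable \<nu>" using borel_measurable_continuous_onI[OF h(1)] by simp
      have "(\<lambda>c. indicator C c *\<^sub>R F (\<pi> c)) \<in> borel_measurable borel"
        using F compact_imp_closed[OF C] by (intro borel_measurable_continuous_on_indicator) auto
      then show "(\<lambda>c. F (\<pi> c) * indicator C c) \<in> borel_measurable \<nu>" by (simp add: mult.commute)
    qed (use AE h(2) in auto)
    ultimately show "(\<lambda>n. \<integral>x. F x \<partial>measure_pmf (Q (r n))) \<longlonglongrightarrow> (\<integral>c. F (\<pi> c) * indicator C c \<partial>\<nu>)"
      by simp
  qed (use \<nu>.prob_space_axioms in auto)
qed

section \<open>Compactness of sets of curves with a common Lipschitz constant\<close>

definition lip_curves :: "real \<Rightarrow> real \<Rightarrow> (real \<Rightarrow> 'a::euclidean_space) set" where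
  "lip_curves C R = {x. (\<forall>s t. dist (x s) (x t) \<le> C * \<bar>s - t\<bar>) \<and> norm (x 0) \<le> R}"

lemma lip_curves_continuous_on:
  assumes "x \<in> lip_curves C R"
  shows "continuous_on S x"
proof -
  have "\<bar>C\<bar>-lipschitz_on S x"
  proof (rule lipschitz_onI)
    fix s t :: real
    have "C * \<bar>s - t\<bar> \<le> \<bar>C\<bar> * \<bar>s - t\<bar>" by (intro mult_right_mono) auto
    then show "dist (x s) (x t) \<le> \<bar>C\<bar> * dist s t"
      using assms unfolding lip_curves_def dist_real_def by (auto intro: order_trans)
  qed simp
  then show ?thesis by (rule lipschitz_on_continuous_on)
qed

text \<open>Tychonoff takes the place of Arzela-Ascoli: the curves are functions on the whole line,
  the topology is pointwise convergence, every value lies in a closed ball depending on the time,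
  and all defining conditions are closed.\<close>

lemma compact_lip_curves: "compact (lip_curves C R :: (real \<Rightarrow> 'a::euclidean_space) set)"
proof -
  let ?B = "PiE UNIV (\<lambda>t::real. cball (0::'a) (R + C * \<bar>t\<bar>))"
  have coord: "continuous_on UNIV (\<lambda>x. x t :: 'a)" for t :: real
    by (rule continuous_on_product_coordinates)
  have "compactin (product_topology (\<lambda>t::real. euclidean :: 'a topology) UNIV) ?B"
    by (subst compactin_PiE) auto
  then have B: "compact ?B" by (simp add: euclidean_product_topology)
  have "closed (lip_curves C R :: (real \<Rightarrow> 'a) set)"
    unfolding lip_curves_def
    by (intro closed_Collect_conj closed_Collect_all closed_Collect_le continuous_intros coord)
  moreover have "lip_curves C R \<subseteq> ?B"
  proof
    fix x :: "real \<Rightarrow> 'a" assume x: "x \<in> lip_curves C R"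
    have "norm (x t) \<le> R + C * \<bar>t\<bar>" for t
    proof -
      have "dist (x t) (x 0) \<le> C * \<bar>t - 0\<bar>" "norm (x 0) \<le> R"
        using x unfolding lip_curves_def by blast+
      then show ?thesis using norm_triangle_sub[of "x t" "x 0"] by (simp add: dist_norm)
    qed
    then show "x \<in> ?B" by (auto simp: PiE_def)
  qed
  ultimately show ?thesis using compact_Int_closed[OF B] by (metis Int_absorb1)
qed

text \<open>Two different curves differ in a coordinate at a rational time, and a rational level
  separates the two values; countably many pairs of half-spaces thus suffice. Joint continuity in
  parameter and time comes from pointwise continuity and the common Lipschitz constant.\<close>

lemma lip_curves_parametrization:
  assumes "C \<ge> 0"
  obtains D :: "real set" and \<pi> :: "real \<Rightarrow> real \<Rightarrow> 'a::euclidean_space"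
  where "compact D" "\<pi> ` D = lip_curves C R" "continuous_on (D \<times> UNIV) (\<lambda>(c, t). \<pi> c t)"
proof -
  let ?I = "(\<rat> :: real set) \<times> (Basis :: 'a set) \<times> (\<rat> :: real set) \<times> (\<rat> :: real set)"
  have I: "countable ?I" by (intro countable_SIGMA countable_rat countable_finite finite_Basis)
  define i where "i = from_nat_into ?I"
  \<comment> \<open>The bound \<open>max u v\<close> instead of \<open>v\<close> keeps the two sets
    a cover also for indices with v < u. The separation takes u = v.\<close>
  define A where "A = (\<lambda>n. case i n of (r, b, u, v) \<Rightarrow> {x :: real \<Rightarrow> 'a. x r \<bullet> b \<le> max u v})"
  define B where "B = (\<lambda>n. case i n of (r, b, u, v) \<Rightarrow> {x :: real \<Rightarrow> 'a. u \<le> x r \<bullet> b})"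
  have coord: "continuous_on UNIV (\<lambda>x. x t :: 'a)" for t :: real
    by (rule continuous_on_product_coordinates)
  have cl: "closed (A n)" "closed (B n)" for n
    unfolding A_def B_def by (auto split: prod.split intro!: closed_Collect_le continuous_intros coord)
  have cover: "lip_curves C R \<subseteq> A n \<union> B n" for n
    unfolding A_def B_def by (cases "i n") auto
  have sep: "\<exists>n. x \<notin> A n \<and> y \<notin> B n \<or> x \<notin> B n \<and> y \<notin> A n"
    if x: "x \<in> lip_curves C R" and y: "y \<in> lip_curves C R" and "x \<noteq> y" for x y
  proof -
    have "\<exists>r\<in>\<rat>. x r \<noteq> y r"
    proof (rule ccontr)
      assume *: "\<not> (\<exists>r\<in>\<rat>. x r \<noteq> y r)"
      have "x t = y t" for t
      proof (rule continuous_constant_on_closure[of \<rat> "\<lambda>r. x r - y r" 0 t, simplified])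
        show "continuous_on (closure \<rat>) (\<lambda>r. x r - y r)"
          by (intro continuous_on_diff lip_curves_continuous_on[OF x] lip_curves_continuous_on[OF y])
      qed (use * Rats_closure_real in auto)
      then show False using \<open>x \<noteq> y\<close> by auto
    qed
    then obtain r b where r: "r \<in> \<rat>" and b: "b \<in> Basis" "x r \<bullet> b \<noteq> y r \<bullet> b"
      using euclidean_eq_iff by blast
    have *: "\<exists>n. x' \<notin> B n \<and> y' \<notin> A n" if less: "x' r \<bullet> b < y' r \<bullet> b" for x' y'
    proof -
      obtain v where v: "v \<in> \<rat>" "x' r \<bullet> b < v" "v < y' r \<bullet> b" using Rats_dense_in_real[OF less] by auto
      obtain n where n: "i n = (r, b, v, v)"
        using from_nat_into_surj[OF I, of "(r, b, v, v)"] r b v unfolding i_def by auto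
      then show ?thesis using v unfolding A_def B_def by (intro exI[of _ n]) auto
    qed
    from b(2) consider "x r \<bullet> b < y r \<bullet> b" | "y r \<bullet> b < x r \<bullet> b" by linarith
    then show ?thesis using *[of x y] *[of y x] by cases blast+
  qed
  obtain D :: "real set" and \<pi> where D: "compact D" "continuous_on D \<pi>" "\<pi> ` D = (lip_curves C R :: (real \<Rightarrow> 'a) set)"
    using compact_image_of_real_compact[OF compact_lip_curves cl cover sep] by blast
  have \<pi>: "continuous_on D (\<lambda>c. \<pi> c t)" for t
    using D(2) by (rule continuous_on_product_then_coordinatewise)
  have "continuous_on (D \<times> UNIV) (\<lambda>(c, t). \<pi> c t)"
    unfolding continuous_on_iff
  proof (intro ballI allI impI)
    fix p :: "real \<times> real" and \<epsilon> :: real assume "p \<in> D \<times> UNIV" "\<epsilon> > 0"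
    then obtain c t where p: "p = (c, t)" "c \<in> D" by auto
    obtain d where d: "d > 0" "\<And>c'. c' \<in> D \<Longrightarrow> dist c' c < d \<Longrightarrow> dist (\<pi> c' t) (\<pi> c t) < \<epsilon> / 2"
      using \<pi>[of t] p(2) \<open>\<epsilon> > 0\<close> unfolding continuous_on_iff by (meson half_gt_zero)
    let ?d = "min d (\<epsilon> / (2 * (C + 1)))"
    show "\<exists>d>0. \<forall>q\<in>D \<times> UNIV. dist q p < d \<longrightarrow> dist (case q of (c, t) \<Rightarrow> \<pi> c t) (case p of (c, t) \<Rightarrow> \<pi> c t) < \<epsilon>"
    proof (intro exI[of _ ?d] conjI ballI impI)
      show "?d > 0" using d(1) \<open>\<epsilon> > 0\<close> assms by simp
      fix q assume "q \<in> D \<times> (UNIV :: real set)" and q: "dist q p < ?d"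
      then obtain c' t' where q': "q = (c', t')" "c' \<in> D" by auto
      have "dist c' c < ?d" "dist t' t < ?d"
        using q dist_fst_le[of q p] dist_snd_le[of q p] unfolding q' p by auto
      then have 1: "dist (\<pi> c' t) (\<pi> c t) < \<epsilon> / 2" and 2: "dist t' t \<le> \<epsilon> / (2 * (C + 1))"
        using d(2)[OF q'(2)] by auto
      have "\<pi> c' \<in> lip_curves C R" using D(3) q'(2) by blast
      then have "dist (\<pi> c' t') (\<pi> c' t) \<le> C * \<bar>t' - t\<bar>" unfolding lip_curves_def by blast
      also have "\<dots> \<le> (C + 1) * (\<epsilon> / (2 * (C + 1)))"
        using 2 assms by (intro mult_mono) (auto simp: dist_real_def)
      also have "\<dots> = \<epsilon> / 2" using assms by (simp add: add_eq_0_iff divide_simps)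
      finally show "dist (case q of (c, t) \<Rightarrow> \<pi> c t) (case p of (c, t) \<Rightarrow> \<pi> c t) < \<epsilon>"
        using 1 dist_triangle[of "\<pi> c' t'" "\<pi> c t" "\<pi> c' t"] unfolding q' p by simp
    qed
  qed
  with D show ?thesis by (intro that)
qed

section \<open>Polygonal curves and Peano's theorem\<close>

text \<open>Boundedness and uniform continuity in a form that can be averaged: the modulus is linear
  in the squared distance, so it can be integrated against the mean square error known for the
  chains.\<close>

definition tame :: "real \<Rightarrow> (real \<Rightarrow> 'a::euclidean_space \<Rightarrow> 'a) \<Rightarrow> bool" where
  "tame C b \<longleftrightarrow> (\<forall>t x. norm (b t x) \<le> C) \<and>
     (\<forall>\<epsilon>>0. \<exists>\<kappa>\<ge>0. \<forall>s t x y. norm (b s x - b t y) \<le> \<epsilon> + \<kappa> * (\<bar>s - t\<bar> + (dist x y)\<^sup>2))"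

lemma tame_bound: "tame C b \<Longrightarrow> norm (b t x) \<le> C" and tame_nonneg: "tame C b \<Longrightarrow> 0 \<le> C"
  unfolding tame_def using order_trans[OF norm_ge_zero] by blast+

lemma tame_modulus:
  assumes "tame C b" "\<epsilon> > 0"
  obtains \<kappa> where "\<kappa> \<ge> 0" "\<And>s t x y. norm (b s x - b t y) \<le> \<epsilon> + \<kappa> * (\<bar>s - t\<bar> + (dist x y)\<^sup>2)"
  using assms unfolding tame_def by blast

lemma tame_uniformly_continuous:
  assumes bd: "\<And>t x. norm (b t x) \<le> C" and uc: "uniformly_continuous_on UNIV (\<lambda>(t, x). b t x)"
  shows "tame C b"
  unfolding tame_def
proof (intro conjI allI impI bd)
  fix \<epsilon> :: real assume "\<epsilon> > 0"
  then obtain d where d: "d > 0" "\<And>p q. dist q p < d \<Longrightarrow> dist (case q of (t, x) \<Rightarrow> b t x) (case p of (t, x) \<Rightarrow> b t x) < \<epsilon>"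
    using uc unfolding uniformly_continuous_on_def by (metis UNIV_I)
  have C: "C \<ge> 0" using bd order_trans[OF norm_ge_zero] by blast
  \<comment> \<open>The difference never exceeds 2C. If the time gap is at least d/2, the term with
    2/d reaches 2C; if the space gap is at least d/2, the term with 4/d^2 does.\<close>
  let ?k = "2 * C * (2 / d + 4 / d\<^sup>2)"
  show "\<exists>\<kappa>\<ge>0. \<forall>s t x y. norm (b s x - b t y) \<le> \<epsilon> + \<kappa> * (\<bar>s - t\<bar> + (dist x y)\<^sup>2)"
  proof (intro exI[of _ ?k] conjI allI)
    show "0 \<le> ?k" using C d(1) by simp
    fix s t :: real and x y :: 'a
    have nn: "0 \<le> ?k * (\<bar>s - t\<bar> + (dist x y)\<^sup>2)" using C d(1) by (intro mult_nonneg_nonneg) auto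
    consider "\<bar>s - t\<bar> < d / 2" "dist x y < d / 2" | "\<bar>s - t\<bar> \<ge> d / 2" | "dist x y \<ge> d / 2" by linarith
    then show "norm (b s x - b t y) \<le> \<epsilon> + ?k * (\<bar>s - t\<bar> + (dist x y)\<^sup>2)"
    proof cases
      case 1
      have "dist (s, x) (t, y) \<le> \<bar>s - t\<bar> + dist x y"
        unfolding dist_Pair_Pair dist_real_def[of s t, symmetric] by (rule sqrt_sum_squares_le_sum) auto
      with 1 have "dist (s, x) (t, y) < d" by simp
      then have "norm (b s x - b t y) < \<epsilon>" using d(2) by (force simp: dist_norm)
      with nn show ?thesis by linarith
    next
      case 2
      have "norm (b s x - b t y) \<le> 2 * C * 1" using norm_triangle_ineq4[of "b s x" "b t y"] bd[of s x] bd[of t y] by simp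
      also have "\<dots> \<le> 2 * C * (2 / d * \<bar>s - t\<bar>)"
        using C 2 d(1) by (intro mult_left_mono) (auto simp: field_simps)
      also have "\<dots> = 2 * C * (2 / d) * \<bar>s - t\<bar>" by simp
      also have "\<dots> \<le> ?k * (\<bar>s - t\<bar> + (dist x y)\<^sup>2)"
        using C d(1) by (intro mult_mono mult_left_mono) auto
      finally show ?thesis using \<open>\<epsilon> > 0\<close> by simp
    next
      case 3
      have "norm (b s x - b t y) \<le> 2 * C * 1" using norm_triangle_ineq4[of "b s x" "b t y"] bd[of s x] bd[of t y] by simp
      also have "\<dots> \<le> 2 * C * (4 / d\<^sup>2 * (dist x y)\<^sup>2)"
      proof (intro mult_left_mono)
        have "(d / 2)\<^sup>2 \<le> (dist x y)\<^sup>2" using 3 d(1) by (intro power_mono) auto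
        then show "1 \<le> 4 / d\<^sup>2 * (dist x y)\<^sup>2" using d(1) by (simp add: field_simps power2_eq_square)
      qed (use C in auto)
      also have "\<dots> = 2 * C * (4 / d\<^sup>2) * (dist x y)\<^sup>2" by simp
      also have "\<dots> \<le> ?k * (\<bar>s - t\<bar> + (dist x y)\<^sup>2)"
        using C d(1) by (intro mult_mono mult_left_mono) auto
      finally show ?thesis using \<open>\<epsilon> > 0\<close> by simp
    qed
  qed
qed

lemma tame_continuous_on:
  assumes "tame C b"
  shows "continuous_on S (\<lambda>(t, x). b t x)"
  unfolding continuous_on_iff
proof (intro ballI allI impI)
  fix p :: "real \<times> 'a" and \<epsilon> :: real assume "\<epsilon> > 0"
  obtain t x where p: "p = (t, x)" by fastforce
  from \<open>\<epsilon> > 0\<close> obtain k where k: "k \<ge> 0" "\<And>s t x y. norm (b s x - b t y) \<le> \<epsilon> / 2 + k * (\<bar>s - t\<bar> + (dist x y)\<^sup>2)"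
    using tame_modulus[OF assms, of "\<epsilon> / 2"] by auto
  let ?d = "min 1 (\<epsilon> / (4 * (k + 1)))"
  show "\<exists>d>0. \<forall>q\<in>S. dist q p < d \<longrightarrow> dist (case q of (t, x) \<Rightarrow> b t x) (case p of (t, x) \<Rightarrow> b t x) < \<epsilon>"
  proof (intro exI[of _ ?d] conjI ballI impI)
    show "0 < ?d" using k(1) \<open>\<epsilon> > 0\<close> by simp
    fix q assume q: "dist q p < ?d"
    obtain t' x' where q': "q = (t', x')" by fastforce
    have 1: "\<bar>t' - t\<bar> < ?d" "dist x' x < ?d"
      using q dist_fst_le[of q p] dist_snd_le[of q p] unfolding q' p by (auto simp: dist_real_def)
    have "(dist x' x)\<^sup>2 \<le> dist x' x * 1" unfolding power2_eq_square using 1(2) by (intro mult_left_mono) auto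
    then have "\<bar>t' - t\<bar> + (dist x' x)\<^sup>2 < 2 * (\<epsilon> / (4 * (k + 1)))"
      using 1 by linarith
    also have "2 * (\<epsilon> / (4 * (k + 1))) = \<epsilon> / (2 * (k + 1))" using k(1) by (simp add: divide_simps)
    finally have "\<bar>t' - t\<bar> + (dist x' x)\<^sup>2 < \<epsilon> / (2 * (k + 1))" .
    then have "k * (\<bar>t' - t\<bar> + (dist x' x)\<^sup>2) \<le> k * (\<epsilon> / (2 * (k + 1)))" using k(1) by (intro mult_left_mono) auto
    also have "\<dots> < \<epsilon> / 2" using k(1) \<open>\<epsilon> > 0\<close> by (simp add: field_simps)
    finally show "dist (case q of (t, x) \<Rightarrow> b t x) (case p of (t, x) \<Rightarrow> b t x) < \<epsilon>"
      using k(2)[of t' x' t x] unfolding q' p by (simp add: dist_norm)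
  qed
qed

text \<open>Clamping the time and projecting to the ball are Lipschitz retractions onto a compact
  set, where a continuous field is bounded and uniformly continuous. On that set the field is
  unchanged.\<close>

lemma tame_truncation:
  fixes b :: "real \<Rightarrow> 'a::euclidean_space \<Rightarrow> 'a"
  assumes b: "continuous_on ({0..T} \<times> UNIV) (\<lambda>(t, x). b t x)" and "T \<ge> 0" "R \<ge> 0"
  obtains C where "tame C (\<lambda>t x. b (max 0 (min T t)) (closest_point (cball 0 R) x))"
proof -
  let ?K = "{0..T} \<times> cball (0::'a) R"
  let ?g = "\<lambda>p :: real \<times> 'a. (max 0 (min T (fst p)), closest_point (cball 0 R) (snd p))"
  have K: "compact ?K" by (intro compact_Times) auto
  have bK: "continuous_on ?K (\<lambda>(t, x). b t x)" using b by (rule continuous_on_subset) auto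
  then have ucK: "uniformly_continuous_on ?K (\<lambda>(t, x). b t x)" using K by (rule compact_uniformly_continuous)
  obtain C where C: "\<And>p. p \<in> ?K \<Longrightarrow> norm (case p of (t, x) \<Rightarrow> b t x) \<le> C"
    using compact_imp_bounded[OF compact_continuous_image[OF bK K]] unfolding bounded_iff by auto
  have cp: "closest_point (cball 0 R) x \<in> cball 0 R" for x :: 'a
    using \<open>R \<ge> 0\<close> by (intro closest_point_in_set) auto
  have g: "?g p \<in> ?K" for p using cp \<open>T \<ge> 0\<close> by auto
  have "2-lipschitz_on UNIV ?g"
  proof (rule lipschitz_onI)
    fix p q :: "real \<times> 'a"
    have "dist (?g p) (?g q) \<le> dist (fst (?g p)) (fst (?g q)) + dist (snd (?g p)) (snd (?g q))"
      unfolding dist_prod_def[of "?g p"] by (rule sqrt_sum_squares_le_sum) auto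
    also have "dist (fst (?g p)) (fst (?g q)) \<le> dist (fst p) (fst q)" by (simp add: dist_real_def min_def max_def)
    also have "dist (snd (?g p)) (snd (?g q)) \<le> dist (snd p) (snd q)"
      using \<open>R \<ge> 0\<close> by (auto intro!: closest_point_lipschitz)
    finally show "dist (?g p) (?g q) \<le> 2 * dist p q"
      using dist_fst_le[of p q] dist_snd_le[of p q] by simp
  qed simp
  then have ug: "uniformly_continuous_on UNIV ?g" by (rule lipschitz_on_uniformly_continuous)
  have "uniformly_continuous_on UNIV (\<lambda>p. case ?g p of (t, x) \<Rightarrow> b t x)"
    by (rule uniformly_continuous_on_compose[OF ug, unfolded o_def])
       (use ucK g in \<open>unfold uniformly_continuous_on_def, meson image_subset_iff subsetD\<close>)
  then have "tame C (\<lambda>t x. b (max 0 (min T t)) (closest_point (cball 0 R) x))"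
    using C[OF g] by (intro tame_uniformly_continuous) (auto simp: case_prod_unfold)
  then show ?thesis by (rule that)
qed

section \<open>Curves with piecewise constant velocity\<close>

definition step_index :: "real \<Rightarrow> real \<Rightarrow> nat" where
  "step_index h s = nat \<lfloor>s / h\<rfloor>"

lemma step_index_eq:
  assumes "h > 0" "real k * h \<le> s" "s < real (Suc k) * h"
  shows "step_index h s = k"
proof -
  have "\<lfloor>s / h\<rfloor> = int k" using assms by (simp add: floor_eq_iff field_simps)
  then show ?thesis by (simp add: step_index_def)
qed

lemma step_index_bounds:
  assumes "h > 0" "s \<ge> 0"
  shows "real (step_index h s) * h \<le> s" "s < real (Suc (step_index h s)) * h"
  using assms floor_divide_lower[of h s] floor_divide_upper[of h s]
  unfolding step_index_def by (simp_all add: algebra_simps)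

lemma step_function_integrable:
  fixes v :: "nat \<Rightarrow> 'a::euclidean_space"
  assumes "\<And>k. norm (v k) \<le> C"
  shows "(\<lambda>s. v (step_index h s)) integrable_on {a..b}"
proof -
  have [measurable]: "step_index h \<in> borel \<rightarrow>\<^sub>M count_space UNIV" unfolding step_index_def by measurable
  have [measurable]: "(\<lambda>s. v (step_index h s)) \<in> borel_measurable borel"
    by (rule measurable_compose[of "step_index h" borel "count_space UNIV"]) auto
  have "set_integrable lborel {a..b} (\<lambda>s. v (step_index h s))"
    unfolding set_integrable_def
    by (rule integrableI_bounded_set_indicator[where B = C]) (auto simp: assms emeasure_lborel_Icc_eq)
  then show ?thesis by (rule set_borel_integral_eq_integral)
qed

text \<open>For negative times the interval of integration is empty and the curve rests at
  \<open>x0\<close>; this makes it Lipschitz on the whole line, as \<open>lip_curves\<close>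
  requires.\<close>

definition polygon :: "real \<Rightarrow> 'a::euclidean_space \<Rightarrow> (nat \<Rightarrow> 'a) \<Rightarrow> real \<Rightarrow> 'a" where
  "polygon h x0 v t = x0 + integral {0..t} (\<lambda>s. v (step_index h s))"

lemma polygon_0 [simp]: "polygon h x0 v 0 = x0"
  by (simp add: polygon_def)

lemma polygon_diff:
  assumes "\<And>k. norm (v k) \<le> C" "0 \<le> s" "s \<le> t"
  shows "polygon h x0 v t - polygon h x0 v s = integral {s..t} (\<lambda>s. v (step_index h s))"
  using Henstock_Kurzweil_Integration.integral_combine[of 0 s t "\<lambda>s. v (step_index h s)",
      OF assms(2,3) step_function_integrable[OF assms(1)]]
  by (simp add: polygon_def algebra_simps)

lemma polygon_in_lip_curves:
  assumes v: "\<And>k. norm (v k) \<le> C" and R: "norm x0 \<le> R"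
  shows "polygon h x0 v \<in> lip_curves C R"
proof -
  have C: "0 \<le> C" using v order_trans[OF norm_ge_zero] by blast
  have bound: "norm (integral {s..t} (\<lambda>s. v (step_index h s))) \<le> C * (t - s)" if "s \<le> t" for s t
    using has_integral_bound_real[OF C finite.emptyI integrable_integral[OF step_function_integrable[of v C h s t, OF v]]] v that
    by simp
  have *: "norm (polygon h x0 v t - polygon h x0 v s) \<le> C * (t - s)" if "s \<le> t" for s t
  proof -
    consider "0 \<le> s" | "s < 0" "0 \<le> t" | "t < 0" by linarith
    then show ?thesis
    proof cases
      case 1
      have "norm (integral {s..t} (\<lambda>s. v (step_index h s))) \<le> C * (t - s)"
        by (rule bound[OF that])
      then show ?thesis using polygon_diff[OF v 1 that] by simp
    next
      case 2
      have "norm (integral {0..t} (\<lambda>s. v (step_index h s))) \<le> C * (t - 0)"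
        by (rule bound[OF 2(2)])
      also have "\<dots> \<le> C * (t - s)" using 2 C by (intro mult_left_mono) auto
      finally show ?thesis using 2 by (simp add: polygon_def)
    next
      case 3
      then show ?thesis using C that by (simp add: polygon_def)
    qed
  qed
  have "dist (polygon h x0 v s) (polygon h x0 v t) \<le> C * \<bar>s - t\<bar>" for s t
  proof (cases "s \<le> t")
    case True
    from *[OF this] True show ?thesis by (simp add: dist_norm norm_minus_commute)
  next
    case False
    with *[of t s] show ?thesis by (simp add: dist_norm)
  qed
  with R show ?thesis by (simp add: lip_curves_def)
qed

lemma polygon_step:
  assumes v: "\<And>k. norm (v k) \<le> C" and h: "h > 0"
  shows "polygon h x0 v (real (Suc k) * h) = polygon h x0 v (real k * h) + h *\<^sub>R v k"
proof -
  let ?S = "{real k * h .. real (Suc k) * h}"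
  \<comment> \<open>The step index jumps at the right end point, which is a null set.\<close>
  have "integral ?S (\<lambda>s. v (step_index h s)) = integral ?S (\<lambda>s. v k)"
    by (rule integral_spike[of "{real (Suc k) * h}"]) (auto simp: step_index_eq h)
  also have "\<dots> = h *\<^sub>R v k" using h by (simp add: algebra_simps)
  finally show ?thesis
    using polygon_diff[OF v, of "real k * h" "real (Suc k) * h"] h by (simp add: algebra_simps)
qed

lemma integral_step_function:
  fixes \<phi> :: "nat \<Rightarrow> real"
  assumes "\<And>k. \<bar>\<phi> k\<bar> \<le> C" "h > 0"
  shows "integral {0..real M * h} (\<lambda>s. \<phi> (step_index h s)) = h * (\<Sum>k<M. \<phi> k)"
proof -
  \<comment> \<open>The integral of a real step function is the value of a polygon at a grid point,
    so \<open>polygon_step\<close> applies.\<close>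
  have "polygon h 0 \<phi> (real M * h) = h * (\<Sum>k<M. \<phi> k)"
    by (induction M) (use polygon_step[of \<phi> C h 0] assms in \<open>simp_all add: distrib_left\<close>)
  then show ?thesis by (simp add: polygon_def)
qed

text \<open>The defect in the integral form of x' = b(t, x). Unlike a derivative, it passes to
  limits of curves.\<close>

definition residual :: "(real \<Rightarrow> 'a::euclidean_space \<Rightarrow> 'a) \<Rightarrow> (real \<Rightarrow> 'a) \<Rightarrow> real \<Rightarrow> 'a" where
  "residual b x t = x t - x 0 - integral {0..t} (\<lambda>s. b s (x s))"

lemma tame_integrable:
  assumes "tame C b" "continuous_on {a..t} x"
  shows "(\<lambda>s. b s (x s)) integrable_on {a..t}"
proof (rule integrable_continuous_real)
  have "continuous_on {a..t} (\<lambda>s. (s, x s))" by (intro continuous_intros assms(2))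
  then show "continuous_on {a..t} (\<lambda>s. b s (x s))"
    using continuous_on_compose2[OF tame_continuous_on[OF assms(1), of UNIV], of "{a..t}" "\<lambda>s. (s, x s)"] by simp
qed

lemma continuous_on_residual:
  assumes b: "tame C b" and \<pi>: "continuous_on (D \<times> UNIV) (\<lambda>(c :: real, t). \<pi> c t)"
  shows "continuous_on D (\<lambda>c. residual b (\<pi> c) t)"
proof -
  have coord: "continuous_on D (\<lambda>c. \<pi> c t)" for t
    using continuous_on_compose2[OF \<pi> continuous_on_Pair[OF continuous_on_id continuous_on_const], of t] by auto
  have "continuous_on (D \<times> cbox 0 t) (\<lambda>(c, s). b s (\<pi> c s))"
  proof -
    have "D \<times> cbox 0 t \<subseteq> D \<times> UNIV" by auto
    from continuous_on_subset[OF \<pi> this]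
    have "continuous_on (D \<times> cbox 0 t) (\<lambda>p. (snd p, case p of (c, s) \<Rightarrow> \<pi> c s))"
      by (intro continuous_intros)
    from continuous_on_compose2[OF tame_continuous_on[OF b, of UNIV] this]
    show ?thesis by (simp add: case_prod_unfold)
  qed
  then have "continuous_on D (\<lambda>c. integral (cbox 0 t) (\<lambda>s. b s (\<pi> c s)))"
    by (rule integral_continuous_on_param)
  then show ?thesis unfolding residual_def by (auto intro!: continuous_intros coord)
qed

text \<open>The points \<open>X k\<close> at which the velocities are read off need not lie on the
  polygon. With its own grid points this is the Euler scheme and the last sum vanishes; with the
  states of a chain the sum is controlled by second moments.\<close>

lemma polygon_residual:
  fixes X :: "nat \<Rightarrow> 'a::euclidean_space"
  assumes b: "tame C b" and h: "h > 0" and t: "0 \<le> t" "t \<le> real M * h"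
    and \<kappa>: "\<kappa> \<ge> 0" "\<And>s t x y. norm (b s x - b t y) \<le> \<epsilon> + \<kappa> * (\<bar>s - t\<bar> + (dist x y)\<^sup>2)" "\<epsilon> \<ge> 0"
    and x: "x = polygon h x0 (\<lambda>k. b (real k * h) (X k))"
  shows "norm (residual b x t) \<le> real M * h * (\<epsilon> + \<kappa> * (h + 2 * C\<^sup>2 * h\<^sup>2))
    + 2 * \<kappa> * h * (\<Sum>k<M. (dist (X k) (x (real k * h)))\<^sup>2)"
proof -
  define v where "v = (\<lambda>k. b (real k * h) (X k))"
  have v: "norm (v k) \<le> C" for k using tame_bound[OF b] by (simp add: v_def)
  have x': "x = polygon h x0 v" by (simp add: x v_def)
  have lip: "x \<in> lip_curves C (norm x0)" unfolding x' by (rule polygon_in_lip_curves[OF v]) simp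
  \<comment> \<open>The cut-off at M makes \<phi> bounded over all indices, as the integrability of
    the step function requires.\<close>
  define \<phi> where "\<phi> = (\<lambda>k. if k < M then (dist (X k) (x (real k * h)))\<^sup>2 else 0)"
  let ?c = "\<epsilon> + \<kappa> * (h + 2 * C\<^sup>2 * h\<^sup>2)"
  have c: "?c \<ge> 0" using \<kappa> h by simp
  have \<phi>0: "\<phi> k \<ge> 0" for k by (simp add: \<phi>_def)
  have \<phi>: "\<bar>\<phi> k\<bar> \<le> (\<Sum>k<M. (dist (X k) (x (real k * h)))\<^sup>2)" for k
    unfolding \<phi>_def by (auto intro!: sum_nonneg member_le_sum)
  have int1: "(\<lambda>s. v (step_index h s)) integrable_on {a..b}" for a b by (rule step_function_integrable[OF v])
  have int2: "(\<lambda>s. b s (x s)) integrable_on {a..t}" for a t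
    by (rule tame_integrable[OF b lip_curves_continuous_on[OF lip]])
  have int3: "(\<lambda>s. \<phi> (step_index h s)) integrable_on {a..b}" for a b
    by (rule step_function_integrable) (use \<phi> in simp)
  \<comment> \<open>The time M h is left out because its step index is M, where \<phi> is cut off to
    0.\<close>
  have pt: "norm (v (step_index h s) - b s (x s)) \<le> ?c + 2 * \<kappa> * \<phi> (step_index h s)"
    if s: "s \<in> {0..t}" "s \<noteq> real M * h" for s
  proof -
    define k where "k = step_index h s"
    have k: "real k * h \<le> s" "s < real (Suc k) * h"
      using step_index_bounds[OF h, of s] s by (auto simp: k_def)
    have "real k * h < real M * h" using k(1) s t by auto
    then have "k < M" using h by simp
    have "dist (x (real k * h)) (x s) \<le> C * \<bar>real k * h - s\<bar>" using lip unfolding lip_curves_def by blast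
    also have "\<dots> \<le> C * h" using k tame_nonneg[OF b] by (intro mult_left_mono) (auto simp: algebra_simps)
    finally have sq: "(dist (x (real k * h)) (x s))\<^sup>2 \<le> (C * h)\<^sup>2" by (intro power_mono) auto
    have "(dist (X k) (x s))\<^sup>2 \<le> (dist (X k) (x (real k * h)) + dist (x (real k * h)) (x s))\<^sup>2"
      by (intro power_mono dist_triangle) auto
    also have "\<dots> \<le> 2 * (dist (X k) (x (real k * h)))\<^sup>2 + 2 * (dist (x (real k * h)) (x s))\<^sup>2"
      using sum_squares_bound[of "dist (X k) (x (real k * h))" "dist (x (real k * h)) (x s)"]
      by (simp add: power2_sum)
    finally have "(dist (X k) (x s))\<^sup>2 \<le> 2 * \<phi> k + 2 * (C * h)\<^sup>2"
      using sq \<open>k < M\<close> unfolding \<phi>_def by simp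
    then have "\<bar>real k * h - s\<bar> + (dist (X k) (x s))\<^sup>2 \<le> h + 2 * C\<^sup>2 * h\<^sup>2 + 2 * \<phi> k"
      using k by (simp add: power_mult_distrib algebra_simps)
    then have "\<kappa> * (\<bar>real k * h - s\<bar> + (dist (X k) (x s))\<^sup>2) \<le> \<kappa> * (h + 2 * C\<^sup>2 * h\<^sup>2 + 2 * \<phi> k)"
      using \<kappa>(1) by (rule mult_left_mono)
    with \<kappa>(2)[of "real k * h" "X k" s "x s"] show ?thesis by (simp add: v_def k_def[symmetric] algebra_simps)
  qed
  have "residual b x t = integral {0..t} (\<lambda>s. v (step_index h s) - b s (x s))"
    using int1 int2 by (simp add: residual_def x' polygon_def Henstock_Kurzweil_Integration.integral_diff)
  also have "norm \<dots> \<le> integral {0..t} (\<lambda>s. ?c + 2 * \<kappa> * \<phi> (step_index h s))"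
  proof -
    let ?g = "\<lambda>s. if s = real M * h then 0 else v (step_index h s) - b s (x s)"
    have "integral {0..t} (\<lambda>s. v (step_index h s) - b s (x s)) = integral {0..t} ?g"
      by (rule integral_spike[of "{real M * h}"]) auto
    also have "norm \<dots> \<le> integral {0..t} (\<lambda>s. ?c + 2 * \<kappa> * \<phi> (step_index h s))"
    proof (rule integral_norm_bound_integral)
      show "?g integrable_on {0..t}"
        by (rule integrable_spike[OF integrable_diff[OF int1 int2], of "{real M * h}"]) auto
      show "(\<lambda>s. ?c + 2 * \<kappa> * \<phi> (step_index h s)) integrable_on {0..t}"
        using int3 by (intro integrable_add integrable_const_ivl integrable_on_mult_right)
      show "norm (?g s) \<le> ?c + 2 * \<kappa> * \<phi> (step_index h s)" if "s \<in> {0..t}" for s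
        using pt[OF that] c \<phi>0 \<kappa>(1) by auto
    qed
    finally show ?thesis .
  qed
  also have "\<dots> \<le> integral {0..real M * h} (\<lambda>s. ?c + 2 * \<kappa> * \<phi> (step_index h s))"
    using int3 t c \<phi>0 \<kappa>(1)
    by (intro integral_subset_le integrable_add integrable_const_ivl integrable_on_mult_right) auto
  also have "\<dots> = real M * h * ?c + 2 * \<kappa> * integral {0..real M * h} (\<lambda>s. \<phi> (step_index h s))"
    using integrable_on_mult_right[OF int3, of "2 * \<kappa>"] h
    by (subst Henstock_Kurzweil_Integration.integral_add) (auto intro!: integrable_const_ivl)
  also have "integral {0..real M * h} (\<lambda>s. \<phi> (step_index h s)) = h * (\<Sum>k<M. \<phi> k)"
    by (rule integral_step_function[OF \<phi> h])
  also have "(\<Sum>k<M. \<phi> k) = (\<Sum>k<M. (dist (X k) (x (real k * h)))\<^sup>2)"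
    by (intro sum.cong) (auto simp: \<phi>_def)
  finally show ?thesis by (simp add: mult.assoc)
qed

text \<open>Euler polygons lie in one compact set of Lipschitz curves and their residuals tend to 0.
  A convergent subsequence of their parameters yields the solution.\<close>

lemma peano_tame:
  fixes b :: "real \<Rightarrow> 'a::euclidean_space \<Rightarrow> 'a"
  assumes b: "tame C b" and T: "T > 0"
  obtains x where "x \<in> lip_curves C (norm x0)" "x 0 = x0" "\<And>t. 0 \<le> t \<Longrightarrow> t \<le> T \<Longrightarrow> residual b x t = 0"
proof -
  obtain D :: "real set" and \<pi> where D: "compact D" "\<pi> ` D = (lip_curves C (norm x0) :: (real \<Rightarrow> 'a) set)"
    and \<pi>: "continuous_on (D \<times> UNIV) (\<lambda>(c, t). \<pi> c t)"
    using lip_curves_parametrization[OF tame_nonneg[OF b]] by blast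
  define h where "h = (\<lambda>M. T / real (Suc M))"
  have h: "h M > 0" "real (Suc M) * h M = T" for M using T by (simp_all add: h_def)
  have h0: "h \<longlonglongrightarrow> 0" unfolding h_def by (rule LIMSEQ_Suc[OF lim_const_over_n])
  define X where "X = (\<lambda>M. rec_nat x0 (\<lambda>k y. y + h M *\<^sub>R b (real k * h M) y))"
  define x where "x = (\<lambda>M. polygon (h M) x0 (\<lambda>k. b (real k * h M) (X M k)))"
  have x: "x M \<in> lip_curves C (norm x0)" for M
    unfolding x_def by (rule polygon_in_lip_curves) (auto intro: tame_bound[OF b])
  have Xx: "x M (real k * h M) = X M k" for M k
  proof (induction k)
    case (Suc k)
    then show ?case unfolding x_def
      by (subst polygon_step[where C = C]) (auto intro: tame_bound[OF b] simp: h(1) X_def)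
  qed (simp add: x_def X_def)
  have res: "(\<lambda>M. residual b (x M) t) \<longlonglongrightarrow> 0" if t: "0 \<le> t" "t \<le> T" for t
  proof (rule metric_LIMSEQ_I)
    fix r :: real assume "r > 0"
    define \<epsilon> where "\<epsilon> = r / (2 * T)"
    have \<epsilon>: "\<epsilon> > 0" "T * \<epsilon> = r / 2" using \<open>r > 0\<close> T by (auto simp: \<epsilon>_def)
    obtain \<kappa> where \<kappa>: "\<kappa> \<ge> 0" "\<And>s t x y. norm (b s x - b t y) \<le> \<epsilon> + \<kappa> * (\<bar>s - t\<bar> + (dist x y)\<^sup>2)"
      using tame_modulus[OF b \<epsilon>(1)] by blast
    have bd: "norm (residual b (x M) t) \<le> T * (\<epsilon> + \<kappa> * (h M + 2 * C\<^sup>2 * (h M)\<^sup>2))" for M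
      using polygon_residual[OF b h(1)[of M] t(1) _ \<kappa> less_imp_le[OF \<epsilon>(1)] x_def[THEN fun_cong], of "Suc M"] t(2)
      unfolding h(2) by (simp add: Xx)
    have "(\<lambda>M. T * (\<epsilon> + \<kappa> * (h M + 2 * C\<^sup>2 * (h M)\<^sup>2))) \<longlonglongrightarrow> T * (\<epsilon> + \<kappa> * (0 + 2 * C\<^sup>2 * 0\<^sup>2))"
      by (intro tendsto_intros h0)
    from order_tendstoD(2)[OF this, of r]
    have "eventually (\<lambda>M. T * (\<epsilon> + \<kappa> * (h M + 2 * C\<^sup>2 * (h M)\<^sup>2)) < r) sequentially"
      using \<epsilon>(2) \<open>r > 0\<close> by simp
    then obtain N where N: "\<And>M. M \<ge> N \<Longrightarrow> T * (\<epsilon> + \<kappa> * (h M + 2 * C\<^sup>2 * (h M)\<^sup>2)) < r"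
      unfolding eventually_sequentially by blast
    then show "\<exists>N. \<forall>M\<ge>N. dist (residual b (x M) t) 0 < r"
      by (intro exI[of _ N]) (auto intro: le_less_trans[OF bd])
  qed
  have "\<exists>c\<in>D. \<pi> c = x M" for M using x[of M] D(2) by (auto simp: image_iff set_eq_iff) metis
  then obtain c where c: "\<And>M. c M \<in> D" "\<And>M. \<pi> (c M) = x M" by metis
  obtain l r where l: "l \<in> D" "strict_mono r" "(c \<circ> r) \<longlonglongrightarrow> l"
    using D(1) c(1) unfolding compact_def by blast
  have lim: "(\<lambda>n. F (\<pi> (c (r n)))) \<longlonglongrightarrow> F (\<pi> l)" if "continuous_on D (\<lambda>c. F (\<pi> c))" for F :: "(real \<Rightarrow> 'a) \<Rightarrow> 'a"
    using continuous_on_tendsto_compose[OF that l(3) l(1)] c(1) by (simp add: o_def)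
  have coord: "continuous_on D (\<lambda>c. \<pi> c t)" for t
    using continuous_on_compose2[OF \<pi> continuous_on_Pair[OF continuous_on_id continuous_on_const], of t] by auto
  show ?thesis
  proof (rule that[of "\<pi> l"])
    show "\<pi> l \<in> lip_curves C (norm x0)" using D(2) l(1) by blast
    show "\<pi> l 0 = x0" using lim[of "\<lambda>x. x 0", OF coord] by (simp add: c(2) x_def LIMSEQ_const_iff)
    fix t assume t: "0 \<le> t" "t \<le> T"
    have "(\<lambda>n. residual b (x (r n)) t) \<longlonglongrightarrow> residual b (\<pi> l) t"
      using lim[of "\<lambda>x. residual b x t", OF continuous_on_residual[OF b \<pi>]] by (simp add: c(2))
    moreover have "(\<lambda>n. residual b (x (r n)) t) \<longlonglongrightarrow> 0"
      using LIMSEQ_subseq_LIMSEQ[OF res[OF t] l(2)] by (simp add: o_def)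
    ultimately show "residual b (\<pi> l) t = 0" by (rule LIMSEQ_unique)
  qed
qed

section \<open>Solutions of inclusions from classical curves, and global existence\<close>

lemma nonincreasing_within:
  fixes h :: "real \<Rightarrow> real"
  assumes d: "\<And>t. t \<in> {a..b} \<Longrightarrow> (h has_real_derivative h' t) (at t within {a..b})"
    and neg: "\<And>t. t \<in> {a..b} \<Longrightarrow> h' t \<le> 0" and st: "a \<le> s" "s \<le> t" "t \<le> b"
  shows "h t \<le> h s"
proof (rule DERIV_nonpos_imp_decreasing_open[OF st(2)])
  fix r assume r: "s < r" "r < t"
  then have "(h has_real_derivative h' r) (at r)"
    using d[of r] st at_within_Icc_at[of a r b] by auto
  then show "\<exists>y. (h has_real_derivative y) (at r) \<and> y \<le> 0" using neg[of r] r st by auto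
next
  show "continuous_on {s..t} h"
    by (rule continuous_on_subset[OF DERIV_continuous_on[OF d]]) (use st in auto)
qed

lemma lipschitz_imp_abs_cont_on:
  assumes "L-lipschitz_on {a..b} y"
  shows "abs_cont_on a b y"
  unfolding abs_cont_on_def
proof (intro allI impI)
  fix \<epsilon> :: real assume "\<epsilon> > 0"
  have L: "L \<ge> 0" using assms by (rule lipschitz_on_nonneg)
  show "\<exists>\<delta>>0. \<forall>I. finite I \<longrightarrow> (\<forall>(c, d)\<in>I. a \<le> c \<and> c \<le> d \<and> d \<le> b) \<longrightarrow>
      disjoint_family_on (\<lambda>(c, d). {c<..<d}) I \<longrightarrow> (\<Sum>(c, d)\<in>I. d - c) < \<delta> \<longrightarrow>
      (\<Sum>(c, d)\<in>I. norm (y d - y c)) < \<epsilon>"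
  \<comment> \<open>The denominator L + 1 instead of L covers the case L = 0.\<close>
  proof (intro exI[of _ "\<epsilon> / (L + 1)"] conjI allI impI)
    show "0 < \<epsilon> / (L + 1)" using L \<open>\<epsilon> > 0\<close> by simp
    fix I :: "(real \<times> real) set"
    assume I: "\<forall>(c, d)\<in>I. a \<le> c \<and> c \<le> d \<and> d \<le> b" and small: "(\<Sum>(c, d)\<in>I. d - c) < \<epsilon> / (L + 1)"
    have nn: "(\<Sum>(c, d)\<in>I. d - c) \<ge> 0" using I by (intro sum_nonneg) auto
    have "(\<Sum>(c, d)\<in>I. norm (y d - y c)) \<le> (\<Sum>(c, d)\<in>I. L * (d - c))"
    proof (rule sum_mono, clarify)
      fix c d assume "(c, d) \<in> I"
      then show "norm (y d - y c) \<le> L * (d - c)"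
        using I lipschitz_onD[OF assms, of d c] by (auto simp: dist_norm)
    qed
    also have "\<dots> = L * (\<Sum>(c, d)\<in>I. d - c)" by (simp add: sum_distrib_left case_prod_unfold)
    also have "\<dots> \<le> (L + 1) * (\<Sum>(c, d)\<in>I. d - c)" using nn by (intro mult_right_mono) auto
    also have "\<dots> < (L + 1) * (\<epsilon> / (L + 1))" using small L by (intro mult_strict_left_mono) auto
    also have "\<dots> = \<epsilon>" using L by simp
    finally show "(\<Sum>(c, d)\<in>I. norm (y d - y c)) < \<epsilon>" .
  qed
qed

lemma solves_inclusionI:
  fixes y :: "real \<Rightarrow> 'b::real_normed_vector"
  assumes d: "\<And>t. t \<in> {a..b} \<Longrightarrow> (y has_vector_derivative v t) (at t within {a..b})"
    and cont: "continuous_on {a..b} v" and v: "\<And>t. t \<in> {a..b} \<Longrightarrow> v t \<in> F t (y t)"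
  shows "solves_inclusion F a b y"
proof -
  obtain B where B: "B > 0" "\<And>t. t \<in> {a..b} \<Longrightarrow> norm (v t) \<le> B"
    using compact_imp_bounded[OF compact_continuous_image[OF cont compact_Icc]] unfolding bounded_pos by auto
  have "B-lipschitz_on {a..b} y"
    by (rule bounded_derivative_imp_lipschitz[where f' = "\<lambda>t s. s *\<^sub>R v t"])
       (use B d in \<open>auto simp: has_vector_derivative_def onorm_scaleR_left bounded_linear_ident onorm_id
         intro!: onorm_le simp: mult.commute mult_left_mono\<close>)
  then have "abs_cont_on a b y" by (rule lipschitz_imp_abs_cont_on)
  moreover have "AE t in lebesgue_on {a..b}. \<exists>v\<in>F t (y t). (y has_vector_derivative v) (at t within {a..b})"
    using d v by (intro AE_I2) auto
  ultimately show ?thesis by (simp add: solves_inclusion_def)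
qed

lemma residual_eq_0_derivative:
  assumes b: "tame C b" and x: "x \<in> lip_curves C R" and T: "0 < T"
    and res: "\<And>t. 0 \<le> t \<Longrightarrow> t \<le> T \<Longrightarrow> residual b x t = 0" and t: "t \<in> {0..T}"
  shows "(x has_vector_derivative b t (x t)) (at t within {0..T})"
proof -
  have "continuous_on {0..T} (\<lambda>s. (s, x s))"
    by (intro continuous_intros lip_curves_continuous_on[OF x])
  then have "continuous_on {0..T} (\<lambda>s. b s (x s))"
    using continuous_on_compose2[OF tame_continuous_on[OF b, of UNIV], of "{0..T}" "\<lambda>s. (s, x s)"] by simp
  from integral_has_vector_derivative[OF this t]
  have "((\<lambda>t. x 0 + integral {0..t} (\<lambda>s. b s (x s))) has_vector_derivative b t (x t)) (at t within {0..T})"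
    by (auto intro!: derivative_eq_intros)
  then show ?thesis
  proof (rule has_vector_derivative_transform_within[OF _ zero_less_one t])
    fix s assume "s \<in> {0..T}"
    then show "x 0 + integral {0..s} (\<lambda>s. b s (x s)) = x s"
      using res[of s] by (simp add: residual_def algebra_simps)
  qed
qed

text \<open>Along a solution (1 + |y|^2) exp(-4 C t) does not increase, as 2 y.b <= 2 C |y| (1 +
  |y|) <= 4 C (1 + |y|^2). The solution of the truncated equation therefore never leaves the ball on
  which nothing was truncated.\<close>

lemma peano_linear_growth:
  fixes b :: "real \<Rightarrow> 'a::euclidean_space \<Rightarrow> 'a"
  assumes b: "continuous_on ({0..T} \<times> UNIV) (\<lambda>(t, x). b t x)"
    and growth: "\<And>t x. t \<in> {0..T} \<Longrightarrow> norm (b t x) \<le> C * (1 + norm x)" and C: "C \<ge> 0"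
    and t0: "0 \<le> t0" "t0 \<le> T"
  obtains x where "x t0 = x0" "\<And>t. t \<in> {t0..T} \<Longrightarrow> (x has_vector_derivative b t (x t)) (at t within {t0..T})"
proof -
  \<comment> \<open>The a priori bound for the norm of a solution up to time T.\<close>
  define R where "R = sqrt ((1 + (norm x0)\<^sup>2) * exp (4 * C * (T - t0)))"
  have R: "R \<ge> 0" by (simp add: R_def)
  define bh where "bh = (\<lambda>t x. b (max 0 (min T t)) (closest_point (cball 0 R) x))"
  obtain B where B: "tame B bh" using tame_truncation[OF b _ R] t0 unfolding bh_def by auto
  have cp: "norm (closest_point (cball 0 R) x) \<le> norm x" for x :: 'a
    using closest_point_lipschitz[of "cball (0::'a) R" x 0] R closest_point_self[of "0::'a" "cball 0 R"]
    by simp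
  have growth': "norm (bh t x) \<le> C * (1 + norm x)" for t x
  proof -
    have "norm (bh t x) \<le> C * (1 + norm (closest_point (cball 0 R) x))"
      unfolding bh_def using t0 by (intro growth) auto
    also have "\<dots> \<le> C * (1 + norm x)" using cp[of x] C by (intro mult_left_mono) auto
    finally show ?thesis .
  qed
  define b' where "b' = (\<lambda>s. bh (t0 + s))"
  have b': "tame B b'"
    unfolding tame_def
  proof (intro conjI allI impI)
    show "norm (b' t x) \<le> B" for t x using tame_bound[OF B] by (simp add: b'_def)
    fix \<epsilon> :: real assume "\<epsilon> > 0"
    then obtain \<kappa> where "\<kappa> \<ge> 0" "\<And>s t x y. norm (bh s x - bh t y) \<le> \<epsilon> + \<kappa> * (\<bar>s - t\<bar> + (dist x y)\<^sup>2)"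
      using tame_modulus[OF B] by blast
    from this(1) this(2)[of "t0 + _" _ "t0 + _"]
    show "\<exists>\<kappa>\<ge>0. \<forall>s t x y. norm (b' s x - b' t y) \<le> \<epsilon> + \<kappa> * (\<bar>s - t\<bar> + (dist x y)\<^sup>2)"
      by (intro exI[of _ \<kappa>]) (auto simp: b'_def)
  qed
  \<comment> \<open>The extra unit of time keeps the interval nondegenerate for t0 = T.\<close>
  let ?L = "T - t0 + 1"
  obtain y where y: "y \<in> lip_curves B (norm x0)" "y 0 = x0" "\<And>t. 0 \<le> t \<Longrightarrow> t \<le> ?L \<Longrightarrow> residual b' y t = 0"
    using peano_tame[OF b', of ?L x0] t0 by auto
  have dy: "(y has_vector_derivative b' t (y t)) (at t within {0..?L})" if "t \<in> {0..?L}" for t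
    using residual_eq_0_derivative[OF b' y(1) _ y(3) that] t0 by auto
  define N where "N = (\<lambda>t. (1 + y t \<bullet> y t) * exp (- 4 * C * t))"
  have dN: "(N has_real_derivative (2 * (y t \<bullet> b' t (y t)) - 4 * C * (1 + y t \<bullet> y t)) * exp (- 4 * C * t)) (at t within {0..?L})"
    if "t \<in> {0..?L}" for t
  proof -
    have *: "((\<lambda>t. y t \<bullet> y t) has_real_derivative 2 * (y t \<bullet> b' t (y t))) (at t within {0..?L})"
      using has_derivative_inner[OF dy[OF that, unfolded has_vector_derivative_def] dy[OF that, unfolded has_vector_derivative_def]]
      unfolding has_field_derivative_def
      by (rule has_derivative_eq_rhs) (simp add: inner_commute algebra_simps fun_eq_iff)
    show ?thesis
      unfolding N_def by (rule derivative_eq_intros * refl | simp add: algebra_simps)+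
  qed
  have N: "N t \<le> N 0" if "t \<in> {0..?L}" for t
  proof (rule nonincreasing_within[OF dN])
    fix t
    let ?n = "norm (y t)"
    have "y t \<bullet> b' t (y t) \<le> ?n * norm (b' t (y t))" by (rule norm_cauchy_schwarz)
    also have "\<dots> \<le> ?n * (C * (1 + ?n))" using growth' by (intro mult_left_mono) (auto simp: b'_def)
    also have "\<dots> = C * (?n + ?n\<^sup>2)" by (simp add: algebra_simps power2_eq_square)
    also have "\<dots> \<le> C * (2 * (1 + ?n\<^sup>2))"
    proof (intro mult_left_mono C)
      have "2 * ?n \<le> ?n\<^sup>2 + 1" using sum_squares_bound[of ?n 1] by simp
      moreover have "n + q \<le> 2 * (1 + q)" if "2 * n \<le> q + 1" "0 \<le> q" for n q :: real using that by simp
      ultimately show "?n + ?n\<^sup>2 \<le> 2 * (1 + ?n\<^sup>2)" using zero_le_power2 by blast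
    qed
    finally show "(2 * (y t \<bullet> b' t (y t)) - 4 * C * (1 + y t \<bullet> y t)) * exp (- 4 * C * t) \<le> 0"
      by (intro mult_nonpos_nonneg) (auto simp: power2_norm_eq_inner algebra_simps)
  qed (use that in auto)
  have yR: "norm (y t) \<le> R" if "t \<in> {0..T - t0}" for t
  proof -
    have "1 + (norm (y t))\<^sup>2 = N t * exp (4 * C * t)"
      by (simp add: N_def power2_norm_eq_inner mult.assoc flip: exp_add)
    also have "\<dots> \<le> N 0 * exp (4 * C * (T - t0))"
      using N[of t] that C by (intro mult_mono) (auto simp: N_def mult_left_mono)
    also have "\<dots> = R\<^sup>2" by (simp add: N_def R_def y(2) power2_norm_eq_inner)
    finally have "(norm (y t))\<^sup>2 \<le> R\<^sup>2" by simp
    then show ?thesis using R by (rule power2_le_imp_le)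
  qed
  show ?thesis
  proof (rule that[of "\<lambda>t. y (t - t0)"])
    show "y (t0 - t0) = x0" using y(2) by simp
    fix t assume t: "t \<in> {t0..T}"
    then have "((\<lambda>t. y (t - t0)) has_vector_derivative 1 *\<^sub>R b' (t - t0) (y (t - t0))) (at t within {t0..T})"
      using dy[of "t - t0"]
      by (intro vector_diff_chain_within[of "\<lambda>t. t - t0" 1 t "{t0..T}" y, unfolded o_def])
         (auto intro!: derivative_eq_intros elim!: has_vector_derivative_within_subset)
    moreover have "b' (t - t0) (y (t - t0)) = b t (y (t - t0))"
      using t t0 yR[of "t - t0"] by (simp add: b'_def bh_def closest_point_self)
    ultimately show "((\<lambda>t. y (t - t0)) has_vector_derivative b t (y (t - t0))) (at t within {t0..T})" by simp
  qed
qed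

section \<open>Classical solutions of the Hamilton--Jacobi equation\<close>

lemma grad_eqI: "GDERIV h x :> D \<Longrightarrow> grad h x = D"
  unfolding grad_def
proof (rule the_equality)
  fix E assume "GDERIV h x :> E" and D: "GDERIV h x :> D"
  then have "(\<lambda>y. y \<bullet> E) = (\<lambda>y. y \<bullet> D)" unfolding gderiv_def by (rule has_derivative_unique)
  then have "(E - D) \<bullet> E = (E - D) \<bullet> D" by (rule fun_cong)
  then have "(E - D) \<bullet> (E - D) = 0" by (simp only: inner_diff_right)
  then show "E = D" by simp
qed

lemma differentiable_imp_GDERIV:
  fixes h :: "'a::euclidean_space \<Rightarrow> real"
  assumes "h differentiable (at x)"
  shows "GDERIV h x :> grad h x"
proof -
  obtain D where D: "(h has_derivative D) (at x)" using assms by (auto simp: differentiable_def)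
  then interpret bounded_linear D by (rule has_derivative_bounded_linear)
  have "D = (\<lambda>y. y \<bullet> (\<Sum>i\<in>Basis. D i *\<^sub>R i))"
  proof
    fix y
    have "D y = D (\<Sum>i\<in>Basis. (y \<bullet> i) *\<^sub>R i)" by (simp add: euclidean_representation)
    also have "\<dots> = (\<Sum>i\<in>Basis. (y \<bullet> i) * D i)" by (simp add: sum scaleR)
    finally show "D y = y \<bullet> (\<Sum>i\<in>Basis. D i *\<^sub>R i)" by (simp add: inner_sum_right mult.commute)
  qed
  with D have "GDERIV h x :> (\<Sum>i\<in>Basis. D i *\<^sub>R i)" by (simp add: gderiv_def)
  moreover from grad_eqI[OF this] have "grad h x = (\<Sum>i\<in>Basis. D i *\<^sub>R i)" .
  ultimately show ?thesis by simp
qed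

text \<open>Here \<open>F\<close>, \<open>G\<close> and \<open>H\<close> are the coefficients and the Hamiltonian along the flow \<open>\<mu>\<close>;
  \<open>p\<close> stands for \<open>\<nabla>V\<close>.\<close>

locale classical_solution =
  fixes T L :: real and P :: "'p::metric_space set"
    and F :: "real \<Rightarrow> 'a::euclidean_space \<Rightarrow> 'p \<Rightarrow> 'a" and G :: "real \<Rightarrow> 'a \<Rightarrow> 'p \<Rightarrow> real"
    and V :: "real \<Rightarrow> 'a \<Rightarrow> real" and H :: "real \<Rightarrow> 'a \<Rightarrow> 'a \<Rightarrow> real" and Lp :: real
  assumes T: "T > 0" and P: "compact P" "P \<noteq> {}"
    and contF: "continuous_on ({0..T} \<times> UNIV \<times> P) (\<lambda>(t, x, u). F t x u)"
    and contG: "continuous_on ({0..T} \<times> UNIV \<times> P) (\<lambda>(t, x, u). G t x u)"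
    and lipF: "\<And>t x x' u. t \<in> {0..T} \<Longrightarrow> u \<in> P \<Longrightarrow> norm (F t x u - F t x' u) \<le> L * norm (x - x')"
    and H_def: "\<And>t x q. H t x q = (SUP u\<in>P. q \<bullet> F t x u - G t x u)"
    and H_diff: "\<And>t x q. t \<in> {0..T} \<Longrightarrow> (\<lambda>q. H t x q) differentiable (at q)"
    and contV: "continuous_on ({0..T} \<times> UNIV) (\<lambda>(t, x). V t x)"
    and V_diff: "\<And>t x. t \<in> {0..T} \<Longrightarrow>
      (\<lambda>(s, y). V s y) differentiable (at (t, x) within {0..T} \<times> UNIV)"
    and HJ: "\<And>t x. t \<in> {0..T} \<Longrightarrow>
      vector_derivative (\<lambda>s. V s x) (at t within {0..T}) + H t x (grad (V t) x) = 0"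
    and lip_grad: "\<And>t. t \<in> {0..T} \<Longrightarrow> Lp-lipschitz_on UNIV (grad (V t))"
begin

definition p :: "real \<Rightarrow> 'a \<Rightarrow> 'a" where "p t x = grad (V t) x"
definition b :: "real \<Rightarrow> 'a \<Rightarrow> 'a" where "b t x = grad (\<lambda>q. H t x q) (p t x)"
definition c :: "real \<Rightarrow> 'a \<Rightarrow> real" where "c t x = p t x \<bullet> b t x - H t x (p t x)"

lemma cont_u:
  assumes "t \<in> {0..T}"
  shows "continuous_on P (F t x)" "continuous_on P (G t x)"
proof -
  have *: "continuous_on P (\<lambda>u. (t, x, u))" by (intro continuous_intros)
  show "continuous_on P (F t x)" using continuous_on_compose2[OF contF *] assms by (simp add: image_subset_iff)
  show "continuous_on P (G t x)" using continuous_on_compose2[OF contG *] assms by (simp add: image_subset_iff)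
qed

lemma H_upper:
  assumes "t \<in> {0..T}" "u \<in> P"
  shows "q \<bullet> F t x u - G t x u \<le> H t x q"
proof -
  have "continuous_on P (\<lambda>u. q \<bullet> F t x u - G t x u)" by (intro continuous_intros cont_u assms)
  then have "bdd_above ((\<lambda>u. q \<bullet> F t x u - G t x u) ` P)"
    using P(1) by (intro bounded_imp_bdd_above compact_imp_bounded compact_continuous_image)
  then show ?thesis unfolding H_def using assms(2) by (rule cSUP_upper[rotated])
qed

lemma H_attained:
  assumes "t \<in> {0..T}"
  obtains u where "u \<in> P" "H t x q = q \<bullet> F t x u - G t x u"
proof -
  have "continuous_on P (\<lambda>u. q \<bullet> F t x u - G t x u)" by (intro continuous_intros cont_u assms)
  then obtain u where u: "u \<in> P" "\<And>v. v \<in> P \<Longrightarrow> q \<bullet> F t x v - G t x v \<le> q \<bullet> F t x u - G t x u"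
    using continuous_attains_sup[OF P] by blast
  have "H t x q \<le> q \<bullet> F t x u - G t x u" unfolding H_def using u(2) P(2) by (intro cSUP_least) auto
  with H_upper[OF assms u(1), of q x] u(1) show ?thesis by (intro that) auto
qed

text \<open>\<open>H t x\<close> is the maximum of affine functions; at a point of differentiability its gradient is the
  slope of any of the active ones.\<close>

lemma b_eq:
  assumes t: "t \<in> {0..T}" and u: "u \<in> P" "H t x (p t x) = p t x \<bullet> F t x u - G t x u"
  shows "b t x = F t x u" "c t x = G t x u"
proof -
  let ?h = "\<lambda>q. H t x q - (q \<bullet> F t x u - G t x u)"
  have "GDERIV (H t x) (p t x) :> b t x"
    using differentiable_imp_GDERIV[OF H_diff[OF t]] unfolding b_def by auto
  then have d: "(?h has_derivative (\<lambda>y. y \<bullet> b t x - y \<bullet> F t x u)) (at (p t x))"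
    unfolding gderiv_def by (auto intro!: derivative_eq_intros)
  have "(\<lambda>y. y \<bullet> b t x - y \<bullet> F t x u) = (\<lambda>y. 0)"
    by (rule differential_zero_maxmin[OF _ open_UNIV d])
       (use H_upper[OF t u(1)] u(2) in auto)
  then have "(b t x - F t x u) \<bullet> b t x - (b t x - F t x u) \<bullet> F t x u = 0" by metis
  then show b: "b t x = F t x u" by (simp flip: inner_diff_right)
  show "c t x = G t x u" using u(2) by (simp add: c_def b)
qed

lemma bc_image:
  assumes "t \<in> {0..T}"
  shows "(b t x, c t x) \<in> (\<lambda>u. (F t x u, G t x u)) ` P"
proof -
  obtain u where u: "u \<in> P" "H t x (p t x) = p t x \<bullet> F t x u - G t x u"
    using H_attained[OF assms] by blast
  show ?thesis using u(1) b_eq[OF assms u] by auto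
qed

lemma H_p: "H t x (p t x) = p t x \<bullet> b t x - c t x"
  by (simp add: c_def)

text \<open>The total derivative is determined by its restrictions to the space and time directions.
  The time part is one-sided at the ends of [0, T], where it is still unique because T > 0, and it
  equals -H by the equation.\<close>

lemma V_derivatives:
  assumes t: "t \<in> {0..T}"
  shows "((\<lambda>(s, y). V s y) has_derivative (\<lambda>(\<tau>, \<xi>). - H t x (p t x) * \<tau> + p t x \<bullet> \<xi>)) (at (t, x) within {0..T} \<times> UNIV)"
    and "GDERIV (V t) x :> p t x"
proof -
  obtain D where D: "((\<lambda>(s, y). V s y) has_derivative D) (at (t, x) within {0..T} \<times> UNIV)"
    using V_diff[OF t] by (auto simp: differentiable_def)
  then interpret bounded_linear D by (rule has_derivative_bounded_linear)
  have "((\<lambda>y. (t, y)) has_derivative (\<lambda>\<xi>. (0, \<xi>))) (at x)"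
    by (auto intro!: derivative_eq_intros)
  from diff_chain_within[OF this has_derivative_subset[OF D]]
  have "((\<lambda>(s, y). V s y) \<circ> (\<lambda>y. (t, y)) has_derivative D \<circ> (\<lambda>\<xi>. (0, \<xi>))) (at x)"
    using t by (simp add: image_subset_iff)
  then have Vt: "(V t has_derivative (\<lambda>\<xi>. D (0, \<xi>))) (at x)" by (simp add: o_def)
  then have "V t differentiable (at x)" by (auto simp: differentiable_def)
  then show GV: "GDERIV (V t) x :> p t x" unfolding p_def by (rule differentiable_imp_GDERIV)
  from has_derivative_unique[OF Vt GV[unfolded gderiv_def]]
  have 1: "D (0, \<xi>) = p t x \<bullet> \<xi>" for \<xi> by (simp add: fun_eq_iff inner_commute)
  have "((\<lambda>s. (s, x)) has_derivative (\<lambda>\<tau>. (\<tau>, 0))) (at t within {0..T})"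
    by (auto intro!: derivative_eq_intros)
  from diff_chain_within[OF this has_derivative_subset[OF D]]
  have "((\<lambda>(s, y). V s y) \<circ> (\<lambda>s. (s, x)) has_derivative D \<circ> (\<lambda>\<tau>. (\<tau>, 0))) (at t within {0..T})"
    by (simp add: image_subset_iff)
  then have "((\<lambda>s. V s x) has_derivative (\<lambda>\<tau>. D (\<tau>, 0))) (at t within {0..T})" by (simp add: o_def)
  moreover have "(\<lambda>\<tau>. D (\<tau>, 0)) = (\<lambda>\<tau>. \<tau> *\<^sub>R D (1, 0))"
  proof
    show "D (\<tau>, 0) = \<tau> *\<^sub>R D (1, 0)" for \<tau> using scaleR[of \<tau> "(1, 0)"] by simp
  qed
  ultimately have "((\<lambda>s. V s x) has_vector_derivative D (1, 0)) (at t within {0..T})"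
    unfolding has_vector_derivative_def by (simp only:)
  then have "vector_derivative (\<lambda>s. V s x) (at t within {0..T}) = D (1, 0)"
    using vector_derivative_within_cbox[of 0 T] T t by simp
  then have 2: "D (1, 0) = - H t x (p t x)" using HJ[OF t, of x] by (simp add: p_def)
  have "D (\<tau>, \<xi>) = - H t x (p t x) * \<tau> + p t x \<bullet> \<xi>" for \<tau> \<xi>
  proof -
    have "D (\<tau>, \<xi>) = D (\<tau> *\<^sub>R (1, 0) + (0, \<xi>))" by simp
    also have "\<dots> = \<tau> * D (1, 0) + D (0, \<xi>)" unfolding add scaleR by simp
    finally show ?thesis by (simp add: 1 2)
  qed
  then have "D = (\<lambda>(\<tau>, \<xi>). - H t x (p t x) * \<tau> + p t x \<bullet> \<xi>)" by auto
  with D show "((\<lambda>(s, y). V s y) has_derivative (\<lambda>(\<tau>, \<xi>). - H t x (p t x) * \<tau> + p t x \<bullet> \<xi>)) (at (t, x) within {0..T} \<times> UNIV)"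
    by simp
qed

lemma V_along:
  assumes x: "(x has_vector_derivative v) (at t within S)" and S: "t \<in> S" "S \<subseteq> {0..T}"
  shows "((\<lambda>s. V s (x s)) has_real_derivative p t (x t) \<bullet> v - H t (x t) (p t (x t))) (at t within S)"
proof -
  have "((\<lambda>s. (s, x s)) has_derivative (\<lambda>\<tau>. (\<tau>, \<tau> *\<^sub>R v))) (at t within S)"
    using x unfolding has_vector_derivative_def by (auto intro!: derivative_eq_intros)
  from diff_chain_within[OF this has_derivative_subset[OF V_derivatives(1)]] S
  have "((\<lambda>s. V s (x s)) has_derivative (\<lambda>\<tau>. - H t (x t) (p t (x t)) * \<tau> + p t (x t) \<bullet> (\<tau> *\<^sub>R v))) (at t within S)"
    by (auto simp: o_def image_subset_iff subset_iff)
  then show ?thesis unfolding has_field_derivative_def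
    by (rule has_derivative_eq_rhs) (simp add: fun_eq_iff algebra_simps)
qed

section \<open>Growth and continuity of \<nabla>V and of the optimal velocity\<close>

lemma growthF:
  obtains C where "C \<ge> 0" "\<And>t x u. t \<in> {0..T} \<Longrightarrow> u \<in> P \<Longrightarrow> norm (F t x u) \<le> C * (1 + norm x)"
proof -
  have K: "compact ({0..T} \<times> {0::'a} \<times> P)" using P by (intro compact_Times) auto
  have "continuous_on ({0..T} \<times> {0} \<times> P) (\<lambda>(t, x, u). F t x u)"
    using contF by (rule continuous_on_subset) auto
  from compact_imp_bounded[OF compact_continuous_image[OF this K]]
  obtain B where B: "B > 0" "\<And>t u. t \<in> {0..T} \<Longrightarrow> u \<in> P \<Longrightarrow> norm (F t 0 u) \<le> B"
    unfolding bounded_pos by fastforce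
  show ?thesis
  proof (rule that[of "max B L"])
    fix t x u assume tu: "t \<in> {0..T}" "u \<in> P"
    have "norm (F t x u) \<le> norm (F t 0 u) + norm (F t x u - F t 0 u)" by (rule norm_triangle_sub)
    also have "\<dots> \<le> B + L * norm x" using B(2)[OF tu] lipF[OF tu, of x 0] by simp
    also have "\<dots> \<le> max B L * 1 + max B L * norm x" by (intro add_mono mult_right_mono) auto
    finally show "norm (F t x u) \<le> max B L * (1 + norm x)" by (simp add: distrib_left)
  qed (use B in auto)
qed

lemma growthb:
  obtains C where "C \<ge> 0" "\<And>t x. t \<in> {0..T} \<Longrightarrow> norm (b t x) \<le> C * (1 + norm x)"
proof -
  obtain C where C: "C \<ge> 0" "\<And>t x u. t \<in> {0..T} \<Longrightarrow> u \<in> P \<Longrightarrow> norm (F t x u) \<le> C * (1 + norm x)"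
    using growthF by blast
  have "norm (b t x) \<le> C * (1 + norm x)" if t: "t \<in> {0..T}" for t x
    using bc_image[OF t, of x] C(2)[OF t] by auto
  with C(1) show ?thesis by (rule that)
qed

text \<open>The point is that the remainder is uniform in time: the gradient can be recovered from
  difference quotients of V with an error that does not depend on t.\<close>

lemma V_taylor:
  assumes t: "t \<in> {0..T}"
  shows "\<bar>V t (x + h) - V t x - p t x \<bullet> h\<bar> \<le> Lp * (norm h)\<^sup>2"
proof -
  let ?g = "\<lambda>y. V t y - p t x \<bullet> y"
  have Lp: "Lp \<ge> 0" using lip_grad[OF t] by (rule lipschitz_on_nonneg)
  have "norm (?g (x + h) - ?g x) \<le> (Lp * norm h) * norm ((x + h) - x)"
  proof (rule differentiable_bound[where S = "cball x (norm h)" and f' = "\<lambda>y \<xi>. \<xi> \<bullet> (p t y - p t x)"])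
    fix y assume y: "y \<in> cball x (norm h)"
    have "(?g has_derivative (\<lambda>\<xi>. \<xi> \<bullet> p t y - p t x \<bullet> \<xi>)) (at y)"
      using V_derivatives(2)[OF t, of y] unfolding gderiv_def
      by (rule has_derivative_diff) (rule has_derivative_inner_right[OF has_derivative_ident])
    then show "(?g has_derivative (\<lambda>\<xi>. \<xi> \<bullet> (p t y - p t x))) (at y within cball x (norm h))"
      by (simp add: inner_diff_right inner_commute[of "p t x"] has_derivative_at_withinI)
    have "norm (p t y - p t x) \<le> Lp * dist y x"
      using lipschitz_onD[OF lip_grad[OF t], of y x] by (simp add: p_def dist_norm)
    also have "\<dots> \<le> Lp * norm h" using y Lp by (intro mult_left_mono) (auto simp: dist_commute)
    finally have *: "norm (p t y - p t x) \<le> Lp * norm h" .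
    show "onorm (\<lambda>\<xi>. \<xi> \<bullet> (p t y - p t x)) \<le> Lp * norm h"
    proof (rule onorm_le)
      fix \<xi>
      have "norm (\<xi> \<bullet> (p t y - p t x)) \<le> norm \<xi> * norm (p t y - p t x)" by (simp add: Cauchy_Schwarz_ineq2)
      also have "\<dots> \<le> norm \<xi> * (Lp * norm h)" using * by (intro mult_left_mono) auto
      finally show "norm (\<xi> \<bullet> (p t y - p t x)) \<le> Lp * norm h * norm \<xi>" by (simp add: mult.commute)
    qed
  qed (auto simp: dist_norm)
  then show ?thesis by (simp add: inner_add_right power2_eq_square algebra_simps)
qed

lemma cont_V_t: "continuous_on {0..T} (\<lambda>t. V t x)"
  using continuous_on_compose2[OF contV continuous_on_Pair[OF continuous_on_id continuous_on_const]]
  by (simp add: image_subset_iff)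

text \<open>A partial derivative differs from the difference quotient with step r by at most Lp r at
  all times, and for fixed r the quotient is continuous in time.\<close>

lemma cont_p_t: "continuous_on {0..T} (\<lambda>t. p t x)"
proof (subst continuous_on_componentwise, rule ballI)
  fix i :: 'a assume i: "i \<in> Basis"
  show "continuous_on {0..T} (\<lambda>t. p t x \<bullet> i)"
    unfolding continuous_on_iff
  proof (intro ballI allI impI)
    fix t and \<epsilon> :: real assume t: "t \<in> {0..T}" and "\<epsilon> > 0"
    have Lp: "Lp \<ge> 0" using lip_grad[OF t] by (rule lipschitz_on_nonneg)
    \<comment> \<open>With this step the two Taylor errors add up to at most r \<epsilon> / 2; the
      other half of r \<epsilon> is left for the change of V in time.\<close>
    define r where "r = \<epsilon> / (4 * (Lp + 1))"
    have r: "r > 0" "4 * ((Lp + 1) * r) = \<epsilon>"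
      using Lp \<open>\<epsilon> > 0\<close> by (simp_all add: r_def add_eq_0_iff divide_simps)
    have "r * \<epsilon> / 4 > 0" using r \<open>\<epsilon> > 0\<close> by simp
    then obtain d1 where d1: "d1 > 0" "\<And>s. s \<in> {0..T} \<Longrightarrow> dist s t < d1 \<Longrightarrow> dist (V s x) (V t x) < r * \<epsilon> / 4"
      using cont_V_t[of x] t unfolding continuous_on_iff by metis
    from \<open>r * \<epsilon> / 4 > 0\<close> obtain d2 where d2: "d2 > 0" "\<And>s. s \<in> {0..T} \<Longrightarrow> dist s t < d2 \<Longrightarrow> dist (V s (x + r *\<^sub>R i)) (V t (x + r *\<^sub>R i)) < r * \<epsilon> / 4"
      using cont_V_t[of "x + r *\<^sub>R i"] t unfolding continuous_on_iff by metis
    show "\<exists>d>0. \<forall>s\<in>{0..T}. dist s t < d \<longrightarrow> dist (p s x \<bullet> i) (p t x \<bullet> i) < \<epsilon>"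
    proof (intro exI[of _ "min d1 d2"] conjI ballI impI)
      fix s assume s: "s \<in> {0..T}" "dist s t < min d1 d2"
      have "norm (r *\<^sub>R i) = r" using r(1) i by simp
      then have "\<bar>V s (x + r *\<^sub>R i) - V s x - p s x \<bullet> (r *\<^sub>R i)\<bar> \<le> Lp * r\<^sup>2"
        "\<bar>V t (x + r *\<^sub>R i) - V t x - p t x \<bullet> (r *\<^sub>R i)\<bar> \<le> Lp * r\<^sup>2"
        using V_taylor[OF s(1), of x "r *\<^sub>R i"] V_taylor[OF t, of x "r *\<^sub>R i"] by auto
      moreover have "\<bar>V s x - V t x\<bar> < r * \<epsilon> / 4" "\<bar>V s (x + r *\<^sub>R i) - V t (x + r *\<^sub>R i)\<bar> < r * \<epsilon> / 4"
        using d1(2)[OF s(1)] d2(2)[OF s(1)] s(2) by (auto simp: dist_real_def)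
      ultimately have "\<bar>(p s x - p t x) \<bullet> (r *\<^sub>R i)\<bar> < 2 * (Lp * r\<^sup>2) + r * \<epsilon> / 2"
        unfolding inner_diff_left by linarith
      also have "\<dots> \<le> r * \<epsilon>"
      proof -
        have "4 * (Lp * r\<^sup>2) \<le> 4 * ((Lp + 1) * r) * r" using r(1) by (simp add: algebra_simps power2_eq_square)
        then show ?thesis unfolding r(2) by (simp add: mult.commute)
      qed
      finally have "r * \<bar>(p s x - p t x) \<bullet> i\<bar> < r * \<epsilon>" using r(1) by (simp add: abs_mult)
      then show "dist (p s x \<bullet> i) (p t x \<bullet> i) < \<epsilon>" using r(1) by (simp add: dist_real_def inner_diff_left)
    qed (use d1 d2 in auto)
  qed
qed

lemma cont_p: "continuous_on ({0..T} \<times> UNIV) (\<lambda>(t, x). p t x)"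
  unfolding continuous_on_iff
proof (intro ballI allI impI)
  fix z :: "real \<times> 'a" and \<epsilon> :: real assume "z \<in> {0..T} \<times> UNIV" "\<epsilon> > 0"
  then obtain t x where z: "z = (t, x)" "t \<in> {0..T}" by auto
  have Lp: "Lp \<ge> 0" using lip_grad[OF z(2)] by (rule lipschitz_on_nonneg)
  obtain d where d: "d > 0" "\<And>s. s \<in> {0..T} \<Longrightarrow> dist s t < d \<Longrightarrow> dist (p s x) (p t x) < \<epsilon> / 2"
    using cont_p_t[of x] z(2) \<open>\<epsilon> > 0\<close> unfolding continuous_on_iff by (meson half_gt_zero)
  let ?d = "min d (\<epsilon> / (2 * (Lp + 1)))"
  show "\<exists>d>0. \<forall>w\<in>{0..T} \<times> UNIV. dist w z < d \<longrightarrow> dist (case w of (t, x) \<Rightarrow> p t x) (case z of (t, x) \<Rightarrow> p t x) < \<epsilon>"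
  proof (intro exI[of _ ?d] conjI ballI impI)
    show "?d > 0" using d(1) Lp \<open>\<epsilon> > 0\<close> by simp
    fix w assume "w \<in> {0..T} \<times> (UNIV :: 'a set)" and w: "dist w z < ?d"
    then obtain s y where sy: "w = (s, y)" "s \<in> {0..T}" by auto
    have "dist s t < ?d" "dist y x < ?d"
      using w dist_fst_le[of w z] dist_snd_le[of w z] unfolding sy z by auto
    then have 1: "dist (p s x) (p t x) < \<epsilon> / 2" and 2: "dist y x \<le> \<epsilon> / (2 * (Lp + 1))"
      using d(2)[OF sy(2)] by auto
    have "dist (p s y) (p s x) \<le> Lp * dist y x"
      using lipschitz_onD[OF lip_grad[OF sy(2)], of y x] by (simp add: p_def)
    also have "\<dots> \<le> (Lp + 1) * (\<epsilon> / (2 * (Lp + 1)))"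
      using 2 Lp by (intro mult_mono) auto
    also have "\<dots> = \<epsilon> / 2" using Lp by (simp add: add_eq_0_iff divide_simps)
    finally show "dist (case w of (t, x) \<Rightarrow> p t x) (case z of (t, x) \<Rightarrow> p t x) < \<epsilon>"
      using 1 dist_triangle[of "p s y" "p t x" "p s x"] unfolding sy z by simp
  qed
qed

text \<open>Maximisers along a convergent sequence accumulate, by compactness of P, at a maximiser
  for the limit point. By \<open>b_eq\<close> every maximiser there gives the same values of f and
  g, so every subsequence has a further subsequence with the same limit.\<close>

lemma cont_bc: "continuous_on ({0..T} \<times> UNIV) (\<lambda>(t, x). (b t x, c t x))"
  unfolding continuous_on_sequentially
proof (intro allI ballI impI, elim conjE)
  fix z and w :: "nat \<Rightarrow> real \<times> 'a"
  let ?bc = "\<lambda>(t, x). (b t x, c t x)"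
  assume wS: "\<forall>n. w n \<in> {0..T} \<times> UNIV" and zS: "z \<in> {0..T} \<times> UNIV" and lim: "w \<longlonglongrightarrow> z"
  have sub: "\<exists>s. strict_mono s \<and> (\<lambda>n. ?bc (w (r (s n)))) \<longlonglongrightarrow> ?bc z" if r: "strict_mono r" for r :: "nat \<Rightarrow> nat"
  proof -
    have "\<exists>u\<in>P. H (fst (w n)) (snd (w n)) (p (fst (w n)) (snd (w n))) =
        p (fst (w n)) (snd (w n)) \<bullet> F (fst (w n)) (snd (w n)) u - G (fst (w n)) (snd (w n)) u" for n
    proof -
      have "fst (w n) \<in> {0..T}" using wS by (auto simp: mem_Times_iff)
      then show ?thesis by (rule H_attained) auto
    qed
    then obtain u where u: "\<And>n. u n \<in> P" "\<And>n. H (fst (w n)) (snd (w n)) (p (fst (w n)) (snd (w n))) =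
        p (fst (w n)) (snd (w n)) \<bullet> F (fst (w n)) (snd (w n)) (u n) - G (fst (w n)) (snd (w n)) (u n)"
      by metis
    obtain v s where v: "v \<in> P" "strict_mono s" "(\<lambda>n. u (r (s n))) \<longlonglongrightarrow> v"
      using P(1) u(1) unfolding compact_def by (auto simp: o_def dest!: spec[of _ "\<lambda>n. u (r n)"])
    define w' where "w' = (\<lambda>n. w (r (s n)))"
    define u' where "u' = (\<lambda>n. u (r (s n)))"
    have w': "w' \<longlonglongrightarrow> z" "\<And>n. w' n \<in> {0..T} \<times> UNIV"
      using LIMSEQ_subseq_LIMSEQ[OF lim strict_mono_o[OF r v(2)]] wS by (simp_all add: w'_def o_def)
    have u': "u' \<longlonglongrightarrow> v" "\<And>n. u' n \<in> P" using v(3) u(1) by (simp_all add: u'_def)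
    have limF: "(\<lambda>n. F (fst (w' n)) (snd (w' n)) (a n)) \<longlonglongrightarrow> F (fst z) (snd z) a'"
      and limG: "(\<lambda>n. G (fst (w' n)) (snd (w' n)) (a n)) \<longlonglongrightarrow> G (fst z) (snd z) a'"
      if a: "a \<longlonglongrightarrow> a'" "\<And>n. a n \<in> P" "a' \<in> P" for a a'
    proof -
      have 1: "(\<lambda>n. (fst (w' n), snd (w' n), a n)) \<longlonglongrightarrow> (fst z, snd z, a')"
        by (intro tendsto_intros w' a)
      have 2: "(fst z, snd z, a') \<in> {0..T} \<times> UNIV \<times> P" using zS a by (auto simp: mem_Times_iff)
      have 3: "\<forall>\<^sub>F n in sequentially. (fst (w' n), snd (w' n), a n) \<in> {0..T} \<times> UNIV \<times> P"
        using w'(2) a by (auto simp: mem_Times_iff)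
      show "(\<lambda>n. F (fst (w' n)) (snd (w' n)) (a n)) \<longlonglongrightarrow> F (fst z) (snd z) a'"
        using continuous_on_tendsto_compose[OF contF 1 2 3] by simp
      show "(\<lambda>n. G (fst (w' n)) (snd (w' n)) (a n)) \<longlonglongrightarrow> G (fst z) (snd z) a'"
        using continuous_on_tendsto_compose[OF contG 1 2 3] by simp
    qed
    have limp: "(\<lambda>n. p (fst (w' n)) (snd (w' n))) \<longlonglongrightarrow> p (fst z) (snd z)"
      using continuous_on_tendsto_compose[OF cont_p w'(1) zS] w'(2) by (simp add: case_prod_unfold)
    have zT: "fst z \<in> {0..T}" and wT: "fst (w' n) \<in> {0..T}" for n using zS w'(2) by (auto simp: mem_Times_iff)
    have "H (fst z) (snd z) (p (fst z) (snd z)) \<le> p (fst z) (snd z) \<bullet> F (fst z) (snd z) v - G (fst z) (snd z) v"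
    proof (unfold H_def, rule cSUP_least[OF P(2)])
      fix a assume a: "a \<in> P"
      show "p (fst z) (snd z) \<bullet> F (fst z) (snd z) a - G (fst z) (snd z) a
          \<le> p (fst z) (snd z) \<bullet> F (fst z) (snd z) v - G (fst z) (snd z) v"
      proof (rule LIMSEQ_le)
        show "(\<lambda>n. p (fst (w' n)) (snd (w' n)) \<bullet> F (fst (w' n)) (snd (w' n)) a - G (fst (w' n)) (snd (w' n)) a)
            \<longlonglongrightarrow> p (fst z) (snd z) \<bullet> F (fst z) (snd z) a - G (fst z) (snd z) a"
          using a by (intro tendsto_intros limp limF limG) auto
        show "(\<lambda>n. p (fst (w' n)) (snd (w' n)) \<bullet> F (fst (w' n)) (snd (w' n)) (u' n) - G (fst (w' n)) (snd (w' n)) (u' n))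
            \<longlonglongrightarrow> p (fst z) (snd z) \<bullet> F (fst z) (snd z) v - G (fst z) (snd z) v"
          using u' v(1) by (intro tendsto_intros limp limF limG) auto
        show "\<exists>N. \<forall>n\<ge>N. p (fst (w' n)) (snd (w' n)) \<bullet> F (fst (w' n)) (snd (w' n)) a - G (fst (w' n)) (snd (w' n)) a
            \<le> p (fst (w' n)) (snd (w' n)) \<bullet> F (fst (w' n)) (snd (w' n)) (u' n) - G (fst (w' n)) (snd (w' n)) (u' n)"
          using H_upper[OF wT a] u(2) unfolding w'_def u'_def by metis
      qed
    qed
    with H_upper[OF zT v(1)] have eq: "H (fst z) (snd z) (p (fst z) (snd z)) = p (fst z) (snd z) \<bullet> F (fst z) (snd z) v - G (fst z) (snd z) v"
      by (intro antisym)
    have "(\<lambda>n. (F (fst (w' n)) (snd (w' n)) (u' n), G (fst (w' n)) (snd (w' n)) (u' n))) \<longlonglongrightarrow> (F (fst z) (snd z) v, G (fst z) (snd z) v)"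
      using u' v(1) by (intro tendsto_Pair limF limG)
    moreover have "(F (fst z) (snd z) v, G (fst z) (snd z) v) = ?bc z"
      using b_eq[OF zT v(1) eq] by (simp add: case_prod_unfold)
    moreover have "(F (fst (w' n)) (snd (w' n)) (u' n), G (fst (w' n)) (snd (w' n)) (u' n)) = ?bc (w' n)" for n
      using b_eq[OF wT u'(2), of n "snd (w' n)" n] u(2) unfolding w'_def u'_def by (simp add: case_prod_unfold)
    ultimately show ?thesis using v(2) by (auto simp: w'_def)
  qed
  show "(?bc \<circ> w) \<longlonglongrightarrow> ?bc z"
  proof (rule ccontr)
    assume "\<not> (?bc \<circ> w) \<longlonglongrightarrow> ?bc z"
    then obtain e where e: "e > 0" "\<And>N. \<exists>n\<ge>N. dist (?bc (w n)) (?bc z) \<ge> e"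
      unfolding lim_sequentially by (auto simp: not_less)
    then have "infinite {n. dist (?bc (w n)) (?bc z) \<ge> e}"
      unfolding infinite_nat_iff_unbounded_le by auto
    from infinite_enumerate[OF this] obtain r :: "nat \<Rightarrow> nat"
      where r: "strict_mono r" "\<And>n. dist (?bc (w (r n))) (?bc z) \<ge> e" by auto
    obtain s where "strict_mono s" "(\<lambda>n. ?bc (w (r (s n)))) \<longlonglongrightarrow> ?bc z" using sub[OF r(1)] by blast
    then obtain n where "dist (?bc (w (r (s n)))) (?bc z) < e" using e(1) unfolding lim_sequentially by blast
    with r(2)[of "s n"] show False by simp
  qed
qed

lemma cont_b: "continuous_on ({0..T} \<times> UNIV) (\<lambda>(t, x). b t x)"
  and cont_c: "continuous_on ({0..T} \<times> UNIV) (\<lambda>(t, x). c t x)"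
  using continuous_on_fst[OF cont_bc] continuous_on_snd[OF cont_bc] by (simp_all add: case_prod_unfold)

lemma continuous_on_along:
  assumes "continuous_on ({0..T} \<times> UNIV) (\<lambda>(t, x). h t x)" "continuous_on S x" "S \<subseteq> {0..T}"
  shows "continuous_on S (\<lambda>t. h t (x t))"
proof -
  have "continuous_on S (\<lambda>t. (t, x t))" by (intro continuous_intros assms(2))
  moreover have "(\<lambda>t. (t, x t)) ` S \<subseteq> {0..T} \<times> UNIV" using assms(3) by auto
  ultimately show ?thesis using continuous_on_compose2[OF assms(1), of S "\<lambda>t. (t, x t)"] by simp
qed

section \<open>Viability of the epigraph and the hypograph\<close>

lemma viable_epigraph:
  assumes u: "u \<in> P"
  shows "viable T {(t, x, z). t \<in> {0..T} \<and> V t x \<le> z} (\<lambda>t (x, z). {(F t x u, G t x u)})"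
  unfolding viable_def
proof clarify
  fix t0 x0 z0 assume t0: "t0 \<in> {0..T}" and z0: "V t0 x0 \<le> z0"
  have cF: "continuous_on ({0..T} \<times> UNIV) (\<lambda>(t, x). F t x u)"
    and cG: "continuous_on ({0..T} \<times> UNIV) (\<lambda>(t, x). G t x u)"
  proof -
    have *: "continuous_on ({0..T} \<times> UNIV) (\<lambda>q :: real \<times> 'a. (fst q, snd q, u))" by (intro continuous_intros)
    have "(\<lambda>q :: real \<times> 'a. (fst q, snd q, u)) ` ({0..T} \<times> UNIV) \<subseteq> {0..T} \<times> UNIV \<times> P" using u by auto
    then show "continuous_on ({0..T} \<times> UNIV) (\<lambda>(t, x). F t x u)" "continuous_on ({0..T} \<times> UNIV) (\<lambda>(t, x). G t x u)"
      using continuous_on_compose2[OF contF *] continuous_on_compose2[OF contG *] by (simp_all add: case_prod_unfold)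
  qed
  obtain C where C: "C \<ge> 0" "\<And>t x u. t \<in> {0..T} \<Longrightarrow> u \<in> P \<Longrightarrow> norm (F t x u) \<le> C * (1 + norm x)"
    using growthF by blast
  obtain x where x: "x t0 = x0" "\<And>t. t \<in> {t0..T} \<Longrightarrow> (x has_vector_derivative F t (x t) u) (at t within {t0..T})"
    using peano_linear_growth[OF cF C(2)[OF _ u] C(1), of t0 x0] t0 by auto
  have sub: "{t0..T} \<subseteq> {0..T}" using t0 by auto
  have cx: "continuous_on {t0..T} x" unfolding continuous_on_eq_continuous_within
    using x(2) has_vector_derivative_continuous by blast
  have cGx: "continuous_on {t0..T} (\<lambda>t. G t (x t) u)" by (rule continuous_on_along[OF cG cx sub])
  have cFx: "continuous_on {t0..T} (\<lambda>t. F t (x t) u)" by (rule continuous_on_along[OF cF cx sub])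
  define z where "z = (\<lambda>t. z0 + integral {t0..t} (\<lambda>s. G s (x s) u))"
  have z: "(z has_vector_derivative G t (x t) u) (at t within {t0..T})" if "t \<in> {t0..T}" for t
    unfolding z_def using integral_has_vector_derivative[OF cGx that] by (auto intro!: derivative_eq_intros)
  have "solves_inclusion (\<lambda>t (x, z). {(F t x u, G t x u)}) t0 T (\<lambda>t. (x t, z t))"
    using x(2) z by (intro solves_inclusionI[where v = "\<lambda>t. (F t (x t) u, G t (x t) u)"] has_vector_derivative_Pair
        continuous_on_Pair cFx cGx) auto
  moreover have "V t (x t) \<le> z t" if t: "t \<in> {t0..T}" for t
  proof -
    let ?h = "\<lambda>t. V t (x t) - z t"
    have "?h t \<le> ?h t0"
    proof (rule nonincreasing_within[where h = ?h and a = t0 and b = T and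
          h' = "\<lambda>s. p s (x s) \<bullet> F s (x s) u - H s (x s) (p s (x s)) - G s (x s) u"])
      fix s assume s: "s \<in> {t0..T}"
      show "(?h has_real_derivative p s (x s) \<bullet> F s (x s) u - H s (x s) (p s (x s)) - G s (x s) u) (at s within {t0..T})"
        using z[OF s] by (intro DERIV_diff V_along[OF x(2)[OF s] s sub]) (simp add: has_real_derivative_iff_has_vector_derivative)
      show "p s (x s) \<bullet> F s (x s) u - H s (x s) (p s (x s)) - G s (x s) u \<le> 0"
        using H_upper[OF _ u, of s "p s (x s)" "x s"] s sub by auto
    qed (use t in auto)
    then show ?thesis using z0 x(1) by (simp add: z_def)
  qed
  ultimately show "\<exists>y. solves_inclusion (\<lambda>t (x, z). {(F t x u, G t x u)}) t0 T y \<and> y t0 = (x0, z0) \<and>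
      (\<forall>t\<in>{t0..T}. (t, y t) \<in> {(t, x, z). t \<in> {0..T} \<and> V t x \<le> z})"
    using t0 x(1) by (intro exI[of _ "\<lambda>t. (x t, z t)"]) (auto simp: z_def)
qed

text \<open>The shift k covers both uses: a curve at constant height below the graph, and with k = 0
  a curve on the graph. The form of \<open>y\<close> is prescribed on the interval only, since
  elements of \<open>curves T\<close> are \<open>undefined\<close> outside it.\<close>

lemma solves_characteristic:
  assumes x: "\<And>t. t \<in> {t0..T} \<Longrightarrow> (x has_vector_derivative b t (x t)) (at t within {t0..T})"
    and t0: "t0 \<ge> 0" and y: "\<And>t. t \<in> {t0..T} \<Longrightarrow> y t = (x t, V t (x t) + k)"
  shows "solves_inclusion (\<lambda>t (x, z). convex hull ((\<lambda>u. (F t x u, G t x u)) ` P)) t0 T y"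
proof (rule solves_inclusionI[where v = "\<lambda>t. (b t (x t), c t (x t))"])
  have sub: "{t0..T} \<subseteq> {0..T}" using t0 by auto
  have cx: "continuous_on {t0..T} x" unfolding continuous_on_eq_continuous_within
    using x has_vector_derivative_continuous by blast
  show "continuous_on {t0..T} (\<lambda>t. (b t (x t), c t (x t)))"
    by (intro continuous_on_Pair continuous_on_along[OF cont_b cx sub] continuous_on_along[OF cont_c cx sub])
  fix t assume t: "t \<in> {t0..T}"
  have "((\<lambda>t. V t (x t) + k) has_real_derivative c t (x t)) (at t within {t0..T})"
    using V_along[OF x[OF t] t sub] unfolding H_p by (auto intro!: derivative_eq_intros)
  then have "((\<lambda>t. (x t, V t (x t) + k)) has_vector_derivative (b t (x t), c t (x t))) (at t within {t0..T})"
    by (intro has_vector_derivative_Pair x t) (simp add: has_real_derivative_iff_has_vector_derivative)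
  then show "(y has_vector_derivative (b t (x t), c t (x t))) (at t within {t0..T})"
    by (rule has_vector_derivative_transform_within[OF _ zero_less_one t]) (simp add: y)
  show "(b t (x t), c t (x t)) \<in> (case y t of (x, z) \<Rightarrow> convex hull ((\<lambda>u. (F t x u, G t x u)) ` P))"
    using bc_image[of t "x t"] t sub by (auto simp: y[OF t] intro: hull_inc)
qed

lemma viable_hypograph:
  "viable T {(t, x, z). t \<in> {0..T} \<and> z \<le> V t x} (\<lambda>t (x, z). convex hull ((\<lambda>u. (F t x u, G t x u)) ` P))"
  unfolding viable_def
proof clarify
  fix t0 x0 z0 assume t0: "t0 \<in> {0..T}" and z0: "z0 \<le> V t0 x0"
  obtain C where C: "C \<ge> 0" "\<And>t x. t \<in> {0..T} \<Longrightarrow> norm (b t x) \<le> C * (1 + norm x)"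
    using growthb by blast
  obtain x where x: "x t0 = x0" "\<And>t. t \<in> {t0..T} \<Longrightarrow> (x has_vector_derivative b t (x t)) (at t within {t0..T})"
    using peano_linear_growth[OF cont_b C(2) C(1), of t0 x0] t0 by auto
  let ?y = "\<lambda>t. (x t, V t (x t) + (z0 - V t0 x0))"
  have "solves_inclusion (\<lambda>t (x, z). convex hull ((\<lambda>u. (F t x u, G t x u)) ` P)) t0 T ?y"
    by (rule solves_characteristic[OF x(2)]) (use t0 in auto)
  then show "\<exists>y. solves_inclusion (\<lambda>t (x, z). convex hull ((\<lambda>u. (F t x u, G t x u)) ` P)) t0 T y \<and> y t0 = (x0, z0) \<and>
      (\<forall>t\<in>{t0..T}. (t, y t) \<in> {(t, x, z). t \<in> {0..T} \<and> z \<le> V t x})"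
    using t0 z0 x(1) by (intro exI[of _ ?y]) auto
qed

end

section \<open>Weak solutions of the continuity equation\<close>

text \<open>The squared positive part is the C^1 building block of the cut-offs in time and in space
  below.\<close>

lemma has_field_derivative_max0_sq:
  "((\<lambda>s. (max 0 s)\<^sup>2) has_real_derivative 2 * max 0 s) (at (s :: real))"
proof -
  consider "s > 0" | "s < 0" | "s = 0" by linarith
  then show ?thesis
  proof cases
    case 1
    have "((\<lambda>s::real. s\<^sup>2) has_real_derivative 2 * max 0 s) (at s)"
      using 1 by (auto intro!: derivative_eq_intros)
    then show ?thesis
      by (rule has_field_derivative_transform_within_open[of _ _ _ "{0<..}"]) (use 1 in auto)
  next
    case 2
    have "((\<lambda>s::real. 0) has_real_derivative 2 * max 0 s) (at s)"
      using 2 by (auto intro!: derivative_eq_intros)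
    then show ?thesis
      by (rule has_field_derivative_transform_within_open[of _ _ _ "{..<0}"]) (use 2 in auto)
  next
    case 3
    have "((\<lambda>h. (max 0 h)\<^sup>2 / h) \<longlongrightarrow> 0) (at (0::real))"
    proof (rule Lim_null_comparison[where g = "\<lambda>h. \<bar>h\<bar>"])
      have "norm ((max 0 h)\<^sup>2 / h) \<le> \<bar>h\<bar>" for h :: real
        by (cases "h > 0") (auto simp: power2_eq_square)
      then show "\<forall>\<^sub>F h in at (0::real). norm ((max 0 h)\<^sup>2 / h) \<le> \<bar>h\<bar>" by auto
      show "((\<lambda>h. \<bar>h\<bar>) \<longlongrightarrow> 0) (at (0::real))" by (rule tendsto_rabs_zero[OF tendsto_ident_at])
    qed
    then show ?thesis using 3 by (simp add: has_field_derivative_iff)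
  qed
qed

lemmas max0_sq_derivs = DERIV_chain'[OF _ has_field_derivative_max0_sq]

lemma Cb1_intervalI:
  assumes T: "T > 0" and d: "\<And>t. t \<in> {0..T} \<Longrightarrow> (\<psi> has_real_derivative \<psi>' t) (at t within {0..T})"
    and c: "continuous_on {0..T} \<psi>'"
  shows "\<psi> \<in> Cb1_interval T" and "\<And>t. t \<in> {0..T} \<Longrightarrow> vector_derivative \<psi> (at t within {0..T}) = \<psi>' t"
proof -
  show vd: "vector_derivative \<psi> (at t within {0..T}) = \<psi>' t" if "t \<in> {0..T}" for t
    using vector_derivative_within_cbox[of 0 T t \<psi>] T that d[OF that]
    by (simp add: has_real_derivative_iff_has_vector_derivative)
  have "continuous_on {0..T} \<psi>" using d by (rule DERIV_continuous_on)
  then have "bounded (\<psi> ` {0..T})" by (intro compact_imp_bounded compact_continuous_image) auto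
  moreover have "bounded (\<psi>' ` {0..T})" using c by (intro compact_imp_bounded compact_continuous_image) auto
  moreover have "\<forall>t\<in>{0..T}. \<psi> differentiable (at t within {0..T})"
    using d unfolding differentiable_def has_field_derivative_def by blast
  ultimately show "\<psi> \<in> Cb1_interval T"
    unfolding Cb1_interval_def using c by (simp add: vd cong: continuous_on_cong_simp image_cong_simp)
qed

lemma integral_lipschitz_diff:
  fixes \<phi> :: "'a::euclidean_space \<Rightarrow> real"
  assumes "K-lipschitz_on UNIV \<phi>" "K > 0"
  shows "\<bar>(\<integral>x. \<phi> x \<partial>law m) - (\<integral>x. \<phi> x \<partial>law m')\<bar> \<le> K * dist m m'"
proof -
  have l: "1-lipschitz_on UNIV (\<lambda>x. \<phi> x / K)"
    using assms by (auto simp: lipschitz_on_def dist_real_def field_simps simp flip: diff_divide_distrib)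
  from wdist_upper[OF l, of m m'] wdist_upper[OF l, of m' m]
  have "\<bar>(\<integral>x. \<phi> x \<partial>law m) / K - (\<integral>x. \<phi> x \<partial>law m') / K\<bar> \<le> dist m m'"
    by (simp add: dist_prob1_def wdist_commute[of m' m])
  then show ?thesis using assms(2) by (simp add: field_simps flip: diff_divide_distrib)
qed

lemma continuous_on_integral_lipschitz:
  fixes \<phi> :: "'a::euclidean_space \<Rightarrow> real"
  assumes "K-lipschitz_on UNIV \<phi>" "K > 0" "continuous_on S \<mu>"
  shows "continuous_on S (\<lambda>t. \<integral>x. \<phi> x \<partial>law (\<mu> t))"
proof -
  have "K-lipschitz_on UNIV (\<lambda>m. \<integral>x. \<phi> x \<partial>law m)"
    using integral_lipschitz_diff[OF assms(1,2)] assms(2) by (intro lipschitz_onI) (auto simp: dist_real_def)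
  from continuous_on_compose2[OF lipschitz_on_continuous_on[OF this] assms(3)] show ?thesis by simp
qed

lemma GDERIV_Cb1:
  fixes \<phi> :: "'a::euclidean_space \<Rightarrow> real"
  assumes d: "\<And>x. GDERIV \<phi> x :> D x" and c: "continuous_on UNIV D"
    and b: "bounded (range \<phi>)" "\<And>x. norm (D x) \<le> K"
  shows "\<phi> \<in> Cb1" "\<exists>K>0. K-lipschitz_on UNIV \<phi>"
proof -
  have g: "grad \<phi> = D" using grad_eqI[OF d] by auto
  have "bounded (range D)" using b(2) by (auto simp: bounded_iff)
  moreover have "\<phi> differentiable (at x)" for x using d[of x] by (auto simp: gderiv_def differentiable_def)
  ultimately show "\<phi> \<in> Cb1" using c b(1) by (simp add: Cb1_def g)
  have "(\<bar>K\<bar> + 1)-lipschitz_on UNIV \<phi>"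
  proof (rule bounded_derivative_imp_lipschitz[where f' = "\<lambda>x h. h \<bullet> D x"])
    show "(\<phi> has_derivative (\<lambda>h. h \<bullet> D x)) (at x within UNIV)" for x using d[of x] by (simp add: gderiv_def)
    show "onorm (\<lambda>h. h \<bullet> D x) \<le> \<bar>K\<bar> + 1" for x
    proof (rule onorm_le)
      fix h
      have "norm (h \<bullet> D x) \<le> norm h * norm (D x)" by (simp add: Cauchy_Schwarz_ineq2)
      also have "\<dots> \<le> norm h * (\<bar>K\<bar> + 1)" using b(2)[of x] by (intro mult_left_mono) auto
      finally show "norm (h \<bullet> D x) \<le> (\<bar>K\<bar> + 1) * norm h" by (simp add: mult.commute)
    qed
  qed auto
  then show "\<exists>K>0. K-lipschitz_on UNIV \<phi>" by (intro exI[of _ "\<bar>K\<bar> + 1"]) auto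
qed

text \<open>By second countability the union of all null open sets is the union of countably many of
  them.\<close>

lemma AE_support:
  fixes m :: "'a::second_countable_topology measure"
  assumes "sets m = sets borel"
  shows "AE x in m. x \<in> support m"
proof -
  let ?F = "{U :: 'a set. open U \<and> emeasure m U = 0}"
  obtain F' where F': "F' \<subseteq> ?F" "countable F'" "\<Union>F' = \<Union>?F"
    by (rule Lindelof[of ?F]) auto
  have "(\<Union>U\<in>F'. U) \<in> null_sets m"
    using F' assms by (intro null_sets_UN') (auto simp: null_sets_def)
  moreover have "- support m = \<Union>?F"
    unfolding support_def by (auto simp: not_gr_zero)
  ultimately have "- support m \<in> null_sets m" using F'(3) by simp
  then show ?thesis by (rule AE_I'[of "- support m"]) auto
qed

lemma set_lborel_eq_integral:
  fixes h :: "real \<Rightarrow> real"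
  assumes "continuous_on {a..b} h"
  shows "(LBINT t:{a..b}. h t) = integral {a..b} h"
  using borel_integrable_atLeastAtMost'[OF assms] by (rule set_borel_integral_eq_integral)

text \<open>The hypothesis is A' <= K A, tested with nonnegative functions. For B = exp(-K t) A it
  says that B does not increase: if B(t) > B(0), a test function that rises near 0 and falls just
  before t compares averages of B over two short intervals and gives a contradiction.\<close>

lemma gronwall_weak:
  fixes A :: "real \<Rightarrow> real"
  assumes T: "T > 0" and A: "continuous_on {0..T} A"
    and weak: "\<And>\<psi> \<psi>'. (\<And>t. t \<in> {0..T} \<Longrightarrow> (\<psi> has_real_derivative \<psi>' t) (at t within {0..T})) \<Longrightarrow>
      continuous_on {0..T} \<psi>' \<Longrightarrow> \<psi> 0 = 0 \<Longrightarrow> \<psi> T = 0 \<Longrightarrow> (\<And>t. t \<in> {0..T} \<Longrightarrow> 0 \<le> \<psi> t) \<Longrightarrow>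
      - integral {0..T} (\<lambda>t. \<psi>' t * A t) \<le> K * integral {0..T} (\<lambda>t. \<psi> t * A t)"
    and t: "t \<in> {0..T}"
  shows "A t \<le> exp (K * t) * A 0"
proof (rule ccontr)
  assume "\<not> A t \<le> exp (K * t) * A 0"
  define B where "B = (\<lambda>s. exp (- K * s) * A s)"
  have "B 0 < B t" using \<open>\<not> A t \<le> exp (K * t) * A 0\<close> by (simp add: B_def exp_minus field_simps)
  then have "t \<noteq> 0" by auto
  then have "t > 0" using t by auto
  \<comment> \<open>Two levels strictly between B(0) and B(t): by continuity B stays below
    \<open>c1\<close> near 0 and above \<open>c2\<close> near t.\<close>
  define c1 c2 where "c1 = (2 * B 0 + B t) / 3" and "c2 = (B 0 + 2 * B t) / 3"
  have c: "B 0 < c1" "c1 < c2" "c2 < B t" using \<open>B 0 < B t\<close> by (auto simp: c1_def c2_def)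
  have B: "continuous_on {0..T} B" unfolding B_def by (intro continuous_intros A)
  have near: "\<exists>d>0. \<forall>s\<in>{0..T}. dist s r < d \<longrightarrow> dist (B s) (B r) < e" if "r \<in> {0..T}" "e > 0" for r e
    using B that unfolding continuous_on_iff by blast
  have "0 \<in> {0..T}" using T by auto
  obtain d1 where d1: "d1 > 0" "\<And>s. s \<in> {0..T} \<Longrightarrow> dist s 0 < d1 \<Longrightarrow> dist (B s) (B 0) < c1 - B 0"
    using near[OF \<open>0 \<in> {0..T}\<close>, of "c1 - B 0"] c(1) by auto
  obtain d2 where d2: "d2 > 0" "\<And>s. s \<in> {0..T} \<Longrightarrow> dist s t < d2 \<Longrightarrow> dist (B s) (B t) < B t - c2"
    using near[OF t, of "B t - c2"] c(3) by auto
  define d where "d = min (min (d1 / 2) (d2 / 2)) (t / 2)"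
  have d: "d > 0" "d < d1" "d < d2" "2 * d \<le> t" using d1(1) d2(1) \<open>t > 0\<close> by (auto simp: d_def)
  \<comment> \<open>The derivative \<open>g'\<close> is a tent on [0, d], and \<open>g\<close> has
    the constant value d^2 / 2 from d on. Hence \<open>w\<close> below rises on [0, d], falls on
    [a, t] and vanishes at 0 and T.\<close>
  define g where "g = (\<lambda>s :: real. (max 0 s)\<^sup>2 - 2 * (max 0 (s - d / 2))\<^sup>2 + (max 0 (s - d))\<^sup>2)"
  define g' where "g' = (\<lambda>s :: real. 2 * max 0 s - 4 * max 0 (s - d / 2) + 2 * max 0 (s - d))"
  have dg: "(g has_real_derivative g' s) (at s)" for s
    unfolding g_def g'_def by (rule max0_sq_derivs derivative_eq_intros refl | simp)+
  have dg2: "((\<lambda>s. g (s - a)) has_real_derivative g' (s - a)) (at s)" for a s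
    using DERIV_shift[of g "g' (s - a)" s "- a"] dg[of "s - a"] by simp
  have cg': "continuous_on S (\<lambda>s. g' (s - a))" for a S unfolding g'_def by (intro continuous_intros)
  have g'nn: "g' s \<ge> 0" for s using d(1) by (auto simp: g'_def max_def)
  have g'0: "g' s = 0" if "s \<le> 0 \<or> d \<le> s" for s using d(1) that by (auto simp: g'_def max_def)
  have g0: "g s = 0" if "s \<le> 0" for s using d(1) that by (auto simp: g_def max_def)
  have gd: "g s = d\<^sup>2 / 2" if "s \<ge> d" for s
    using d(1) that by (auto simp: g_def max_def power2_eq_square field_simps)
  have gmono: "g r \<le> g s" if "r \<le> s" for r s
    using DERIV_nonneg_imp_nondecreasing[OF that, of g] dg g'nn by blast
  define a where "a = t - d"
  have a: "d \<le> a" "a + d = t" "t \<le> T" using d t by (auto simp: a_def)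
  define w where "w = (\<lambda>s. g s - g (s - a))"
  define w' where "w' = (\<lambda>s. g' s - g' (s - a))"
  have dw0: "(w has_real_derivative w' s) (at s)" for s
    unfolding w_def w'_def by (intro DERIV_diff dg dg2)
  have cw0': "continuous_on S w'" for S
    unfolding w'_def using cg'[of S 0] cg'[of S a] by (intro continuous_on_diff) auto
  have cw0: "continuous_on S w" for S by (rule DERIV_continuous_on[where D = w']) (rule has_field_derivative_at_within[OF dw0])
  define \<psi> where "\<psi> = (\<lambda>s. exp (- K * s) * w s)"
  define \<psi>' where "\<psi>' = (\<lambda>s. exp (- K * s) * (w' s - K * w s))"
  have "- integral {0..T} (\<lambda>t. \<psi>' t * A t) \<le> K * integral {0..T} (\<lambda>t. \<psi> t * A t)"
  proof (rule weak)
    show "(\<psi> has_real_derivative \<psi>' s) (at s within {0..T})" for s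
      unfolding \<psi>_def \<psi>'_def
      by (rule derivative_eq_intros has_field_derivative_at_within[OF dw0] refl | simp add: algebra_simps)+
    show "continuous_on {0..T} \<psi>'" unfolding \<psi>'_def by (intro continuous_intros cw0 cw0')
    show "\<psi> 0 = 0" using a d by (simp add: \<psi>_def w_def g0)
    show "\<psi> T = 0" using a d by (simp add: \<psi>_def w_def gd)
    show "0 \<le> \<psi> s" for s using gmono[of "s - a" s] a d by (simp add: \<psi>_def w_def)
  qed
  moreover have "integral {0..T} (\<lambda>t. \<psi>' t * A t) + K * integral {0..T} (\<lambda>t. \<psi> t * A t) = integral {0..T} (\<lambda>t. w' t * B t)"
  proof -
    have "(\<lambda>t. \<psi>' t * A t) integrable_on {0..T}" "(\<lambda>t. K * (\<psi> t * A t)) integrable_on {0..T}"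
      unfolding \<psi>_def \<psi>'_def by (intro integrable_continuous_real continuous_intros A cw0 cw0')+
    then have "integral {0..T} (\<lambda>t. \<psi>' t * A t) + integral {0..T} (\<lambda>t. K * (\<psi> t * A t)) = integral {0..T} (\<lambda>t. \<psi>' t * A t + K * (\<psi> t * A t))"
      by (rule Henstock_Kurzweil_Integration.integral_add[symmetric])
    also have "\<dots> = integral {0..T} (\<lambda>t. w' t * B t)"
      by (rule arg_cong[where f = "integral _"]) (simp add: fun_eq_iff \<psi>_def \<psi>'_def B_def algebra_simps)
    finally show ?thesis by simp
  qed
  ultimately have "0 \<le> integral {0..T} (\<lambda>t. w' t * B t)" by linarith
  also have "\<dots> \<le> integral {0..T} (\<lambda>t. c1 * g' t - c2 * g' (t - a))"
  proof (rule integral_le)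
    show "(\<lambda>t. w' t * B t) integrable_on {0..T}"
      by (intro integrable_continuous_real continuous_intros B cw0')
    show "(\<lambda>t. c1 * g' t - c2 * g' (t - a)) integrable_on {0..T}"
      using cg'[of "{0..T}" 0] cg'[of "{0..T}" a] by (intro integrable_continuous_real continuous_intros) auto
    fix s assume s: "s \<in> {0..T}"
    have "g' s * B s \<le> c1 * g' s"
    proof (cases "s < d")
      case True
      then have "B s \<le> c1" using d1(2)[OF s] d s by (auto simp: dist_real_def)
      then show ?thesis using g'nn[of s] by (simp add: mult.commute mult_right_mono)
    qed (simp add: g'0)
    moreover have "c2 * g' (s - a) \<le> g' (s - a) * B s"
    proof (cases "a < s \<and> s < t")
      case True
      then have "c2 \<le> B s" using d2(2)[OF s] d a s by (auto simp: dist_real_def)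
      then show ?thesis using g'nn[of "s - a"] by (simp add: mult.commute mult_right_mono)
    qed (use a in \<open>auto simp: g'0\<close>)
    ultimately show "w' s * B s \<le> c1 * g' s - c2 * g' (s - a)" by (simp add: w'_def algebra_simps)
  qed
  also have "\<dots> = (c1 - c2) * (d\<^sup>2 / 2)"
  proof (rule integral_unique)
    have "((\<lambda>t. c1 * g' t - c2 * g' (t - a)) has_integral (c1 * g T - c2 * g (T - a)) - (c1 * g 0 - c2 * g (0 - a))) {0..T}"
      using T
      by (intro fundamental_theorem_of_calculus)
         (auto simp flip: has_real_derivative_iff_has_vector_derivative
            intro!: has_field_derivative_at_within[of _ _ _ "{0..T}"] derivative_eq_intros dg dg2)
    then show "((\<lambda>t. c1 * g' t - c2 * g' (t - a)) has_integral (c1 - c2) * (d\<^sup>2 / 2)) {0..T}"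
      using a d by (simp add: gd g0 algebra_simps diff_divide_distrib)
  qed
  also have "\<dots> < 0" using c d(1) by (intro mult_neg_pos) auto
  finally show False by simp
qed

text \<open>The right-hand side remains a Lebesgue integral: no regularity of \<open>b\<close> is
  assumed here, so its integrand need not be integrable.\<close>

lemma weak_solution_test:
  fixes \<phi> :: "'a::euclidean_space \<Rightarrow> real"
  assumes weak: "weak_solution T b m0 \<mu>" and T: "T > 0" and \<mu>: "continuous_on {0..T} \<mu>"
    and \<phi>: "\<And>x. GDERIV \<phi> x :> D x" "continuous_on UNIV D" "bounded (range \<phi>)" "\<And>x. norm (D x) \<le> K"
    and \<psi>: "\<And>t. t \<in> {0..T} \<Longrightarrow> (\<psi> has_real_derivative \<psi>' t) (at t within {0..T})"
      "continuous_on {0..T} \<psi>'" "\<psi> 0 = 0" "\<psi> T = 0"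
  shows "- integral {0..T} (\<lambda>t. \<psi>' t * (\<integral>x. \<phi> x \<partial>law (\<mu> t))) =
    (LBINT t:{0..T}. \<psi> t * (\<integral>x. b t x \<bullet> D x \<partial>law (\<mu> t)))"
proof -
  note psi = Cb1_intervalI[of T \<psi> \<psi>', OF T \<psi>(1,2)]
  note phi = GDERIV_Cb1[OF \<phi>]
  have g: "grad \<phi> = D" using grad_eqI[OF \<phi>(1)] by auto
  obtain L where "L > 0" "L-lipschitz_on UNIV \<phi>" using phi(2) by blast
  then have "continuous_on {0..T} (\<lambda>t. \<integral>x. \<phi> x \<partial>law (\<mu> t))"
    using \<mu> by (intro continuous_on_integral_lipschitz)
  then have c: "continuous_on {0..T} (\<lambda>t. \<psi>' t * (\<integral>x. \<phi> x \<partial>law (\<mu> t)))" by (intro continuous_intros \<psi>(2))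
  have "- (LBINT t:{0..T}. \<integral>x. vector_derivative \<psi> (at t within {0..T}) * \<phi> x \<partial>law (\<mu> t)) =
      (LBINT t:{0..T}. \<integral>x. \<psi> t * (b t x \<bullet> grad \<phi> x) \<partial>law (\<mu> t))"
    using weak phi(1) psi(1) \<psi>(3,4) unfolding weak_solution_def by blast
  also have "(LBINT t:{0..T}. \<integral>x. vector_derivative \<psi> (at t within {0..T}) * \<phi> x \<partial>law (\<mu> t)) =
      (LBINT t:{0..T}. \<psi>' t * (\<integral>x. \<phi> x \<partial>law (\<mu> t)))"
  proof (rule set_lebesgue_integral_cong, simp, intro allI impI)
    fix t assume "t \<in> {0..T}"
    from psi(2)[OF _ this]
    have "vector_derivative \<psi> (at t within {0..T}) = \<psi>' t" by blast
    then show "(\<integral>x. vector_derivative \<psi> (at t within {0..T}) * \<phi> x \<partial>law (\<mu> t)) = \<psi>' t * (\<integral>x. \<phi> x \<partial>law (\<mu> t))"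
      by simp
  qed
  also have "\<dots> = integral {0..T} (\<lambda>t. \<psi>' t * (\<integral>x. \<phi> x \<partial>law (\<mu> t)))"
    by (rule set_lborel_eq_integral[OF c])
  finally show ?thesis by (simp add: g)
qed

text \<open>The bounded functions \<phi>_q = S^q / (1 + S^q) satisfy b.\<nabla>\<phi>_q <= 4 C q
  \<phi>_q by the linear growth of b. Gronwall and the bound on the initial law make the integral of
  \<phi>_q at time t at most (1/2)^q. Where S >= 1, however, \<phi>_q >= 1/2 for every q, so this
  set is null.\<close>

lemma weak_solution_compact_support:
  fixes b :: "real \<Rightarrow> 'a::euclidean_space \<Rightarrow> 'a"
  assumes weak: "weak_solution T b m0 \<mu>" and T: "T > 0" and \<mu>: "continuous_on {0..T} \<mu>"
    and growth: "\<And>t x. t \<in> {0..T} \<Longrightarrow> norm (b t x) \<le> C * (1 + norm x)" and C: "C \<ge> 0"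
    and m0: "AE x in law m0. norm x \<le> R0"
  obtains R where "R \<ge> 0" "\<And>t. t \<in> {0..T} \<Longrightarrow> AE x in law (\<mu> t). norm x \<le> R"
proof -
  \<comment> \<open>Chosen so that exp(4 C T) (1 + R0^2) / A = 1/2.\<close>
  define A where "A = 2 * (1 + R0\<^sup>2) * exp (4 * C * T)"
  have A: "A > 0" by (simp add: A_def add_pos_nonneg)
  define S where "S = (\<lambda>x :: 'a. (1 + x \<bullet> x) / A)"
  have S0: "S x > 0" for x using A by (simp add: S_def add_pos_nonneg)
  have contS: "continuous_on UNIV S" unfolding S_def using A by (intro continuous_intros) auto
  define \<phi> where "\<phi> = (\<lambda>q x. S x ^ q / (1 + S x ^ q))"
  have pos: "1 + S x ^ q > 0" for x q using S0[of x] by (simp add: add_pos_pos)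
  have ne: "1 + S x ^ q \<noteq> 0" for x q using pos[of x q] by simp
  have \<phi>01: "0 \<le> \<phi> q x" "\<phi> q x \<le> 1" for q x using S0[of x] pos[of x q] by (auto simp: \<phi>_def field_simps)
  \<comment> \<open>S times the derivative of s^q / (1 + s^q) at S; the factor S enters through 1 /
    A = S / (1 + |x|^2) in the gradient of S.\<close>
  define w where "w = (\<lambda>q x. real q * (S x ^ q / (1 + S x ^ q)\<^sup>2))"
  have w: "0 \<le> w q x" "w q x \<le> real q * \<phi> q x" for q x
  proof -
    show "0 \<le> w q x" using S0[of x] by (simp add: w_def)
    have "S x ^ q / (1 + S x ^ q)\<^sup>2 = \<phi> q x / (1 + S x ^ q)" by (simp add: \<phi>_def power2_eq_square)
    also have "\<dots> \<le> \<phi> q x / 1" using \<phi>01(1)[of q x] S0[of x] pos[of x q] by (intro divide_left_mono) auto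
    finally show "w q x \<le> real q * \<phi> q x" unfolding w_def by (intro mult_left_mono) auto
  qed
  define D where "D = (\<lambda>q x. (w q x * (2 / (1 + x \<bullet> x))) *\<^sub>R x)"
  have dS: "(S has_derivative (\<lambda>h. 2 * (x \<bullet> h) / A)) (at x)" for x
    unfolding S_def using A by (auto intro!: derivative_eq_intros simp: inner_commute)
  have D: "GDERIV (\<phi> q) x :> D q x" for q x
  proof -
    have "((\<lambda>s::real. s ^ q / (1 + s ^ q)) has_real_derivative real q * S x ^ (q - 1) / (1 + S x ^ q)\<^sup>2) (at (S x))"
      using ne[of x q] by (auto intro!: derivative_eq_intros simp: power2_eq_square field_simps)
    from DERIV_compose_FDERIV[OF this dS]
    have "(\<phi> q has_derivative (\<lambda>h. 2 * (x \<bullet> h) / A * (real q * S x ^ (q - 1) / (1 + S x ^ q)\<^sup>2))) (at x)"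
      by (simp add: \<phi>_def)
    moreover have "2 * (x \<bullet> h) / A * (real q * S x ^ (q - 1) / (1 + S x ^ q)\<^sup>2) = h \<bullet> D q x" for h
    proof (cases q)
      case 0
      then show ?thesis by (simp add: D_def w_def)
    next
      case (Suc k)
      have "1 / A = S x / (1 + x \<bullet> x)"
        using add_pos_nonneg[OF zero_less_one inner_ge_zero[of x]] by (simp add: S_def)
      then have "2 * (x \<bullet> h) / A * (real q * S x ^ (q - 1) / (1 + S x ^ q)\<^sup>2) =
          2 * (x \<bullet> h) * (S x / (1 + x \<bullet> x)) * (real q * S x ^ (q - 1) / (1 + S x ^ q)\<^sup>2)" by (simp add: divide_inverse)
      also have "\<dots> = h \<bullet> D q x" by (simp add: D_def w_def Suc inner_commute mult_ac)
      finally show ?thesis .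
    qed
    ultimately show ?thesis by (simp add: gderiv_def)
  qed
  have contD: "continuous_on UNIV (D q)" for q
  proof -
    have "1 + x \<bullet> x \<noteq> 0" for x :: 'a using add_pos_nonneg[OF zero_less_one inner_ge_zero[of x]] by simp
    then show ?thesis unfolding D_def w_def using ne by (intro continuous_intros contS) auto
  qed
  have frac: "2 / (1 + x \<bullet> x) * norm x \<le> 1" for x :: 'a
    using sum_squares_bound[of "norm x" 1] add_pos_nonneg[OF zero_less_one inner_ge_zero[of x]]
    by (simp add: field_simps power2_norm_eq_inner)
  have bdD: "norm (D q x) \<le> real q" for q x
  proof -
    have "norm (D q x) = w q x * (2 / (1 + x \<bullet> x) * norm x)"
      using w(1)[of q x] add_pos_nonneg[OF zero_less_one inner_ge_zero[of x]] by (simp add: D_def abs_mult)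
    also have "\<dots> \<le> w q x * 1" by (intro mult_left_mono frac w)
    also have "\<dots> \<le> real q * 1" using w(2)[of q x] mult_left_mono[OF \<phi>01(2)[of q x], of "real q"] by simp
    finally show ?thesis by simp
  qed
  have bD: "b t x \<bullet> D q x \<le> 4 * C * real q * \<phi> q x" if t: "t \<in> {0..T}" for t q x
  proof -
    have "b t x \<bullet> x \<le> norm (b t x) * norm x" by (rule norm_cauchy_schwarz)
    also have "\<dots> \<le> C * (1 + norm x) * norm x" using growth[OF t] by (intro mult_right_mono) auto
    also have "\<dots> = C * (norm x + (norm x)\<^sup>2)" by (simp add: algebra_simps power2_eq_square)
    also have "\<dots> \<le> C * (2 * (1 + (norm x)\<^sup>2))"
    proof (intro mult_left_mono C)
      have "2 * norm x \<le> (norm x)\<^sup>2 + 1" using sum_squares_bound[of "norm x" 1] by simp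
      moreover have "n + q \<le> 2 * (1 + q)" if "2 * n \<le> q + 1" "0 \<le> q" for n q :: real using that by simp
      ultimately show "norm x + (norm x)\<^sup>2 \<le> 2 * (1 + (norm x)\<^sup>2)" using zero_le_power2 by blast
    qed
    finally have *: "b t x \<bullet> x \<le> 2 * C * (1 + x \<bullet> x)" by (simp add: power2_norm_eq_inner algebra_simps)
    have "b t x \<bullet> D q x = w q x * (2 / (1 + x \<bullet> x)) * (b t x \<bullet> x)" by (simp add: D_def)
    also have "\<dots> \<le> w q x * (2 / (1 + x \<bullet> x)) * (2 * C * (1 + x \<bullet> x))"
      using w(1)[of q x] add_pos_nonneg[OF zero_less_one inner_ge_zero[of x]] by (intro mult_left_mono *) auto
    also have "\<dots> = 4 * C * w q x"
      using add_pos_nonneg[OF zero_less_one inner_ge_zero[of x]] by (simp add: field_simps)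
    also have "\<dots> \<le> 4 * C * (real q * \<phi> q x)" using w(2) C by (intro mult_left_mono) auto
    finally show ?thesis by (simp add: mult_ac)
  qed
  define a where "a = (\<lambda>q t. \<integral>x. \<phi> q x \<partial>law (\<mu> t))"
  have bounded: "bounded (range (\<phi> q))" for q using \<phi>01 by (auto simp: bounded_iff intro!: exI[of _ 1])
  have cont_a: "continuous_on {0..T} (a q)" for q
  proof -
    obtain L where "L > 0" "L-lipschitz_on UNIV (\<phi> q)" using GDERIV_Cb1(2)[OF D contD bounded bdD] by blast
    then show ?thesis unfolding a_def using \<mu> by (intro continuous_on_integral_lipschitz)
  qed
  have meas_\<phi>: "\<phi> q \<in> borel_measurable borel" for q
    unfolding \<phi>_def using ne by (intro borel_measurable_continuous_onI continuous_intros contS) auto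
  have int_\<phi>: "integrable (law m) (\<phi> q)" for m q
  proof -
    interpret prob_space "law m" by (rule law_prob1)
    note [measurable_cong] = law_prob1(2)[of m]
    have "\<phi> q \<in> borel_measurable (law m)" using meas_\<phi>[of q] by measurable
    then show ?thesis using \<phi>01 by (intro integrable_const_bound[where B = 1]) auto
  qed
  have a0: "a q t \<ge> 0" for q t unfolding a_def by (intro integral_nonneg_AE) (auto simp: \<phi>01)
  have growth_a: "a q t \<le> exp (4 * C * real q * t) * a q 0" if t: "t \<in> {0..T}" for q t
  proof (rule gronwall_weak[OF T cont_a _ t])
    fix \<psi> \<psi>' :: "real \<Rightarrow> real"
    assume \<psi>: "\<And>t. t \<in> {0..T} \<Longrightarrow> (\<psi> has_real_derivative \<psi>' t) (at t within {0..T})"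
      "continuous_on {0..T} \<psi>'" "\<psi> 0 = 0" "\<psi> T = 0" and nn: "\<And>t. t \<in> {0..T} \<Longrightarrow> 0 \<le> \<psi> t"
    have c\<psi>: "continuous_on {0..T} \<psi>" using \<psi>(1) by (rule DERIV_continuous_on)
    have c: "continuous_on {0..T} (\<lambda>t. 4 * C * real q * (\<psi> t * a q t))" by (intro continuous_intros c\<psi> cont_a)
    have nn': "0 \<le> 4 * C * real q * (\<psi> t * a q t)" if "t \<in> {0..T}" for t using nn[OF that] a0 C by simp
    have "- integral {0..T} (\<lambda>t. \<psi>' t * a q t) = (LBINT t:{0..T}. \<psi> t * (\<integral>x. b t x \<bullet> D q x \<partial>law (\<mu> t)))"
      unfolding a_def by (rule weak_solution_test[OF weak T \<mu> D contD bounded bdD \<psi>])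
    also have "\<dots> \<le> (LBINT t:{0..T}. 4 * C * real q * (\<psi> t * a q t))"
    \<comment> \<open>A function that is not integrable has integral 0 by convention, and the bound
      on the right is nonnegative. The inner integral is treated in the same way.\<close>
    proof (cases "set_integrable lborel {0..T} (\<lambda>t. \<psi> t * (\<integral>x. b t x \<bullet> D q x \<partial>law (\<mu> t)))")
      case True
      then show ?thesis
      proof (rule set_integral_mono[OF _ borel_integrable_atLeastAtMost'[OF c]])
        fix t assume t: "t \<in> {0..T}"
        have "(\<integral>x. b t x \<bullet> D q x \<partial>law (\<mu> t)) \<le> 4 * C * real q * a q t"
        proof (cases "integrable (law (\<mu> t)) (\<lambda>x. b t x \<bullet> D q x)")
          case True
          then have "(\<integral>x. b t x \<bullet> D q x \<partial>law (\<mu> t)) \<le> (\<integral>x. 4 * C * real q * \<phi> q x \<partial>law (\<mu> t))"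
            using int_\<phi> by (intro integral_mono bD t) auto
          then show ?thesis by (simp add: a_def)
        next
          case False
          then show ?thesis using a0 C by (simp add: not_integrable_integral_eq)
        qed
        then have "\<psi> t * (\<integral>x. b t x \<bullet> D q x \<partial>law (\<mu> t)) \<le> \<psi> t * (4 * C * real q * a q t)"
          using nn[OF t] by (rule mult_left_mono)
        then show "\<psi> t * (\<integral>x. b t x \<bullet> D q x \<partial>law (\<mu> t)) \<le> 4 * C * real q * (\<psi> t * a q t)" by (simp add: mult_ac)
      qed
    next
      case False
      then have "(LBINT t:{0..T}. \<psi> t * (\<integral>x. b t x \<bullet> D q x \<partial>law (\<mu> t))) = 0"
        unfolding set_integrable_def set_lebesgue_integral_def by (rule not_integrable_integral_eq)
      also have "0 \<le> (LBINT t:{0..T}. 4 * C * real q * (\<psi> t * a q t))"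
        unfolding set_lebesgue_integral_def using nn' by (intro integral_nonneg_AE) (auto simp: indicator_def)
      finally show ?thesis .
    qed
    also have "\<dots> = 4 * C * real q * integral {0..T} (\<lambda>t. \<psi> t * a q t)"
      by (subst set_lborel_eq_integral[OF c]) simp
    finally show "- integral {0..T} (\<lambda>t. \<psi>' t * a q t) \<le> 4 * C * real q * integral {0..T} (\<lambda>t. \<psi> t * a q t)" .
  qed
  have a_init: "a q 0 \<le> ((1 + R0\<^sup>2) / A) ^ q" for q
  proof -
    interpret prob_space "law m0" by (rule law_prob1)
    have "a q 0 = (\<integral>x. \<phi> q x \<partial>law m0)" using weak by (simp add: a_def weak_solution_def)
    also have "\<dots> \<le> (\<integral>x. ((1 + R0\<^sup>2) / A) ^ q \<partial>law m0)"
    proof (rule integral_mono_AE)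
      show "AE x in law m0. \<phi> q x \<le> ((1 + R0\<^sup>2) / A) ^ q"
        using m0
      proof eventually_elim
        case (elim x)
        have "x \<bullet> x \<le> R0\<^sup>2" using elim power_mono[OF elim, of 2] by (simp add: power2_norm_eq_inner)
        then have "S x \<le> (1 + R0\<^sup>2) / A" using A by (simp add: S_def divide_right_mono)
        then have "S x ^ q \<le> ((1 + R0\<^sup>2) / A) ^ q" using S0[of x] by (intro power_mono) auto
        moreover have "\<phi> q x \<le> S x ^ q / 1" unfolding \<phi>_def using S0[of x] by (intro divide_left_mono) (auto simp: add_pos_pos)
        ultimately show ?case by simp
      qed
    qed (auto intro: int_\<phi>)
    finally show ?thesis by (simp add: prob_space)
  qed
  have "AE x in law (\<mu> t). norm x \<le> sqrt A" if t: "t \<in> {0..T}" for t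
  proof -
    interpret prob_space "law (\<mu> t)" by (rule law_prob1)
    note [measurable_cong] = law_prob1(2)[of "\<mu> t"]
    let ?E = "{x. 1 \<le> S x}"
    have [measurable]: "S \<in> borel_measurable borel" using contS by (rule borel_measurable_continuous_onI)
    have E: "?E \<in> sets borel" by measurable
    have bound: "prob ?E \<le> 2 * (1/2) ^ q" for q
    proof -
      have "prob ?E / 2 = (\<integral>x. indicator ?E x / 2 \<partial>law (\<mu> t))" using E by (simp add: law_prob1)
      also have "\<dots> \<le> a q t"
        unfolding a_def
      proof (rule integral_mono)
        show "integrable (law (\<mu> t)) (\<lambda>x. indicator ?E x / 2 :: real)"
          using E by (intro integrable_const_bound[where B = 1]) (auto simp: indicator_def)
        show "indicator ?E x / 2 \<le> \<phi> q x" for x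
        proof (cases "1 \<le> S x")
          case True
          have half: "1 / 2 \<le> y / (1 + y)" if "1 \<le> y" for y :: real using that by (simp add: field_simps)
          have "1 / 2 \<le> \<phi> q x" unfolding \<phi>_def by (rule half[OF one_le_power[OF True]])
          then show ?thesis using True by simp
        qed (use \<phi>01 in auto)
      qed (rule int_\<phi>)
      also have "\<dots> \<le> exp (4 * C * real q * t) * ((1 + R0\<^sup>2) / A) ^ q"
        by (rule order_trans[OF growth_a[OF t]]) (intro mult_left_mono a_init, simp)
      also have "\<dots> \<le> exp (4 * C * real q * T) * ((1 + R0\<^sup>2) / A) ^ q"
        using t C A by (intro mult_right_mono) (auto simp: mult_left_mono)
      also have "\<dots> = (exp (4 * C * T) * ((1 + R0\<^sup>2) / A)) ^ q"
        unfolding power_mult_distrib exp_of_nat_mult[symmetric] by (simp add: mult_ac)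
      also have "exp (4 * C * T) * ((1 + R0\<^sup>2) / A) = 1 / 2"
      proof -
        have "v * (u / (2 * u * v)) = 1 / 2" if "u > 0" "v > 0" for u v :: real using that by simp
        from this[of "1 + R0\<^sup>2" "exp (4 * C * T)"] show ?thesis unfolding A_def by (simp only: add_pos_nonneg zero_less_one zero_le_power2 exp_gt_zero)
      qed
      finally show ?thesis by simp
    qed
    have "(\<lambda>q. 2 * (1/2::real) ^ q) \<longlonglongrightarrow> 2 * 0" by (intro tendsto_intros LIMSEQ_realpow_zero) auto
    then have "prob ?E \<le> 2 * 0" by (rule LIMSEQ_le_const) (use bound in blast)
    then have "prob ?E = 0" using measure_nonneg[of "law (\<mu> t)" ?E] by linarith
    then have "AE x in law (\<mu> t). x \<notin> ?E" using E by (subst (asm) prob_eq_0) (auto simp: law_prob1)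
    then show ?thesis
    proof eventually_elim
      case (elim x)
      then have "(norm x)\<^sup>2 \<le> A" using A by (simp add: S_def field_simps power2_norm_eq_inner)
      then show ?case by (simp add: real_le_rsqrt)
    qed
  qed
  then show ?thesis using A by (intro that[of "sqrt A"]) auto
qed

text \<open>Inf-convolution: g is the largest L-Lipschitz function that lies below f on K.\<close>

lemma lipschitz_approximation:
  fixes f :: "'a::euclidean_space \<Rightarrow> real"
  assumes K: "compact K" and f: "continuous_on K f" and e: "e > 0"
  obtains g L where "L > 0" "L-lipschitz_on UNIV g" "\<And>x. x \<in> K \<Longrightarrow> \<bar>f x - g x\<bar> \<le> e"
proof (cases "K = {}")
  case True
  have "1-lipschitz_on UNIV (\<lambda>x::'a. 0 :: real)" by (rule lipschitz_onI) auto
  with True show ?thesis by (intro that[of 1 "\<lambda>x. 0"]) auto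
next
  case False
  obtain M where M: "\<And>x. x \<in> K \<Longrightarrow> \<bar>f x\<bar> \<le> M"
    using compact_imp_bounded[OF compact_continuous_image[OF f K]] unfolding bounded_iff by auto
  then have "M \<ge> 0" using False by fastforce
  obtain d where d: "d > 0" "\<And>x y. x \<in> K \<Longrightarrow> y \<in> K \<Longrightarrow> dist x y < d \<Longrightarrow> \<bar>f x - f y\<bar> < e"
    using compact_uniformly_continuous[OF f K] e unfolding uniformly_continuous_on_def dist_real_def by meson
  \<comment> \<open>For points at distance at least d the penalty L dist is at least 2M, the largest
    possible drop of f; between closer points f drops by less than e.\<close>
  define L where "L = 2 * M / d + 1"
  have L: "L > 0" using \<open>M \<ge> 0\<close> d(1) by (simp add: L_def add_nonneg_pos)
  have mod: "f x \<le> f y + L * dist x y + e" if "x \<in> K" "y \<in> K" for x y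
  proof (cases "dist x y < d")
    case True
    then have "f x - f y < e" using d(2)[OF that] by (simp add: abs_less_iff)
    moreover have "0 \<le> L * dist x y" using L by simp
    ultimately show ?thesis by linarith
  next
    case False
    have "2 * M = 2 * M / d * d" using d(1) by simp
    also have "\<dots> \<le> L * dist x y"
      using False d(1) L \<open>M \<ge> 0\<close> by (intro mult_mono) (auto simp: L_def)
    finally show ?thesis using M[OF that(1)] M[OF that(2)] e by (auto simp: abs_le_iff)
  qed
  define g where "g = (\<lambda>x. INF y\<in>K. f y + L * dist x y)"
  have bdd: "bdd_below ((\<lambda>y. f y + L * dist x y) ` K)" for x
  proof (rule bdd_belowI2)
    fix y assume "y \<in> K"
    then show "- M \<le> f y + L * dist x y" using M[of y] L by (auto simp: abs_le_iff intro: order_trans[of _ "f y"])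
  qed
  have le: "g x \<le> g x' + L * dist x x'" for x x'
  proof -
    have "g x - L * dist x x' \<le> g x'"
      unfolding g_def[THEN fun_cong, of x']
    proof (rule cINF_greatest[OF False])
      fix y assume y: "y \<in> K"
      have "g x \<le> f y + L * dist x y" unfolding g_def using bdd y by (rule cINF_lower)
      also have "\<dots> \<le> f y + L * (dist x x' + dist x' y)"
        using L by (intro add_left_mono mult_left_mono dist_triangle) auto
      finally show "g x - L * dist x x' \<le> f y + L * dist x' y" by (simp add: algebra_simps)
    qed
    then show ?thesis by simp
  qed
  have "L-lipschitz_on UNIV g"
  proof (rule lipschitz_onI)
    show "dist (g x) (g y) \<le> L * dist x y" for x y
      using le[of x y] le[of y x] by (simp add: dist_real_def abs_le_iff dist_commute algebra_simps)
  qed (use L in simp)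
  moreover have "\<bar>f x - g x\<bar> \<le> e" if x: "x \<in> K" for x
  proof -
    have "g x \<le> f x + L * dist x x" unfolding g_def using bdd x by (rule cINF_lower)
    moreover have "f x - e \<le> g x" unfolding g_def
      by (rule cINF_greatest[OF False]) (use mod[OF x] in \<open>force simp: algebra_simps\<close>)
    ultimately show ?thesis using e by simp
  qed
  ultimately show ?thesis using L by (intro that)
qed

lemma integrable_law_continuous:
  fixes h :: "'a::euclidean_space \<Rightarrow> real"
  assumes "continuous_on UNIV h" "AE x in law m. norm x \<le> R"
  shows "integrable (law m) h"
proof -
  interpret prob_space "law m" by (rule law_prob1)
  have "compact (h ` cball 0 R)"
    by (intro compact_continuous_image continuous_on_subset[OF assms(1)]) auto
  then obtain B where "\<forall>y\<in>h ` cball 0 R. norm y \<le> B"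
    using compact_imp_bounded[of "h ` cball 0 R"] unfolding bounded_iff by blast
  then have B: "norm (h x) \<le> B" if "norm x \<le> R" for x using that by simp
  have "h \<in> borel_measurable (law m)"
    using borel_measurable_continuous_onI[OF assms(1)] measurable_cong_sets[OF law_prob1(2)[of m] refl] by blast
  then show ?thesis
    using assms(2) B by (intro integrable_const_bound[where B = B]) auto
qed

text \<open>The distance of measures controls integrals of Lipschitz functions, so a(t, .) is
  replaced by a Lipschitz approximation on the ball carrying the laws. The change of a in time is
  uniform on that ball.\<close>

lemma continuous_on_integral_law:
  fixes a :: "real \<Rightarrow> 'a::euclidean_space \<Rightarrow> real"
  assumes a: "continuous_on ({0..T} \<times> UNIV) (\<lambda>(t, x). a t x)" and \<mu>: "continuous_on {0..T} \<mu>"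
    and supp: "\<And>t. t \<in> {0..T} \<Longrightarrow> AE x in law (\<mu> t). norm x \<le> R"
  shows "continuous_on {0..T} (\<lambda>t. \<integral>x. a t x \<partial>law (\<mu> t))"
  unfolding continuous_on_iff
proof (intro ballI allI impI)
  fix t \<epsilon> :: real assume t: "t \<in> {0..T}" and "\<epsilon> > 0"
  define e where "e = \<epsilon> / 5"
  have e: "e > 0" "\<epsilon> = 5 * e" using \<open>\<epsilon> > 0\<close> by (auto simp: e_def)
  have sect: "continuous_on UNIV (a s)" if "s \<in> {0..T}" for s
  proof -
    have "continuous_on UNIV (\<lambda>x :: 'a. (s, x))" by (intro continuous_intros)
    from continuous_on_compose2[OF a this] that show ?thesis by (simp add: image_subset_iff)
  qed
  have int: "integrable (law (\<mu> r)) (a s)" if "s \<in> {0..T}" "r \<in> {0..T}" for s r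
    using sect[OF that(1)] supp[OF that(2)] by (rule integrable_law_continuous)
  obtain g L where g: "L > 0" "L-lipschitz_on UNIV g" "\<And>x. x \<in> cball 0 R \<Longrightarrow> \<bar>a t x - g x\<bar> \<le> e"
    using lipschitz_approximation[OF compact_cball continuous_on_subset[OF sect[OF t] subset_UNIV] e(1)] by metis
  have close: "\<bar>(\<integral>x. h x \<partial>law (\<mu> s)) - (\<integral>x. k x \<partial>law (\<mu> s))\<bar> \<le> e"
    if "s \<in> {0..T}" "\<And>x. x \<in> cball 0 R \<Longrightarrow> \<bar>h x - k x\<bar> \<le> e" "integrable (law (\<mu> s)) h" "integrable (law (\<mu> s)) k"
    for h k :: "'a \<Rightarrow> real" and s
  proof -
    interpret prob_space "law (\<mu> s)" by (rule law_prob1)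
    have "\<bar>(\<integral>x. h x \<partial>law (\<mu> s)) - (\<integral>x. k x \<partial>law (\<mu> s))\<bar> = \<bar>\<integral>x. h x - k x \<partial>law (\<mu> s)\<bar>"
      using that by simp
    also have "\<dots> \<le> (\<integral>x. \<bar>h x - k x\<bar> \<partial>law (\<mu> s))" by (rule integral_abs_bound)
    also have "\<dots> \<le> (\<integral>x. e \<partial>law (\<mu> s))"
      by (rule integral_mono_AE) (use that supp[OF that(1)] in auto)
    finally show ?thesis by (simp add: prob_space)
  qed
  have "compact ({0..T} \<times> cball (0::'a) R)" by (intro compact_Times) auto
  then have "uniformly_continuous_on ({0..T} \<times> cball (0::'a) R) (\<lambda>(t, x). a t x)"
    by (intro compact_uniformly_continuous continuous_on_subset[OF a]) auto
  then obtain d1 where d1: "d1 > 0" "\<And>p q. p \<in> {0..T} \<times> cball 0 R \<Longrightarrow> q \<in> {0..T} \<times> cball 0 R \<Longrightarrow> dist q p < d1 \<Longrightarrow>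
      dist (case q of (t, x) \<Rightarrow> a t x) (case p of (t, x) \<Rightarrow> a t x) < e"
    using e(1) unfolding uniformly_continuous_on_def by blast
  obtain d2 where d2: "d2 > 0" "\<And>s. s \<in> {0..T} \<Longrightarrow> dist s t < d2 \<Longrightarrow>
      dist (\<integral>x. g x \<partial>law (\<mu> s)) (\<integral>x. g x \<partial>law (\<mu> t)) < e"
    using continuous_on_integral_lipschitz[OF g(2,1) \<mu>] t e(1) unfolding continuous_on_iff by blast
  show "\<exists>d>0. \<forall>s\<in>{0..T}. dist s t < d \<longrightarrow> dist (\<integral>x. a s x \<partial>law (\<mu> s)) (\<integral>x. a t x \<partial>law (\<mu> t)) < \<epsilon>"
  proof (intro exI[of _ "min d1 d2"] conjI ballI impI)
    fix s assume s: "s \<in> {0..T}" "dist s t < min d1 d2"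
    have "\<bar>(\<integral>x. a s x \<partial>law (\<mu> s)) - (\<integral>x. a t x \<partial>law (\<mu> s))\<bar> \<le> e"
    proof (rule close[OF s(1)])
      fix x :: 'a assume "x \<in> cball 0 R"
      then show "\<bar>a s x - a t x\<bar> \<le> e"
        using d1(2)[of "(t, x)" "(s, x)"] s t by (simp add: dist_Pair_Pair dist_real_def)
    qed (use int s t in auto)
    moreover have "\<bar>(\<integral>x. a t x \<partial>law (\<mu> s)) - (\<integral>x. g x \<partial>law (\<mu> s))\<bar> \<le> e"
      using close[OF s(1) g(3) int[OF t s(1)] law_lipschitz(1)[OF g(2)]] .
    moreover have "\<bar>(\<integral>x. a t x \<partial>law (\<mu> t)) - (\<integral>x. g x \<partial>law (\<mu> t))\<bar> \<le> e"
      using close[OF t g(3) int[OF t t] law_lipschitz(1)[OF g(2)]] .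
    moreover have "\<bar>(\<integral>x. g x \<partial>law (\<mu> s)) - (\<integral>x. g x \<partial>law (\<mu> t))\<bar> < e"
      using d2(2)[OF s(1)] s(2) by (simp add: dist_real_def)
    ultimately show "dist (\<integral>x. a s x \<partial>law (\<mu> s)) (\<integral>x. a t x \<partial>law (\<mu> t)) < \<epsilon>"
      unfolding dist_real_def e(2) by (simp add: abs_le_iff abs_less_iff)
  qed (use d1 d2 in auto)
qed

text \<open>The test function \<open>\<psi>\<close> vanishing at the end points whose derivative is \<open>B\<close> minus its mean shows
  that \<open>B\<close> coincides with its mean.\<close>

lemma weak_derivative_imp_integral:
  fixes A \<beta> :: "real \<Rightarrow> real"
  assumes T: "T > 0" and A: "continuous_on {0..T} A" and \<beta>: "continuous_on {0..T} \<beta>"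
    and weak: "\<And>\<psi> \<psi>'. (\<And>t. t \<in> {0..T} \<Longrightarrow> (\<psi> has_real_derivative \<psi>' t) (at t within {0..T})) \<Longrightarrow>
      continuous_on {0..T} \<psi>' \<Longrightarrow> \<psi> 0 = 0 \<Longrightarrow> \<psi> T = 0 \<Longrightarrow>
      - integral {0..T} (\<lambda>t. \<psi>' t * A t) = integral {0..T} (\<lambda>t. \<psi> t * \<beta> t)"
    and st: "0 \<le> s" "s \<le> t" "t \<le> T"
  shows "A t - A s = integral {s..t} \<beta>"
proof -
  define J where "J = (\<lambda>t. integral {0..t} \<beta>)"
  have dJ: "(J has_real_derivative \<beta> t) (at t within {0..T})" if "t \<in> {0..T}" for t
    unfolding J_def by (rule integral_has_real_derivative[OF \<beta> that])
  have cJ: "continuous_on {0..T} J" using dJ by (rule DERIV_continuous_on)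
  define B where "B = (\<lambda>t. A t - J t)"
  have cB: "continuous_on {0..T} B" unfolding B_def by (intro continuous_intros A cJ)
  define m where "m = integral {0..T} B / T"
  define \<psi>' where "\<psi>' = (\<lambda>t. B t - m)"
  have c\<psi>': "continuous_on {0..T} \<psi>'" unfolding \<psi>'_def by (intro continuous_intros cB)
  define \<psi> where "\<psi> = (\<lambda>t. integral {0..t} \<psi>')"
  have d\<psi>: "(\<psi> has_real_derivative \<psi>' t) (at t within {0..T})" if "t \<in> {0..T}" for t
    unfolding \<psi>_def by (rule integral_has_real_derivative[OF c\<psi>' that])
  have c\<psi>: "continuous_on {0..T} \<psi>" using d\<psi> by (rule DERIV_continuous_on)
  have \<psi>0: "\<psi> 0 = 0" by (simp add: \<psi>_def)
  have int: "h integrable_on {0..T}" if "continuous_on {0..T} h" for h :: "real \<Rightarrow> real"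
    using that by (rule integrable_continuous_real)
  have \<psi>T: "\<psi> T = 0"
    using T unfolding \<psi>_def \<psi>'_def
    by (simp add: Henstock_Kurzweil_Integration.integral_diff[OF int[OF cB] integrable_const_ivl] m_def)
  \<comment> \<open>Integration by parts writes the right-hand side of the weak equation as a test
    of the antiderivative \<open>J\<close>; with the weak equation, \<open>B\<close> has weak
    derivative 0.\<close>
  have parts: "integral {0..T} (\<lambda>t. \<psi>' t * J t) + integral {0..T} (\<lambda>t. \<psi> t * \<beta> t) = 0"
  proof -
    have "((\<lambda>t. \<psi>' t * J t + \<psi> t * \<beta> t) has_integral \<psi> T * J T - \<psi> 0 * J 0) {0..T}"
    proof (rule fundamental_theorem_of_calculus)
      fix t assume t: "t \<in> {0..T}"
      from DERIV_mult[OF d\<psi>[OF t] dJ[OF t]]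
      show "((\<lambda>t. \<psi> t * J t) has_vector_derivative \<psi>' t * J t + \<psi> t * \<beta> t) (at t within {0..T})"
        by (simp add: has_real_derivative_iff_has_vector_derivative[symmetric] mult.commute add.commute)
    qed (use T in simp)
    then have "integral {0..T} (\<lambda>t. \<psi>' t * J t + \<psi> t * \<beta> t) = 0" using \<psi>0 \<psi>T by (simp add: integral_unique)
    then show ?thesis
      by (subst (asm) Henstock_Kurzweil_Integration.integral_add) (auto intro!: int continuous_intros c\<psi>' cJ c\<psi> \<beta>)
  qed
  have "integral {0..T} (\<lambda>t. \<psi>' t * \<psi>' t) = integral {0..T} (\<lambda>t. \<psi>' t * A t - \<psi>' t * J t - m * \<psi>' t)"
    by (rule arg_cong[where f = "integral _"]) (simp add: fun_eq_iff \<psi>'_def B_def algebra_simps)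
  also have "\<dots> = integral {0..T} (\<lambda>t. \<psi>' t * A t) - integral {0..T} (\<lambda>t. \<psi>' t * J t) - m * integral {0..T} \<psi>'"
    by (subst Henstock_Kurzweil_Integration.integral_diff Henstock_Kurzweil_Integration.integral_mult_right;
        (intro int continuous_intros c\<psi>' cJ A)?)+ (rule refl)
  also have "\<dots> = 0" using weak[OF d\<psi> c\<psi>' \<psi>0 \<psi>T] parts \<psi>T by (simp add: \<psi>_def)
  finally have "integral (cbox 0 T) (\<lambda>t. \<psi>' t * \<psi>' t) = 0" by simp
  then have "\<psi>' t * \<psi>' t = 0" if "t \<in> {0..T}" for t
  proof -
    have "continuous_on (cbox 0 T) (\<lambda>t. \<psi>' t * \<psi>' t)" using c\<psi>' by (simp add: continuous_on_mult)
    from integral_cbox_eq_0_iff[OF this] \<open>integral (cbox 0 T) (\<lambda>t. \<psi>' t * \<psi>' t) = 0\<close> T that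
    show ?thesis by simp
  qed
  then have "B t = m" if "t \<in> {0..T}" for t using that by (simp add: \<psi>'_def)
  then have "B t = B s" using st by simp
  then have "A t - A s = J t - J s" by (simp add: B_def)
  also have "\<dots> = integral {s..t} \<beta>"
    using Henstock_Kurzweil_Integration.integral_combine[of 0 s t \<beta>] st
      integrable_continuous_real[OF continuous_on_subset[OF \<beta>, of "{0..t}"]] by (simp add: J_def)
  finally show ?thesis .
qed

text \<open>As every \<mu>[t] is carried by one ball, a C^1 cut-off equal to 1 there turns an
  arbitrary C^1 function into an admissible test function without changing any of the
  integrals.\<close>

lemma weak_solution_integral:
  fixes b :: "real \<Rightarrow> 'a::euclidean_space \<Rightarrow> 'a"
  assumes weak: "weak_solution T b m0 \<mu>" and T: "T > 0" and \<mu>: "continuous_on {0..T} \<mu>"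
    and b: "continuous_on ({0..T} \<times> UNIV) (\<lambda>(t, x). b t x)"
    and supp: "\<And>t. t \<in> {0..T} \<Longrightarrow> AE x in law (\<mu> t). norm x \<le> R"
    and \<phi>: "\<And>x. GDERIV \<phi> x :> D x" and D: "continuous_on UNIV D"
    and st: "0 \<le> s" "s \<le> t" "t \<le> T"
  shows "(\<integral>x. \<phi> x \<partial>law (\<mu> t)) - (\<integral>x. \<phi> x \<partial>law (\<mu> s)) = integral {s..t} (\<lambda>r. \<integral>x. b r x \<bullet> D x \<partial>law (\<mu> r))"
proof -
  define q where "q = (\<lambda>s :: real. (max 0 s)\<^sup>2)"
  define q' where "q' = (\<lambda>s :: real. 2 * max 0 s)"
  have dq: "(q has_real_derivative q' s) (at s)" for s
    unfolding q_def q'_def by (rule has_field_derivative_max0_sq)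
  have cq: "continuous_on S q" "continuous_on S q'" for S unfolding q_def q'_def by (intro continuous_intros)+
  \<comment> \<open>Equal to 1 for |x| <= R, and to 0 once |x|^2 >= R^2 + 1.\<close>
  define \<theta> where "\<theta> = (\<lambda>x :: 'a. q (1 - q (x \<bullet> x - R\<^sup>2)))"
  define \<theta>' where "\<theta>' = (\<lambda>x :: 'a. (- q' (1 - q (x \<bullet> x - R\<^sup>2)) * q' (x \<bullet> x - R\<^sup>2) * 2) *\<^sub>R x)"
  have d\<theta>: "(\<theta> has_derivative (\<lambda>h. h \<bullet> \<theta>' x)) (at x)" for x
  proof -
    have "((\<lambda>s. q (1 - q (s - R\<^sup>2))) has_real_derivative - q' (1 - q (x \<bullet> x - R\<^sup>2)) * q' (x \<bullet> x - R\<^sup>2)) (at (x \<bullet> x))"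
    proof -
      have "((\<lambda>s. q (s - R\<^sup>2)) has_real_derivative q' (x \<bullet> x - R\<^sup>2)) (at (x \<bullet> x))"
        using DERIV_shift[of q "q' (x \<bullet> x - R\<^sup>2)" "x \<bullet> x" "- R\<^sup>2"] dq[of "x \<bullet> x - R\<^sup>2"] by simp
      from DERIV_chain'[OF DERIV_diff[OF DERIV_const this] dq, of 1] show ?thesis by (simp add: mult.commute)
    qed
    moreover have "((\<lambda>x. x \<bullet> x) has_derivative (\<lambda>h. 2 * (h \<bullet> x))) (at x)"
      by (auto intro!: derivative_eq_intros simp: inner_commute)
    ultimately have "(\<theta> has_derivative (\<lambda>h. 2 * (h \<bullet> x) * (- q' (1 - q (x \<bullet> x - R\<^sup>2)) * q' (x \<bullet> x - R\<^sup>2)))) (at x)"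
      unfolding \<theta>_def by (rule DERIV_compose_FDERIV)
    then show ?thesis by (simp add: \<theta>'_def mult_ac)
  qed
  have c\<theta>: "continuous_on UNIV \<theta>"
    unfolding \<theta>_def by (intro continuous_on_compose2[OF cq(1)[of UNIV]] continuous_intros) auto
  have c\<theta>': "continuous_on UNIV \<theta>'"
    unfolding \<theta>'_def
    by (intro continuous_intros continuous_on_compose2[OF cq(1)[of UNIV]] continuous_on_compose2[OF cq(2)[of UNIV]]) auto
  have one: "\<theta> x = 1" "\<theta>' x = 0" if "norm x \<le> R" for x
  proof -
    have "(norm x)\<^sup>2 \<le> R\<^sup>2" using that by (intro power_mono) auto
    then have "x \<bullet> x - R\<^sup>2 \<le> 0" by (simp add: power2_norm_eq_inner)
    then show "\<theta> x = 1" "\<theta>' x = 0" by (auto simp: \<theta>_def \<theta>'_def q_def q'_def max_def)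
  qed
  \<comment> \<open>This radius works because (|R| + 1)^2 >= R^2 + 1.\<close>
  let ?K = "cball (0::'a) (\<bar>R\<bar> + 1)"
  have zero: "\<theta> x = 0" "\<theta>' x = 0" if "x \<notin> ?K" for x
  proof -
    have "(\<bar>R\<bar> + 1)\<^sup>2 \<le> (norm x)\<^sup>2" using that by (intro power_mono) auto
    then have "x \<bullet> x - R\<^sup>2 \<ge> 1" by (simp add: power2_norm_eq_inner power2_sum)
    then have "1 \<le> q (x \<bullet> x - R\<^sup>2)" using power_mono[of 1 "x \<bullet> x - R\<^sup>2" 2] by (simp add: q_def)
    moreover have "q s = 0" "q' s = 0" if "s \<le> 0" for s using that by (auto simp: q_def q'_def)
    ultimately show "\<theta> x = 0" "\<theta>' x = 0" by (auto simp: \<theta>_def \<theta>'_def)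
  qed
  define \<phi>1 where "\<phi>1 = (\<lambda>x. \<phi> x * \<theta> x)"
  define D1 where "D1 = (\<lambda>x. \<theta> x *\<^sub>R D x + \<phi> x *\<^sub>R \<theta>' x)"
  have c\<phi>: "continuous_on UNIV \<phi>"
    using \<phi> unfolding gderiv_def by (intro has_derivative_continuous_on) auto
  have d1: "GDERIV \<phi>1 x :> D1 x" for x
    unfolding gderiv_def \<phi>1_def
    by (rule has_derivative_eq_rhs[OF has_derivative_mult[OF \<phi>[unfolded gderiv_def] d\<theta>]])
       (simp add: D1_def inner_add_right algebra_simps)
  have cD1: "continuous_on UNIV D1" unfolding D1_def by (intro continuous_intros c\<theta> c\<theta>' D c\<phi>)
  have "compact (\<phi>1 ` ?K)"
    unfolding \<phi>1_def by (intro compact_continuous_image continuous_intros continuous_on_subset[OF c\<phi>] continuous_on_subset[OF c\<theta>]) auto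
  then have "bounded (insert 0 (\<phi>1 ` ?K))" by (intro bounded_insert[THEN iffD2] compact_imp_bounded)
  moreover have "\<phi>1 x \<in> insert 0 (\<phi>1 ` ?K)" for x
    by (cases "x \<in> ?K") (use zero(1)[of x] in \<open>simp_all add: \<phi>1_def\<close>)
  then have "range \<phi>1 \<subseteq> insert 0 (\<phi>1 ` ?K)" by blast
  ultimately have bd\<phi>: "bounded (range \<phi>1)" by (rule bounded_subset)
  have "compact (D1 ` ?K)" by (intro compact_continuous_image continuous_on_subset[OF cD1]) auto
  then obtain B where "B > 0" "\<forall>y\<in>D1 ` ?K. norm y \<le> B"
    using compact_imp_bounded[of "D1 ` ?K"] unfolding bounded_pos by blast
  then have B: "B > 0" "\<And>x. x \<in> ?K \<Longrightarrow> norm (D1 x) \<le> B" by blast+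
  have bdD: "norm (D1 x) \<le> B" for x
    using B zero[of x] by (cases "x \<in> ?K") (auto simp: D1_def)
  have eq: "(\<integral>x. \<phi> x \<partial>law (\<mu> t)) = (\<integral>x. \<phi>1 x \<partial>law (\<mu> t))"
    and eqD: "(\<integral>x. b t x \<bullet> D x \<partial>law (\<mu> t)) = (\<integral>x. b t x \<bullet> D1 x \<partial>law (\<mu> t))" if t: "t \<in> {0..T}" for t
  proof -
    have cb: "continuous_on UNIV (b t)"
    proof -
      have "continuous_on UNIV (\<lambda>x :: 'a. (t, x))" by (intro continuous_intros)
      from continuous_on_compose2[OF b this] t show ?thesis by (simp add: image_subset_iff)
    qed
    have m: "h \<in> borel_measurable (law (\<mu> t))" if "continuous_on UNIV h" for h :: "'a \<Rightarrow> real"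
      using borel_measurable_continuous_onI[OF that] measurable_cong_sets[OF law_prob1(2)[of "\<mu> t"] refl] by blast
    show "(\<integral>x. \<phi> x \<partial>law (\<mu> t)) = (\<integral>x. \<phi>1 x \<partial>law (\<mu> t))"
      using supp[OF t] by (intro integral_cong_AE m) (auto simp: \<phi>1_def one intro!: continuous_intros c\<phi> c\<theta>)
    show "(\<integral>x. b t x \<bullet> D x \<partial>law (\<mu> t)) = (\<integral>x. b t x \<bullet> D1 x \<partial>law (\<mu> t))"
      using supp[OF t] by (intro integral_cong_AE m) (auto simp: D1_def one intro!: continuous_intros cb D c\<phi> c\<theta> c\<theta>')
  qed
  have cA: "continuous_on {0..T} (\<lambda>t. \<integral>x. \<phi>1 x \<partial>law (\<mu> t))"
  proof -
    obtain L where "L > 0" "L-lipschitz_on UNIV \<phi>1" using GDERIV_Cb1(2)[OF d1 cD1 bd\<phi> bdD] by blast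
    then show ?thesis using \<mu> by (intro continuous_on_integral_lipschitz)
  qed
  have "continuous_on ({0..T} \<times> UNIV) (\<lambda>(t, x). b t x \<bullet> D1 x)"
    using b unfolding case_prod_unfold by (intro continuous_intros continuous_on_compose2[OF cD1]) auto
  then have c\<beta>: "continuous_on {0..T} (\<lambda>t. \<integral>x. b t x \<bullet> D1 x \<partial>law (\<mu> t))"
    using \<mu> supp by (rule continuous_on_integral_law)
  have "(\<integral>x. \<phi>1 x \<partial>law (\<mu> t)) - (\<integral>x. \<phi>1 x \<partial>law (\<mu> s)) = integral {s..t} (\<lambda>r. \<integral>x. b r x \<bullet> D1 x \<partial>law (\<mu> r))"
  proof (rule weak_derivative_imp_integral[OF T cA c\<beta> _ st])
    fix \<psi> \<psi>' :: "real \<Rightarrow> real"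
    assume \<psi>: "\<And>t. t \<in> {0..T} \<Longrightarrow> (\<psi> has_real_derivative \<psi>' t) (at t within {0..T})"
      "continuous_on {0..T} \<psi>'" "\<psi> 0 = 0" "\<psi> T = 0"
    have "continuous_on {0..T} (\<lambda>t. \<psi> t * (\<integral>x. b t x \<bullet> D1 x \<partial>law (\<mu> t)))"
      by (intro continuous_intros c\<beta> DERIV_continuous_on[OF \<psi>(1)])
    from set_lborel_eq_integral[OF this] weak_solution_test[OF weak T \<mu> d1 cD1 bd\<phi> bdD \<psi>]
    show "- integral {0..T} (\<lambda>t. \<psi>' t * (\<integral>x. \<phi>1 x \<partial>law (\<mu> t))) = integral {0..T} (\<lambda>t. \<psi> t * (\<integral>x. b t x \<bullet> D1 x \<partial>law (\<mu> t)))"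
      by simp
  qed
  also have "\<dots> = integral {s..t} (\<lambda>r. \<integral>x. b r x \<bullet> D x \<partial>law (\<mu> r))"
    using st by (intro integral_cong) (simp add: eqD)
  finally show ?thesis using st by (simp add: eq)
qed

section \<open>Markov chains with prescribed one-time laws\<close>

lemma pmf_embed_finite:
  assumes "finite A" "\<And>x. 0 \<le> p x" "\<And>x. x \<notin> A \<Longrightarrow> p x = 0" "sum p A = 1"
  shows "pmf (embed_pmf p) x = p x"
proof (rule pmf_embed_pmf)
  have "(\<integral>\<^sup>+x. ennreal (p x) \<partial>count_space UNIV) = (\<Sum>x\<in>A. ennreal (p x))"
    by (rule nn_integral_count_space') (use assms in auto)
  also have "\<dots> = 1" using assms(2,4) by (simp add: sum_ennreal)
  finally show "(\<integral>\<^sup>+x. ennreal (p x) \<partial>count_space UNIV) = 1" .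
qed (rule assms)

text \<open>The kernel with the jump rates \<open>J i m / P i\<close>; states of probability zero stay put.\<close>

lemma jump_kernel:
  fixes P P' :: "'s pmf" and J :: "'s \<Rightarrow> 'm::finite \<Rightarrow> real" and mv :: "'s \<Rightarrow> 'm \<Rightarrow> 's"
  assumes I: "finite I" "set_pmf P \<subseteq> I"
    and J: "\<And>i m. 0 \<le> J i m" "\<And>i. (\<Sum>m\<in>UNIV. J i m) \<le> pmf P i"
    and bal: "\<And>j. pmf P' j = pmf P j - (\<Sum>m\<in>UNIV. J j m) + (\<Sum>m\<in>UNIV. \<Sum>i\<in>I. J i m * of_bool (mv i m = j))"
  obtains K where "\<And>i. finite (set_pmf (K i))" "bind_pmf P K = P'"
    "\<And>i (F :: 's \<Rightarrow> 'b::euclidean_space). pmf P i *\<^sub>R (\<integral>j. F j \<partial>measure_pmf (K i)) =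
        pmf P i *\<^sub>R F i + (\<Sum>m\<in>UNIV. J i m *\<^sub>R (F (mv i m) - F i))"
    "\<And>i (F :: 's \<Rightarrow> real). pmf P i * (\<integral>j. F j \<partial>measure_pmf (K i)) =
        pmf P i * F i + (\<Sum>m\<in>UNIV. J i m * (F (mv i m) - F i))"
proof -
  \<comment> \<open>\<open>None\<close> stands for staying; division by a zero probability gives 0
    and leaves all the weight there.\<close>
  define r where "r = (\<lambda>i a. case a of None \<Rightarrow> 1 - (\<Sum>m\<in>UNIV. J i m / pmf P i) | Some m \<Rightarrow> J i m / pmf P i)"
  have sum_r: "sum (g :: 'm option \<Rightarrow> 'c::comm_monoid_add) UNIV = g None + (\<Sum>m\<in>UNIV. g (Some m))" for g
    by (simp add: UNIV_option_conv sum.reindex)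
  have J0: "J i m = 0" if "pmf P i = 0" for i m
  proof -
    have "J i m \<le> (\<Sum>m\<in>UNIV. J i m)" by (intro member_le_sum J) auto
    with J(2)[of i] J(1)[of i m] that show ?thesis by simp
  qed
  have le1: "(\<Sum>m\<in>UNIV. J i m / pmf P i) \<le> 1" for i
    using J(2)[of i] pmf_nonneg[of P i] by (cases "pmf P i = 0") (simp_all add: divide_le_eq_1 flip: sum_divide_distrib)
  have r: "pmf (embed_pmf (r i)) a = r i a" for i a
  proof (rule pmf_embed_finite[of UNIV])
    show "0 \<le> r i a" for a using le1[of i] J(1) by (auto simp: r_def split: option.split)
    show "sum (r i) UNIV = 1" unfolding sum_r by (simp add: r_def)
  qed auto
  define K where "K = (\<lambda>i. map_pmf (\<lambda>a. case a of None \<Rightarrow> i | Some m \<Rightarrow> mv i m) (embed_pmf (r i)))"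
  have int: "pmf P i *\<^sub>R (\<integral>j. F j \<partial>measure_pmf (K i)) = pmf P i *\<^sub>R F i + (\<Sum>m\<in>UNIV. J i m *\<^sub>R (F (mv i m) - F i))"
    for i and F :: "'s \<Rightarrow> 'c::euclidean_space"
  proof -
    have "(\<integral>j. F j \<partial>measure_pmf (K i)) = (\<Sum>a\<in>UNIV. r i a *\<^sub>R F (case a of None \<Rightarrow> i | Some m \<Rightarrow> mv i m))"
      unfolding K_def integral_map_pmf by (subst integral_measure_pmf[of UNIV]) (auto simp: r)
    also have "\<dots> = F i + (\<Sum>m\<in>UNIV. (J i m / pmf P i) *\<^sub>R (F (mv i m) - F i))"
      unfolding sum_r by (simp add: r_def scaleR_diff_left scaleR_diff_right sum_subtractf scaleR_sum_left)
    finally have "pmf P i *\<^sub>R (\<integral>j. F j \<partial>measure_pmf (K i)) =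
        pmf P i *\<^sub>R F i + (\<Sum>m\<in>UNIV. (pmf P i * (J i m / pmf P i)) *\<^sub>R (F (mv i m) - F i))"
      by (simp add: scaleR_add_right scaleR_sum_right)
    also have "(\<Sum>m\<in>UNIV. (pmf P i * (J i m / pmf P i)) *\<^sub>R (F (mv i m) - F i)) = (\<Sum>m\<in>UNIV. J i m *\<^sub>R (F (mv i m) - F i))"
      using J0[of i] by (intro sum.cong) auto
    finally show ?thesis .
  qed
  show ?thesis
  proof (rule that[of K])
    show "finite (set_pmf (K i))" for i by (simp add: K_def)
    show "pmf P i *\<^sub>R (\<integral>j. F j \<partial>measure_pmf (K i)) = pmf P i *\<^sub>R F i + (\<Sum>m\<in>UNIV. J i m *\<^sub>R (F (mv i m) - F i))"
      for i and F :: "'s \<Rightarrow> 'b" by (rule int)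
    show "pmf P i * (\<integral>j. F j \<partial>measure_pmf (K i)) = pmf P i * F i + (\<Sum>m\<in>UNIV. J i m * (F (mv i m) - F i))"
      for i and F :: "'s \<Rightarrow> real" using int[of i F] by simp
    show "bind_pmf P K = P'"
    proof (rule pmf_eqI)
      fix j
      have out: "pmf P i = 0" if "i \<notin> I" for i using that I(2) by (auto simp: pmf_eq_0_set_pmf)
      have "pmf (bind_pmf P K) j = (\<Sum>i\<in>I. pmf (K i) j * pmf P i)"
        unfolding pmf_bind using I by (intro integral_measure_pmf_real) auto
      also have "\<dots> = (\<Sum>i\<in>I. pmf P i * of_bool (i = j) + (\<Sum>m\<in>UNIV. J i m * (of_bool (mv i m = j) - of_bool (i = j))))"
      proof (intro sum.cong refl)
        fix i
        have "pmf (K i) j = (\<integral>k. of_bool (k = j) \<partial>measure_pmf (K i))"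
        proof -
          have "(\<lambda>k. of_bool (k = j) :: real) = indicator {j}" by (auto simp: indicator_def fun_eq_iff)
          then show ?thesis by (simp add: pmf.rep_eq)
        qed
        then show "pmf (K i) j * pmf P i = pmf P i * of_bool (i = j) + (\<Sum>m\<in>UNIV. J i m * (of_bool (mv i m = j) - of_bool (i = j)))"
          using int[of i "\<lambda>k. of_bool (k = j) :: real"] by (simp add: mult.commute)
      qed
      also have "\<dots> = (\<Sum>i\<in>I. pmf P i * of_bool (i = j)) + (\<Sum>i\<in>I. \<Sum>m\<in>UNIV. J i m * of_bool (mv i m = j))
          - (\<Sum>i\<in>I. \<Sum>m\<in>UNIV. J i m * of_bool (i = j))"
        by (simp add: sum.distrib sum_subtractf right_diff_distrib)
      also have "(\<Sum>i\<in>I. pmf P i * of_bool (i = j)) = pmf P j"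
        using I(1) out[of j] by (simp add: sum.delta' if_distrib of_bool_def cong: if_cong)
      also have "(\<Sum>i\<in>I. \<Sum>m\<in>UNIV. J i m * of_bool (i = j)) = (\<Sum>m\<in>UNIV. J j m)"
      proof -
        have "(\<Sum>i\<in>I. \<Sum>m\<in>UNIV. J i m * of_bool (i = j)) = (\<Sum>i\<in>I. if i = j then \<Sum>m\<in>UNIV. J j m else 0)"
          by (intro sum.cong) auto
        then show ?thesis using I(1) J0[OF out[of j]] by (simp add: sum.delta')
      qed
      also have "(\<Sum>i\<in>I. \<Sum>m\<in>UNIV. J i m * of_bool (mv i m = j)) = (\<Sum>m\<in>UNIV. \<Sum>i\<in>I. J i m * of_bool (mv i m = j))"
        by (rule sum.swap)
      finally show "pmf (bind_pmf P K) j = pmf P' j" using bal[of j] by simp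
    qed
  qed
qed

text \<open>The Markov property is stated for functions that see the past up to k and the next
  state: the next state may be averaged with the kernel. This is the form that the recursion for
  second moments needs.\<close>

lemma markov_chain:
  fixes P :: "nat \<Rightarrow> 's pmf" and K :: "nat \<Rightarrow> 's \<Rightarrow> 's pmf"
  assumes bind: "\<And>k. k < M \<Longrightarrow> bind_pmf (P k) (K k) = P (Suc k)"
    and fin: "finite (set_pmf (P 0))" "\<And>k i. finite (set_pmf (K k i))"
  obtains Q :: "(nat \<Rightarrow> 's) pmf" where "finite (set_pmf Q)" "\<And>k. k \<le> M \<Longrightarrow> map_pmf (\<lambda>\<omega>. \<omega> k) Q = P k"
    "\<And>k F. k < M \<Longrightarrow> (\<And>\<omega> \<omega>'. (\<And>l. l \<le> k \<Longrightarrow> \<omega> l = \<omega>' l) \<Longrightarrow> F \<omega> = F \<omega>') \<Longrightarrow>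
      (\<integral>\<omega>. F \<omega> (\<omega> (Suc k)) \<partial>measure_pmf Q) = (\<integral>\<omega>. (\<integral>j. (F \<omega> j :: real) \<partial>measure_pmf (K k (\<omega> k))) \<partial>measure_pmf Q)"
proof -
  \<comment> \<open>Paths start constant and the passage from k to k + 1 overwrites one coordinate;
    so finitely many paths carry each law, and later steps do not touch earlier coordinates.\<close>
  define Q where "Q = rec_nat (map_pmf (\<lambda>i _. i) (P 0))
    (\<lambda>k Qk. bind_pmf Qk (\<lambda>\<omega>. map_pmf (\<lambda>j. fun_upd \<omega> (Suc k) j) (K k (\<omega> k))))"
  have Q0: "Q 0 = map_pmf (\<lambda>i _. i) (P 0)" by (simp add: Q_def)
  have QS: "Q (Suc k) = bind_pmf (Q k) (\<lambda>\<omega>. map_pmf (\<lambda>j. fun_upd \<omega> (Suc k) j) (K k (\<omega> k)))" for k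
    by (simp add: Q_def)
  have finQ: "finite (set_pmf (Q k))" for k
    by (induction k) (auto simp: Q0 QS fin)
  have past: "map_pmf G (Q m) = map_pmf G (Q k)" if "k \<le> m" "\<And>\<omega> \<omega>'. (\<And>l. l \<le> k \<Longrightarrow> \<omega> l = \<omega>' l) \<Longrightarrow> G \<omega> = G \<omega>'"
    for G :: "(nat \<Rightarrow> 's) \<Rightarrow> 'x" and k m
    using that(1)
  proof (induction m rule: dec_induct)
    case (step m)
    have "map_pmf G (Q (Suc m)) = bind_pmf (Q m) (\<lambda>\<omega>. map_pmf (\<lambda>j. G (fun_upd \<omega> (Suc m) j)) (K m (\<omega> m)))"
      by (simp add: QS map_bind_pmf map_pmf_comp)
    also have "\<dots> = bind_pmf (Q m) (\<lambda>\<omega>. map_pmf (\<lambda>j. G \<omega>) (K m (\<omega> m)))"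
    proof -
      have "G (fun_upd \<omega> (Suc m) j) = G \<omega>" for \<omega> j using step(1) by (intro that(2)) auto
      then show ?thesis by simp
    qed
    also have "\<dots> = map_pmf G (Q m)" by (simp add: map_pmf_const map_pmf_def)
    finally show ?case using step by simp
  qed simp
  have last: "map_pmf (\<lambda>\<omega>. \<omega> k) (Q k) = P k" if "k \<le> M" for k
    using that
  proof (induction k)
    case (Suc k)
    have "map_pmf (\<lambda>\<omega>. \<omega> (Suc k)) (Q (Suc k)) = bind_pmf (Q k) (\<lambda>\<omega>. K k (\<omega> k))"
      by (simp add: QS map_bind_pmf map_pmf_comp)
    also have "\<dots> = bind_pmf (map_pmf (\<lambda>\<omega>. \<omega> k) (Q k)) (K k)" by (simp add: bind_map_pmf)
    finally show ?case using Suc bind by simp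
  qed (simp add: Q0 map_pmf_comp)
  show ?thesis
  proof (rule that[of "Q M"])
    show "finite (set_pmf (Q M))" by (rule finQ)
    show "map_pmf (\<lambda>\<omega>. \<omega> k) (Q M) = P k" if "k \<le> M" for k
      using past[OF that, of "\<lambda>\<omega>. \<omega> k"] last[OF that] by simp
    fix k and F :: "(nat \<Rightarrow> 's) \<Rightarrow> 's \<Rightarrow> real"
    assume k: "k < M" and F: "\<And>\<omega> \<omega>'. (\<And>l. l \<le> k \<Longrightarrow> \<omega> l = \<omega>' l) \<Longrightarrow> F \<omega> = F \<omega>'"
    let ?H = "\<lambda>\<omega>. map_pmf (F \<omega>) (K k (\<omega> k))"
    have FS: "F \<omega> = F \<omega>'" if "\<And>l. l \<le> Suc k \<Longrightarrow> \<omega> l = \<omega>' l" for \<omega> \<omega>' using that by (intro F) auto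
    have "map_pmf (\<lambda>\<omega>. F \<omega> (\<omega> (Suc k))) (Q M) = map_pmf (\<lambda>\<omega>. F \<omega> (\<omega> (Suc k))) (Q (Suc k))"
    proof (rule past)
      show "F \<omega> (\<omega> (Suc k)) = F \<omega>' (\<omega>' (Suc k))" if "\<And>l. l \<le> Suc k \<Longrightarrow> \<omega> l = \<omega>' l" for \<omega> \<omega>'
        using FS[OF that] that[of "Suc k"] by simp
    qed (use k in simp)
    also have "\<dots> = bind_pmf (Q k) (\<lambda>\<omega>. map_pmf (\<lambda>j. F (fun_upd \<omega> (Suc k) j) j) (K k (\<omega> k)))"
      by (simp add: QS map_bind_pmf map_pmf_comp)
    also have "\<dots> = bind_pmf (Q k) ?H"
    proof -
      have "F (fun_upd \<omega> (Suc k) j) = F \<omega>" for \<omega> j by (rule F) auto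
      then show ?thesis by simp
    qed
    also have "\<dots> = bind_pmf (map_pmf ?H (Q k)) (\<lambda>p. p)" by (simp add: bind_map_pmf)
    also have "map_pmf ?H (Q k) = map_pmf ?H (Q M)"
    proof (rule past[symmetric])
      show "?H \<omega> = ?H \<omega>'" if "\<And>l. l \<le> k \<Longrightarrow> \<omega> l = \<omega>' l" for \<omega> \<omega>' using F[OF that] that[of k] by simp
    qed (use k in simp)
    also have "bind_pmf (map_pmf ?H (Q M)) (\<lambda>p. p) = bind_pmf (Q M) ?H" by (simp add: bind_map_pmf)
    finally have eq: "map_pmf (\<lambda>\<omega>. F \<omega> (\<omega> (Suc k))) (Q M) = bind_pmf (Q M) ?H" .
    have "(\<integral>\<omega>. F \<omega> (\<omega> (Suc k)) \<partial>measure_pmf (Q M)) = (\<integral>x. x \<partial>measure_pmf (bind_pmf (Q M) ?H))"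
      by (simp flip: eq)
    also have "\<dots> = (\<Sum>\<omega>\<in>set_pmf (Q M). pmf (Q M) \<omega> *\<^sub>R (\<integral>x. x \<partial>measure_pmf (?H \<omega>)))"
      by (rule pmf_expectation_bind) (auto simp: finQ fin)
    also have "\<dots> = (\<integral>\<omega>. (\<integral>j. F \<omega> j \<partial>measure_pmf (K k (\<omega> k))) \<partial>measure_pmf (Q M))"
      by (subst integral_measure_pmf_real[OF finQ[of M]]) (auto simp: mult.commute)
    finally show "(\<integral>\<omega>. F \<omega> (\<omega> (Suc k)) \<partial>measure_pmf (Q M)) = (\<integral>\<omega>. (\<integral>j. F \<omega> j \<partial>measure_pmf (K k (\<omega> k))) \<partial>measure_pmf (Q M))" .
  qed
qed

text \<open>The deviation D from the accumulated drift is almost a martingale. In one step |D|^2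
  grows in mean by 2 D.e, where e is the small conditional mean of the increment, plus the mean
  square of the increment. The growth is linear in k because |D| has an a priori bound.\<close>

lemma markov_chain_drift:
  fixes P :: "nat \<Rightarrow> 's pmf" and K :: "nat \<Rightarrow> 's \<Rightarrow> 's pmf"
    and pos :: "'s \<Rightarrow> 'a::euclidean_space" and v :: "nat \<Rightarrow> 's \<Rightarrow> 'a"
  assumes bind: "\<And>k. k < M \<Longrightarrow> bind_pmf (P k) (K k) = P (Suc k)"
    and fin: "finite (set_pmf (P 0))" "\<And>k i. finite (set_pmf (K k i))"
    and pos: "\<And>k i. k \<le> M \<Longrightarrow> i \<in> set_pmf (P k) \<Longrightarrow> norm (pos i) \<le> \<rho>"
    and v: "\<And>k i. norm (v k i) \<le> C" and h: "h \<ge> 0"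
    and drift: "\<And>k. k < M \<Longrightarrow> (\<integral>i. norm ((\<integral>j. pos j - pos i \<partial>measure_pmf (K k i)) - h *\<^sub>R v k i) \<partial>measure_pmf (P k)) \<le> h * \<eta>"
    and square: "\<And>k. k < M \<Longrightarrow> (\<integral>i. (\<integral>j. (norm (pos j - pos i))\<^sup>2 \<partial>measure_pmf (K k i)) \<partial>measure_pmf (P k)) \<le> h * \<eta>"
  obtains Q :: "(nat \<Rightarrow> 's) pmf" where "finite (set_pmf Q)" "\<And>k. k \<le> M \<Longrightarrow> map_pmf (\<lambda>\<omega>. \<omega> k) Q = P k"
    "\<And>k. k \<le> M \<Longrightarrow> (\<integral>\<omega>. (norm (pos (\<omega> k) - pos (\<omega> 0) - h *\<^sub>R (\<Sum>l<k. v l (\<omega> l))))\<^sup>2 \<partial>measure_pmf Q) \<le>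
      real k * h * (2 * (2 * \<rho> + real M * h * C) * \<eta> + 2 * \<eta> + 2 * h * C\<^sup>2)"
proof -
  have "\<exists>Q :: (nat \<Rightarrow> 's) pmf. finite (set_pmf Q) \<and> (\<forall>k\<le>M. map_pmf (\<lambda>\<omega>. \<omega> k) Q = P k) \<and>
      (\<forall>k<M. \<forall>F. (\<forall>\<omega> \<omega>'. (\<forall>l\<le>k. \<omega> l = \<omega>' l) \<longrightarrow> F \<omega> = F \<omega>') \<longrightarrow>
      (\<integral>\<omega>. F \<omega> (\<omega> (Suc k)) \<partial>measure_pmf Q) = (\<integral>\<omega>. (\<integral>j. (F \<omega> j :: real) \<partial>measure_pmf (K k (\<omega> k))) \<partial>measure_pmf Q))"
    by (rule markov_chain[of M P K, OF bind fin]) (assumption | blast)+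
  then obtain Q :: "(nat \<Rightarrow> 's) pmf" where Q: "finite (set_pmf Q)" "\<And>k. k \<le> M \<Longrightarrow> map_pmf (\<lambda>\<omega>. \<omega> k) Q = P k"
    and mk': "\<forall>k<M. \<forall>F. (\<forall>\<omega> \<omega>'. (\<forall>l\<le>k. \<omega> l = \<omega>' l) \<longrightarrow> F \<omega> = F \<omega>') \<longrightarrow>
      (\<integral>\<omega>. F \<omega> (\<omega> (Suc k)) \<partial>measure_pmf Q) = (\<integral>\<omega>. (\<integral>j. (F \<omega> j :: real) \<partial>measure_pmf (K k (\<omega> k))) \<partial>measure_pmf Q)"
    by blast
  have mk: "(\<integral>\<omega>. F \<omega> (\<omega> (Suc k)) \<partial>measure_pmf Q) = (\<integral>\<omega>. (\<integral>j. (F \<omega> j :: real) \<partial>measure_pmf (K k (\<omega> k))) \<partial>measure_pmf Q)"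
    if "k < M" "\<And>\<omega> \<omega>'. (\<And>l. l \<le> k \<Longrightarrow> \<omega> l = \<omega>' l) \<Longrightarrow> F \<omega> = F \<omega>'" for k F
    using mk'[rule_format, of k F] that by blast
  have intQ: "integrable (measure_pmf Q) (g :: _ \<Rightarrow> real)" for g by (rule integrable_measure_pmf_finite[OF Q(1)])
  have intK: "integrable (measure_pmf (K k i)) (g :: _ \<Rightarrow> 'b::euclidean_space)" for g k i
    by (rule integrable_measure_pmf_finite[OF fin(2)])
  have C: "C \<ge> 0" using v order_trans[OF norm_ge_zero] by blast
  define D where "D = (\<lambda>k \<omega>. pos (\<omega> k) - pos (\<omega> 0) - h *\<^sub>R (\<Sum>l<k. v l (\<omega> l)))"
  \<comment> \<open>Two positions of norm at most \<rho>, and at most M velocities times h.\<close>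
  let ?m = "2 * \<rho> + real M * h * C"
  have Dm: "norm (D k \<omega>) \<le> ?m" if k: "k \<le> M" and \<omega>: "\<omega> \<in> set_pmf Q" for k \<omega>
  proof -
    have mem: "\<omega> l \<in> set_pmf (P l)" if "l \<le> M" for l
      using Q(2)[OF that] \<omega> by (metis image_eqI set_map_pmf)
    have "norm (\<Sum>l<k. v l (\<omega> l)) \<le> real (card {..<k}) * C" by (rule sum_norm_bound) (rule v)
    also have "\<dots> \<le> real M * C" using k C by (intro mult_right_mono) auto
    finally have "h * norm (\<Sum>l<k. v l (\<omega> l)) \<le> h * (real M * C)" using h by (rule mult_left_mono)
    moreover have "norm (D k \<omega>) \<le> norm (pos (\<omega> k)) + norm (pos (\<omega> 0)) + norm (h *\<^sub>R (\<Sum>l<k. v l (\<omega> l)))"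
      unfolding D_def using norm_triangle_ineq4[of "pos (\<omega> k) - pos (\<omega> 0)" "h *\<^sub>R (\<Sum>l<k. v l (\<omega> l))"]
        norm_triangle_ineq4[of "pos (\<omega> k)" "pos (\<omega> 0)"] by linarith
    moreover have "norm (pos (\<omega> k)) \<le> \<rho>" "norm (pos (\<omega> 0)) \<le> \<rho>" using pos mem k by auto
    ultimately show ?thesis using h by (simp add: mult_ac)
  qed
  have m0: "?m \<ge> 0"
  proof -
    obtain i where "i \<in> set_pmf (P 0)" using set_pmf_not_empty by fastforce
    then have "\<rho> \<ge> 0" using pos[of 0 i] norm_ge_zero order_trans by blast
    then show ?thesis using h C by simp
  qed
  let ?c = "2 * ?m * \<eta> + 2 * \<eta> + 2 * h * C\<^sup>2"
  have "(\<integral>\<omega>. (norm (D k \<omega>))\<^sup>2 \<partial>measure_pmf Q) \<le> real k * h * ?c" if "k \<le> M" for k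
    using that
  proof (induction k)
    case (Suc k)
    then have k: "k < M" by simp
    define e where "e = (\<lambda>i. (\<integral>j. pos j - pos i \<partial>measure_pmf (K k i)) - h *\<^sub>R v k i)"
    define s where "s = (\<lambda>i. \<integral>j. (norm (pos j - pos i))\<^sup>2 \<partial>measure_pmf (K k i))"
    let ?F = "\<lambda>\<omega> j. (norm (D k \<omega> + (pos j - pos (\<omega> k) - h *\<^sub>R v k (\<omega> k))))\<^sup>2"
    have marg: "(\<integral>\<omega>. g (\<omega> k) \<partial>measure_pmf Q) = (\<integral>i. g i \<partial>measure_pmf (P k))" for g :: "'s \<Rightarrow> real"
      using Q(2)[of k] k integral_map_pmf[of "\<lambda>\<omega>. \<omega> k" Q g] by simp
    have "(\<integral>\<omega>. (norm (D (Suc k) \<omega>))\<^sup>2 \<partial>measure_pmf Q) = (\<integral>\<omega>. ?F \<omega> (\<omega> (Suc k)) \<partial>measure_pmf Q)"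
      by (simp add: D_def algebra_simps)
    also have "\<dots> = (\<integral>\<omega>. (\<integral>j. ?F \<omega> j \<partial>measure_pmf (K k (\<omega> k))) \<partial>measure_pmf Q)"
    proof (rule mk[OF k])
      fix \<omega> \<omega>' :: "nat \<Rightarrow> 's" assume eq: "\<And>l. l \<le> k \<Longrightarrow> \<omega> l = \<omega>' l"
      have "(\<Sum>l<k. v l (\<omega> l)) = (\<Sum>l<k. v l (\<omega>' l))" by (intro sum.cong) (auto simp: eq)
      then have "D k \<omega> = D k \<omega>'" by (simp add: D_def eq)
      then show "?F \<omega> = ?F \<omega>'" by (simp add: eq)
    qed
    also have "\<dots> \<le> (\<integral>\<omega>. (norm (D k \<omega>))\<^sup>2 + (2 * ?m * norm (e (\<omega> k)) + (2 * s (\<omega> k) + 2 * h\<^sup>2 * C\<^sup>2)) \<partial>measure_pmf Q)"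
    proof (rule integral_mono_AE[OF intQ intQ], unfold AE_measure_pmf_iff, rule ballI)
      fix \<omega> assume \<omega>: "\<omega> \<in> set_pmf Q"
      let ?i = "\<omega> k" and ?d = "D k \<omega>"
      let ?Z = "\<lambda>j. pos j - pos ?i - h *\<^sub>R v k ?i"
      interpret K: prob_space "measure_pmf (K k ?i)" by (rule prob_space_measure_pmf)
      have "?F \<omega> j \<le> (norm ?d)\<^sup>2 + 2 * (?d \<bullet> ?Z j) + (2 * (norm (pos j - pos ?i))\<^sup>2 + 2 * h\<^sup>2 * C\<^sup>2)" for j
      proof -
        have "?F \<omega> j = (norm ?d)\<^sup>2 + 2 * (?d \<bullet> ?Z j) + (norm (?Z j))\<^sup>2"
          unfolding power2_norm_eq_inner by (simp add: inner_add_left inner_add_right inner_commute)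
        moreover have "(norm (?Z j))\<^sup>2 \<le> (norm (pos j - pos ?i) + h * C)\<^sup>2"
        proof (intro power_mono norm_ge_zero)
          have "norm (?Z j) \<le> norm (pos j - pos ?i) + norm (h *\<^sub>R v k ?i)" by (rule norm_triangle_ineq4)
          also have "norm (h *\<^sub>R v k ?i) \<le> h * C" using h v[of k ?i] by (simp add: mult_left_mono)
          finally show "norm (?Z j) \<le> norm (pos j - pos ?i) + h * C" by simp
        qed
        moreover have "(norm (pos j - pos ?i) + h * C)\<^sup>2 \<le> 2 * (norm (pos j - pos ?i))\<^sup>2 + 2 * (h * C)\<^sup>2"
          using sum_squares_bound[of "norm (pos j - pos ?i)" "h * C"] by (simp add: power2_sum)
        ultimately show ?thesis by (simp add: power_mult_distrib)
      qed
      then have "(\<integral>j. ?F \<omega> j \<partial>measure_pmf (K k ?i)) \<le>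
          (\<integral>j. (norm ?d)\<^sup>2 + 2 * (?d \<bullet> ?Z j) + (2 * (norm (pos j - pos ?i))\<^sup>2 + 2 * h\<^sup>2 * C\<^sup>2) \<partial>measure_pmf (K k ?i))"
        by (intro integral_mono intK)
      also have "\<dots> = (norm ?d)\<^sup>2 + 2 * (?d \<bullet> e ?i) + (2 * s ?i + 2 * h\<^sup>2 * C\<^sup>2)"
      proof -
        have "(\<integral>j. ?Z j \<partial>measure_pmf (K k ?i)) = e ?i"
          unfolding e_def by (subst Bochner_Integration.integral_diff) (auto intro: intK)
        then have "(\<integral>j. ?d \<bullet> ?Z j \<partial>measure_pmf (K k ?i)) = ?d \<bullet> e ?i"
          using integral_inner_right[where M = "measure_pmf (K k ?i)" and f = ?Z and c = ?d] by (simp add: intK)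
        moreover have "(\<integral>j. c + 2 * A j + (2 * B j + c') \<partial>measure_pmf (K k ?i)) =
            c + 2 * (\<integral>j. A j \<partial>measure_pmf (K k ?i)) + (2 * (\<integral>j. B j \<partial>measure_pmf (K k ?i)) + c')"
          for A B :: "'s \<Rightarrow> real" and c c' by (simp add: intK)
        ultimately show ?thesis unfolding s_def by simp
      qed
      also have "?d \<bullet> e ?i \<le> norm ?d * norm (e ?i)" by (rule norm_cauchy_schwarz)
      also have "norm ?d * norm (e ?i) \<le> ?m * norm (e ?i)" using Dm[OF _ \<omega>, of k] k by (intro mult_right_mono) auto
      finally show "(\<integral>j. ?F \<omega> j \<partial>measure_pmf (K k ?i)) \<le> (norm ?d)\<^sup>2 + (2 * ?m * norm (e ?i) + (2 * s ?i + 2 * h\<^sup>2 * C\<^sup>2))"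
        by (simp only: mult.assoc add.assoc)
    qed
    also have "\<dots> = (\<integral>\<omega>. (norm (D k \<omega>))\<^sup>2 \<partial>measure_pmf Q) + (2 * ?m * (\<integral>i. norm (e i) \<partial>measure_pmf (P k))
        + (2 * (\<integral>i. s i \<partial>measure_pmf (P k)) + 2 * h\<^sup>2 * C\<^sup>2))"
    proof -
      have "(\<integral>\<omega>. A \<omega> + (c * B \<omega> + (2 * B' \<omega> + c')) \<partial>measure_pmf Q) =
          (\<integral>\<omega>. A \<omega> \<partial>measure_pmf Q) + (c * (\<integral>\<omega>. B \<omega> \<partial>measure_pmf Q) + (2 * (\<integral>\<omega>. B' \<omega> \<partial>measure_pmf Q) + c'))"
        for A B B' :: "(nat \<Rightarrow> 's) \<Rightarrow> real" and c c' by (simp add: intQ)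
      then show ?thesis using marg[of "\<lambda>i. norm (e i)"] marg[of s] by (simp only:)
    qed
    also have "\<dots> \<le> real k * h * ?c + (2 * ?m * (h * \<eta>) + (2 * (h * \<eta>) + 2 * h\<^sup>2 * C\<^sup>2))"
      using Suc k drift[OF k] square[OF k] m0
      by (intro add_mono mult_left_mono) (auto simp: e_def s_def)
    also have "\<dots> = real (Suc k) * h * ?c" by (simp add: algebra_simps power2_eq_square)
    finally show ?case .
  qed (simp add: D_def)
  with Q show ?thesis by (intro that[of Q]) (auto simp: D_def)
qed

section \<open>Bernstein weights on a lattice\<close>

text \<open>The index k - 1 at k = 0 has to give the zero polynomial, whereas truncated subtraction
  would give index 0.\<close>

definition Bernstein_low :: "nat \<Rightarrow> nat \<Rightarrow> real \<Rightarrow> real" where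
  "Bernstein_low n k y = (if k = 0 then 0 else Bernstein n (k - 1) y)"

lemma Bernstein_eq_0: "n < k \<Longrightarrow> Bernstein n k y = 0"
  by (simp add: Bernstein_def)

text \<open>This and \<open>Bernstein_down\<close> compare degree n with degree n + 1: the ratios
  are (1 - k/(n+1)) / (1 - y) and (k/(n+1)) / y, close to 1 where k/(n+1) is close to y.\<close>

lemma Bernstein_up:
  "(1 - y) * (real (Suc n) * Bernstein n k y) = (real (Suc n) - real k) * Bernstein (Suc n) k y"
proof (cases "k \<le> n")
  case True
  have "Suc n * (n choose k) = (Suc n - k) * (Suc n choose k)"
    using binomial_absorb_comp[of "Suc n" k] by simp
  then have "real (Suc n * (n choose k)) = real ((Suc n - k) * (Suc n choose k))" by (rule arg_cong)
  then have *: "real (Suc n) * real (n choose k) = (real (Suc n) - real k) * real (Suc n choose k)"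
    by (simp only: of_nat_mult of_nat_diff[OF le_SucI[OF True]])
  have "(1 - y) * (real (Suc n) * Bernstein n k y) = (real (Suc n) * real (n choose k)) * (y ^ k * ((1 - y) * (1 - y) ^ (n - k)))"
    by (simp add: Bernstein_def mult_ac)
  also have "(1 - y) * (1 - y) ^ (n - k) = (1 - y) ^ (Suc n - k)" using True by (simp add: Suc_diff_le)
  finally show ?thesis unfolding * by (simp add: Bernstein_def mult_ac)
next
  case False
  then show ?thesis by (cases "k = Suc n") (simp_all add: Bernstein_eq_0)
qed

lemma Bernstein_down:
  "y * (real (Suc n) * Bernstein_low n k y) = real k * Bernstein (Suc n) k y"
proof (cases k)
  case 0
  then show ?thesis by (simp add: Bernstein_low_def)
next
  case (Suc j)
  have "Suc j * (Suc n choose Suc j) = Suc n * (n choose j)" by (rule Suc_times_binomial_eq[symmetric, folded mult.commute])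
  then have "real (Suc j * (Suc n choose Suc j)) = real (Suc n * (n choose j))" by (rule arg_cong)
  then have "real (Suc j) * real (Suc n choose Suc j) = real (Suc n) * real (n choose j)" by (simp only: of_nat_mult)
  then show ?thesis by (simp add: Suc Bernstein_low_def Bernstein_def mult_ac del: of_nat_Suc binomial_Suc_Suc)
qed

text \<open>To be read as the gain from the lower neighbour minus the loss to the upper one, without
  remainder.\<close>

lemma has_real_derivative_Bernstein:
  "(Bernstein (Suc n) k has_real_derivative real (Suc n) * (Bernstein_low n k y - Bernstein n k y)) (at y)"
proof (cases "k \<le> Suc n")
  case True
  have up: "real (Suc n choose k) * real (Suc n - k) = real (Suc n) * real (n choose k)"
  proof (cases "k = Suc n")
    case False
    have "Suc n * (n choose k) = (Suc n - k) * (Suc n choose k)"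
      using binomial_absorb_comp[of "Suc n" k] by simp
    then show ?thesis by (metis of_nat_mult mult.commute)
  qed simp
  have down: "real (Suc n choose k) * (real k * y ^ (k - 1)) * (1 - y) ^ (Suc n - k) = real (Suc n) * Bernstein_low n k y"
  proof (cases k)
    case (Suc j)
    have "Suc j * (Suc n choose Suc j) = Suc n * (n choose j)" by (rule Suc_times_binomial_eq[symmetric, folded mult.commute])
    then have "real (Suc n choose Suc j) * real (Suc j) = real (Suc n) * real (n choose j)" by (metis of_nat_mult mult.commute)
    then show ?thesis by (simp add: Suc Bernstein_low_def Bernstein_def mult_ac del: of_nat_Suc binomial_Suc_Suc)
  qed (simp add: Bernstein_low_def)
  have "(Bernstein (Suc n) k has_real_derivative
      real (Suc n choose k) * (real k * y ^ (k - 1)) * (1 - y) ^ (Suc n - k)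
      - real (Suc n choose k) * real (Suc n - k) * (y ^ k * (1 - y) ^ (Suc n - k - 1))) (at y)"
    unfolding Bernstein_def
    by (rule derivative_eq_intros refl | simp add: algebra_simps)+
  also have "real (Suc n choose k) * real (Suc n - k) * (y ^ k * (1 - y) ^ (Suc n - k - 1)) = real (Suc n) * Bernstein n k y"
    unfolding up by (simp add: Bernstein_def)
  finally show ?thesis unfolding down by (simp add: right_diff_distrib)
next
  case False
  then have "Bernstein (Suc n) k = (\<lambda>y. 0)" by (auto simp: Bernstein_def fun_eq_iff)
  then show ?thesis using False by (auto simp: Bernstein_low_def Bernstein_eq_0)
qed

lemma sum_Bernstein_variance:
  assumes "n > 0"
  shows "(\<Sum>k\<le>n. Bernstein n k x * (x - real k / real n)\<^sup>2) = x * (1 - x) / real n"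
proof -
  \<comment> \<open>Splits the square into the moments of k (k - 1), k and 1.\<close>
  have *: "\<And>a b x::real. (a - b)\<^sup>2 * x = a * (a - 1) * x + (1 - 2 * b) * a * x + b * b * x"
    by (simp add: algebra_simps power2_eq_square)
  have "(\<Sum>k\<le>n. (real k - real n * x)\<^sup>2 * Bernstein n k x) = real n * x * (1 - x)"
    apply (simp add: * sum.distrib)
    apply (simp flip: sum_distrib_left add: mult.assoc)
    apply (simp add: algebra_simps power2_eq_square)
    done
  then have "(\<Sum>k\<le>n. (real k - real n * x)\<^sup>2 * Bernstein n k x) / (real n)\<^sup>2 = x * (1 - x) / real n"
    using assms by (simp add: power2_eq_square)
  moreover have "(real k - real n * x)\<^sup>2 * Bernstein n k x / (real n)\<^sup>2 = Bernstein n k x * (x - real k / real n)\<^sup>2" for k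
    using assms by (simp add: power2_eq_square field_simps)
  ultimately show ?thesis by (simp add: sum_divide_distrib)
qed

lemma continuous_on_Bernstein [continuous_intros]:
  "continuous_on S h \<Longrightarrow> continuous_on S (\<lambda>x. Bernstein n k (h x))"
  unfolding Bernstein_def by (intro continuous_intros)

lemma continuous_on_Bernstein_low [continuous_intros]:
  "continuous_on S h \<Longrightarrow> continuous_on S (\<lambda>x. Bernstein_low n k (h x))"
  unfolding Bernstein_low_def by (cases "k = 0") (simp_all add: continuous_on_Bernstein)

text \<open>The lattice points \<open>lat_pos l n i\<close>, \<open>i \<in> lat n\<close>, subdivide the cube of side \<open>l\<close> centred at the origin
  into \<open>n + 1\<close> parts per direction, and \<open>wgt l n i x\<close> is the probability that
  \<open>n + 1\<close> coin tosses per direction, with bias \<open>cube_coord l x k\<close>, lead from \<open>x\<close> to the lattice point \<open>i\<close>.\<close>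

definition lat :: "nat \<Rightarrow> ('n::finite \<Rightarrow> nat) set" where
  "lat n = {i. \<forall>k. i k \<le> Suc n}"

definition lat_pos :: "real \<Rightarrow> nat \<Rightarrow> ('n::finite \<Rightarrow> nat) \<Rightarrow> real^'n" where
  "lat_pos l n i = (\<chi> k. l * (real (i k) / real (Suc n) - 1 / 2))"

definition cube_coord :: "real \<Rightarrow> real^'n \<Rightarrow> 'n \<Rightarrow> real" where
  "cube_coord l x k = 1 / 2 + x $ k / l"

definition wgt :: "real \<Rightarrow> nat \<Rightarrow> ('n::finite \<Rightarrow> nat) \<Rightarrow> real^'n \<Rightarrow> real" where
  "wgt l n i x = (\<Prod>k\<in>UNIV. Bernstein (Suc n) (i k) (cube_coord l x k))"

text \<open>In direction k the degree is lowered by one. This is the weight of the edge from i to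
  its upper neighbour, and \<open>wgt_down\<close> that of the edge from the lower neighbour to
  i.\<close>

definition wgt_up :: "real \<Rightarrow> nat \<Rightarrow> ('n::finite \<Rightarrow> nat) \<Rightarrow> 'n \<Rightarrow> real^'n \<Rightarrow> real" where
  "wgt_up l n i k x = Bernstein n (i k) (cube_coord l x k) * (\<Prod>m\<in>UNIV - {k}. Bernstein (Suc n) (i m) (cube_coord l x m))"

definition wgt_down :: "real \<Rightarrow> nat \<Rightarrow> ('n::finite \<Rightarrow> nat) \<Rightarrow> 'n \<Rightarrow> real^'n \<Rightarrow> real" where
  "wgt_down l n i k x = Bernstein_low n (i k) (cube_coord l x k) * (\<Prod>m\<in>UNIV - {k}. Bernstein (Suc n) (i m) (cube_coord l x m))"

lemma finite_lat: "finite (lat n :: ('n::finite \<Rightarrow> nat) set)"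
proof -
  have "lat n = (PiE UNIV (\<lambda>_. {..Suc n}) :: ('n \<Rightarrow> nat) set)" by (auto simp: lat_def PiE_def extensional_def)
  then show ?thesis by (simp add: finite_PiE)
qed

lemma wgt_split: "wgt l n i x = Bernstein (Suc n) (i k) (cube_coord l x k) * (\<Prod>m\<in>UNIV - {k}. Bernstein (Suc n) (i m) (cube_coord l x m))"
  unfolding wgt_def by (rule prod.remove) auto

lemma wgt_up_eq: "(1 - cube_coord l x k) * wgt_up l n i k x = (1 - real (i k) / real (Suc n)) * wgt l n i x"
proof -
  have "(1 - y) * Bernstein n j y = (1 - real j / real (Suc n)) * Bernstein (Suc n) j y" for y j
    using Bernstein_up[of y n j] by (simp add: field_simps del: of_nat_Suc)
  then show ?thesis unfolding wgt_up_def wgt_split[of l n i x k] mult.assoc[symmetric] by (simp only:)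
qed

lemma wgt_down_eq: "cube_coord l x k * wgt_down l n i k x = real (i k) / real (Suc n) * wgt l n i x"
proof -
  have "y * Bernstein_low n j y = real j / real (Suc n) * Bernstein (Suc n) j y" for y j
    using Bernstein_down[of y n j] by (simp add: field_simps del: of_nat_Suc)
  then show ?thesis unfolding wgt_down_def wgt_split[of l n i x k] mult.assoc[symmetric] by (simp only:)
qed

text \<open>An edge has the same weight seen from either end. This conservation turns the equation
  for the weights into a balance of mass.\<close>

lemma wgt_down_shift: "wgt_down l n (fun_upd i k (Suc (i k))) k x = wgt_up l n i k x"
proof -
  have "(\<Prod>m\<in>UNIV - {k}. Bernstein (Suc n) (fun_upd i k (Suc (i k)) m) (cube_coord l x m)) =
      (\<Prod>m\<in>UNIV - {k}. Bernstein (Suc n) (i m) (cube_coord l x m))"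
    by (intro prod.cong) auto
  then show ?thesis by (simp add: wgt_down_def wgt_up_def Bernstein_low_def)
qed

lemma prod_Bernstein_eq_0:
  assumes "m \<noteq> k" "Suc n < i m"
  shows "(\<Prod>m\<in>UNIV - {k}. Bernstein (Suc n) (i m) (cube_coord l x m)) = 0"
  using assms by (intro prod_zero bexI[of _ m]) (auto simp: Bernstein_eq_0)

text \<open>No mass leaves the lattice: an edge that points out of it has weight 0.\<close>

lemma wgt_up_outside: "fun_upd i k (Suc (i k)) \<notin> lat n \<Longrightarrow> wgt_up l n i k x = 0"
  and wgt_down_outside: "i \<notin> lat n \<Longrightarrow> wgt_down l n i k x = 0"
  and wgt_outside: "i \<notin> lat n \<Longrightarrow> wgt l n i x = 0"
proof -
  show "wgt_up l n i k x = 0" if "fun_upd i k (Suc (i k)) \<notin> lat n"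
  proof -
    from that obtain m where "fun_upd i k (Suc (i k)) m > Suc n" unfolding lat_def by (auto simp: not_le)
    then show ?thesis using prod_Bernstein_eq_0[of m k n i l x]
      by (cases "m = k") (auto simp: wgt_up_def Bernstein_eq_0)
  qed
  show "wgt_down l n i k x = 0" if "i \<notin> lat n"
  proof -
    from that obtain m where "i m > Suc n" unfolding lat_def by (auto simp: not_le)
    then show ?thesis using prod_Bernstein_eq_0[of m k n i l x]
      by (cases "m = k") (auto simp: wgt_down_def Bernstein_low_def Bernstein_eq_0)
  qed
  show "wgt l n i x = 0" if "i \<notin> lat n"
  proof -
    from that obtain m where "i m > Suc n" unfolding lat_def by (auto simp: not_le)
    then show ?thesis unfolding wgt_def by (intro prod_zero bexI[of _ m]) (auto simp: Bernstein_eq_0)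
  qed
qed

lemma wgt_down_zero: "i k = 0 \<Longrightarrow> wgt_down l n i k x = 0"
  by (simp add: wgt_down_def Bernstein_low_def)

lemma continuous_on_cube_coord [continuous_intros]: "continuous_on S (\<lambda>x. cube_coord l x k)"
  unfolding cube_coord_def divide_inverse by (intro continuous_intros)

lemma continuous_on_wgt: "continuous_on S (wgt l n i)" "continuous_on S (wgt_up l n i k)" "continuous_on S (wgt_down l n i k)"
  unfolding wgt_def[abs_def] wgt_up_def[abs_def] wgt_down_def[abs_def]
  by (intro continuous_intros continuous_on_prod)+

text \<open>The factor Suc n / l is the reciprocal of the lattice spacing; the length of a jump
  cancels it later.\<close>

lemma GDERIV_wgt:
  "GDERIV (wgt l n i) x :> (\<chi> k. real (Suc n) / l * (wgt_down l n i k x - wgt_up l n i k x))"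
proof -
  let ?B = "\<lambda>k x. Bernstein (Suc n) (i k) (cube_coord l x k)"
  let ?B' = "\<lambda>k. real (Suc n) * (Bernstein_low n (i k) (cube_coord l x k) - Bernstein n (i k) (cube_coord l x k))"
  have "((\<lambda>x. cube_coord l x k) has_derivative (\<lambda>h. h $ k / l)) (at x)" for k
    unfolding cube_coord_def divide_inverse
    by (auto intro!: derivative_eq_intros bounded_linear_imp_has_derivative)
  from DERIV_compose_FDERIV[OF has_real_derivative_Bernstein this]
  have "(?B k has_derivative (\<lambda>h. h $ k / l * ?B' k)) (at x)" for k .
  from has_derivative_prod[of UNIV ?B "\<lambda>k h. h $ k / l * ?B' k" x UNIV, OF this]
  have "(wgt l n i has_derivative (\<lambda>h. \<Sum>k\<in>UNIV. h $ k / l * ?B' k * (\<Prod>m\<in>UNIV - {k}. ?B m x))) (at x)"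
    by (simp add: wgt_def[abs_def])
  then show ?thesis unfolding gderiv_def
  proof (rule has_derivative_eq_rhs)
    have "a / l * (N * (p - q)) * r = a * (N / l * (p * r - q * r))" for a N p q r :: real
      by (simp add: algebra_simps diff_divide_distrib)
    then show "(\<lambda>h. \<Sum>k\<in>UNIV. h $ k / l * ?B' k * (\<Prod>m\<in>UNIV - {k}. ?B m x)) =
        (\<lambda>h. h \<bullet> (\<chi> k. real (Suc n) / l * (wgt_down l n i k x - wgt_up l n i k x)))"
      by (simp only: fun_eq_iff inner_vec_def vec_lambda_beta inner_real_def wgt_up_def wgt_down_def) simp
  qed
qed

lemma
  fixes x :: "real^'n"
  shows sum_wgt: "(\<Sum>i\<in>lat n. wgt l n i x) = 1"
  and sum_wgt_variance: "(\<Sum>i\<in>lat n. wgt l n i x * (cube_coord l x k - real (i k) / real (Suc n))\<^sup>2) =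
    cube_coord l x k * (1 - cube_coord l x k) / real (Suc n)"
proof -
  have lat: "lat n = (PiE UNIV (\<lambda>_. {..Suc n}) :: ('n \<Rightarrow> nat) set)" by (auto simp: lat_def PiE_def extensional_def)
  show "(\<Sum>i\<in>lat n. wgt l n i x) = 1"
    unfolding lat wgt_def
    by (subst prod_sum_PiE[of UNIV "\<lambda>_. {..Suc n}" "\<lambda>k j. Bernstein (Suc n) j (cube_coord l x k)", symmetric]) (auto simp del: sum.atMost_Suc)
  let ?f = "\<lambda>m j. if m = k then Bernstein (Suc n) j (cube_coord l x m) * (cube_coord l x k - real j / real (Suc n))\<^sup>2
      else Bernstein (Suc n) j (cube_coord l x m)"
  have "wgt l n i x * (cube_coord l x k - real (i k) / real (Suc n))\<^sup>2 = (\<Prod>m\<in>UNIV. ?f m (i m))" for i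
  proof -
    have "(\<Prod>m\<in>UNIV. ?f m (i m)) = ?f k (i k) * (\<Prod>m\<in>UNIV - {k}. ?f m (i m))" by (rule prod.remove) auto
    also have "(\<Prod>m\<in>UNIV - {k}. ?f m (i m)) = (\<Prod>m\<in>UNIV - {k}. Bernstein (Suc n) (i m) (cube_coord l x m))"
      by (intro prod.cong) auto
    finally show ?thesis unfolding wgt_split[of l n i x k] by (simp add: mult_ac)
  qed
  then have "(\<Sum>i\<in>lat n. wgt l n i x * (cube_coord l x k - real (i k) / real (Suc n))\<^sup>2) = (\<Prod>m\<in>UNIV. \<Sum>j\<le>Suc n. ?f m j)"
    unfolding lat by (subst prod_sum_PiE) (auto simp del: sum.atMost_Suc)
  also have "\<dots> = (\<Sum>j\<le>Suc n. ?f k j) * (\<Prod>m\<in>UNIV - {k}. \<Sum>j\<le>Suc n. ?f m j)" by (rule prod.remove) auto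
  also have "(\<Prod>m\<in>UNIV - {k}. \<Sum>j\<le>Suc n. ?f m j) = (\<Prod>m\<in>UNIV - {k}. 1)"
    by (intro prod.cong refl) (simp del: sum.atMost_Suc)
  also have "(\<Sum>j\<le>Suc n. ?f k j) = cube_coord l x k * (1 - cube_coord l x k) / real (Suc n)"
    using sum_Bernstein_variance[of "Suc n" "cube_coord l x k"] by (simp del: sum.atMost_Suc of_nat_Suc)
  finally show "(\<Sum>i\<in>lat n. wgt l n i x * (cube_coord l x k - real (i k) / real (Suc n))\<^sup>2) =
      cube_coord l x k * (1 - cube_coord l x k) / real (Suc n)" by simp
qed

lemma norm_lat_pos:
  assumes "i \<in> lat n" "l > 0"
  shows "norm (lat_pos l n i :: real^'n) \<le> real CARD('n) * l"
proof -
  have "norm (lat_pos l n i) \<le> (\<Sum>k\<in>UNIV. \<bar>lat_pos l n i $ k\<bar>)" by (rule norm_le_l1_cart)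
  also have "\<dots> \<le> (\<Sum>k\<in>(UNIV :: 'n set). l)"
  proof (rule sum_mono)
    fix k
    have "i k \<le> Suc n" using assms(1) by (simp add: lat_def)
    then have "real (i k) / real (Suc n) \<le> 1" by (simp add: divide_le_eq_1 del: of_nat_Suc)
    moreover have "0 \<le> real (i k) / real (Suc n)" by simp
    ultimately have "\<bar>real (i k) / real (Suc n) - 1 / 2\<bar> \<le> 1" by linarith
    then show "\<bar>lat_pos l n i $ k\<bar> \<le> l" using assms(2) mult_left_mono[of _ 1 l] by (simp add: lat_pos_def abs_mult)
  qed
  finally show ?thesis by simp
qed

lemma lat_pos_dist:
  assumes "l > 0"
  shows "(dist x (lat_pos l n i))\<^sup>2 = l\<^sup>2 * (\<Sum>k\<in>UNIV. (cube_coord l x k - real (i k) / real (Suc n))\<^sup>2)"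
proof -
  have "(x - lat_pos l n i) $ k = l * (cube_coord l x k - real (i k) / real (Suc n))" for k
    using assms by (simp add: lat_pos_def cube_coord_def field_simps del: of_nat_Suc)
  then have "(dist x (lat_pos l n i))\<^sup>2 = (\<Sum>k\<in>UNIV. (l * (cube_coord l x k - real (i k) / real (Suc n)))\<^sup>2)"
    by (simp add: dist_norm norm_vec_def L2_set_def sum_nonneg del: of_nat_Suc)
  then show ?thesis by (simp add: power_mult_distrib sum_distrib_left)
qed

text \<open>The ball of radius l/4 keeps the coordinates away from 0 and 1, so that dividing by y or
  by 1 - y costs at most the factor 4 in the estimates below.\<close>

lemma cube_coord_bounds:
  assumes "norm x \<le> l / 4" "l > 0"
  shows "1 / 4 \<le> cube_coord l x k" "cube_coord l x k \<le> 3 / 4"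
proof -
  have "\<bar>x $ k\<bar> \<le> l / 4" using component_le_norm_cart[of x k] assms(1) by linarith
  then have "\<bar>x $ k / l\<bar> \<le> 1 / 4" using assms(2) by (simp add: abs_divide field_simps)
  then show "1 / 4 \<le> cube_coord l x k" "cube_coord l x k \<le> 3 / 4" unfolding cube_coord_def by linarith+
qed

context
  fixes l :: real and x :: "real^'n"
  assumes x: "norm x \<le> l / 4" "l > 0"
begin

lemma wgt_nonneg: "0 \<le> wgt l n i x"
  and wgt_up_nonneg: "0 \<le> wgt_up l n i k x"
  and wgt_down_nonneg: "0 \<le> wgt_down l n i k x"
proof -
  have "0 \<le> cube_coord l x k" "cube_coord l x k \<le> 1" for k using cube_coord_bounds[OF x, of k] by auto
  then show "0 \<le> wgt l n i x" "0 \<le> wgt_up l n i k x" "0 \<le> wgt_down l n i k x"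
    unfolding wgt_def wgt_up_def wgt_down_def Bernstein_low_def
    by (auto intro!: prod_nonneg mult_nonneg_nonneg Bernstein_nonneg)
qed

text \<open>By \<open>wgt_up_eq\<close>, (1 - y) (wgt_up - wgt) = (y - i k/(n+1)) wgt, and 1 - y >=
  1/4; likewise with y for \<open>wgt_down\<close>.\<close>

lemma wgt_up_diff: "\<bar>wgt_up l n i k x - wgt l n i x\<bar> \<le> 4 * \<bar>cube_coord l x k - real (i k) / real (Suc n)\<bar> * wgt l n i x"
  and wgt_down_diff: "\<bar>wgt_down l n i k x - wgt l n i x\<bar> \<le> 4 * \<bar>cube_coord l x k - real (i k) / real (Suc n)\<bar> * wgt l n i x"
proof -
  let ?y = "cube_coord l x k" and ?j = "real (i k) / real (Suc n)" and ?w = "wgt l n i x"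
  have y: "1 / 4 \<le> ?y" "1 / 4 \<le> 1 - ?y" using cube_coord_bounds[OF x, of k] by auto
  have *: "\<bar>u - ?w\<bar> \<le> 4 * \<bar>?y - ?j\<bar> * ?w" if "a * u - a * ?w = c * ?w" "\<bar>c\<bar> = \<bar>?y - ?j\<bar>" "1 / 4 \<le> a" for u a c
  proof -
    have "1 / 4 * \<bar>u - ?w\<bar> \<le> a * \<bar>u - ?w\<bar>" using that(3) by (rule mult_right_mono) auto
    also have "\<dots> = \<bar>a * u - a * ?w\<bar>" using that(3) by (simp add: abs_mult flip: right_diff_distrib)
    also have "\<dots> = \<bar>?y - ?j\<bar> * ?w" using that(1,2) wgt_nonneg[of n i] by (simp add: abs_mult)
    finally show ?thesis by simp
  qed
  show "\<bar>wgt_up l n i k x - ?w\<bar> \<le> 4 * \<bar>?y - ?j\<bar> * ?w"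
    by (rule *[of "1 - ?y" _ "?y - ?j"]) (use wgt_up_eq[of l x k n i] y in \<open>auto simp: algebra_simps\<close>)
  show "\<bar>wgt_down l n i k x - ?w\<bar> \<le> 4 * \<bar>?y - ?j\<bar> * ?w"
    by (rule *[of ?y _ "?j - ?y"]) (use wgt_down_eq[of l x k n i] y in \<open>auto simp: algebra_simps\<close>)
qed

lemma wgt_up_le: "wgt_up l n i k x \<le> 4 * wgt l n i x"
  and wgt_down_le: "wgt_down l n i k x \<le> 4 * wgt l n i x"
proof -
  let ?y = "cube_coord l x k" and ?j = "real (i k) / real (Suc n)" and ?w = "wgt l n i x"
  have y: "1 / 4 \<le> ?y" "1 / 4 \<le> 1 - ?y" using cube_coord_bounds[OF x, of k] by auto
  have w: "0 \<le> ?w" by (rule wgt_nonneg)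
  have "1 / 4 * wgt_up l n i k x \<le> (1 - ?y) * wgt_up l n i k x"
    by (intro mult_right_mono y wgt_up_nonneg)
  also have "\<dots> \<le> 1 * ?w" unfolding wgt_up_eq using w by (intro mult_right_mono) auto
  finally show "wgt_up l n i k x \<le> 4 * ?w" by simp
  show "wgt_down l n i k x \<le> 4 * ?w"
  proof (cases "i \<in> lat n")
    case True
    then have "i k \<le> Suc n" by (simp add: lat_def)
    then have j: "?j \<le> 1" by (simp add: divide_le_eq_1 del: of_nat_Suc)
    have "1 / 4 * wgt_down l n i k x \<le> ?y * wgt_down l n i k x"
      by (intro mult_right_mono y wgt_down_nonneg)
    also have "\<dots> \<le> 1 * ?w" unfolding wgt_down_eq using w j by (intro mult_right_mono)
    finally show ?thesis by simp
  qed (simp add: wgt_down_outside wgt_outside)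
qed

lemma sum_wgt_variance_le: "(\<Sum>i\<in>lat n. wgt l n i x * (cube_coord l x k - real (i k) / real (Suc n))\<^sup>2) \<le> 1 / real (Suc n)"
proof -
  have "cube_coord l x k * (1 - cube_coord l x k) \<le> 1 * 1"
    using cube_coord_bounds[OF x, of k] by (intro mult_mono) auto
  then show ?thesis unfolding sum_wgt_variance by (intro divide_right_mono) auto
qed

lemma sum_wgt_dist: "(\<Sum>i\<in>lat n. wgt l n i x * (dist x (lat_pos l n i))\<^sup>2) \<le> l\<^sup>2 * real CARD('n) / real (Suc n)"
proof -
  have "(\<Sum>i\<in>lat n. wgt l n i x * (dist x (lat_pos l n i))\<^sup>2) =
      l\<^sup>2 * (\<Sum>k\<in>UNIV. \<Sum>i\<in>lat n. wgt l n i x * (cube_coord l x k - real (i k) / real (Suc n))\<^sup>2)"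
    by (simp add: lat_pos_dist[OF x(2)] sum_distrib_left mult_ac del: of_nat_Suc) (rule sum.swap)
  also have "\<dots> \<le> l\<^sup>2 * (\<Sum>k\<in>(UNIV::'n set). 1 / real (Suc n))"
    by (intro mult_left_mono sum_mono sum_wgt_variance_le) auto
  finally show ?thesis by (simp del: of_nat_Suc)
qed

text \<open>Cauchy-Schwarz in pointwise form, |d| <= (1/s + s d^2) / 2. The choice s = sqrt (n+1)
  balances the total mass 1 against the variance bound 1/(n+1).\<close>

lemma sum_wgt_abs: "(\<Sum>i\<in>lat n. \<bar>cube_coord l x k - real (i k) / real (Suc n)\<bar> * wgt l n i x) \<le> 1 / sqrt (real (Suc n))"
proof -
  let ?d = "\<lambda>i. cube_coord l x k - real (i k) / real (Suc n)" and ?s = "sqrt (real (Suc n))"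
  have s: "?s > 0" "?s * ?s = real (Suc n)" by auto
  have pt: "\<bar>d\<bar> \<le> (1 / ?s + ?s * d\<^sup>2) / 2" for d :: real
  proof -
    have "2 * \<bar>d\<bar> * ?s \<le> 1 + (?s * \<bar>d\<bar>)\<^sup>2" using sum_squares_bound[of 1 "?s * \<bar>d\<bar>"] by (simp add: mult_ac)
    also have "(?s * \<bar>d\<bar>)\<^sup>2 = ?s * d\<^sup>2 * ?s"
      unfolding power_mult_distrib power2_abs power2_eq_square[of ?s] by (simp only: mult_ac)
    finally have "2 * \<bar>d\<bar> * ?s \<le> (1 / ?s + ?s * d\<^sup>2) * ?s"
      unfolding distrib_right using s(1) by (simp del: of_nat_Suc)
    then show ?thesis using s(1) by (simp add: mult_le_cancel_right)
  qed
  have "(\<Sum>i\<in>lat n. \<bar>?d i\<bar> * wgt l n i x) \<le> (\<Sum>i\<in>lat n. (1 / ?s + ?s * (?d i)\<^sup>2) / 2 * wgt l n i x)"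
    by (intro sum_mono mult_right_mono pt wgt_nonneg)
  also have "\<dots> = 1 / ?s / 2 * (\<Sum>i\<in>lat n. wgt l n i x) + ?s / 2 * (\<Sum>i\<in>lat n. wgt l n i x * (?d i)\<^sup>2)"
  proof -
    have "(1 / s + s * q) / 2 * w = 1 / s / 2 * w + s / 2 * (w * q)" for s q w :: real
      by (simp add: algebra_simps add_divide_distrib)
    then show ?thesis by (simp only: sum.distrib sum_distrib_left)
  qed
  also have "\<dots> \<le> 1 / ?s / 2 * 1 + ?s / 2 * (1 / real (Suc n))"
    by (intro add_mono mult_left_mono sum_wgt_variance_le) (auto simp: sum_wgt)
  also have "?s / 2 * (1 / real (Suc n)) = 1 / ?s / 2" 
  proof -
    have "u / 2 * (1 / N) = 1 / u / 2" if "u * u = N" "u > 0" for u N :: real using that by auto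
    then show ?thesis using s by blast
  qed
  finally show ?thesis by simp
qed

end

section \<open>Lattice chains approximating a flow of measures\<close>

text \<open>What is kept of the weak solution: a field tame on the whole space, laws in the ball of
  radius l/4, well inside the cube of side l, and the integrated equation for all C^1 test
  functions.\<close>

locale cube_flow =
  fixes T C l :: real and b :: "real \<Rightarrow> real^'n \<Rightarrow> real^'n" and \<mu> :: "real \<Rightarrow> (real^'n) prob1"
  assumes T: "T > 0" and b: "tame C b" and l: "l > 0" and \<mu>: "continuous_on {0..T} \<mu>"
    and supp: "\<And>t. t \<in> {0..T} \<Longrightarrow> AE x in law (\<mu> t). norm x \<le> l / 4"
    and transport: "\<And>\<phi> D s t. (\<And>x. GDERIV \<phi> x :> D x) \<Longrightarrow> continuous_on UNIV D \<Longrightarrow> 0 \<le> s \<Longrightarrow> s \<le> t \<Longrightarrow> t \<le> T \<Longrightarrow>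
      (\<integral>x. \<phi> x \<partial>law (\<mu> t)) - (\<integral>x. \<phi> x \<partial>law (\<mu> s)) = integral {s..t} (\<lambda>r. \<integral>x. b r x \<bullet> D x \<partial>law (\<mu> r))"
begin

abbreviation E :: "real \<Rightarrow> (real^'n \<Rightarrow> real) \<Rightarrow> real" where
  "E t \<phi> \<equiv> (\<integral>x. \<phi> x \<partial>law (\<mu> t))"

lemma C: "C \<ge> 0" using b by (rule tame_nonneg)

lemma b_component: "\<bar>b t x $ k\<bar> \<le> C"
  using component_le_norm_cart[of "b t x" k] tame_bound[OF b, of t x] by linarith

lemma continuous_on_b_component: "continuous_on S (\<lambda>p. b (fst p) (snd p) $ k)"
  using continuous_on_component[OF tame_continuous_on[OF b], of S k] by (simp add: case_prod_unfold)

lemma continuous_on_b_section: "continuous_on S (\<lambda>x. b t x $ k)"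
proof -
  have "continuous_on S (\<lambda>x. (t, x))" by (intro continuous_intros)
  from continuous_on_compose2[OF continuous_on_b_component[of UNIV k] this] show ?thesis by simp
qed

lemma integrable_E:
  fixes \<phi> :: "real^'n \<Rightarrow> real"
  shows "t \<in> {0..T} \<Longrightarrow> continuous_on UNIV \<phi> \<Longrightarrow> integrable (law (\<mu> t)) \<phi>"
  using supp by (intro integrable_law_continuous)

lemma E_mono:
  assumes "t \<in> {0..T}" "continuous_on UNIV \<phi>" "continuous_on UNIV \<psi>" "\<And>x. norm x \<le> l / 4 \<Longrightarrow> \<phi> x \<le> \<psi> x"
  shows "E t \<phi> \<le> E t \<psi>"
  by (rule integral_mono_AE) (use integrable_E assms supp[of t] in auto)

lemma E_const: "E t (\<lambda>_. c) = c"
proof -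
  interpret prob_space "law (\<mu> t)" by (rule law_prob1)
  show ?thesis by (simp add: prob_space)
qed

lemma E_nonneg:
  assumes "t \<in> {0..T}" "continuous_on UNIV \<phi>" "\<And>x. norm x \<le> l / 4 \<Longrightarrow> 0 \<le> \<phi> x"
  shows "0 \<le> E t \<phi>"
  using E_mono[of t "\<lambda>_. 0" \<phi>] assms by (simp add: E_const)

lemma continuous_on_E:
  assumes "continuous_on ({0..T} \<times> UNIV) (\<lambda>p. a (fst p) (snd p))"
  shows "continuous_on {0..T} (\<lambda>t. E t (a t))"
  using continuous_on_integral_law[of T a \<mu> "l / 4"] assms \<mu> supp by (simp add: case_prod_unfold)

text \<open>The law of the random rounding to the lattice of a point distributed by
  \<mu>[t].\<close>

definition occ :: "nat \<Rightarrow> real \<Rightarrow> ('n \<Rightarrow> nat) \<Rightarrow> real" where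
  "occ n t i = E t (wgt l n i)"

text \<open>A bound for the relative rate of change of every \<open>occ\<close>: in each of the
  CARD('n) directions |b_k| <= C and |wgt_down - wgt_up| <= 4 wgt, and the last factor comes from
  the gradient.\<close>

definition growth_rate :: "nat \<Rightarrow> real" where
  "growth_rate n = 4 * real CARD('n) * C * (real (Suc n) / l)"

text \<open>Splitting b_k into positive and negative parts makes all fluxes nonnegative, as
  transition probabilities have to be.\<close>

definition up :: "nat \<Rightarrow> ('n \<Rightarrow> nat) \<Rightarrow> 'n \<Rightarrow> real \<Rightarrow> real^'n \<Rightarrow> real" where
  "up n i k t x = max 0 (b t x $ k) * wgt_up l n i k x"

definition down :: "nat \<Rightarrow> ('n \<Rightarrow> nat) \<Rightarrow> 'n \<Rightarrow> real \<Rightarrow> real^'n \<Rightarrow> real" where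
  "down n i k t x = max 0 (- (b t x $ k)) * wgt_down l n i k x"

definition flux :: "nat \<Rightarrow> real \<Rightarrow> real \<Rightarrow> (real \<Rightarrow> real^'n \<Rightarrow> real) \<Rightarrow> real" where
  "flux n h t a = real (Suc n) / l * integral {t..t + h} (\<lambda>s. E s (a s))"

text \<open>The mass moved during \<open>[t, t + h]\<close> from \<open>i\<close> in the direction \<open>k\<close>, upwards for
  \<open>True\<close> and downwards for \<open>False\<close>.\<close>

definition jump :: "nat \<Rightarrow> real \<Rightarrow> real \<Rightarrow> ('n \<Rightarrow> nat) \<Rightarrow> 'n \<times> bool \<Rightarrow> real" where
  "jump n h t i m = (case m of (k, u) \<Rightarrow> flux n h t (if u then up n i k else down n i k))"

text \<open>At \<open>i k = 0\<close> the downward move is truncated and stays at i; the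
  corresponding jump is 0 by \<open>wgt_down_zero\<close>.\<close>

definition move :: "('n \<Rightarrow> nat) \<Rightarrow> 'n \<times> bool \<Rightarrow> ('n \<Rightarrow> nat)" where
  "move i m = (case m of (k, u) \<Rightarrow> fun_upd i k (if u then Suc (i k) else i k - 1))"

lemma growth_rate_nonneg: "growth_rate n \<ge> 0"
  using C l by (simp add: growth_rate_def)

lemma cont_wgt: "continuous_on S (\<lambda>p. wgt l n i (snd p))" "continuous_on S (\<lambda>p. wgt_up l n i k (snd p))"
    "continuous_on S (\<lambda>p. wgt_down l n i k (snd p))"
proof -
  have s: "continuous_on S (\<lambda>p. snd p)" by (intro continuous_intros)
  show "continuous_on S (\<lambda>p. wgt l n i (snd p))" "continuous_on S (\<lambda>p. wgt_up l n i k (snd p))"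
    "continuous_on S (\<lambda>p. wgt_down l n i k (snd p))"
    by (rule continuous_on_compose2[OF continuous_on_wgt(1)[of UNIV] s]
        continuous_on_compose2[OF continuous_on_wgt(2)[of UNIV] s]
        continuous_on_compose2[OF continuous_on_wgt(3)[of UNIV] s], simp)+
qed

lemma cont_updown: "continuous_on S (\<lambda>p. up n i k (fst p) (snd p))" "continuous_on S (\<lambda>p. down n i k (fst p) (snd p))"
  unfolding up_def down_def by (intro continuous_intros cont_wgt continuous_on_b_component)+

lemma cont_updown_section: "continuous_on S (up n i k t)" "continuous_on S (down n i k t)"
  unfolding up_def[abs_def] down_def[abs_def] by (intro continuous_intros continuous_on_wgt continuous_on_b_section)+

lemma updown_bounds:
  assumes "norm x \<le> l / 4"
  shows "0 \<le> up n i k t x" "up n i k t x \<le> 4 * C * wgt l n i x" "0 \<le> down n i k t x" "down n i k t x \<le> 4 * C * wgt l n i x"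
proof -
  note [simp] = wgt_up_nonneg[OF assms l] wgt_down_nonneg[OF assms l] wgt_nonneg[OF assms l]
  have m: "max 0 (b t x $ k) \<le> C" "max 0 (- (b t x $ k)) \<le> C" using b_component[of t x k] by auto
  show "0 \<le> up n i k t x" "0 \<le> down n i k t x" by (simp_all add: up_def down_def)
  have "up n i k t x \<le> C * (4 * wgt l n i x)"
    unfolding up_def by (intro mult_mono m wgt_up_le assms l C) auto
  then show "up n i k t x \<le> 4 * C * wgt l n i x" by (simp add: mult_ac)
  have "down n i k t x \<le> C * (4 * wgt l n i x)"
    unfolding down_def by (intro mult_mono m wgt_down_le assms l C) auto
  then show "down n i k t x \<le> 4 * C * wgt l n i x" by (simp add: mult_ac)
qed

lemma occ_nonneg: "t \<in> {0..T} \<Longrightarrow> 0 \<le> occ n t i"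
  unfolding occ_def by (intro E_nonneg continuous_on_wgt) (auto intro: wgt_nonneg l)

lemma occ_outside: "i \<notin> lat n \<Longrightarrow> occ n t i = 0"
proof -
  assume "i \<notin> lat n"
  then have "wgt l n i = (\<lambda>_. 0)" by (intro ext wgt_outside)
  then show ?thesis by (simp add: occ_def)
qed

lemma sum_occ_mult:
  assumes "t \<in> {0..T}"
  shows "(\<Sum>i\<in>lat n. occ n t i * c i) = E t (\<lambda>x. \<Sum>i\<in>lat n. wgt l n i x * c i)"
  unfolding occ_def using assms
  by (subst Bochner_Integration.integral_sum) (auto intro!: integrable_E continuous_intros continuous_on_wgt)

lemma sum_occ: "t \<in> {0..T} \<Longrightarrow> (\<Sum>i\<in>lat n. occ n t i) = 1"
  using sum_occ_mult[of t n "\<lambda>_. 1"] by (simp only: sum_wgt mult_1_right E_const)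

lemma continuous_on_occ: "continuous_on {0..T} (\<lambda>t. occ n t i)"
  unfolding occ_def by (rule continuous_on_E) (rule cont_wgt)

lemma cont_interval_int:
  assumes "continuous_on {0..T} g" "0 \<le> s" "t \<le> T"
  shows "(g :: real \<Rightarrow> real) integrable_on {s..t}"
  using continuous_on_subset[OF assms(1)] assms(2,3) by (intro integrable_continuous_real) auto

lemma cont_E_updown: "continuous_on {0..T} (\<lambda>s. E s (up n i k s))" "continuous_on {0..T} (\<lambda>s. E s (down n i k s))"
  by (intro continuous_on_E cont_updown)+

text \<open>The weight itself is the test function in \<open>transport\<close>. The second bound is
  relative to the mass at j, so even a tiny mass changes little during a short step and fluxes can
  be divided by it.\<close>

lemma occ_diff:
  assumes st: "0 \<le> s" "s \<le> t" "t \<le> T"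
  shows "occ n t j - occ n s j = real (Suc n) / l * integral {s..t} (\<lambda>r. \<Sum>k\<in>UNIV. E r (\<lambda>x. b r x $ k * (wgt_down l n j k x - wgt_up l n j k x)))"
    and "\<bar>occ n t j - occ n s j\<bar> \<le> growth_rate n * integral {s..t} (\<lambda>r. occ n r j)"
proof -
  let ?D = "\<lambda>x. (\<chi> k. real (Suc n) / l * (wgt_down l n j k x - wgt_up l n j k x)) :: real^'n"
  have cD: "continuous_on UNIV ?D"
    by (intro continuous_on_vec_lambda continuous_intros continuous_on_wgt)
  have "occ n t j - occ n s j = integral {s..t} (\<lambda>r. E r (\<lambda>x. b r x \<bullet> ?D x))"
    unfolding occ_def by (rule transport[OF GDERIV_wgt cD st])
  also have "\<dots> = integral {s..t} (\<lambda>r. real (Suc n) / l * (\<Sum>k\<in>UNIV. E r (\<lambda>x. b r x $ k * (wgt_down l n j k x - wgt_up l n j k x))))"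
  proof (rule integral_cong)
    fix r assume r: "r \<in> {s..t}"
    have "E r (\<lambda>x. b r x \<bullet> ?D x) = E r (\<lambda>x. \<Sum>k\<in>UNIV. real (Suc n) / l * (b r x $ k * (wgt_down l n j k x - wgt_up l n j k x)))"
      by (simp add: inner_vec_def mult_ac)
    also have "\<dots> = (\<Sum>k\<in>UNIV. E r (\<lambda>x. real (Suc n) / l * (b r x $ k * (wgt_down l n j k x - wgt_up l n j k x))))"
      using r st by (intro Bochner_Integration.integral_sum integrable_E continuous_intros continuous_on_wgt continuous_on_b_section) auto
    finally show "E r (\<lambda>x. b r x \<bullet> ?D x) = real (Suc n) / l * (\<Sum>k\<in>UNIV. E r (\<lambda>x. b r x $ k * (wgt_down l n j k x - wgt_up l n j k x)))"
      by (simp add: sum_distrib_left del: of_nat_Suc)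
  qed
  finally show eq: "occ n t j - occ n s j = real (Suc n) / l * integral {s..t} (\<lambda>r. \<Sum>k\<in>UNIV. E r (\<lambda>x. b r x $ k * (wgt_down l n j k x - wgt_up l n j k x)))"
    by simp
  have cE: "continuous_on {0..T} (\<lambda>r. \<Sum>k\<in>UNIV. E r (\<lambda>x. b r x $ k * (wgt_down l n j k x - wgt_up l n j k x)))"
    by (intro continuous_on_sum continuous_on_E continuous_intros cont_wgt continuous_on_b_component)
  have "\<bar>integral {s..t} (\<lambda>r. \<Sum>k\<in>UNIV. E r (\<lambda>x. b r x $ k * (wgt_down l n j k x - wgt_up l n j k x)))\<bar>
      \<le> integral {s..t} (\<lambda>r. 4 * real CARD('n) * C * occ n r j)"
    unfolding real_norm_def[symmetric]
  proof (rule integral_norm_bound_integral)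
    fix r assume r: "r \<in> {s..t}"
    then have rT: "r \<in> {0..T}" using st by auto
    have "\<bar>E r (\<lambda>x. b r x $ k * (wgt_down l n j k x - wgt_up l n j k x))\<bar> \<le> C * (4 * occ n r j)" for k
    proof -
      have "\<bar>E r (\<lambda>x. b r x $ k * (wgt_down l n j k x - wgt_up l n j k x))\<bar> \<le> E r (\<lambda>x. \<bar>b r x $ k * (wgt_down l n j k x - wgt_up l n j k x)\<bar>)"
        by (rule integral_abs_bound)
      also have "\<dots> \<le> E r (\<lambda>x. C * (4 * wgt l n j x))"
      proof (rule E_mono[OF rT])
        fix x :: "real^'n" assume x: "norm x \<le> l / 4"
        have "\<bar>wgt_down l n j k x - wgt_up l n j k x\<bar> \<le> 4 * wgt l n j x"
          using wgt_up_nonneg[OF x l] wgt_down_nonneg[OF x l] wgt_up_le[OF x l] wgt_down_le[OF x l]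
          by (smt (verit, best))
        then show "\<bar>b r x $ k * (wgt_down l n j k x - wgt_up l n j k x)\<bar> \<le> C * (4 * wgt l n j x)"
          unfolding abs_mult using b_component C by (intro mult_mono) auto
      qed (intro continuous_intros continuous_on_wgt continuous_on_b_section)+
      finally show ?thesis by (simp add: occ_def)
    qed
    then have "\<bar>\<Sum>k\<in>UNIV. E r (\<lambda>x. b r x $ k * (wgt_down l n j k x - wgt_up l n j k x))\<bar> \<le> (\<Sum>k\<in>(UNIV::'n set). C * (4 * occ n r j))"
      by (intro order_trans[OF sum_abs] sum_mono)
    then show "norm (\<Sum>k\<in>UNIV. E r (\<lambda>x. b r x $ k * (wgt_down l n j k x - wgt_up l n j k x))) \<le> 4 * real CARD('n) * C * occ n r j"
      by (simp add: mult_ac)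
  qed (use st in \<open>auto intro!: cont_interval_int cE continuous_intros continuous_on_occ\<close>)
  then have "real (Suc n) / l * \<bar>integral {s..t} (\<lambda>r. \<Sum>k\<in>UNIV. E r (\<lambda>x. b r x $ k * (wgt_down l n j k x - wgt_up l n j k x)))\<bar>
      \<le> real (Suc n) / l * (4 * real CARD('n) * C * integral {s..t} (\<lambda>r. occ n r j))"
    using l by (intro mult_left_mono) auto
  then show "\<bar>occ n t j - occ n s j\<bar> \<le> growth_rate n * integral {s..t} (\<lambda>r. occ n r j)"
    unfolding eq abs_mult using l by (simp add: growth_rate_def mult_ac del: of_nat_Suc)
qed

context
  fixes n :: nat and h t :: real
  assumes h: "h \<ge> 0" "4 * growth_rate n * h \<le> 1" and t: "0 \<le> t" "t + h \<le> T"
begin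

lemma tT: "t \<in> {0..T}" and thT: "s \<in> {t..t + h} \<Longrightarrow> s \<in> {0..T}"
  using t h by auto

text \<open>Gronwall by looking at the time where the mass is largest on the step: the increase up
  to there is at most half of the maximum.\<close>

lemma occ_le: assumes s: "s \<in> {t..t + h}" shows "occ n s i \<le> 2 * occ n t i"
proof -
  have "continuous_on {t..t + h} (\<lambda>r. occ n r i)"
    by (rule continuous_on_subset[OF continuous_on_occ]) (use t in auto)
  then obtain r where r: "r \<in> {t..t + h}" "\<And>s. s \<in> {t..t + h} \<Longrightarrow> occ n s i \<le> occ n r i"
    using continuous_attains_sup[of "{t..t + h}" "\<lambda>r. occ n r i"] h by auto
  let ?m = "occ n r i"
  have m: "0 \<le> ?m" using occ_nonneg[OF thT[OF r(1)]] .
  have "?m - occ n t i \<le> growth_rate n * integral {t..r} (\<lambda>s. occ n s i)"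
    using occ_diff(2)[of t r n i] r(1) t by simp
  also have "integral {t..r} (\<lambda>s. occ n s i) \<le> integral {t..r} (\<lambda>s. ?m)"
    using r t by (intro integral_le cont_interval_int continuous_on_occ) auto
  also have "\<dots> \<le> h * ?m" using r(1) m by (simp add: mult_right_mono)
  finally have "?m - occ n t i \<le> growth_rate n * (h * ?m)"
    using growth_rate_nonneg[of n] by (simp add: mult_left_mono)
  also have "\<dots> \<le> 1 / 2 * ?m"
  proof -
    have "growth_rate n * h \<le> 1 / 2" using h by simp
    then show ?thesis using m mult_right_mono[of "growth_rate n * h" "1/2" ?m] by (simp add: mult.assoc)
  qed
  finally show ?thesis using r(2)[OF s] by simp
qed

lemma sum_occ_diff: assumes s: "s \<in> {t..t + h}" shows "(\<Sum>i\<in>lat n. \<bar>occ n s i - occ n t i\<bar>) \<le> growth_rate n * h"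
proof -
  have int: "(\<lambda>r. occ n r i) integrable_on {t..s}" for i
    using s t by (intro cont_interval_int continuous_on_occ) auto
  have "(\<Sum>i\<in>lat n. \<bar>occ n s i - occ n t i\<bar>) \<le> (\<Sum>i\<in>lat n. growth_rate n * integral {t..s} (\<lambda>r. occ n r i))"
    using s t by (intro sum_mono occ_diff(2)) auto
  also have "\<dots> = growth_rate n * integral {t..s} (\<lambda>r. \<Sum>i\<in>lat n. occ n r i)"
    using int finite_lat by (subst Henstock_Kurzweil_Integration.integral_sum) (auto simp: sum_distrib_left)
  also have "integral {t..s} (\<lambda>r. \<Sum>i\<in>lat n. occ n r i) = integral {t..s} (\<lambda>r. 1)"
    using s t by (intro integral_cong sum_occ) auto
  also have "\<dots> \<le> h" using s by simp
  finally show ?thesis using growth_rate_nonneg[of n] by (simp add: mult_left_mono)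
qed

text \<open>The bound by the integral of the masses is kept for summing over i, where the masses add
  up to 1; the bound by the mass at time t is for the transition probabilities.\<close>

lemma flux_bounds:
  assumes a: "a = up n i k \<or> a = down n i k"
  shows "0 \<le> flux n h t a" "flux n h t a \<le> real (Suc n) / l * (4 * C * integral {t..t + h} (\<lambda>s. occ n s i))"
    "flux n h t a \<le> real (Suc n) / l * (8 * C * h * occ n t i)"
proof -
  have ca: "continuous_on {0..T} (\<lambda>s. E s (a s))" using a cont_E_updown by auto
  have cs: "continuous_on UNIV (a s)" for s using a cont_updown_section by auto
  have int: "(\<lambda>s. E s (a s)) integrable_on {t..t + h}" by (rule cont_interval_int[OF ca t])
  have into: "(\<lambda>s. 4 * C * occ n s i) integrable_on {t..t + h}"
    by (intro cont_interval_int t continuous_intros continuous_on_occ)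
  have pos: "0 \<le> E s (a s)" "E s (a s) \<le> 4 * C * occ n s i" if "s \<in> {t..t + h}" for s
  proof -
    note sT = thT[OF that]
    show "0 \<le> E s (a s)" using a updown_bounds by (intro E_nonneg sT cs) auto
    have "E s (a s) \<le> E s (\<lambda>x. 4 * C * wgt l n i x)"
      using a updown_bounds by (intro E_mono sT cs) (auto intro!: continuous_intros continuous_on_wgt)
    then show "E s (a s) \<le> 4 * C * occ n s i" by (simp add: occ_def)
  qed
  have N: "real (Suc n) / l \<ge> 0" using l by simp
  show "0 \<le> flux n h t a" unfolding flux_def
    using pos int by (intro mult_nonneg_nonneg N integral_nonneg) auto
  have *: "integral {t..t + h} (\<lambda>s. E s (a s)) \<le> integral {t..t + h} (\<lambda>s. 4 * C * occ n s i)"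
    by (rule integral_le[OF int into pos(2)])
  then show "flux n h t a \<le> real (Suc n) / l * (4 * C * integral {t..t + h} (\<lambda>s. occ n s i))"
    unfolding flux_def by (intro mult_left_mono N) simp
  have "integral {t..t + h} (\<lambda>s. 4 * C * occ n s i) \<le> integral {t..t + h} (\<lambda>s. 4 * C * (2 * occ n t i))"
    by (intro integral_le into integrable_const_ivl mult_left_mono occ_le) (use C in auto)
  also have "\<dots> = 8 * C * h * occ n t i" using h by simp
  finally show "flux n h t a \<le> real (Suc n) / l * (8 * C * h * occ n t i)"
    unfolding flux_def using * by (intro mult_left_mono N) simp
qed

lemma sum_moves: "(\<Sum>m\<in>(UNIV :: ('n \<times> bool) set). g m) = (\<Sum>k\<in>UNIV. g (k, True) + g (k, False))"
  for g :: "'n \<times> bool \<Rightarrow> 'c::comm_monoid_add"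
proof -
  have "(\<Sum>m\<in>UNIV. g m) = (\<Sum>k\<in>UNIV. \<Sum>u\<in>UNIV. g (k, u))"
    by (simp add: sum.cartesian_product)
  then show ?thesis by (simp add: UNIV_bool add.commute)
qed

lemma jump_nonneg: "0 \<le> jump n h t i m"
  unfolding jump_def by (auto split: prod.split intro!: flux_bounds)

text \<open>The origin of the condition on h: each of the 2 CARD('n) fluxes is at most 8 C h (Suc n
  / l) times the mass, in total 4 h \<open>growth_rate n\<close> times the mass.\<close>

lemma sum_jump_le: "(\<Sum>m\<in>UNIV. jump n h t i m) \<le> occ n t i"
proof -
  have "(\<Sum>m\<in>UNIV. jump n h t i m) \<le> (\<Sum>m\<in>(UNIV::('n \<times> bool) set). real (Suc n) / l * (8 * C * h * occ n t i))"
  proof (rule sum_mono)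
    fix m :: "'n \<times> bool"
    obtain k u where m: "m = (k, u)" by fastforce
    show "jump n h t i m \<le> real (Suc n) / l * (8 * C * h * occ n t i)"
      unfolding jump_def m prod.case by (rule flux_bounds(3)[of _ i k]) simp
  qed
  also have "\<dots> = 4 * growth_rate n * h * occ n t i"
    by (simp add: growth_rate_def del: of_nat_Suc) 
  also have "\<dots> \<le> 1 * occ n t i" using h occ_nonneg[OF tT] by (intro mult_right_mono) auto
  finally show ?thesis by simp
qed

lemma sum_jump_total: "(\<Sum>i\<in>lat n. \<Sum>m\<in>UNIV. jump n h t i m) \<le> 8 * real CARD('n) * C * h * (real (Suc n) / l)"
proof -
  have int: "(\<lambda>r. occ n r i) integrable_on {t..t + h}" for i
    using t by (intro cont_interval_int continuous_on_occ) auto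
  have "(\<Sum>i\<in>lat n. \<Sum>m\<in>UNIV. jump n h t i m) \<le> (\<Sum>i\<in>lat n. \<Sum>m\<in>(UNIV::('n \<times> bool) set). real (Suc n) / l * (4 * C * integral {t..t + h} (\<lambda>s. occ n s i)))"
  proof (intro sum_mono)
    fix i and m :: "'n \<times> bool"
    obtain k u where m: "m = (k, u)" by fastforce
    show "jump n h t i m \<le> real (Suc n) / l * (4 * C * integral {t..t + h} (\<lambda>s. occ n s i))"
      unfolding jump_def m prod.case by (rule flux_bounds(2)[of _ i k]) simp
  qed
  also have "\<dots> = 8 * real CARD('n) * C * (real (Suc n) / l) * (\<Sum>i\<in>lat n. integral {t..t + h} (\<lambda>s. occ n s i))"
    by (simp add: sum_distrib_left sum_divide_distrib mult_ac del: of_nat_Suc)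
  also have "(\<Sum>i\<in>lat n. integral {t..t + h} (\<lambda>s. occ n s i)) = integral {t..t + h} (\<lambda>s. \<Sum>i\<in>lat n. occ n s i)"
    using int finite_lat by (subst Henstock_Kurzweil_Integration.integral_sum) auto
  also have "\<dots> = integral {t..t + h} (\<lambda>s. 1)"
    using thT by (intro integral_cong sum_occ) auto
  also have "\<dots> = h" using h by simp
  finally show ?thesis by (simp add: mult_ac)
qed

lemma flux_zero: "(\<And>s x. a s x = 0) \<Longrightarrow> flux n h t a = 0"
  by (simp add: flux_def)

text \<open>Only the lower neighbour sends mass upwards to j, and by \<open>wgt_down_shift\<close>
  its outflow is a flux weighted with \<open>wgt_down\<close> at j. For j k = 0 there is no such
  neighbour and both sides vanish.\<close>

lemma inflow_up: "(\<Sum>i\<in>lat n. jump n h t i (k, True) * of_bool (move i (k, True) = j)) = flux n h t (\<lambda>s x. max 0 (b s x $ k) * wgt_down l n j k x)"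
proof (cases "j k = 0")
  case True
  then have "move i (k, True) \<noteq> j" for i by (auto simp: move_def)
  moreover have "flux n h t (\<lambda>s x. max 0 (b s x $ k) * wgt_down l n j k x) = 0"
    using True by (intro flux_zero) (simp add: wgt_down_zero)
  ultimately show ?thesis by simp
next
  case False
  define i where "i = fun_upd j k (j k - 1)"
  have mv: "move i' (k, True) = j \<longleftrightarrow> i' = i" for i'
    using False by (auto simp: move_def i_def fun_eq_iff)
  have j: "j = fun_upd i k (Suc (i k))" using False by (auto simp: i_def fun_eq_iff)
  have eq: "flux n h t (\<lambda>s x. max 0 (b s x $ k) * wgt_down l n j k x) = jump n h t i (k, True)"
    unfolding jump_def up_def[abs_def] by (subst j) (simp add: wgt_down_shift)
  \<comment> \<open>The sum runs over the lattice, so a source outside of it must not carry any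
    flux.\<close>
  have "jump n h t i (k, True) = 0" if "i \<notin> lat n"
  proof -
    from that obtain m where "i m > Suc n" unfolding lat_def by (auto simp: not_le)
    then have "\<not> fun_upd i k (Suc (i k)) m \<le> Suc n" by (cases "m = k") auto
    then have "fun_upd i k (Suc (i k)) \<notin> lat n" unfolding lat_def by blast
    then show ?thesis by (simp add: jump_def up_def[abs_def] wgt_up_outside flux_zero)
  qed
  then show ?thesis unfolding eq by (simp add: mv of_bool_def if_distrib sum.delta finite_lat cong: if_cong)
qed

lemma inflow_down: "(\<Sum>i\<in>lat n. jump n h t i (k, False) * of_bool (move i (k, False) = j)) = flux n h t (\<lambda>s x. max 0 (- (b s x $ k)) * wgt_up l n j k x)"
proof -
  define i where "i = fun_upd j k (Suc (j k))"
  \<comment> \<open>Without the restriction, truncation would make j its own second preimage when j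
    k = 0; the jump from there is 0.\<close>
  have mv: "move i' (k, False) = j \<longleftrightarrow> i' = i" if "i' k \<noteq> 0" for i'
    using that by (auto simp: move_def i_def fun_eq_iff)
  have z: "jump n h t i' (k, False) = 0" if "i' k = 0" for i'
    using that by (simp add: jump_def down_def[abs_def] wgt_down_zero flux_zero)
  have eq: "flux n h t (\<lambda>s x. max 0 (- (b s x $ k)) * wgt_up l n j k x) = jump n h t i (k, False)"
    unfolding jump_def down_def[abs_def] i_def by (simp add: wgt_down_shift)
  have out: "jump n h t i (k, False) = 0" if "i \<notin> lat n"
    using that by (simp add: jump_def down_def[abs_def] wgt_down_outside flux_zero)
  have "(\<Sum>i'\<in>lat n. jump n h t i' (k, False) * of_bool (move i' (k, False) = j)) = (\<Sum>i'\<in>lat n. if i' = i then jump n h t i (k, False) else 0)"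
  proof (intro sum.cong refl)
    fix i'
    show "jump n h t i' (k, False) * of_bool (move i' (k, False) = j) = (if i' = i then jump n h t i (k, False) else 0)"
      using mv[of i'] z[of i'] by (cases "i' k = 0") (auto simp: i_def)
  qed
  then show ?thesis unfolding eq using out by (simp add: sum.delta' finite_lat)
qed

text \<open>Pointwise, b_k (wgt_down - wgt_up) = b+ wgt_down + b- wgt_up - b+ wgt_up - b- wgt_down
  with the positive and negative parts of b_k. The first two terms are the inflow to j, the last two
  the outflow from j.\<close>

lemma balance:
  "occ n (t + h) j = occ n t j - (\<Sum>m\<in>UNIV. jump n h t j m)
    + (\<Sum>m\<in>UNIV. \<Sum>i\<in>lat n. jump n h t i m * of_bool (move i m = j))"
proof -
  let ?p = "\<lambda>k s x. max 0 (b s x $ k)" and ?q = "\<lambda>k s x. max 0 (- (b s x $ k))"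
  have fl: "flux n h t (\<lambda>s x. ?p k s x * wgt_down l n j k x) + flux n h t (\<lambda>s x. ?q k s x * wgt_up l n j k x)
      - flux n h t (up n j k) - flux n h t (down n j k)
      = real (Suc n) / l * integral {t..t + h} (\<lambda>r. E r (\<lambda>x. b r x $ k * (wgt_down l n j k x - wgt_up l n j k x)))" for k
  proof -
    have cE: "continuous_on {0..T} (\<lambda>s. E s (\<lambda>x. ?p k s x * wgt_down l n j k x))"
        "continuous_on {0..T} (\<lambda>s. E s (\<lambda>x. ?q k s x * wgt_up l n j k x))"
      by (intro continuous_on_E continuous_intros cont_wgt continuous_on_b_component)+
    note I = cont_interval_int[OF cE(1) t] cont_interval_int[OF cE(2) t] cont_interval_int[OF cont_E_updown(1) t] cont_interval_int[OF cont_E_updown(2) t]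
    have "integral {t..t + h} (\<lambda>r. E r (\<lambda>x. b r x $ k * (wgt_down l n j k x - wgt_up l n j k x))) =
        integral {t..t + h} (\<lambda>s. E s (\<lambda>x. ?p k s x * wgt_down l n j k x) + E s (\<lambda>x. ?q k s x * wgt_up l n j k x) - E s (up n j k s) - E s (down n j k s))"
    proof (rule integral_cong)
      fix s assume "s \<in> {t..t + h}"
      note sT = thT[OF this]
      have i: "integrable (law (\<mu> s)) (\<lambda>x. ?p k s x * wgt_down l n j k x)" "integrable (law (\<mu> s)) (\<lambda>x. ?q k s x * wgt_up l n j k x)"
        "integrable (law (\<mu> s)) (up n j k s)" "integrable (law (\<mu> s)) (down n j k s)"
        by (intro integrable_E sT continuous_intros continuous_on_wgt continuous_on_b_section cont_updown_section)+
      have "b s x $ k * (wgt_down l n j k x - wgt_up l n j k x) =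
          ?p k s x * wgt_down l n j k x + ?q k s x * wgt_up l n j k x - up n j k s x - down n j k s x" for x
        by (simp add: up_def down_def max_def algebra_simps)
      then show "E s (\<lambda>x. b s x $ k * (wgt_down l n j k x - wgt_up l n j k x)) =
          E s (\<lambda>x. ?p k s x * wgt_down l n j k x) + E s (\<lambda>x. ?q k s x * wgt_up l n j k x) - E s (up n j k s) - E s (down n j k s)"
        using i by simp
    qed
    also have "\<dots> = integral {t..t + h} (\<lambda>s. E s (\<lambda>x. ?p k s x * wgt_down l n j k x)) + integral {t..t + h} (\<lambda>s. E s (\<lambda>x. ?q k s x * wgt_up l n j k x))
        - integral {t..t + h} (\<lambda>s. E s (up n j k s)) - integral {t..t + h} (\<lambda>s. E s (down n j k s))"
      by (simp add: Henstock_Kurzweil_Integration.integral_diff Henstock_Kurzweil_Integration.integral_add integrable_add integrable_diff I)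
    finally have "c * integral {t..t + h} (\<lambda>s. E s (\<lambda>x. ?p k s x * wgt_down l n j k x)) + c * integral {t..t + h} (\<lambda>s. E s (\<lambda>x. ?q k s x * wgt_up l n j k x))
        - c * integral {t..t + h} (\<lambda>s. E s (up n j k s)) - c * integral {t..t + h} (\<lambda>s. E s (down n j k s)) =
        c * integral {t..t + h} (\<lambda>r. E r (\<lambda>x. b r x $ k * (wgt_down l n j k x - wgt_up l n j k x)))" for c
      by (simp only: right_diff_distrib distrib_left)
    then show ?thesis unfolding flux_def .
  qed
  have cE: "continuous_on {0..T} (\<lambda>r. E r (\<lambda>x. b r x $ k * (wgt_down l n j k x - wgt_up l n j k x)))" for k
    by (intro continuous_on_E continuous_intros cont_wgt continuous_on_b_component)
  have "occ n (t + h) j - occ n t j = real (Suc n) / l * integral {t..t + h} (\<lambda>r. \<Sum>k\<in>UNIV. E r (\<lambda>x. b r x $ k * (wgt_down l n j k x - wgt_up l n j k x)))"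
    using t h by (intro occ_diff(1)) auto
  also have "\<dots> = (\<Sum>k\<in>UNIV. real (Suc n) / l * integral {t..t + h} (\<lambda>r. E r (\<lambda>x. b r x $ k * (wgt_down l n j k x - wgt_up l n j k x))))"
    by (subst Henstock_Kurzweil_Integration.integral_sum) (auto intro!: cont_interval_int[OF cE t] simp: sum_distrib_left simp del: of_nat_Suc)
  also have "\<dots> = (\<Sum>k\<in>UNIV. \<Sum>i\<in>lat n. jump n h t i (k, True) * of_bool (move i (k, True) = j))
      + (\<Sum>k\<in>UNIV. \<Sum>i\<in>lat n. jump n h t i (k, False) * of_bool (move i (k, False) = j))
      - (\<Sum>k\<in>UNIV. jump n h t j (k, True)) - (\<Sum>k\<in>UNIV. jump n h t j (k, False))"
    unfolding fl[symmetric] inflow_up inflow_down by (simp add: sum.distrib sum_subtractf jump_def)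
  finally show ?thesis by (simp add: sum_moves sum.distrib)
qed

text \<open>The downward identity carries the jump as a factor: at \<open>i k = 0\<close> the move
  is truncated, and both sides agree because the jump is 0.\<close>

lemma lat_pos_move:
  "lat_pos l n (move i (k, True)) - lat_pos l n i = (l / real (Suc n)) *\<^sub>R axis k 1"
  "jump n h t i (k, False) *\<^sub>R (lat_pos l n (move i (k, False)) - lat_pos l n i) = - (jump n h t i (k, False) * (l / real (Suc n))) *\<^sub>R axis k 1"
proof -
  have alg: "l * ((1 + a) / N - 1 / 2) - l * (a / N - 1 / 2) = l / N" for a N
    by (simp add: algebra_simps add_divide_distrib)
  have shift: "lat_pos l n (fun_upd i k (Suc (i k))) - lat_pos l n i = (l / real (Suc n)) *\<^sub>R axis k 1" for i
    unfolding vec_eq_iff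
  proof
    fix m
    show "(lat_pos l n (fun_upd i k (Suc (i k))) - lat_pos l n i) $ m = ((l / real (Suc n)) *\<^sub>R axis k 1) $ m"
      using alg[of "real (i k)" "real (Suc n)"] by (cases "m = k") (simp_all add: lat_pos_def axis_def)
  qed
  then show "lat_pos l n (move i (k, True)) - lat_pos l n i = (l / real (Suc n)) *\<^sub>R axis k 1"
    by (simp add: move_def)
  show "jump n h t i (k, False) *\<^sub>R (lat_pos l n (move i (k, False)) - lat_pos l n i) = - (jump n h t i (k, False) * (l / real (Suc n))) *\<^sub>R axis k 1"
  proof (cases "i k = 0")
    case True
    then have "jump n h t i (k, False) = 0" by (simp add: jump_def down_def[abs_def] wgt_down_zero flux_zero)
    then show ?thesis by simp
  next
    case False
    then have "fun_upd (move i (k, False)) k (Suc (move i (k, False) k)) = i" by (auto simp: move_def fun_eq_iff)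
    with shift[of "move i (k, False)"]
    have "lat_pos l n i - lat_pos l n (move i (k, False)) = (l / real (Suc n)) *\<^sub>R axis k 1" by simp
    then have "lat_pos l n (move i (k, False)) - lat_pos l n i = - (l / real (Suc n)) *\<^sub>R axis k 1"
      by (metis minus_diff_eq scaleR_minus_left)
    then show ?thesis by simp
  qed
qed

text \<open>Three errors: edge weights in place of full weights (4 C / sqrt (n+1)), the value of b
  at time t and the lattice point in place of b(s, x) (\<epsilon> and \<kappa>, with the variance of
  the rounding), and the change of the masses during the step (growth rate).\<close>

lemma drift_pointwise:
  assumes \<kappa>: "\<kappa> \<ge> 0" "\<And>s t x y. norm (b s x - b t y) \<le> \<epsilon> + \<kappa> * (\<bar>s - t\<bar> + (dist x y)\<^sup>2)"
    and s: "s \<in> {t..t + h}"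
  shows "(\<Sum>i\<in>lat n. \<bar>E s (up n i k s) - E s (down n i k s) - b t (lat_pos l n i) $ k * occ n t i\<bar>) \<le>
    4 * C / sqrt (real (Suc n)) + \<epsilon> + \<kappa> * (h + l\<^sup>2 * real CARD('n) / real (Suc n)) + C * (growth_rate n * h)"
proof -
  note sT = thT[OF s]
  let ?\<beta> = "\<lambda>i. b t (lat_pos l n i) $ k"
  let ?f = "\<lambda>i x. \<bar>up n i k s x - down n i k s x - b s x $ k * wgt l n i x\<bar> + \<bar>b s x $ k - ?\<beta> i\<bar> * wgt l n i x"
  have cf: "continuous_on UNIV (?f i)" for i
    by (intro continuous_intros cont_updown_section continuous_on_wgt continuous_on_b_section)
  have pt: "\<bar>E s (up n i k s) - E s (down n i k s) - ?\<beta> i * occ n t i\<bar> \<le> E s (?f i) + C * \<bar>occ n s i - occ n t i\<bar>" for i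
  proof -
    have i: "integrable (law (\<mu> s)) (up n i k s)" "integrable (law (\<mu> s)) (down n i k s)" "integrable (law (\<mu> s)) (wgt l n i)"
      by (intro integrable_E sT cont_updown_section continuous_on_wgt)+
    have eq: "E s (up n i k s) - E s (down n i k s) - ?\<beta> i * occ n s i = E s (\<lambda>x. up n i k s x - down n i k s x - ?\<beta> i * wgt l n i x)"
      using i by (simp add: occ_def)
    have "\<bar>E s (up n i k s) - E s (down n i k s) - ?\<beta> i * occ n s i\<bar> \<le> E s (\<lambda>x. \<bar>up n i k s x - down n i k s x - ?\<beta> i * wgt l n i x\<bar>)"
      unfolding eq by (rule integral_abs_bound)
    also have "\<dots> \<le> E s (?f i)"
    proof (rule E_mono[OF sT])
      fix x :: "real^'n" assume x: "norm x \<le> l / 4"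
      have eq: "up n i k s x - down n i k s x - ?\<beta> i * wgt l n i x = (up n i k s x - down n i k s x - b s x $ k * wgt l n i x) + (b s x $ k - ?\<beta> i) * wgt l n i x"
        by (simp add: algebra_simps)
      show "\<bar>up n i k s x - down n i k s x - ?\<beta> i * wgt l n i x\<bar> \<le> ?f i x"
        unfolding eq by (rule order_trans[OF abs_triangle_ineq]) (simp add: abs_mult wgt_nonneg[OF x l])
    qed (intro continuous_intros cont_updown_section continuous_on_wgt continuous_on_b_section)+
    finally have 1: "\<bar>E s (up n i k s) - E s (down n i k s) - ?\<beta> i * occ n s i\<bar> \<le> E s (?f i)" .
    have "\<bar>?\<beta> i * occ n s i - ?\<beta> i * occ n t i\<bar> \<le> C * \<bar>occ n s i - occ n t i\<bar>"
      unfolding right_diff_distrib[symmetric] abs_mult by (intro mult_right_mono b_component) auto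
    with 1 show ?thesis by linarith
  qed
  have "(\<Sum>i\<in>lat n. \<bar>E s (up n i k s) - E s (down n i k s) - ?\<beta> i * occ n t i\<bar>) \<le> (\<Sum>i\<in>lat n. E s (?f i) + C * \<bar>occ n s i - occ n t i\<bar>)"
    by (intro sum_mono pt)
  also have "\<dots> = E s (\<lambda>x. \<Sum>i\<in>lat n. ?f i x) + C * (\<Sum>i\<in>lat n. \<bar>occ n s i - occ n t i\<bar>)"
  proof -
    have "E s (\<lambda>x. \<Sum>i\<in>lat n. ?f i x) = (\<Sum>i\<in>lat n. E s (?f i))"
      by (rule Bochner_Integration.integral_sum) (intro integrable_E sT cf)
    then show ?thesis
      unfolding sum.distrib[of "\<lambda>i. E s (?f i)" "\<lambda>i. C * \<bar>occ n s i - occ n t i\<bar>"] by (simp only: sum_distrib_left)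
  qed
  also have "\<dots> \<le> (4 * C / sqrt (real (Suc n)) + (\<epsilon> + \<kappa> * (h + l\<^sup>2 * real CARD('n) / real (Suc n)))) + C * (growth_rate n * h)"
  proof (intro add_mono mult_left_mono sum_occ_diff s C)
    have "E s (\<lambda>x. \<Sum>i\<in>lat n. ?f i x) \<le> E s (\<lambda>_. 4 * C / sqrt (real (Suc n)) + (\<epsilon> + \<kappa> * (h + l\<^sup>2 * real CARD('n) / real (Suc n))))"
    proof (rule E_mono[OF sT])
      fix x :: "real^'n" assume x: "norm x \<le> l / 4"
      let ?c = "\<lambda>i. \<bar>cube_coord l x k - real (i k) / real (Suc n)\<bar>"
      have "(\<Sum>i\<in>lat n. \<bar>up n i k s x - down n i k s x - b s x $ k * wgt l n i x\<bar>) \<le> (\<Sum>i\<in>lat n. 4 * C * (?c i * wgt l n i x))"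
      proof (rule sum_mono)
        fix i
        let ?p = "max 0 (b s x $ k)" and ?q = "max 0 (- (b s x $ k))"
        have eq: "up n i k s x - down n i k s x - b s x $ k * wgt l n i x =
            ?p * (wgt_up l n i k x - wgt l n i x) - ?q * (wgt_down l n i k x - wgt l n i x)"
          by (simp add: up_def down_def max_def algebra_simps)
        have "\<bar>up n i k s x - down n i k s x - b s x $ k * wgt l n i x\<bar> \<le> ?p * \<bar>wgt_up l n i k x - wgt l n i x\<bar> + ?q * \<bar>wgt_down l n i k x - wgt l n i x\<bar>"
          unfolding eq by (rule order_trans[OF abs_triangle_ineq4]) (simp add: abs_mult)
        also have "\<dots> \<le> ?p * (4 * ?c i * wgt l n i x) + ?q * (4 * ?c i * wgt l n i x)"
          by (intro add_mono mult_left_mono wgt_up_diff wgt_down_diff x l) auto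
        also have "\<dots> = (?p + ?q) * (4 * ?c i * wgt l n i x)" by (simp add: algebra_simps)
        also have "\<dots> \<le> C * (4 * ?c i * wgt l n i x)"
          using b_component[of s x k] by (intro mult_right_mono) (auto simp: wgt_nonneg[OF x l])
        finally show "\<bar>up n i k s x - down n i k s x - b s x $ k * wgt l n i x\<bar> \<le> 4 * C * (?c i * wgt l n i x)"
          by (simp add: mult_ac)
      qed
      also have "\<dots> = 4 * C * (\<Sum>i\<in>lat n. ?c i * wgt l n i x)" by (simp add: sum_distrib_left)
      also have "\<dots> \<le> 4 * C * (1 / sqrt (real (Suc n)))" using C by (intro mult_left_mono sum_wgt_abs x l) auto
      finally have A: "(\<Sum>i\<in>lat n. \<bar>up n i k s x - down n i k s x - b s x $ k * wgt l n i x\<bar>) \<le> 4 * C / sqrt (real (Suc n))" by simp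
      have "(\<Sum>i\<in>lat n. \<bar>b s x $ k - ?\<beta> i\<bar> * wgt l n i x) \<le> (\<Sum>i\<in>lat n. (\<epsilon> + \<kappa> * (h + (dist x (lat_pos l n i))\<^sup>2)) * wgt l n i x)"
      proof (intro sum_mono mult_right_mono wgt_nonneg x l)
        fix i
        have "\<bar>b s x $ k - ?\<beta> i\<bar> \<le> norm (b s x - b t (lat_pos l n i))"
          using component_le_norm_cart[of "b s x - b t (lat_pos l n i)" k] by simp
        also have "\<dots> \<le> \<epsilon> + \<kappa> * (\<bar>s - t\<bar> + (dist x (lat_pos l n i))\<^sup>2)" by (rule \<kappa>(2))
        also have "\<dots> \<le> \<epsilon> + \<kappa> * (h + (dist x (lat_pos l n i))\<^sup>2)"
          using s \<kappa>(1) by (intro add_left_mono mult_left_mono add_right_mono) auto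
        finally show "\<bar>b s x $ k - ?\<beta> i\<bar> \<le> \<epsilon> + \<kappa> * (h + (dist x (lat_pos l n i))\<^sup>2)" .
      qed
      also have "\<dots> = (\<epsilon> + \<kappa> * h) * (\<Sum>i\<in>lat n. wgt l n i x) + \<kappa> * (\<Sum>i\<in>lat n. wgt l n i x * (dist x (lat_pos l n i))\<^sup>2)"
        by (simp add: sum_distrib_left sum.distrib[symmetric] algebra_simps)
      also have "\<dots> \<le> (\<epsilon> + \<kappa> * h) * 1 + \<kappa> * (l\<^sup>2 * real CARD('n) / real (Suc n))"
        unfolding sum_wgt using \<kappa>(1) by (intro add_left_mono mult_left_mono sum_wgt_dist x l)
      finally have B: "(\<Sum>i\<in>lat n. \<bar>b s x $ k - ?\<beta> i\<bar> * wgt l n i x) \<le> \<epsilon> + \<kappa> * (h + l\<^sup>2 * real CARD('n) / real (Suc n))"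
        by (simp add: algebra_simps)
      show "(\<Sum>i\<in>lat n. ?f i x) \<le> 4 * C / sqrt (real (Suc n)) + (\<epsilon> + \<kappa> * (h + l\<^sup>2 * real CARD('n) / real (Suc n)))"
        unfolding sum.distrib using A B by (rule add_mono)
    qed (intro continuous_intros continuous_on_sum cf continuous_on_const)+
    then show "E s (\<lambda>x. \<Sum>i\<in>lat n. ?f i x) \<le> 4 * C / sqrt (real (Suc n)) + (\<epsilon> + \<kappa> * (h + l\<^sup>2 * real CARD('n) / real (Suc n)))"
      by (simp only: E_const)
  qed
  finally show ?thesis by (simp add: add.assoc)
qed

end

definition occ_pmf :: "nat \<Rightarrow> real \<Rightarrow> ('n \<Rightarrow> nat) pmf" where
  "occ_pmf n t = embed_pmf (occ n t)"

lemma pmf_occ: "t \<in> {0..T} \<Longrightarrow> pmf (occ_pmf n t) i = occ n t i"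
  unfolding occ_pmf_def
  by (rule pmf_embed_finite[OF finite_lat]) (auto intro: occ_nonneg occ_outside sum_occ)

lemma set_occ_pmf: "t \<in> {0..T} \<Longrightarrow> set_pmf (occ_pmf n t) \<subseteq> lat n"
  using occ_outside by (auto simp: set_pmf_eq pmf_occ)

lemma integral_occ_pmf:
  fixes \<phi> :: "('n \<Rightarrow> nat) \<Rightarrow> real"
  assumes "t \<in> {0..T}"
  shows "(\<integral>i. \<phi> i \<partial>measure_pmf (occ_pmf n t)) = (\<Sum>i\<in>lat n. occ n t i * \<phi> i)"
  using integral_measure_pmf_real[OF finite_lat, of "occ_pmf n t" \<phi> n] set_occ_pmf[OF assms, of n]
  by (auto simp: pmf_occ[OF assms] mult.commute)

text \<open>In the average over \<open>occ_pmf\<close> the weight \<open>occ n t i\<close> cancels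
  the denominator of the kernel, and the spacing l/(n+1) cancels the factor in \<open>flux\<close>;
  the integrated drift is left. For the squares, a total mass of order h (n+1)/l makes jumps of
  squared length (l/(n+1))^2, which gives order h l/(n+1).\<close>

lemma lattice_kernel:
  assumes h: "h \<ge> 0" "4 * growth_rate n * h \<le> 1" and t: "0 \<le> t" "t + h \<le> T"
    and \<kappa>: "\<kappa> \<ge> 0" "\<And>s t x y. norm (b s x - b t y) \<le> \<epsilon> + \<kappa> * (\<bar>s - t\<bar> + (dist x y)\<^sup>2)"
  obtains K where "\<And>i. finite (set_pmf (K i))" "bind_pmf (occ_pmf n t) K = occ_pmf n (t + h)"
    "(\<integral>i. norm ((\<integral>j. lat_pos l n j - lat_pos l n i \<partial>measure_pmf (K i)) - h *\<^sub>R b t (lat_pos l n i)) \<partial>measure_pmf (occ_pmf n t)) \<le>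
      h * (real CARD('n) * (4 * C / sqrt (real (Suc n)) + \<epsilon> + \<kappa> * (h + l\<^sup>2 * real CARD('n) / real (Suc n)) + C * (growth_rate n * h)))"
    "(\<integral>i. (\<integral>j. (norm (lat_pos l n j - lat_pos l n i))\<^sup>2 \<partial>measure_pmf (K i)) \<partial>measure_pmf (occ_pmf n t)) \<le>
      h * (8 * real CARD('n) * C * (l / real (Suc n)))"
proof -
  have tT: "t \<in> {0..T}" "t + h \<in> {0..T}" using t h by auto
  note P = pmf_occ[OF tT(1), of n]
  let ?N = "real (Suc n)" and ?P = "occ_pmf n t" and ?J = "jump n h t" and ?pos = "lat_pos l n :: ('n \<Rightarrow> nat) \<Rightarrow> real^'n"
  let ?B = "4 * C / sqrt ?N + \<epsilon> + \<kappa> * (h + l\<^sup>2 * real CARD('n) / ?N) + C * (growth_rate n * h)"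
  have sub: "set_pmf ?P \<subseteq> lat n" by (rule set_occ_pmf[OF tT(1)])
  have "\<exists>K. (\<forall>i. finite (set_pmf (K i))) \<and> bind_pmf ?P K = occ_pmf n (t + h) \<and>
    (\<forall>i (F :: ('n \<Rightarrow> nat) \<Rightarrow> real^'n). pmf ?P i *\<^sub>R (\<integral>j. F j \<partial>measure_pmf (K i)) =
        pmf ?P i *\<^sub>R F i + (\<Sum>m\<in>UNIV. ?J i m *\<^sub>R (F (move i m) - F i))) \<and>
    (\<forall>i (F :: ('n \<Rightarrow> nat) \<Rightarrow> real). pmf ?P i * (\<integral>j. F j \<partial>measure_pmf (K i)) =
        pmf ?P i * F i + (\<Sum>m\<in>UNIV. ?J i m * (F (move i m) - F i)))"
  proof (rule jump_kernel[of "lat n" ?P ?J "occ_pmf n (t + h)" move])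
    show "pmf (occ_pmf n (t + h)) j = pmf ?P j - (\<Sum>m\<in>UNIV. ?J j m) + (\<Sum>m\<in>UNIV. \<Sum>i\<in>lat n. ?J i m * of_bool (move i m = j))" for j
      unfolding P pmf_occ[OF tT(2)] by (rule balance[OF h t])
    show "(\<Sum>m\<in>UNIV. ?J i m) \<le> pmf ?P i" for i unfolding P by (rule sum_jump_le[OF h t])
  qed (rule finite_lat sub jump_nonneg[OF h t] | blast)+
  then obtain K where K: "\<And>i. finite (set_pmf (K i))" "bind_pmf ?P K = occ_pmf n (t + h)"
    and KF: "\<And>i (F :: ('n \<Rightarrow> nat) \<Rightarrow> real^'n). occ n t i *\<^sub>R (\<integral>j. F j \<partial>measure_pmf (K i)) =
        occ n t i *\<^sub>R F i + (\<Sum>m\<in>UNIV. ?J i m *\<^sub>R (F (move i m) - F i))"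
    and KG: "\<And>i (F :: ('n \<Rightarrow> nat) \<Rightarrow> real). occ n t i * (\<integral>j. F j \<partial>measure_pmf (K i)) =
        occ n t i * F i + (\<Sum>m\<in>UNIV. ?J i m * (F (move i m) - F i))"
    unfolding P by blast
  have int: "(\<lambda>s. E s (up n i k s) - E s (down n i k s) - c) integrable_on {t..t + h}" for i k c
    by (intro cont_interval_int t continuous_intros cont_E_updown)
  have drift: "norm (occ n t i *\<^sub>R ((\<integral>j. ?pos j - ?pos i \<partial>measure_pmf (K i)) - h *\<^sub>R b t (?pos i))) \<le>
      (\<Sum>k\<in>UNIV. integral {t..t + h} (\<lambda>s. \<bar>E s (up n i k s) - E s (down n i k s) - b t (?pos i) $ k * occ n t i\<bar>))" for i
  proof -
    let ?e = "occ n t i *\<^sub>R ((\<integral>j. ?pos j - ?pos i \<partial>measure_pmf (K i)) - h *\<^sub>R b t (?pos i))"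
    have "occ n t i *\<^sub>R (\<integral>j. ?pos j - ?pos i \<partial>measure_pmf (K i)) = (\<Sum>m\<in>UNIV. ?J i m *\<^sub>R (?pos (move i m) - ?pos i))"
      using KF[of i "\<lambda>j. ?pos j - ?pos i"] by simp
    also have "\<dots> = (\<Sum>k\<in>UNIV. ((?J i (k, True) - ?J i (k, False)) * (l / ?N)) *\<^sub>R axis k 1)"
      unfolding sum_moves[OF h t] lat_pos_move[OF h t]
      by (simp add: algebra_simps diff_divide_distrib del: of_nat_Suc)
    finally have e: "?e $ k = (?J i (k, True) - ?J i (k, False)) * (l / ?N) - h * (b t (?pos i) $ k * occ n t i)" for k
      by (simp add: scaleR_diff_right axis_def if_distrib sum.delta mult_ac del: of_nat_Suc cong: if_cong)
    have "\<bar>?e $ k\<bar> \<le> integral {t..t + h} (\<lambda>s. \<bar>E s (up n i k s) - E s (down n i k s) - b t (?pos i) $ k * occ n t i\<bar>)" for k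
    proof -
      have J: "?J i (k, True) = ?N / l * integral {t..t + h} (\<lambda>s. E s (up n i k s))"
        "?J i (k, False) = ?N / l * integral {t..t + h} (\<lambda>s. E s (down n i k s))"
        by (simp_all add: jump_def flux_def)
      have iu: "(\<lambda>s. E s (up n i k s)) integrable_on {t..t + h}" "(\<lambda>s. E s (down n i k s)) integrable_on {t..t + h}"
        by (intro cont_interval_int t cont_E_updown)+
      have eq: "?e $ k = integral {t..t + h} (\<lambda>s. E s (up n i k s)) - integral {t..t + h} (\<lambda>s. E s (down n i k s)) - h * (b t (?pos i) $ k * occ n t i)"
        unfolding e J using l by (simp add: field_simps del: of_nat_Suc)
      have eq2: "\<dots> = integral {t..t + h} (\<lambda>s. E s (up n i k s) - E s (down n i k s) - b t (?pos i) $ k * occ n t i)"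
        using h iu by (simp add: Henstock_Kurzweil_Integration.integral_diff integrable_diff integrable_const_ivl)
      show ?thesis
        unfolding eq eq2 real_norm_def[symmetric]
        by (rule integral_norm_bound_integral)
           (auto intro!: int cont_interval_int t continuous_intros cont_E_updown)
    qed
    then show ?thesis by (intro order_trans[OF norm_le_l1_cart] sum_mono)
  qed
  show ?thesis
  proof (rule that[OF K])
    let ?e = "\<lambda>i. norm ((\<integral>j. ?pos j - ?pos i \<partial>measure_pmf (K i)) - h *\<^sub>R b t (?pos i))"
    have "(\<integral>i. ?e i \<partial>measure_pmf ?P) = (\<Sum>i\<in>lat n. norm (occ n t i *\<^sub>R ((\<integral>j. ?pos j - ?pos i \<partial>measure_pmf (K i)) - h *\<^sub>R b t (?pos i))))"
      using occ_nonneg[OF tT(1)] by (simp add: integral_occ_pmf[OF tT(1)] del: scaleR_right_diff_distrib)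
    also have "\<dots> \<le> (\<Sum>i\<in>lat n. \<Sum>k\<in>UNIV. integral {t..t + h} (\<lambda>s. \<bar>E s (up n i k s) - E s (down n i k s) - b t (?pos i) $ k * occ n t i\<bar>))"
      by (intro sum_mono drift)
    also have "\<dots> = (\<Sum>k\<in>UNIV. integral {t..t + h} (\<lambda>s. \<Sum>i\<in>lat n. \<bar>E s (up n i k s) - E s (down n i k s) - b t (?pos i) $ k * occ n t i\<bar>))"
    proof -
      have "(\<lambda>s. \<bar>E s (up n i k s) - E s (down n i k s) - b t (?pos i) $ k * occ n t i\<bar>) integrable_on {t..t + h}" for i k
        by (intro cont_interval_int t continuous_intros cont_E_updown)
      then show ?thesis
        by (subst sum.swap) (simp add: Henstock_Kurzweil_Integration.integral_sum finite_lat)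
    qed
    also have "\<dots> \<le> (\<Sum>k\<in>(UNIV::'n set). integral {t..t + h} (\<lambda>s. ?B))"
    proof (intro sum_mono integral_le integrable_const_ivl)
      show "(\<lambda>s. \<Sum>i\<in>lat n. \<bar>E s (up n i k s) - E s (down n i k s) - b t (?pos i) $ k * occ n t i\<bar>) integrable_on {t..t + h}" for k
        by (intro cont_interval_int t continuous_intros cont_E_updown)
      show "(\<Sum>i\<in>lat n. \<bar>E s (up n i k s) - E s (down n i k s) - b t (?pos i) $ k * occ n t i\<bar>) \<le> ?B" if "s \<in> {t..t + h}" for s k
        by (rule drift_pointwise[OF h t \<kappa> that])
    qed
    also have "\<dots> = h * (real CARD('n) * ?B)" using h by (simp add: mult_ac del: of_nat_Suc)
    finally show "(\<integral>i. ?e i \<partial>measure_pmf ?P) \<le> h * (real CARD('n) * ?B)" .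
    have "(\<integral>i. (\<integral>j. (norm (?pos j - ?pos i))\<^sup>2 \<partial>measure_pmf (K i)) \<partial>measure_pmf ?P) = (\<Sum>i\<in>lat n. \<Sum>m\<in>UNIV. ?J i m * (norm (?pos (move i m) - ?pos i))\<^sup>2)"
      unfolding integral_occ_pmf[OF tT(1)]
      by (intro sum.cong refl) (use KG[of _ "\<lambda>j. (norm (?pos j - ?pos _))\<^sup>2"] in simp)
    also have "\<dots> \<le> (\<Sum>i\<in>lat n. \<Sum>m\<in>UNIV. ?J i m * (l / ?N)\<^sup>2)"
    proof (intro sum_mono)
      fix i and m :: "'n \<times> bool"
      obtain k u where m: "m = (k, u)" by fastforce
      show "?J i m * (norm (?pos (move i m) - ?pos i))\<^sup>2 \<le> ?J i m * (l / ?N)\<^sup>2"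
      proof (cases u)
        case True
        then show ?thesis unfolding m using lat_pos_move(1)[OF h t, of i k] by (simp add: norm_axis_1 power_divide del: of_nat_Suc)
      next
        case False
        show ?thesis
        proof (cases "?J i (k, False) = 0")
          case J: False
          have "?J i (k, False) *\<^sub>R (?pos (move i (k, False)) - ?pos i) = ?J i (k, False) *\<^sub>R (- (l / ?N) *\<^sub>R axis k 1)"
            using lat_pos_move(2)[OF h t, of i k] by simp
          then have "?pos (move i (k, False)) - ?pos i = - (l / ?N) *\<^sub>R axis k 1" using J by (rule scaleR_left_imp_eq[rotated])
          then show ?thesis unfolding m using False by (simp add: norm_axis_1 power_divide del: of_nat_Suc)
        qed (use m False in simp)
      qed
    qed
    also have "\<dots> = (l / ?N)\<^sup>2 * (\<Sum>i\<in>lat n. \<Sum>m\<in>UNIV. ?J i m)"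
      by (simp add: sum_distrib_left mult_ac del: of_nat_Suc)
    also have "\<dots> \<le> (l / ?N)\<^sup>2 * (8 * real CARD('n) * C * h * (?N / l))"
      by (intro mult_left_mono sum_jump_total[OF h t]) auto
    also have "\<dots> = h * (8 * real CARD('n) * C * (l / ?N))"
      using l by (simp add: power2_eq_square field_simps del: of_nat_Suc)
    finally show "(\<integral>i. (\<integral>j. (norm (?pos j - ?pos i))\<^sup>2 \<partial>measure_pmf (K i)) \<partial>measure_pmf ?P) \<le> h * (8 * real CARD('n) * C * (l / ?N))" .
  qed
qed

text \<open>The sum of the two error bounds of \<open>lattice_kernel\<close> per unit of time, so
  that one number serves for the drift and for the square.\<close>

definition lat_err :: "nat \<Rightarrow> real \<Rightarrow> real \<Rightarrow> real \<Rightarrow> real" where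
  "lat_err n h \<epsilon> \<kappa> = real CARD('n) * (4 * C / sqrt (real (Suc n)) + \<epsilon> + \<kappa> * (h + l\<^sup>2 * real CARD('n) / real (Suc n)) + C * (growth_rate n * h))
    + 8 * real CARD('n) * C * (l / real (Suc n))"

lemma lattice_chain:
  assumes h: "h > 0" "4 * growth_rate n * h \<le> 1" and M: "real M * h \<le> T"
    and \<kappa>: "\<kappa> \<ge> 0" "\<And>s t x y. norm (b s x - b t y) \<le> \<epsilon> + \<kappa> * (\<bar>s - t\<bar> + (dist x y)\<^sup>2)" "\<epsilon> \<ge> 0"
  obtains Q :: "(nat \<Rightarrow> 'n \<Rightarrow> nat) pmf" where "finite (set_pmf Q)"
    "\<And>k. k \<le> M \<Longrightarrow> map_pmf (\<lambda>\<omega>. \<omega> k) Q = occ_pmf n (real k * h)"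
    "\<And>k. k \<le> M \<Longrightarrow> (\<integral>\<omega>. (norm (lat_pos l n (\<omega> k) - lat_pos l n (\<omega> 0) - h *\<^sub>R (\<Sum>j<k. b (real j * h) (lat_pos l n (\<omega> j)))))\<^sup>2 \<partial>measure_pmf Q) \<le>
      T * ((2 * (2 * (real CARD('n) * l) + T * C) + 2) * lat_err n h \<epsilon> \<kappa> + 2 * h * C\<^sup>2)"
proof -
  let ?\<eta> = "lat_err n h \<epsilon> \<kappa>"
  have kT: "real k * h \<in> {0..T}" if "k \<le> M" for k
  proof -
    have "real k * h \<le> real M * h" using that h by (intro mult_right_mono) auto
    also note M
    finally show ?thesis using h by simp
  qed
  have step: "0 \<le> real k * h" "real k * h + h \<le> T" if "k < M" for k
    using kT[of "Suc k"] that h by (auto simp: algebra_simps)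
  have g: "growth_rate n * h \<ge> 0" using growth_rate_nonneg[of n] h by simp
  have err1: "h * (real CARD('n) * (4 * C / sqrt (real (Suc n)) + \<epsilon> + \<kappa> * (h + l\<^sup>2 * real CARD('n) / real (Suc n)) + C * (growth_rate n * h))) \<le> h * ?\<eta>"
    unfolding lat_err_def using h C l by (intro mult_left_mono) auto
  have err2: "h * (8 * real CARD('n) * C * (l / real (Suc n))) \<le> h * ?\<eta>"
    unfolding lat_err_def using h C l \<kappa> g by (intro mult_left_mono) (auto intro!: mult_nonneg_nonneg add_nonneg_nonneg)
  have \<eta>: "?\<eta> \<ge> 0"
    unfolding lat_err_def using h C l \<kappa> g by (auto intro!: mult_nonneg_nonneg add_nonneg_nonneg)
  let ?\<Phi> = "\<lambda>k K. (\<forall>i. finite (set_pmf (K i))) \<and> (k < M \<longrightarrow> bind_pmf (occ_pmf n (real k * h)) K = occ_pmf n (real (Suc k) * h) \<and>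
    (\<integral>i. norm ((\<integral>j. lat_pos l n j - lat_pos l n i \<partial>measure_pmf (K i)) - h *\<^sub>R b (real k * h) (lat_pos l n i)) \<partial>measure_pmf (occ_pmf n (real k * h))) \<le> h * ?\<eta> \<and>
    (\<integral>i. (\<integral>j. (norm (lat_pos l n j - lat_pos l n i))\<^sup>2 \<partial>measure_pmf (K i)) \<partial>measure_pmf (occ_pmf n (real k * h))) \<le> h * ?\<eta>)"
  have ex: "\<exists>K. ?\<Phi> k K" for k
  proof (cases "k < M")
    case True
    have e: "real (Suc k) * h = real k * h + h" by (simp add: algebra_simps)
    show ?thesis
      unfolding e
      by (rule lattice_kernel[OF less_imp_le[OF h(1)] h(2) step[OF True] \<kappa>(1,2)])
         (use err1 err2 in \<open>meson order_trans\<close>)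
  next
    case False
    \<comment> \<open>From step M on, any kernel with finite support will do.\<close>
    then show ?thesis by (intro exI[of _ return_pmf]) auto
  qed
  from choice[of ?\<Phi>] ex obtain K where K': "\<And>k. ?\<Phi> k (K k)" by blast
  have K: "\<And>k i. finite (set_pmf (K k i))" "\<And>k. k < M \<Longrightarrow> bind_pmf (occ_pmf n (real k * h)) (K k) = occ_pmf n (real (Suc k) * h)"
    "\<And>k. k < M \<Longrightarrow> (\<integral>i. norm ((\<integral>j. lat_pos l n j - lat_pos l n i \<partial>measure_pmf (K k i)) - h *\<^sub>R b (real k * h) (lat_pos l n i)) \<partial>measure_pmf (occ_pmf n (real k * h))) \<le> h * ?\<eta>"
    "\<And>k. k < M \<Longrightarrow> (\<integral>i. (\<integral>j. (norm (lat_pos l n j - lat_pos l n i))\<^sup>2 \<partial>measure_pmf (K k i)) \<partial>measure_pmf (occ_pmf n (real k * h))) \<le> h * ?\<eta>"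
    using K' by blast+
  show ?thesis
  proof (rule markov_chain_drift[of M "\<lambda>k. occ_pmf n (real k * h)" K "lat_pos l n" "real CARD('n) * l" "\<lambda>k i. b (real k * h) (lat_pos l n i)" C h ?\<eta>])
    show "finite (set_pmf (occ_pmf n (real 0 * h)))"
      using finite_subset[OF set_occ_pmf finite_lat] T by auto
    show "norm (lat_pos l n i) \<le> real CARD('n) * l" if "k \<le> M" "i \<in> set_pmf (occ_pmf n (real k * h))" for k i
      using that set_occ_pmf[OF kT[OF that(1)]] l by (intro norm_lat_pos) auto
    fix Q :: "(nat \<Rightarrow> 'n \<Rightarrow> nat) pmf"
    assume Q: "finite (set_pmf Q)" "\<And>k. k \<le> M \<Longrightarrow> map_pmf (\<lambda>\<omega>. \<omega> k) Q = occ_pmf n (real k * h)"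
      "\<And>k. k \<le> M \<Longrightarrow> (\<integral>\<omega>. (norm (lat_pos l n (\<omega> k) - lat_pos l n (\<omega> 0) - h *\<^sub>R (\<Sum>j<k. b (real j * h) (lat_pos l n (\<omega> j)))))\<^sup>2 \<partial>measure_pmf Q) \<le>
        real k * h * (2 * (2 * (real CARD('n) * l) + real M * h * C) * ?\<eta> + 2 * ?\<eta> + 2 * h * C\<^sup>2)"
    have "real k * h * (2 * (2 * (real CARD('n) * l) + real M * h * C) * ?\<eta> + 2 * ?\<eta> + 2 * h * C\<^sup>2) \<le>
        T * ((2 * (2 * (real CARD('n) * l) + T * C) + 2) * ?\<eta> + 2 * h * C\<^sup>2)" if "k \<le> M" for k
    proof -
      have "2 * (2 * (real CARD('n) * l) + real M * h * C) * ?\<eta> \<le> 2 * (2 * (real CARD('n) * l) + T * C) * ?\<eta>"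
        using M C \<eta> by (intro mult_right_mono mult_left_mono add_left_mono) auto
      then have "2 * (2 * (real CARD('n) * l) + real M * h * C) * ?\<eta> + 2 * ?\<eta> + 2 * h * C\<^sup>2 \<le> (2 * (2 * (real CARD('n) * l) + T * C) + 2) * ?\<eta> + 2 * h * C\<^sup>2"
        by (simp add: distrib_right)
      moreover have "0 \<le> 2 * (2 * (real CARD('n) * l) + real M * h * C) * ?\<eta> + 2 * ?\<eta> + 2 * h * C\<^sup>2"
        using h l C \<eta> by (auto intro!: mult_nonneg_nonneg add_nonneg_nonneg)
      ultimately show ?thesis using kT[OF that] T by (intro mult_mono) auto
    qed
    with Q show thesis by (intro that[of Q]) (auto intro: order_trans)
  qed (use K h tame_bound[OF b] in auto)
qed

lemma lattice_chain_small:
  assumes "\<delta> > 0"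
  obtains h M n and Q :: "(nat \<Rightarrow> 'n \<Rightarrow> nat) pmf"
  where "h > 0" "h \<le> \<delta>" "real M * h = T" "1 / real (Suc n) \<le> \<delta>" "finite (set_pmf Q)"
    "\<And>k. k \<le> M \<Longrightarrow> map_pmf (\<lambda>\<omega>. \<omega> k) Q = occ_pmf n (real k * h)"
    "\<And>k. k \<le> M \<Longrightarrow> (\<integral>\<omega>. (norm (lat_pos l n (\<omega> k) - lat_pos l n (\<omega> 0) - h *\<^sub>R (\<Sum>j<k. b (real j * h) (lat_pos l n (\<omega> j)))))\<^sup>2 \<partial>measure_pmf Q) \<le> \<delta>"
proof -
  let ?d = "real CARD('n)"
  define Z where "Z = 2 * (2 * (?d * l) + T * C) + 2"
  have Z: "Z > 0" unfolding Z_def using l T C by (intro add_nonneg_pos) auto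
  \<comment> \<open>The part of the error that does not vanish as n grows then contributes \<delta>
    / 2.\<close>
  define \<epsilon> where "\<epsilon> = \<delta> / (2 * T * Z * ?d)"
  have \<epsilon>: "\<epsilon> > 0" "T * (Z * (?d * \<epsilon>)) = \<delta> / 2" using assms T Z by (auto simp: \<epsilon>_def)
  obtain \<kappa> where \<kappa>: "\<kappa> \<ge> 0" "\<And>s t x y. norm (b s x - b t y) \<le> \<epsilon> + \<kappa> * (\<bar>s - t\<bar> + (dist x y)\<^sup>2)"
    using tame_modulus[OF b \<epsilon>(1)] by blast
  obtain q :: nat where q: "16 * ?d * C * T / l \<le> real q" using real_arch_simple by blast
  \<comment> \<open>Since \<open>growth_rate n\<close> grows like n, a step of order 1/n^2 makes
    growth rate times step tend to 0. The factor Suc q enforces the smallness condition for every n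
    and keeps T / h an integer.\<close>
  define h where "h = (\<lambda>n. T / (real (Suc n) ^ 2 * real (Suc q)))"
  have hpos: "h n > 0" for n unfolding h_def using T by (intro divide_pos_pos mult_pos_pos) auto
  have N0: "(\<lambda>n. 1 / real (Suc n)) \<longlonglongrightarrow> 0" using LIMSEQ_inverse_real_of_nat by (simp add: inverse_eq_divide)
  have gh: "growth_rate n * h n = 4 * ?d * C * T / l / real (Suc q) * (1 / real (Suc n))" for n
    using l by (simp add: growth_rate_def h_def power2_eq_square divide_simps del: of_nat_Suc)
  have small: "4 * growth_rate n * h n \<le> 1" for n
  proof -
    have "4 * growth_rate n * h n = 16 * ?d * C * T / l / real (Suc q) * (1 / real (Suc n))"
      unfolding mult.assoc[of 4] gh by simp
    also have "\<dots> \<le> 1 * 1"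
    proof (intro mult_mono)
      have "16 * ?d * C * T / l \<le> real (Suc q)" using q by simp
      then have "16 * ?d * C * T / l / real (Suc q) \<le> real (Suc q) / real (Suc q)" by (rule divide_right_mono) simp
      then show "16 * ?d * C * T / l / real (Suc q) \<le> 1" by (simp del: of_nat_Suc)
    qed (use l C T in auto)
    finally show ?thesis by simp
  qed
  have h0: "h \<longlonglongrightarrow> 0"
  proof -
    have "(\<lambda>n. T / real (Suc q) * (1 / real (Suc n) * (1 / real (Suc n)))) \<longlonglongrightarrow> T / real (Suc q) * (0 * 0)"
      by (intro tendsto_intros N0)
    then show ?thesis by (simp add: h_def[abs_def] power2_eq_square mult_ac del: of_nat_Suc)
  qed
  have sq: "(\<lambda>n. 1 / sqrt (real (Suc n))) \<longlonglongrightarrow> 0"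
    using tendsto_real_sqrt[OF N0] by (simp add: real_sqrt_divide del: of_nat_Suc)
  have "(\<lambda>n. ?d * (4 * C * (1 / sqrt (real (Suc n))) + \<epsilon> + \<kappa> * (h n + l\<^sup>2 * ?d * (1 / real (Suc n))) + C * (4 * ?d * C * T / l / real (Suc q) * (1 / real (Suc n))))
      + 8 * ?d * C * (l * (1 / real (Suc n)))) \<longlonglongrightarrow>
      ?d * (4 * C * 0 + \<epsilon> + \<kappa> * (0 + l\<^sup>2 * ?d * 0) + C * (4 * ?d * C * T / l / real (Suc q) * 0)) + 8 * ?d * C * (l * 0)"
    by (intro tendsto_intros N0 h0 sq)
  then have err: "(\<lambda>n. lat_err n (h n) \<epsilon> \<kappa>) \<longlonglongrightarrow> ?d * \<epsilon>"
    unfolding lat_err_def gh by (simp del: of_nat_Suc)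
  have "(\<lambda>n. T * (Z * lat_err n (h n) \<epsilon> \<kappa> + 2 * h n * C\<^sup>2)) \<longlonglongrightarrow> T * (Z * (?d * \<epsilon>) + 2 * 0 * C\<^sup>2)"
    by (intro tendsto_intros err h0)
  then have lim: "(\<lambda>n. T * (Z * lat_err n (h n) \<epsilon> \<kappa> + 2 * h n * C\<^sup>2)) \<longlonglongrightarrow> \<delta> / 2" using \<epsilon>(2) by simp
  have "eventually (\<lambda>n. T * (Z * lat_err n (h n) \<epsilon> \<kappa> + 2 * h n * C\<^sup>2) < \<delta>) sequentially"
    by (rule order_tendstoD(2)[OF lim]) (use assms in simp)
  moreover have "eventually (\<lambda>n. h n < \<delta>) sequentially" by (rule order_tendstoD(2)[OF h0 assms])
  moreover have "eventually (\<lambda>n. 1 / real (Suc n) < \<delta>) sequentially" by (rule order_tendstoD(2)[OF N0 assms])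
  ultimately have "eventually (\<lambda>n. T * (Z * lat_err n (h n) \<epsilon> \<kappa> + 2 * h n * C\<^sup>2) < \<delta> \<and> h n < \<delta> \<and> 1 / real (Suc n) < \<delta>) sequentially"
    by eventually_elim simp
  then obtain n where n: "T * (Z * lat_err n (h n) \<epsilon> \<kappa> + 2 * h n * C\<^sup>2) < \<delta>" "h n < \<delta>" "1 / real (Suc n) < \<delta>"
    using eventually_happens'[OF sequentially_bot] by blast
  define M where "M = Suc n ^ 2 * Suc q"
  have "real M = real (Suc n) ^ 2 * real (Suc q)" by (simp only: M_def of_nat_mult of_nat_power)
  moreover have "x * (T / x) = T" if "x \<noteq> 0" for x using that by simp
  ultimately have M: "real M * h n = T" by (simp add: h_def del: of_nat_Suc)
  show ?thesis
  proof (rule lattice_chain[OF hpos small eq_refl[OF M] \<kappa> less_imp_le[OF \<epsilon>(1)], folded Z_def])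
    fix Q :: "(nat \<Rightarrow> 'n \<Rightarrow> nat) pmf"
    assume Q: "finite (set_pmf Q)" "\<And>k. k \<le> M \<Longrightarrow> map_pmf (\<lambda>\<omega>. \<omega> k) Q = occ_pmf n (real k * h n)"
      "\<And>k. k \<le> M \<Longrightarrow> (\<integral>\<omega>. (norm (lat_pos l n (\<omega> k) - lat_pos l n (\<omega> 0) - h n *\<^sub>R (\<Sum>j<k. b (real j * h n) (lat_pos l n (\<omega> j)))))\<^sup>2 \<partial>measure_pmf Q) \<le>
        T * (Z * lat_err n (h n) \<epsilon> \<kappa> + 2 * h n * C\<^sup>2)"
    show thesis
      by (rule that[OF hpos less_imp_le[OF n(2)] M less_imp_le[OF n(3)] Q(1,2) order_trans[OF Q(3) less_imp_le[OF n(1)]]])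
  qed
qed

text \<open>Young's inequality; it turns mean square bounds into bounds in mean.\<close>

lemma abs_le_square: "\<tau> > 0 \<Longrightarrow> \<bar>u\<bar> \<le> \<tau> + u\<^sup>2 / \<tau>" for u \<tau> :: real
proof -
  assume \<tau>: "\<tau> > 0"
  have "2 * (\<tau> * \<bar>u\<bar>) \<le> \<tau> * \<tau> + u\<^sup>2" using sum_squares_bound[of \<tau> "\<bar>u\<bar>"] by (simp add: power2_eq_square)
  moreover have "0 \<le> \<tau> * \<bar>u\<bar>" using \<tau> by simp
  ultimately have "\<tau> * \<bar>u\<bar> \<le> \<tau> * \<tau> + u\<^sup>2" by linarith
  then have "\<tau> * \<bar>u\<bar> \<le> \<tau> * (\<tau> + u\<^sup>2 / \<tau>)" using \<tau> by (simp add: distrib_left)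
  then show ?thesis using \<tau> by simp
qed

lemma curve_approximation:
  assumes \<eta>: "\<eta> > 0"
  obtains R :: "(real \<Rightarrow> real^'n) pmf"
  where "finite (set_pmf R)" "set_pmf R \<subseteq> lip_curves C (real CARD('n) * l)"
    "\<And>t \<phi>. t \<in> {0..T} \<Longrightarrow> 1-lipschitz_on UNIV \<phi> \<Longrightarrow> \<bar>(\<integral>x. \<phi> (x t) \<partial>measure_pmf R) - E t \<phi>\<bar> \<le> \<eta>"
    "\<And>t. t \<in> {0..T} \<Longrightarrow> (\<integral>x. norm (residual b x t) \<partial>measure_pmf R) \<le> \<eta>"
proof -
  let ?d = "real CARD('n)"
  \<comment> \<open>Of the six parts, three go to the distance between curve and chain, two to the
    rounding to the lattice, one to the change of \<mu> within a step.\<close>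
  define \<tau> where "\<tau> = \<eta> / 6"
  have \<tau>: "\<tau> > 0" "6 * \<tau> = \<eta>" using \<eta> by (auto simp: \<tau>_def)
  define \<epsilon> where "\<epsilon> = \<eta> / (2 * T)"
  have \<epsilon>: "\<epsilon> > 0" "T * \<epsilon> = \<eta> / 2" using \<eta> T by (auto simp: \<epsilon>_def)
  obtain \<kappa> where \<kappa>: "\<kappa> \<ge> 0" "\<And>s t x y. norm (b s x - b t y) \<le> \<epsilon> + \<kappa> * (\<bar>s - t\<bar> + (dist x y)\<^sup>2)"
    using tame_modulus[OF b \<epsilon>(1)] by blast
  obtain d\<mu> where d\<mu>: "d\<mu> > 0" "\<And>s t. s \<in> {0..T} \<Longrightarrow> t \<in> {0..T} \<Longrightarrow> dist s t < d\<mu> \<Longrightarrow> dist (\<mu> s) (\<mu> t) < \<tau>"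
    using compact_uniformly_continuous[OF \<mu> compact_Icc] \<tau>(1) unfolding uniformly_continuous_on_def by meson
  let ?k = "T * \<kappa> * (3 + 2 * C\<^sup>2)"
  have kk: "?k \<ge> 0" using T \<kappa>(1) by simp
  have small: "\<exists>\<delta>>0. \<delta> \<le> 1 \<and> \<delta> \<le> a \<and> \<delta> \<le> a' \<and> \<delta> \<le> a'' \<and> \<delta> \<le> c \<and> \<delta> \<le> c'"
    if "0 < a" "0 < a'" "0 < a''" "0 < c" "0 < c'" for a a' a'' c c' :: real
    using that by (intro exI[of _ "min (min (min 1 a) (min a' a'')) (min c c')"]) auto
  \<comment> \<open>The bounds on \<delta> serve, in this order, the mean square distance to the
    chain, the continuity of \<mu>, the rounding error, the motion of a curve during one step, and
    the residual.\<close>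
  have "0 < \<tau>\<^sup>2" "0 < d\<mu> / 2" "0 < \<tau>\<^sup>2 / (l\<^sup>2 * ?d)" "0 < \<tau> / (C + 1)" "0 < \<eta> / (2 * (?k + 1))"
    using \<tau>(1) d\<mu>(1) l C \<eta> kk by (intro divide_pos_pos mult_pos_pos zero_less_power; simp)+
  from small[OF this] obtain \<delta> where \<delta>pos: "\<delta> > 0"
    and \<delta>: "\<delta> \<le> 1" "\<delta> \<le> \<tau>\<^sup>2" "\<delta> \<le> d\<mu> / 2" "\<delta> \<le> \<tau>\<^sup>2 / (l\<^sup>2 * ?d)" "\<delta> \<le> \<tau> / (C + 1)" "\<delta> \<le> \<eta> / (2 * (?k + 1))"
    by blast
  obtain h M n and Q :: "(nat \<Rightarrow> 'n \<Rightarrow> nat) pmf"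
    where h: "h > 0" "h \<le> \<delta>" and M: "real M * h = T" and n: "1 / real (Suc n) \<le> \<delta>" and finQ: "finite (set_pmf Q)"
    and marg: "\<And>k. k \<le> M \<Longrightarrow> map_pmf (\<lambda>\<omega>. \<omega> k) Q = occ_pmf n (real k * h)"
    and L2: "\<And>k. k \<le> M \<Longrightarrow> (\<integral>\<omega>. (norm (lat_pos l n (\<omega> k) - lat_pos l n (\<omega> 0) - h *\<^sub>R (\<Sum>j<k. b (real j * h) (lat_pos l n (\<omega> j)))))\<^sup>2 \<partial>measure_pmf Q) \<le> \<delta>"
    by (rule lattice_chain_small[OF \<delta>pos], rule that)
  let ?pos = "lat_pos l n :: ('n \<Rightarrow> nat) \<Rightarrow> real^'n"
  \<comment> \<open>Only the initial point and the velocities are taken from the chain. The curve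
    stays C-Lipschitz however the chain jumps, and \<open>L2\<close> keeps it near the chain in mean
    square.\<close>
  define X where "X = (\<lambda>\<omega>. polygon h (?pos (\<omega> 0)) (\<lambda>k. b (real k * h) (?pos (\<omega> k))))"
  have bC: "norm (b t x) \<le> C" for t x by (rule tame_bound[OF b])
  have kT: "real k * h \<in> {0..T}" if "k \<le> M" for k
  proof -
    have "real k * h \<le> real M * h" using that h by (intro mult_right_mono) auto
    then show ?thesis using M h by simp
  qed
  have Xgrid: "X \<omega> (real k * h) = ?pos (\<omega> 0) + h *\<^sub>R (\<Sum>j<k. b (real j * h) (?pos (\<omega> j)))" for \<omega> k
    by (induction k) (simp_all add: X_def polygon_step[OF bC h(1)] scaleR_add_right del: of_nat_Suc)
  define \<Delta> where "\<Delta> = (\<lambda>k \<omega>. dist (?pos (\<omega> k)) (X \<omega> (real k * h)))"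
  have L2': "(\<integral>\<omega>. (\<Delta> k \<omega>)\<^sup>2 \<partial>measure_pmf Q) \<le> \<delta>" if "k \<le> M" for k
    using L2[OF that] unfolding \<Delta>_def Xgrid dist_norm diff_diff_eq[symmetric] .
  have lat: "\<omega> k \<in> lat n" if "\<omega> \<in> set_pmf Q" "k \<le> M" for \<omega> k
    using set_occ_pmf[OF kT[OF that(2)], of n] marg[OF that(2)] that(1) by (metis image_eqI set_map_pmf subsetD)
  have Xlip: "X \<omega> \<in> lip_curves C (?d * l)" if "\<omega> \<in> set_pmf Q" for \<omega>
    unfolding X_def by (rule polygon_in_lip_curves[OF bC norm_lat_pos[OF lat[OF that] l]]) simp
  have intQ: "integrable (measure_pmf Q) (g :: _ \<Rightarrow> real)" for g by (rule integrable_measure_pmf_finite[OF finQ])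
  show ?thesis
  proof (rule that[of "map_pmf X Q"])
    show "finite (set_pmf (map_pmf X Q))" using finQ by simp
    show "set_pmf (map_pmf X Q) \<subseteq> lip_curves C (?d * l)" using Xlip by auto
    fix t assume t: "t \<in> {0..T}"
    define k where "k = step_index h t"
    have kt: "real k * h \<le> t" "t < real (Suc k) * h"
      using step_index_bounds[OF h(1), of t] t by (auto simp: k_def)
    have "real k * h \<le> real M * h" using kt(1) t M by auto
    then have kM: "k \<le> M" using h(1) by simp
    have tk: "\<bar>t - real k * h\<bar> \<le> h" using kt by (simp add: algebra_simps)
    {
      fix \<phi> :: "real^'n \<Rightarrow> real" assume \<phi>: "1-lipschitz_on UNIV \<phi>"
      have lip: "\<bar>\<phi> x - \<phi> y\<bar> \<le> dist x y" for x y using lipschitz_onD[OF \<phi>, of x y] by (simp add: dist_real_def)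
      have c\<phi>: "continuous_on UNIV \<phi>" using \<phi> by (rule lipschitz_on_continuous_on)
      have "\<bar>(\<integral>\<omega>. \<phi> (X \<omega> t) \<partial>measure_pmf Q) - (\<integral>\<omega>. \<phi> (?pos (\<omega> k)) \<partial>measure_pmf Q)\<bar> \<le> 3 * \<tau>"
      proof -
        have "\<bar>(\<integral>\<omega>. \<phi> (X \<omega> t) \<partial>measure_pmf Q) - (\<integral>\<omega>. \<phi> (?pos (\<omega> k)) \<partial>measure_pmf Q)\<bar> = \<bar>\<integral>\<omega>. \<phi> (X \<omega> t) - \<phi> (?pos (\<omega> k)) \<partial>measure_pmf Q\<bar>"
          by (simp add: intQ)
        also have "\<dots> \<le> (\<integral>\<omega>. \<bar>\<phi> (X \<omega> t) - \<phi> (?pos (\<omega> k))\<bar> \<partial>measure_pmf Q)" by (rule integral_abs_bound)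
        also have "\<dots> \<le> (\<integral>\<omega>. 2 * \<tau> + (\<Delta> k \<omega>)\<^sup>2 / \<tau> \<partial>measure_pmf Q)"
        proof (rule integral_mono_AE[OF intQ intQ], unfold AE_measure_pmf_iff, rule ballI)
          fix \<omega> assume "\<omega> \<in> set_pmf Q"
          then have "dist (X \<omega> t) (X \<omega> (real k * h)) \<le> C * \<bar>t - real k * h\<bar>" using Xlip unfolding lip_curves_def by blast
          also have "\<dots> \<le> (C + 1) * (\<tau> / (C + 1))" using tk h \<delta>(5) C by (intro mult_mono) auto
          also have "\<dots> = \<tau>" using C by simp
          finally have "dist (X \<omega> t) (X \<omega> (real k * h)) \<le> \<tau>" .
          moreover have "dist (X \<omega> t) (?pos (\<omega> k)) \<le> dist (X \<omega> t) (X \<omega> (real k * h)) + \<Delta> k \<omega>"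
            unfolding \<Delta>_def by (metis dist_commute dist_triangle)
          moreover have "\<Delta> k \<omega> \<le> \<tau> + (\<Delta> k \<omega>)\<^sup>2 / \<tau>" using abs_le_square[OF \<tau>(1), of "\<Delta> k \<omega>"] by linarith
          ultimately show "\<bar>\<phi> (X \<omega> t) - \<phi> (?pos (\<omega> k))\<bar> \<le> 2 * \<tau> + (\<Delta> k \<omega>)\<^sup>2 / \<tau>"
            using lip[of "X \<omega> t" "?pos (\<omega> k)"] by linarith
        qed
        also have "\<dots> = 2 * \<tau> + (\<integral>\<omega>. (\<Delta> k \<omega>)\<^sup>2 \<partial>measure_pmf Q) / \<tau>" by (simp add: intQ)
        also have "(\<integral>\<omega>. (\<Delta> k \<omega>)\<^sup>2 \<partial>measure_pmf Q) / \<tau> \<le> \<tau>\<^sup>2 / \<tau>"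
          using L2'[OF kM] \<delta>(2) \<tau>(1) by (intro divide_right_mono) auto
        also have "\<tau>\<^sup>2 / \<tau> = \<tau>" using \<tau>(1) by (simp add: power2_eq_square)
        finally show ?thesis by simp
      qed
      moreover have "\<bar>(\<integral>\<omega>. \<phi> (?pos (\<omega> k)) \<partial>measure_pmf Q) - E (real k * h) \<phi>\<bar> \<le> 2 * \<tau>"
      proof -
        note rT = kT[OF kM]
        have "(\<integral>\<omega>. \<phi> (?pos (\<omega> k)) \<partial>measure_pmf Q) = (\<integral>i. \<phi> (?pos i) \<partial>measure_pmf (occ_pmf n (real k * h)))"
          unfolding marg[OF kM, symmetric] by simp
        also have "\<dots> = E (real k * h) (\<lambda>x. \<Sum>i\<in>lat n. wgt l n i x * \<phi> (?pos i))"
          unfolding integral_occ_pmf[OF rT] by (rule sum_occ_mult[OF rT])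
        finally have eq: "(\<integral>\<omega>. \<phi> (?pos (\<omega> k)) \<partial>measure_pmf Q) - E (real k * h) \<phi> = E (real k * h) (\<lambda>x. (\<Sum>i\<in>lat n. wgt l n i x * \<phi> (?pos i)) - \<phi> x)"
          by (subst Bochner_Integration.integral_diff) (auto intro!: integrable_E rT continuous_intros continuous_on_wgt c\<phi>)
        have "\<bar>E (real k * h) (\<lambda>x. (\<Sum>i\<in>lat n. wgt l n i x * \<phi> (?pos i)) - \<phi> x)\<bar> \<le> E (real k * h) (\<lambda>x. \<bar>(\<Sum>i\<in>lat n. wgt l n i x * \<phi> (?pos i)) - \<phi> x\<bar>)"
          by (rule integral_abs_bound)
        also have "\<dots> \<le> E (real k * h) (\<lambda>_. 2 * \<tau>)"
        proof (rule E_mono[OF rT])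
          fix x :: "real^'n" assume x: "norm x \<le> l / 4"
          have "(\<Sum>i\<in>lat n. wgt l n i x * \<phi> (?pos i)) - \<phi> x = (\<Sum>i\<in>lat n. wgt l n i x * (\<phi> (?pos i) - \<phi> x))"
            using sum_wgt[of l n x] by (simp add: right_diff_distrib sum_subtractf flip: sum_distrib_right)
          then have "\<bar>(\<Sum>i\<in>lat n. wgt l n i x * \<phi> (?pos i)) - \<phi> x\<bar> \<le> (\<Sum>i\<in>lat n. \<bar>wgt l n i x * (\<phi> (?pos i) - \<phi> x)\<bar>)"
            by simp
          also have "\<dots> \<le> (\<Sum>i\<in>lat n. wgt l n i x * (\<tau> + (dist x (?pos i))\<^sup>2 / \<tau>))"
          proof (rule sum_mono)
            fix i
            have "\<bar>\<phi> (?pos i) - \<phi> x\<bar> \<le> \<tau> + (dist x (?pos i))\<^sup>2 / \<tau>"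
              using lip[of "?pos i" x] abs_le_square[OF \<tau>(1), of "dist x (?pos i)"] by (simp add: dist_commute)
            then show "\<bar>wgt l n i x * (\<phi> (?pos i) - \<phi> x)\<bar> \<le> wgt l n i x * (\<tau> + (dist x (?pos i))\<^sup>2 / \<tau>)"
              unfolding abs_mult using wgt_nonneg[OF x l, of n i] by (simp add: mult_left_mono)
          qed
          also have "\<dots> = \<tau> * (\<Sum>i\<in>lat n. wgt l n i x) + (\<Sum>i\<in>lat n. wgt l n i x * (dist x (?pos i))\<^sup>2) / \<tau>"
            by (simp add: distrib_left sum.distrib sum_distrib_left sum_divide_distrib mult.commute)
          also have "\<dots> \<le> \<tau> * 1 + \<tau>\<^sup>2 / \<tau>"
          proof (intro add_mono divide_right_mono)
            have "(\<Sum>i\<in>lat n. wgt l n i x * (dist x (?pos i))\<^sup>2) \<le> l\<^sup>2 * ?d * (1 / real (Suc n))"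
              using sum_wgt_dist[OF x l, of n] by simp
            also have "\<dots> \<le> l\<^sup>2 * ?d * (\<tau>\<^sup>2 / (l\<^sup>2 * ?d))" using n \<delta>(4) by (intro mult_left_mono) auto
            also have "\<dots> = \<tau>\<^sup>2" using l by simp
            finally show "(\<Sum>i\<in>lat n. wgt l n i x * (dist x (?pos i))\<^sup>2) \<le> \<tau>\<^sup>2" .
          qed (use \<tau>(1) in \<open>auto simp: sum_wgt\<close>)
          also have "\<dots> = 2 * \<tau>" using \<tau>(1) by (simp add: power2_eq_square)
          finally show "\<bar>(\<Sum>i\<in>lat n. wgt l n i x * \<phi> (?pos i)) - \<phi> x\<bar> \<le> 2 * \<tau>" .
        qed (intro continuous_intros continuous_on_wgt c\<phi>)+
        also have "\<dots> = 2 * \<tau>" by (rule E_const)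
        finally show ?thesis unfolding eq .
      qed
      moreover have "\<bar>E (real k * h) \<phi> - E t \<phi>\<bar> \<le> \<tau>"
      proof -
        have "dist (real k * h) t < d\<mu>" using tk h \<delta>(3) d\<mu>(1) by (simp add: dist_real_def abs_minus_commute)
        from d\<mu>(2)[OF kT[OF kM] t this] integral_lipschitz_diff[OF \<phi> zero_less_one, of "\<mu> (real k * h)" "\<mu> t"]
        show ?thesis by simp
      qed
      ultimately have "\<bar>(\<integral>\<omega>. \<phi> (X \<omega> t) \<partial>measure_pmf Q) - E t \<phi>\<bar> \<le> 6 * \<tau>" by linarith
      then show "\<bar>(\<integral>x. \<phi> (x t) \<partial>measure_pmf (map_pmf X Q)) - E t \<phi>\<bar> \<le> \<eta>" using \<tau>(2) by simp
    }
    let ?c = "T * (\<epsilon> + \<kappa> * (h + 2 * C\<^sup>2 * h\<^sup>2))"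
    have "(\<integral>\<omega>. norm (residual b (X \<omega>) t) \<partial>measure_pmf Q) \<le> (\<integral>\<omega>. ?c + 2 * \<kappa> * h * (\<Sum>k<M. (\<Delta> k \<omega>)\<^sup>2) \<partial>measure_pmf Q)"
    proof (rule integral_mono[OF intQ intQ])
      fix \<omega>
      have "t \<le> real M * h" using t M by simp
      from polygon_residual[OF b h(1) _ this \<kappa> less_imp_le[OF \<epsilon>(1)] X_def[THEN fun_cong]] t
      show "norm (residual b (X \<omega>) t) \<le> ?c + 2 * \<kappa> * h * (\<Sum>k<M. (\<Delta> k \<omega>)\<^sup>2)" by (simp add: M \<Delta>_def)
    qed
    also have "\<dots> = ?c + 2 * \<kappa> * h * (\<Sum>k<M. \<integral>\<omega>. (\<Delta> k \<omega>)\<^sup>2 \<partial>measure_pmf Q)" by (simp add: intQ)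
    \<comment> \<open>M second moments of size at most \<delta>, multiplied by h, amount to T
      \<delta>.\<close>
    also have "\<dots> \<le> ?c + 2 * \<kappa> * h * (\<Sum>k<M. \<delta>)"
      using \<kappa>(1) h(1) by (intro add_left_mono mult_left_mono sum_mono L2') auto
    also have "\<dots> = T * \<epsilon> + T * \<kappa> * (h + 2 * C\<^sup>2 * h\<^sup>2 + 2 * \<delta>)"
      unfolding M[symmetric] by (simp add: algebra_simps)
    also have "\<dots> \<le> T * \<epsilon> + T * \<kappa> * (\<delta> + 2 * C\<^sup>2 * \<delta> + 2 * \<delta>)"
    proof -
      have "h\<^sup>2 \<le> \<delta> * 1" unfolding power2_eq_square using h \<delta>(1) by (intro mult_mono) auto
      then show ?thesis using h T \<kappa>(1) by (intro add_left_mono mult_left_mono add_mono) auto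
    qed
    also have "\<dots> = T * \<epsilon> + ?k * \<delta>" by (simp add: algebra_simps)
    also have "?k * \<delta> \<le> (?k + 1) * (\<eta> / (2 * (?k + 1)))" using \<delta>(6) kk \<delta>pos by (intro mult_mono) auto
    also have "\<dots> = \<eta> / 2"
    proof -
      have "(k + 1) * (\<eta> / (2 * (k + 1))) = \<eta> / 2" if "k \<ge> 0" for k :: real
        using that by (simp add: add_eq_0_iff divide_simps)
      then show ?thesis using kk .
    qed
    finally show "(\<integral>x. norm (residual b x t) \<partial>measure_pmf (map_pmf X Q)) \<le> \<eta>" using \<epsilon>(2) by simp
  qed
qed

end

section \<open>The superposition principle\<close>

text \<open>Countably many times suffice, which turns a property of almost every curve at each
  single time into one at all times at once. The rationals clamped to [0, T] are dense there and
  include both end points.\<close>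

lemma vanishes_everywhere:
  fixes h :: "real \<Rightarrow> real"
  assumes h: "continuous_on {0..T} h" and T: "T \<ge> 0" and z: "\<And>r. r \<in> \<rat> \<Longrightarrow> h (max 0 (min T r)) = 0" and t: "t \<in> {0..T}"
  shows "h t = 0"
proof -
  have "continuous_on UNIV (\<lambda>r. h (max 0 (min T r)))"
    by (rule continuous_on_compose2[OF h]) (use T in \<open>auto intro!: continuous_intros\<close>)
  then have "h (max 0 (min T t)) = 0"
    by (intro continuous_constant_on_closure[of \<rat> "\<lambda>r. h (max 0 (min T r))" 0 t]) (auto simp: Rats_closure_real z)
  then show ?thesis using t by simp
qed

lemma continuous_on_residual_time:
  assumes b: "tame C b" and x: "x \<in> lip_curves C' R"
  shows "continuous_on {0..T} (residual b x)"
proof -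
  have "(\<lambda>s. b s (x s)) integrable_on {0..T}"
    by (rule tame_integrable[OF b lip_curves_continuous_on[OF x]])
  from indefinite_integral_continuous_1[OF this]
  show ?thesis unfolding residual_def[abs_def] by (intro continuous_intros lip_curves_continuous_on[OF x])
qed

text \<open>The curves stay indexed by reals: \<nu> is a measure on parameters, and the factor
  \<open>indicator D\<close> makes the evaluation Borel measurable on the whole line, although the
  continuity of \<pi> is known over D only.\<close>

lemma (in cube_flow) superposition:
  obtains \<nu> :: "real measure" and D :: "real set" and \<pi> :: "real \<Rightarrow> real \<Rightarrow> real^'n"
  where "prob_space \<nu>" "sets \<nu> = sets borel" "compact D" "AE c in \<nu>. c \<in> D"
    "continuous_on (D \<times> UNIV) (\<lambda>(c, t). \<pi> c t)"
    "\<And>c. c \<in> D \<Longrightarrow> \<pi> c \<in> lip_curves C (real CARD('n) * l)"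
    "\<And>c t. c \<in> D \<Longrightarrow> t \<in> {0..T} \<Longrightarrow> residual b (\<pi> c) t = 0"
    "\<And>c t. c \<in> D \<Longrightarrow> t \<in> {0..T} \<Longrightarrow> norm (\<pi> c t) \<le> l / 4"
    "\<And>t. t \<in> {0..T} \<Longrightarrow> law (\<mu> t) = distr \<nu> borel (\<lambda>c. indicator D c *\<^sub>R \<pi> c t)"
proof -
  let ?R = "real CARD('n) * l"
  obtain D :: "real set" and \<pi> where D: "compact D" "\<pi> ` D = (lip_curves C ?R :: (real \<Rightarrow> real^'n) set)"
    and \<pi>: "continuous_on (D \<times> UNIV) (\<lambda>(c, t). \<pi> c t)"
    by (rule lip_curves_parametrization[OF C])
  have coord: "continuous_on D (\<lambda>c. \<pi> c t)" for t
    using continuous_on_compose2[OF \<pi> continuous_on_Pair[OF continuous_on_id continuous_on_const], of t] by auto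
  have lip: "\<pi> c \<in> lip_curves C ?R" if "c \<in> D" for c using D(2) that by blast
  let ?ok = "\<lambda>m Q. finite (set_pmf Q) \<and> set_pmf Q \<subseteq> lip_curves C ?R \<and>
    (\<forall>t\<in>{0..T}. \<forall>\<phi>. 1-lipschitz_on UNIV \<phi> \<longrightarrow> \<bar>(\<integral>x. \<phi> (x t) \<partial>measure_pmf Q) - E t \<phi>\<bar> \<le> 1 / real (Suc m)) \<and>
    (\<forall>t\<in>{0..T}. (\<integral>x. norm (residual b x t) \<partial>measure_pmf Q) \<le> 1 / real (Suc m))"
  have "\<exists>Q. ?ok m Q" for m
    by (rule curve_approximation[of "1 / real (Suc m)"]) (auto simp del: of_nat_Suc)
  then obtain Q where Q: "\<And>m. ?ok m (Q m)" using choice[of ?ok] by blast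
  have Qsub: "set_pmf (Q m) \<subseteq> \<pi> ` D" for m using Q[of m] unfolding D(2) by blast
  obtain \<nu> r where \<nu>: "prob_space \<nu>" "sets \<nu> = sets borel" "AE c in \<nu>. c \<in> D" and r: "strict_mono r"
    and lim: "\<And>F :: (real \<Rightarrow> real^'n) \<Rightarrow> real. continuous_on D (\<lambda>c. F (\<pi> c)) \<Longrightarrow>
      (\<lambda>n. \<integral>x. F x \<partial>measure_pmf (Q (r n))) \<longlonglongrightarrow> (\<integral>c. F (\<pi> c) * indicator D c \<partial>\<nu>)"
    by (rule discrete_measures_subsequence[OF D(1) Qsub], rule that)
  interpret \<nu>: prob_space \<nu> by fact
  have N0: "(\<lambda>n. 1 / real (Suc (r n))) \<longlonglongrightarrow> 0"
  proof -
    have "(\<lambda>n. 1 / real (Suc n)) \<longlonglongrightarrow> 0" using LIMSEQ_inverse_real_of_nat by (simp add: inverse_eq_divide)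
    from LIMSEQ_subseq_LIMSEQ[OF this r] show ?thesis by (simp add: o_def)
  qed
  have meas: "(\<lambda>c. indicator D c *\<^sub>R h c) \<in> borel_measurable \<nu>" if "continuous_on D h" for h :: "real \<Rightarrow> 'x::{topological_space,real_normed_vector}"
  proof -
    have "(\<lambda>c. indicator D c *\<^sub>R h c) \<in> borel_measurable borel"
      using that compact_imp_closed[OF D(1)] by (intro borel_measurable_continuous_on_indicator) auto
    then show ?thesis using measurable_cong_sets[OF \<nu>(2) refl] by blast
  qed
  have val: "(\<integral>c. \<phi> (\<pi> c t) * indicator D c \<partial>\<nu>) = E t \<phi>" if t: "t \<in> {0..T}" and \<phi>: "1-lipschitz_on UNIV \<phi>" for t \<phi>
  proof (rule LIMSEQ_unique)
    have "continuous_on D (\<lambda>c. \<phi> (\<pi> c t))"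
      by (rule continuous_on_compose2[OF lipschitz_on_continuous_on[OF \<phi>] coord]) simp
    from lim[of "\<lambda>x. \<phi> (x t)", OF this]
    show "(\<lambda>n. \<integral>x. \<phi> (x t) \<partial>measure_pmf (Q (r n))) \<longlonglongrightarrow> (\<integral>c. \<phi> (\<pi> c t) * indicator D c \<partial>\<nu>)" .
    have "\<bar>(\<integral>x. \<phi> (x t) \<partial>measure_pmf (Q (r n))) - E t \<phi>\<bar> \<le> 1 / real (Suc (r n))" for n
      using Q[of "r n"] t \<phi> by blast
    then have "(\<lambda>n. (\<integral>x. \<phi> (x t) \<partial>measure_pmf (Q (r n))) - E t \<phi>) \<longlonglongrightarrow> 0"
      by (intro Lim_null_comparison[OF _ N0]) (auto simp del: of_nat_Suc)
    then show "(\<lambda>n. \<integral>x. \<phi> (x t) \<partial>measure_pmf (Q (r n))) \<longlonglongrightarrow> E t \<phi>" by (rule LIM_zero_cancel)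
  qed
  have cres: "continuous_on D (\<lambda>c. residual b (\<pi> c) t)" for t by (rule continuous_on_residual[OF b \<pi>])
  have AEres: "AE c in \<nu>. c \<in> D \<longrightarrow> residual b (\<pi> c) t = 0" if t: "t \<in> {0..T}" for t
  proof -
    let ?F = "\<lambda>c. norm (residual b (\<pi> c) t) * indicator D c"
    have cn: "continuous_on D (\<lambda>c. norm (residual b (\<pi> c) t))" by (intro continuous_intros cres)
    obtain B where B: "\<forall>y\<in>(\<lambda>c. norm (residual b (\<pi> c) t)) ` D. norm y \<le> B"
      using compact_imp_bounded[OF compact_continuous_image[OF cn D(1)]] unfolding bounded_iff by blast
    have mF: "?F \<in> borel_measurable \<nu>" using meas[OF cn] by (simp add: mult.commute)
    have iF: "integrable \<nu> ?F"
    proof (rule \<nu>.integrable_const_bound[OF _ mF])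
      show "AE c in \<nu>. norm (?F c) \<le> B" using \<nu>(3) by eventually_elim (use B in auto)
    qed
    have "(\<lambda>n. \<integral>x. norm (residual b x t) \<partial>measure_pmf (Q (r n))) \<longlonglongrightarrow> 0"
    proof (rule Lim_null_comparison[OF _ N0], intro always_eventually allI)
      fix n
      have "(\<integral>x. norm (residual b x t) \<partial>measure_pmf (Q (r n))) \<le> 1 / real (Suc (r n))" using Q[of "r n"] t by blast
      then show "norm (\<integral>x. norm (residual b x t) \<partial>measure_pmf (Q (r n))) \<le> 1 / real (Suc (r n))" by simp
    qed
    with lim[of "\<lambda>x. norm (residual b x t)", OF cn] have "(\<integral>c. ?F c \<partial>\<nu>) = 0" by (rule LIMSEQ_unique)
    then have "AE c in \<nu>. ?F c = 0" using integral_nonneg_eq_0_iff_AE[OF iF] by simp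
    then show ?thesis by eventually_elim (auto simp: indicator_def split: if_splits)
  qed
  let ?X = "\<lambda>t c. indicator D c *\<^sub>R \<pi> c t"
  have mX: "?X t \<in> borel_measurable \<nu>" for t by (rule meas[OF coord])
  have law: "law (\<mu> t) = distr \<nu> borel (?X t)" if t: "t \<in> {0..T}" for t
  proof -
    let ?m = "distr \<nu> borel (?X t)"
    obtain B where B: "\<forall>y\<in>(\<lambda>c. \<pi> c t) ` D. norm y \<le> B"
      using compact_imp_bounded[OF compact_continuous_image[OF coord D(1)]] unfolding bounded_iff by blast
    have "integrable \<nu> (\<lambda>c. norm (?X t c))"
    proof (rule \<nu>.integrable_const_bound[where B = "\<bar>B\<bar>"])
      show "AE c in \<nu>. norm (norm (?X t c)) \<le> \<bar>B\<bar>" using B by (force simp: indicator_def)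
      show "(\<lambda>c. norm (?X t c)) \<in> borel_measurable \<nu>" by (rule measurable_compose[OF mX borel_measurable_norm])
    qed
    then have int: "integrable ?m (\<lambda>x. norm x)" by (subst integrable_distr_eq[OF mX]) auto
    have m: "law (Prob1 ?m) = ?m"
      by (rule Prob1_inverse) (use \<nu>.prob_space_distr[OF mX] int in auto)
    have eq: "(\<integral>x. \<phi> x \<partial>law (Prob1 ?m)) = E t \<phi>" if \<phi>: "1-lipschitz_on UNIV \<phi>" for \<phi> :: "real^'n \<Rightarrow> real"
    proof -
      have c\<phi>: "\<phi> \<in> borel_measurable borel" by (rule borel_measurable_continuous_onI[OF lipschitz_on_continuous_on[OF \<phi>]])
      have "(\<integral>x. \<phi> x \<partial>?m) = (\<integral>c. \<phi> (?X t c) \<partial>\<nu>)" by (rule integral_distr[OF mX c\<phi>])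
      also have "\<dots> = (\<integral>c. \<phi> (\<pi> c t) * indicator D c \<partial>\<nu>)"
      proof (rule integral_cong_AE)
        show "(\<lambda>c. \<phi> (?X t c)) \<in> borel_measurable \<nu>" using measurable_compose[OF mX c\<phi>] .
        have "continuous_on D (\<lambda>c. \<phi> (\<pi> c t))"
          by (rule continuous_on_compose2[OF lipschitz_on_continuous_on[OF \<phi>] coord]) simp
        from meas[OF this] show "(\<lambda>c. \<phi> (\<pi> c t) * indicator D c) \<in> borel_measurable \<nu>" by (simp add: mult.commute)
        show "AE c in \<nu>. \<phi> (?X t c) = \<phi> (\<pi> c t) * indicator D c" using \<nu>(3) by eventually_elim simp
      qed
      finally show ?thesis by (simp add: m val[OF t \<phi>])
    qed
    \<comment> \<open>Equal integrals of all 1-Lipschitz functions mean distance 0, hence equal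
      measures.\<close>
    have "wdist (Prob1 ?m) (\<mu> t) \<le> 0" by (rule wdist_least) (simp add: eq)
    then have "dist (Prob1 ?m) (\<mu> t) \<le> 0" by (simp add: dist_prob1_def)
    then have "Prob1 ?m = \<mu> t" by simp
    then show ?thesis using m by simp
  qed
  \<comment> \<open>The bound is written as the vanishing of a continuous function, so that the
    passage from rational times to all times applies to it as well.\<close>
  have AEbd: "AE c in \<nu>. c \<in> D \<longrightarrow> max 0 (norm (\<pi> c t) - l / 4) = 0" if t: "t \<in> {0..T}" for t
  proof -
    have "AE x in distr \<nu> borel (?X t). norm x \<le> l / 4" using supp[OF t] unfolding law[OF t] .
    then have "AE c in \<nu>. norm (?X t c) \<le> l / 4" by (subst (asm) AE_distr_iff[OF mX]) auto
    then show ?thesis by eventually_elim auto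
  qed
  let ?\<tau> = "\<lambda>q. max 0 (min T q)"
  have \<tau>: "?\<tau> q \<in> {0..T}" for q using T by auto
  \<comment> \<open>A closed set of full measure on which both conditions hold at all times: the
    conclusions then hold for every parameter of a compact set and not merely for almost every
    one.\<close>
  define D' where "D' = D \<inter> (\<Inter>t\<in>{0..T}. {c \<in> D. residual b (\<pi> c) t = 0} \<inter> {c \<in> D. max 0 (norm (\<pi> c t) - l / 4) = 0})"
  have closed: "closed {c \<in> D. h c = 0}" if "continuous_on D h" for h :: "real \<Rightarrow> 'y::real_normed_vector"
    using continuous_closed_preimage[OF that compact_imp_closed[OF D(1)], of "{0}"] by (simp add: vimage_def Int_def)
  have D': "compact D'"
    unfolding D'_def by (intro compact_Int_closed D(1) closed_INT ballI closed_Int closed cres continuous_intros coord)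
  have "AE c in \<nu>. \<forall>q\<in>\<rat>. c \<in> D \<longrightarrow> residual b (\<pi> c) (?\<tau> q) = 0 \<and> max 0 (norm (\<pi> c (?\<tau> q)) - l / 4) = 0"
  proof (intro AE_ball_countable[THEN iffD2] countable_rat ballI)
    fix q :: real assume "q \<in> \<rat>"
    show "AE c in \<nu>. c \<in> D \<longrightarrow> residual b (\<pi> c) (?\<tau> q) = 0 \<and> max 0 (norm (\<pi> c (?\<tau> q)) - l / 4) = 0"
      using AEres[OF \<tau>[of q]] AEbd[OF \<tau>[of q]] by eventually_elim simp
  qed
  with \<nu>(3) have AED': "AE c in \<nu>. c \<in> D'"
  proof eventually_elim
    case (elim c)
    have "norm (residual b (\<pi> c) t) = 0" if "t \<in> {0..T}" for t
      by (rule vanishes_everywhere[OF _ less_imp_le[OF T] _ that])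
         (use elim in \<open>auto intro!: continuous_intros continuous_on_residual_time[OF b lip]\<close>)
    moreover have "max 0 (norm (\<pi> c t) - l / 4) = 0" if "t \<in> {0..T}" for t
      by (rule vanishes_everywhere[OF _ less_imp_le[OF T] _ that])
         (use elim in \<open>auto intro!: continuous_intros lip_curves_continuous_on[OF lip]\<close>)
    ultimately show ?case using elim by (auto simp: D'_def)
  qed
  have sub: "D' \<subseteq> D" by (auto simp: D'_def)
  show ?thesis
  proof (rule that[OF \<nu>(1,2) D' AED'])
    show "continuous_on (D' \<times> UNIV) (\<lambda>(c, t). \<pi> c t)" using sub by (intro continuous_on_subset[OF \<pi>]) auto
    show "\<pi> c \<in> lip_curves C ?R" if "c \<in> D'" for c using lip sub that by blast
    show "residual b (\<pi> c) t = 0" if "c \<in> D'" "t \<in> {0..T}" for c t using that by (auto simp: D'_def)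
    show "norm (\<pi> c t) \<le> l / 4" if "c \<in> D'" "t \<in> {0..T}" for c t
    proof -
      have "max 0 (norm (\<pi> c t) - l / 4) = 0" using that by (auto simp: D'_def)
      then show ?thesis by linarith
    qed
    fix t assume t: "t \<in> {0..T}"
    have mX': "(\<lambda>c. indicator D' c *\<^sub>R \<pi> c t) \<in> borel_measurable \<nu>"
    proof -
      have "(\<lambda>c. indicator D' c *\<^sub>R \<pi> c t) \<in> borel_measurable borel"
        using continuous_on_subset[OF coord sub] compact_imp_closed[OF D'] by (intro borel_measurable_continuous_on_indicator) auto
      then show ?thesis using measurable_cong_sets[OF \<nu>(2) refl] by blast
    qed
    show "law (\<mu> t) = distr \<nu> borel (\<lambda>c. indicator D' c *\<^sub>R \<pi> c t)"
      unfolding law[OF t]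
      by (rule distr_cong_AE[OF refl refl _ mX mX']) (use AED' sub in \<open>auto simp: indicator_def elim!: eventually_mono\<close>)
  qed
qed

section \<open>Measures on spaces of curves\<close>

lemma topspace_curves: "topspace (curves T) = {\<omega>. \<omega> \<in> extensional {0..T} \<and> continuous_on {0..T} \<omega>}"
proof -
  have "compactin (top_of_set {0..T}) (topspace (top_of_set {0..T}))"
    by (simp add: compactin_subtopology)
  from compactin_mspace_cfunspace[OF this, of euclidean_metric] show ?thesis
    by (auto simp: curves_def)
qed

lemma curves_open_contains:
  assumes U: "openin (curves T) U" "\<omega> \<in> U" and T: "0 \<le> T"
  obtains r where "r > 0" "\<And>\<omega>'. \<omega>' \<in> topspace (curves T) \<Longrightarrow> (\<And>t. t \<in> {0..T} \<Longrightarrow> dist (\<omega> t) (\<omega>' t) \<le> r) \<Longrightarrow> \<omega>' \<in> U"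
proof -
  let ?m = "cfunspace (top_of_set {0..T}) euclidean_metric"
  interpret M: Metric_space "mspace ?m" "mdist ?m" by (rule Metric_space_mspace_mdist)
  have "openin M.mtopology U" using U(1) by (simp add: curves_def mtopology_of_def)
  then obtain r where r: "r > 0" "M.mball \<omega> r \<subseteq> U" "U \<subseteq> mspace ?m"
    unfolding M.openin_mtopology using U(2) by blast
  show ?thesis
  \<comment> \<open>Halving the radius turns the non-strict pointwise bound into a strict bound for
    the supremum.\<close>
  proof (rule that[of "r / 2"])
    fix \<omega>' assume \<omega>': "\<omega>' \<in> topspace (curves T)" and d: "\<And>t. t \<in> {0..T} \<Longrightarrow> dist (\<omega> t) (\<omega>' t) \<le> r / 2"
    have mem: "\<omega>' \<in> mspace ?m" "\<omega> \<in> mspace ?m" using \<omega>' r(3) U(2) by (auto simp: curves_def)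
    have "mdist ?m \<omega> \<omega>' \<le> r / 2"
      using cfunspace_mdist_le[OF mem(2,1), of "r / 2"] d T by simp
    then have "mdist ?m \<omega> \<omega>' < r" using r(1) by linarith
    then have "\<omega>' \<in> M.mball \<omega> r" using mem by (simp only: M.in_mball)
    with r(2) show "\<omega>' \<in> U" by blast
  qed (use r in simp)
qed

lemma openin_curves_eval:
  assumes W: "open W" and t: "t \<in> {0..T}"
  shows "openin (curves T) {\<omega> \<in> topspace (curves T). \<omega> t \<in> W}"
proof -
  let ?m = "cfunspace (top_of_set {0..T}) euclidean_metric"
  interpret M: Metric_space "mspace ?m" "mdist ?m" by (rule Metric_space_mspace_mdist)
  have top: "topspace (curves T) = mspace ?m" by (simp add: curves_def)
  have "openin M.mtopology {\<omega> \<in> mspace ?m. \<omega> t \<in> W}"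
    unfolding M.openin_mtopology
  proof (intro conjI allI impI)
    fix \<omega> assume \<omega>: "\<omega> \<in> {\<omega> \<in> mspace ?m. \<omega> t \<in> W}"
    then obtain e where e: "e > 0" "ball (\<omega> t) e \<subseteq> W" using W unfolding open_contains_ball by blast
    have "M.mball \<omega> e \<subseteq> {\<omega> \<in> mspace ?m. \<omega> t \<in> W}"
    proof
      fix \<omega>' assume "\<omega>' \<in> M.mball \<omega> e"
      then have m: "\<omega> \<in> mspace ?m" "\<omega>' \<in> mspace ?m" "mdist ?m \<omega> \<omega>' < e" by (simp_all only: M.in_mball)
      have "mdist euclidean_metric (\<omega> t) (\<omega>' t) \<le> mdist ?m \<omega> \<omega>'"
        by (rule mdist_cfunspace_imp_mdist_le[OF m(1,2) order_refl]) (use t in simp)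
      then have "dist (\<omega> t) (\<omega>' t) < e" using m(3) by simp
      then show "\<omega>' \<in> {\<omega> \<in> mspace ?m. \<omega> t \<in> W}" using e(2) m(2) by auto
    qed
    with e(1) show "\<exists>r>0. M.mball \<omega> r \<subseteq> {\<omega> \<in> mspace ?m. \<omega> t \<in> W}" by blast
  qed auto
  then show ?thesis unfolding top by (simp add: curves_def mtopology_of_def)
qed

lemma space_borel_of_topology: "space (borel_of_topology X) = topspace X"
  and open_in_borel_of_topology: "openin X U \<Longrightarrow> U \<in> sets (borel_of_topology X)"
proof -
  have "{U. openin X U} \<subseteq> Pow (topspace X)" using openin_subset by blast
  then show "space (borel_of_topology X) = topspace X" "openin X U \<Longrightarrow> U \<in> sets (borel_of_topology X)"
    by (auto simp: borel_of_topology_def)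
qed

text \<open>The measure is the image of \<nu> under the map from parameters to restricted curves.
  Uniform continuity of \<Psi> on the compact set D x [0, T] makes this map continuous on D for
  uniform convergence, and measurability is to be checked on open sets only.\<close>

lemma measure_on_curves:
  fixes \<Psi> :: "real \<Rightarrow> real \<Rightarrow> 'a::euclidean_space \<times> real"
  assumes \<nu>: "prob_space \<nu>" "sets \<nu> = sets borel" and D: "compact D" "AE c in \<nu>. c \<in> D"
    and T: "0 \<le> T" and \<Psi>: "continuous_on (D \<times> {0..T}) (\<lambda>(c, t). \<Psi> c t)"
    and S: "\<And>c. c \<in> D \<Longrightarrow> restrict (\<Psi> c) {0..T} \<in> S" "S \<subseteq> topspace (curves T)"
  obtains \<xi> where "prob_space \<xi>" "sets \<xi> = sets (borel_of_topology (subtopology (curves T) S))"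
    "\<And>t. t \<in> {0..T} \<Longrightarrow> distr \<xi> borel (\<lambda>\<omega>. fst (\<omega> t)) = distr \<nu> borel (\<lambda>c. indicator D c *\<^sub>R fst (\<Psi> c t))"
proof -
  interpret \<nu>: prob_space \<nu> by fact
  let ?X = "subtopology (curves T) S"
  have "D \<noteq> {}"
  proof
    assume "D = {}"
    then have "AE c in \<nu>. False" using D(2) by simp
    then show False using \<nu>.prob_space by simp
  qed
  then obtain c0 where c0: "c0 \<in> D" by blast
  \<comment> \<open>The parameters outside \<open>D\<close> form a null set; they are sent to one
    admissible curve, so that all values lie in \<open>S\<close>.\<close>
  define \<theta> where "\<theta> = (\<lambda>c. restrict (\<Psi> (if c \<in> D then c else c0)) {0..T})"
  have \<theta>S: "\<theta> c \<in> S" for c using S(1) c0 by (simp add: \<theta>_def)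
  have top: "topspace ?X = S" using S(2) by auto
  have uc: "uniformly_continuous_on (D \<times> {0..T}) (\<lambda>(c, t). \<Psi> c t)"
    by (intro compact_uniformly_continuous \<Psi> compact_Times D) auto
  have op: "openin (top_of_set D) {c \<in> D. \<theta> c \<in> U}" if U: "openin ?X U" for U
    unfolding openin_contains_ball
  proof (intro conjI ballI)
    fix c assume c: "c \<in> {c \<in> D. \<theta> c \<in> U}"
    obtain U' where U': "openin (curves T) U'" "U = U' \<inter> S" using U unfolding openin_subtopology by blast
    then have "\<theta> c \<in> U'" using c by blast
    then obtain r where r: "r > 0" "\<And>\<omega>'. \<omega>' \<in> topspace (curves T) \<Longrightarrow> (\<And>t. t \<in> {0..T} \<Longrightarrow> dist (\<theta> c t) (\<omega>' t) \<le> r) \<Longrightarrow> \<omega>' \<in> U'"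
      using curves_open_contains[OF U'(1) _ T] by blast
    obtain d where d: "d > 0" "\<And>p q. p \<in> D \<times> {0..T} \<Longrightarrow> q \<in> D \<times> {0..T} \<Longrightarrow> dist q p < d \<Longrightarrow>
        dist (case q of (c, t) \<Rightarrow> \<Psi> c t) (case p of (c, t) \<Rightarrow> \<Psi> c t) < r"
      using uc r(1) unfolding uniformly_continuous_on_def by blast
    have "ball c d \<inter> D \<subseteq> {c \<in> D. \<theta> c \<in> U}"
    proof
      fix c' assume c': "c' \<in> ball c d \<inter> D"
      have "\<theta> c' \<in> U'"
      proof (rule r(2))
        show "\<theta> c' \<in> topspace (curves T)" using \<theta>S S(2) by blast
        fix t assume t: "t \<in> {0..T}"
        have "dist (\<Psi> c t) (\<Psi> c' t) < r"
          using d(2)[of "(c', t)" "(c, t)"] c c' t by (simp add: dist_Pair_Pair)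
        then show "dist (\<theta> c t) (\<theta> c' t) \<le> r" using c c' t by (simp add: \<theta>_def)
      qed
      then show "c' \<in> {c \<in> D. \<theta> c \<in> U}" using c' \<theta>S U'(2) by blast
    qed
    with d(1) show "\<exists>e>0. ball c e \<inter> D \<subseteq> {c \<in> D. \<theta> c \<in> U}" by blast
  qed auto
  have sp: "space \<nu> = UNIV" using sets_eq_imp_space_eq[OF \<nu>(2)] by simp
  have Dm: "D \<in> sets borel" using compact_imp_closed[OF D(1)] by simp
  have \<theta>m: "\<theta> \<in> \<nu> \<rightarrow>\<^sub>M borel_of_topology ?X"
    unfolding borel_of_topology_def
  proof (rule measurable_measure_of)
    show "{U. openin ?X U} \<subseteq> Pow (topspace ?X)" using openin_subset by blast
    show "\<theta> \<in> space \<nu> \<rightarrow> topspace ?X" using \<theta>S unfolding top by blast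
    fix U assume "U \<in> {U. openin ?X U}"
    then have "openin (top_of_set D) {c \<in> D. \<theta> c \<in> U}" using op by blast
    then obtain W where W: "open W" "{c \<in> D. \<theta> c \<in> U} = D \<inter> W" unfolding openin_open by blast
    have "\<theta> -` U \<inter> space \<nu> = (D \<inter> W) \<union> (if \<theta> c0 \<in> U then - D else {})"
    proof (rule set_eqI)
      fix c
      show "c \<in> \<theta> -` U \<inter> space \<nu> \<longleftrightarrow> c \<in> (D \<inter> W) \<union> (if \<theta> c0 \<in> U then - D else {})"
      proof (cases "c \<in> D")
        case True
        then show ?thesis using W(2) by (auto simp: sp)
      next
        case False
        then have "\<theta> c = \<theta> c0" using c0 by (simp add: \<theta>_def)
        with False show ?thesis by (simp add: sp)
      qed
    qed
    also have "\<dots> \<in> sets borel" using Dm W(1) by auto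
    finally show "\<theta> -` U \<inter> space \<nu> \<in> sets \<nu>" by (simp add: \<nu>(2))
  qed
  define \<xi> where "\<xi> = distr \<nu> (borel_of_topology ?X) \<theta>"
  show ?thesis
  proof (rule that[of \<xi>])
    show "prob_space \<xi>" unfolding \<xi>_def by (rule \<nu>.prob_space_distr[OF \<theta>m])
    show "sets \<xi> = sets (borel_of_topology ?X)" by (simp add: \<xi>_def)
    fix t assume t: "t \<in> {0..T}"
    have ev: "(\<lambda>\<omega> :: real \<Rightarrow> 'a \<times> real. fst (\<omega> t)) \<in> borel_measurable (borel_of_topology ?X)"
    proof (rule borel_measurableI)
      fix W :: "'a set" assume "open W"
      then have "open (W \<times> (UNIV :: real set))" by (intro open_Times) auto
      from openin_curves_eval[OF this t]
      have "openin ?X ({\<omega> \<in> topspace (curves T). \<omega> t \<in> W \<times> UNIV} \<inter> S)" unfolding openin_subtopology by blast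
      then have "{\<omega> \<in> topspace (curves T). \<omega> t \<in> W \<times> UNIV} \<inter> S \<in> sets (borel_of_topology ?X)"
        by (rule open_in_borel_of_topology)
      moreover have "(\<lambda>\<omega>. fst (\<omega> t)) -` W \<inter> space (borel_of_topology ?X) = {\<omega> \<in> topspace (curves T). \<omega> t \<in> W \<times> UNIV} \<inter> S"
        unfolding space_borel_of_topology by (auto simp: mem_Times_iff)
      ultimately show "(\<lambda>\<omega>. fst (\<omega> t)) -` W \<inter> space (borel_of_topology ?X) \<in> sets (borel_of_topology ?X)"
        by (simp only:)
    qed
    have c\<Psi>: "continuous_on D (\<lambda>c. fst (\<Psi> c t))"
    proof -
      have "continuous_on D (\<lambda>c. (c, t))" by (intro continuous_intros)
      from continuous_on_compose2[OF \<Psi> this] t have "continuous_on D (\<lambda>c. \<Psi> c t)" by (simp add: image_subset_iff)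
      then show ?thesis by (rule continuous_on_fst)
    qed
    have m2: "(\<lambda>c. indicator D c *\<^sub>R fst (\<Psi> c t)) \<in> borel_measurable \<nu>"
    proof -
      have "(\<lambda>c. indicator D c *\<^sub>R fst (\<Psi> c t)) \<in> borel_measurable borel"
        by (rule borel_measurable_continuous_on_indicator[OF Dm c\<Psi>])
      then show ?thesis using measurable_cong_sets[OF \<nu>(2) refl] by blast
    qed
    have "distr \<xi> borel (\<lambda>\<omega>. fst (\<omega> t)) = distr \<nu> borel ((\<lambda>\<omega>. fst (\<omega> t)) \<circ> \<theta>)"
      unfolding \<xi>_def by (rule distr_distr[OF ev \<theta>m])
    also have "\<dots> = distr \<nu> borel (\<lambda>c. indicator D c *\<^sub>R fst (\<Psi> c t))"
    proof (rule distr_cong_AE[OF refl refl _ _ m2])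
      show "(\<lambda>\<omega>. fst (\<omega> t)) \<circ> \<theta> \<in> borel_measurable \<nu>" by (rule measurable_comp[OF \<theta>m ev])
      show "AE c in \<nu>. ((\<lambda>\<omega>. fst (\<omega> t)) \<circ> \<theta>) c = indicator D c *\<^sub>R fst (\<Psi> c t)"
        using D(2) by eventually_elim (use t in \<open>simp add: \<theta>_def\<close>)
    qed
    finally show "distr \<xi> borel (\<lambda>\<omega>. fst (\<omega> t)) = distr \<nu> borel (\<lambda>c. indicator D c *\<^sub>R fst (\<Psi> c t))" .
  qed
qed

section \<open>From the classical system to the minimax solution\<close>

theorem proposition3:
  fixes T L\<^sub>f\<^sub>x L\<^sub>f\<^sub>m :: real
    and P :: "'p::metric_space set"
    and f :: "real \<Rightarrow> real^'n \<Rightarrow> (real^'n) prob1 \<Rightarrow> 'p \<Rightarrow> real^'n"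
    and g :: "real \<Rightarrow> real^'n \<Rightarrow> (real^'n) prob1 \<Rightarrow> 'p \<Rightarrow> real"
    and \<sigma> :: "real^'n \<Rightarrow> (real^'n) prob1 \<Rightarrow> real"
    and m\<^sub>0 :: "(real^'n) prob1"
    and G :: "(real^'n) set"
    and V :: "real \<Rightarrow> real^'n \<Rightarrow> real"
    and \<mu> :: "real \<Rightarrow> (real^'n) prob1"
  assumes "T > 0"
    and "compact P" and "P \<noteq> {}"
    and "continuous_on ({0..T} \<times> UNIV \<times> UNIV \<times> P) (\<lambda>(t, x, m, u). f t x m u)"
    and "continuous_on ({0..T} \<times> UNIV \<times> UNIV \<times> P) (\<lambda>(t, x, m, u). g t x m u)"
    and "\<And>t x' x'' m u. t \<in> {0..T} \<Longrightarrow> u \<in> P \<Longrightarrow>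
           norm (f t x' m u - f t x'' m u) \<le> L\<^sub>f\<^sub>x * norm (x' - x'')"
    and "\<And>t x m' m'' u. t \<in> {0..T} \<Longrightarrow> u \<in> P \<Longrightarrow>
           norm (f t x m' u - f t x m'' u) \<le> L\<^sub>f\<^sub>m * dist m' m''"
    and "continuous_on UNIV (\<lambda>(x, m). \<sigma> x m)"
    and "compact (support (law m\<^sub>0))"
    and "compact G"
    and "\<And>\<nu> u x. continuous_on {0..T} \<nu> \<Longrightarrow>
           u \<in> lebesgue_on {0..T} \<rightarrow>\<^sub>M restrict_space borel P \<Longrightarrow>
           solves_inclusion (\<lambda>t y. {f t y (\<nu> t) (u t)}) 0 T x \<Longrightarrow>
           x 0 \<in> support (law m\<^sub>0) \<Longrightarrow> \<forall>t\<in>{0..T}. x t \<in> G"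
    and "continuous_on ({0..T} \<times> UNIV) (\<lambda>(t, x). V t x)"
    and "continuous_on {0..T} \<mu>"
    and "\<And>t x m p. t \<in> {0..T} \<Longrightarrow> (\<lambda>p. ham P f g t x m p) differentiable (at p)"
    and "classical_HJ T P f g \<sigma> \<mu> V"
    and "\<exists>L. \<forall>t\<in>{0..T}. L-lipschitz_on UNIV (grad (V t))"
    and "weak_solution T (\<lambda>t x. grad (\<lambda>p. ham P f g t x (\<mu> t) p) (grad (V t) x)) m\<^sub>0 \<mu>"
  shows "minimax_MFG T P f g \<sigma> m\<^sub>0 V \<mu>"
proof -
  note T = assms(1) and \<mu> = assms(13)
  obtain Lp where Lp: "\<And>t. t \<in> {0..T} \<Longrightarrow> Lp-lipschitz_on UNIV (grad (V t))" using assms(16) by blast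
  \<comment> \<open>Freezing the measure argument along the flow keeps f and g continuous in (t, x,
    u), since \<mu> is continuous.\<close>
  have arg: "continuous_on ({0..T} \<times> UNIV \<times> P) (\<lambda>q. (fst q, fst (snd q), \<mu> (fst q), snd (snd q)))"
    by (intro continuous_intros continuous_on_compose2[OF \<mu>]) auto
  have img: "(\<lambda>q. (fst q, fst (snd q), \<mu> (fst q), snd (snd q))) ` ({0..T} \<times> UNIV \<times> P) \<subseteq> {0..T} \<times> UNIV \<times> UNIV \<times> P"
    by auto
  interpret classical_solution T L\<^sub>f\<^sub>x P "\<lambda>t x u. f t x (\<mu> t) u" "\<lambda>t x u. g t x (\<mu> t) u" V "\<lambda>t x q. ham P f g t x (\<mu> t) q" Lp
  proof
    show "continuous_on ({0..T} \<times> UNIV \<times> P) (\<lambda>(t, x, u). f t x (\<mu> t) u)"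
      using continuous_on_compose2[OF assms(4) arg img] by (simp add: case_prod_unfold)
    show "continuous_on ({0..T} \<times> UNIV \<times> P) (\<lambda>(t, x, u). g t x (\<mu> t) u)"
      using continuous_on_compose2[OF assms(5) arg img] by (simp add: case_prod_unfold)
    show "ham P f g t x (\<mu> t) q = (SUP u\<in>P. q \<bullet> f t x (\<mu> t) u - g t x (\<mu> t) u)" for t x q
      by (simp add: ham_def)
    show "(\<lambda>(s, y). V s y) differentiable (at (t, x) within {0..T} \<times> UNIV)"
      "vector_derivative (\<lambda>s. V s x) (at t within {0..T}) + ham P f g t x (\<mu> t) (grad (V t) x) = 0"
      if "t \<in> {0..T}" for t x
      using assms(15) that unfolding classical_HJ_def by blast+
  qed (use assms Lp in auto)
  have HJ: "minimax_HJ T P f g \<sigma> \<mu> V"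
    unfolding minimax_HJ_def E_plus_def E_minus_def
    using viable_epigraph viable_hypograph assms(12,15) by (auto simp: classical_HJ_def)
  have weak: "weak_solution T b m\<^sub>0 \<mu>" using assms(17) by (simp add: b_def[abs_def] p_def)
  obtain R0 where R0: "\<And>x. x \<in> support (law m\<^sub>0) \<Longrightarrow> norm x \<le> R0"
    using compact_imp_bounded[OF assms(9)] unfolding bounded_iff by blast
  have m0: "AE x in law m\<^sub>0. norm x \<le> R0"
    using AE_support[OF law_prob1(2)[of m\<^sub>0]] by eventually_elim (rule R0)
  obtain Cb where Cb: "Cb \<ge> 0" "\<And>t x. t \<in> {0..T} \<Longrightarrow> norm (b t x) \<le> Cb * (1 + norm x)" using growthb by blast
  obtain R where R: "R \<ge> 0" "\<And>t. t \<in> {0..T} \<Longrightarrow> AE x in law (\<mu> t). norm x \<le> R"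
    by (rule weak_solution_compact_support[OF weak T \<mu> Cb(2) Cb(1) m0]) (assumption | rule that)+
  \<comment> \<open>The ball of radius R carrying all laws lies in that of radius l/4; the added 1
    keeps l positive for R = 0.\<close>
  define l where "l = 4 * (R + 1)"
  have l: "l > 0" "R \<le> l / 4" "0 \<le> l / 4" using R(1) by (auto simp: l_def)
  \<comment> \<open>The truncation changes nothing on the ball of radius l/4, which carries the laws
    and contains the limit curves; so these are integral curves of \<open>b\<close> itself.\<close>
  define bh where "bh = (\<lambda>t x. b (max 0 (min T t)) (closest_point (cball 0 (l / 4)) x))"
  obtain C where C: "tame C bh" using tame_truncation[OF cont_b less_imp_le[OF T] l(3)] unfolding bh_def by blast
  have bh: "bh t x = b t x" if "t \<in> {0..T}" "norm x \<le> l / 4" for t x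
    using that by (simp add: bh_def closest_point_self)
  have supp: "AE x in law (\<mu> t). norm x \<le> l / 4" if "t \<in> {0..T}" for t
    using R(2)[OF that] by eventually_elim (use l in simp)
  interpret flow: cube_flow T C l bh \<mu>
  proof
    fix \<phi> D s t
    assume \<phi>: "\<And>x :: real^'n. GDERIV \<phi> x :> D x" and D: "continuous_on UNIV D" and st: "0 \<le> s" "s \<le> t" "t \<le> T"
    have "(\<integral>x. \<phi> x \<partial>law (\<mu> t)) - (\<integral>x. \<phi> x \<partial>law (\<mu> s)) = integral {s..t} (\<lambda>r. \<integral>x. b r x \<bullet> D x \<partial>law (\<mu> r))"
      by (rule weak_solution_integral[OF weak T \<mu> cont_b supp \<phi> D st])
    also have "\<dots> = integral {s..t} (\<lambda>r. \<integral>x. bh r x \<bullet> D x \<partial>law (\<mu> r))"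
    proof (rule integral_cong)
      fix r assume "r \<in> {s..t}"
      then have r: "r \<in> {0..T}" using st by auto
      have "continuous_on UNIV (\<lambda>x :: real^'n. (r, x))" by (intro continuous_intros)
      from continuous_on_compose2[OF cont_b this] continuous_on_compose2[OF tame_continuous_on[OF C, of UNIV] this] r
      have cb: "continuous_on UNIV (b r)" "continuous_on UNIV (bh r)" by (simp_all add: image_subset_iff)
      have m: "h \<in> borel_measurable (law (\<mu> r))" if "continuous_on UNIV h" for h :: "real^'n \<Rightarrow> real"
        using borel_measurable_continuous_onI[OF that] measurable_cong_sets[OF law_prob1(2)[of "\<mu> r"] refl] by blast
      show "(\<integral>x. b r x \<bullet> D x \<partial>law (\<mu> r)) = (\<integral>x. bh r x \<bullet> D x \<partial>law (\<mu> r))"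
        using supp[OF r] by (intro integral_cong_AE m continuous_intros cb D) (auto simp: bh[OF r])
    qed
    finally show "(\<integral>x. \<phi> x \<partial>law (\<mu> t)) - (\<integral>x. \<phi> x \<partial>law (\<mu> s)) = integral {s..t} (\<lambda>r. \<integral>x. bh r x \<bullet> D x \<partial>law (\<mu> r))" .
  qed (use T C l \<mu> supp in auto)
  obtain \<nu> :: "real measure" and D and \<pi> :: "real \<Rightarrow> real \<Rightarrow> real^'n"
    where \<nu>: "prob_space \<nu>" "sets \<nu> = sets borel" and D: "compact D" "AE c in \<nu>. c \<in> D"
    and \<pi>: "continuous_on (D \<times> UNIV) (\<lambda>(c, t). \<pi> c t)"
    and lip: "\<And>c. c \<in> D \<Longrightarrow> \<pi> c \<in> lip_curves C (real CARD('n) * l)"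
    and res: "\<And>c t. c \<in> D \<Longrightarrow> t \<in> {0..T} \<Longrightarrow> residual bh (\<pi> c) t = 0"
    and bound: "\<And>c t. c \<in> D \<Longrightarrow> t \<in> {0..T} \<Longrightarrow> norm (\<pi> c t) \<le> l / 4"
    and law: "\<And>t. t \<in> {0..T} \<Longrightarrow> law (\<mu> t) = distr \<nu> borel (\<lambda>c. indicator D c *\<^sub>R \<pi> c t)"
    by (rule flow.superposition, rule that)
  \<comment> \<open>The second component is forced by the condition z = V(t, x) in
    \<open>char_curves\<close>.\<close>
  define \<Psi> where "\<Psi> = (\<lambda>c t. (\<pi> c t, V t (\<pi> c t)))"
  have c\<Psi>: "continuous_on (D \<times> {0..T}) (\<lambda>(c, t). \<Psi> c t)"
  proof -
    have c: "continuous_on (D \<times> {0..T}) (\<lambda>q. \<pi> (fst q) (snd q))"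
      using continuous_on_subset[OF \<pi>, of "D \<times> {0..T}"] by (auto simp: case_prod_unfold)
    have "continuous_on (D \<times> {0..T}) (\<lambda>q. V (snd q) (\<pi> (fst q) (snd q)))"
      using continuous_on_compose2[OF contV continuous_on_Pair[OF continuous_on_snd[OF continuous_on_id] c]]
      by (auto simp: image_subset_iff)
    with c show ?thesis unfolding \<Psi>_def case_prod_unfold by (intro continuous_on_Pair)
  qed
  let ?S = "char_curves T P f g \<mu> V"
  have S: "restrict (\<Psi> c) {0..T} \<in> ?S" if c: "c \<in> D" for c
  proof -
    have "continuous_on {0..T} (\<lambda>t. (c, t))" by (intro continuous_intros)
    from continuous_on_compose2[OF c\<Psi> this] c have "continuous_on {0..T} (\<Psi> c)" by (simp add: image_subset_iff)
    then have "continuous_on {0..T} (restrict (\<Psi> c) {0..T})" by (rule continuous_on_eq) simp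
    then have 1: "restrict (\<Psi> c) {0..T} \<in> topspace (curves T)" by (simp add: topspace_curves)
    have "(\<pi> c has_vector_derivative b t (\<pi> c t)) (at t within {0..T})" if t: "t \<in> {0..T}" for t
      using residual_eq_0_derivative[OF C lip[OF c] T _ t] res[OF c] by (simp add: bh[OF t bound[OF c t]])
    then have "solves_inclusion (\<lambda>t (x, z). E_minus P f g t x (\<mu> t)) 0 T (restrict (\<Psi> c) {0..T})"
      unfolding E_minus_def by (intro solves_characteristic[where x = "\<pi> c" and k = 0]) (auto simp: \<Psi>_def)
    with 1 show ?thesis by (simp add: char_curves_def \<Psi>_def)
  qed
  have "?S \<subseteq> topspace (curves T)" by (auto simp: char_curves_def)
  from measure_on_curves[OF \<nu> D less_imp_le[OF T] c\<Psi> S this]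
  obtain \<xi> where \<xi>: "prob_space \<xi>" "sets \<xi> = sets (borel_of_topology (subtopology (curves T) ?S))"
    "\<And>t. t \<in> {0..T} \<Longrightarrow> distr \<xi> borel (\<lambda>\<omega>. fst (\<omega> t)) = distr \<nu> borel (\<lambda>c. indicator D c *\<^sub>R fst (\<Psi> c t))"
    by blast
  have "law (\<mu> t) = distr \<xi> borel (\<lambda>\<omega>. fst (\<omega> t))" if "t \<in> {0..T}" for t
    using law[OF that] \<xi>(3)[OF that] by (simp add: \<Psi>_def)
  with \<xi>(1,2) HJ assms(12) \<mu> weak show ?thesis
    unfolding minimax_MFG_def weak_solution_def by blast
qed

end
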